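(* There is a deterministic algorithm which, when given $\varepsilon\in(0,1)$ and a DNF formula $f$ on $n\ge2$ variables with $m\ge1$ terms as input, returns an $O(\varepsilon)$-additive approximation to $\mathsf{Bias}(f)$ in time $$\left(\frac{mn}{\varepsilon}\right)^{\tilde O(\log\log n+\log\log m+\log(1/\varepsilon))}.$$ In particular, for $m\le\mathrm{poly}(n)$ and $\varepsilon\ge 1/\mathrm{poly}(\log n)$ the running time is $n^{\tilde O(\log\log n)}$; that is, for all constants $a,b>0$, on inputs with $m\le n^a$ and $\varepsilon\ge(\log n)^{-b}$ the running time is $n^{\tilde O(\log\log n)}$ with implied constants depending only on $a,b$.
   Context: A DNF formula is an OR of terms, each term being an AND of literals. For $f:\{0,1\}^n\to\{0,1\}$ let $\mathsf{Bias}(f)=\Pr_x[f(x)=1]$, $x$ uniform in $\{0,1\}^n$. An algorithm gives an $\eta$-additive approximation to $\mathsf{Bias}(f)$ if its output lies in $[\mathsf{Bias}(f)-\eta,\mathsf{Bias}(f)+\eta]$; "$O(\varepsilon)$-additive" means $\eta\le C\varepsilon$ for an absolute constant $C$. Notation: $\tilde O(T)$ denotes a quantity that is at most $C\,T(\log T)^C$ for a constant $C$ (absolute unless stated otherwise). Convention: in asymptotic bounds $\log(y)$ is read as $\max\{2,\log_2 y\}$. *)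

theory Defs
  imports "HOL-Probability.Probability"
begin

section \<open>DNF formulas\<close>

datatype literal = Pos nat | Neg nat

text \<open>A formula is the list of its terms, a term the list of its literals. The empty term is
  the constant 1; contradictory terms and repeated terms are allowed.\<close>

type_synonym dnf = "literal list list"

fun lit_var :: "literal \<Rightarrow> nat" where
  "lit_var (Pos i) = i"
| "lit_var (Neg i) = i"

fun lit_holds :: "(nat \<Rightarrow> bool) \<Rightarrow> literal \<Rightarrow> bool" where
  "lit_holds x (Pos i) = x i"
| "lit_holds x (Neg i) = (\<not> x i)"

definition dnf_holds :: "dnf \<Rightarrow> (nat \<Rightarrow> bool) \<Rightarrow> bool" where
  "dnf_holds f x \<longleftrightarrow> (\<exists>T\<in>set f. \<forall>l\<in>set T. lit_holds x l)"

text \<open>The variables are \<open>0, \<dots>, n - 1\<close>. Without distinctness of the literals within a term, the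
  length of the input would not be bounded in terms of \<open>n\<close> and the number of terms.\<close>

definition is_dnf :: "nat \<Rightarrow> dnf \<Rightarrow> bool" where
  "is_dnf n f \<longleftrightarrow> (\<forall>T\<in>set f. distinct T \<and> (\<forall>l\<in>set T. lit_var l < n))"

definition cube :: "nat \<Rightarrow> (nat \<Rightarrow> bool) set" where
  "cube n = {..<n} \<rightarrow>\<^sub>E UNIV"

definition Bias :: "nat \<Rightarrow> ((nat \<Rightarrow> bool) \<Rightarrow> bool) \<Rightarrow> real" where
  "Bias n g = measure_pmf.prob (pmf_of_set (cube n)) {x. g x}"


section \<open>Deterministic algorithms and their running time\<close>

text \<open>Algorithms are programs of a random access machine with structured control flow. A program
  works on arrays of natural numbers, \<open>s a i\<close> being the content of cell \<open>i\<close> of array \<open>a\<close>; since the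
  array names in a program are fixed, interleaving its finitely many arrays turns it
  into a program for a machine with a single memory and indirect addressing.

  Every operation has unit cost. The only arithmetic operations are addition and truncated
  subtraction, so \<open>t\<close> steps increase the bit length of the largest number by \<open>O(t)\<close>
  only, and the running time is polynomially related to that of Turing machines. Unit-cost
  multiplication would destroy this property.\<close>

type_synonym state = "nat \<Rightarrow> nat \<Rightarrow> nat"

datatype aexp = Num nat | Cell nat aexp | Plus aexp aexp | Monus aexp aexp

datatype com =
    Skip
  | Assign nat aexp aexp
  | Seq com com
  | If aexp com com
  | While aexp com

fun aval :: "aexp \<Rightarrow> state \<Rightarrow> nat" where
  "aval (Num k) s = k"
| "aval (Cell a e) s = s a (aval e s)"
| "aval (Plus e e') s = aval e s + aval e' s"
| "aval (Monus e e') s = aval e s - aval e' s"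

fun acost :: "aexp \<Rightarrow> nat" where
  "acost (Num k) = 1"
| "acost (Cell a e) = acost e + 1"
| "acost (Plus e e') = acost e + acost e' + 1"
| "acost (Monus e e') = acost e + acost e' + 1"

text \<open>\<open>exec c s t s'\<close>: started in state \<open>s\<close>, the program \<open>c\<close> halts after \<open>t\<close> steps
  in state \<open>s'\<close>. \<open>Assign a e e'\<close> stores the value of \<open>e'\<close> in the cell of \<open>a\<close> whose index is the
  value of \<open>e\<close>. A test succeeds if its value is nonzero, so \<open>Monus e' e\<close> tests \<open>e < e'\<close>.\<close>

inductive exec :: "com \<Rightarrow> state \<Rightarrow> nat \<Rightarrow> state \<Rightarrow> bool" where
  Skip: "exec Skip s 1 s"
| Assign: "exec (Assign a e e') s (acost e + acost e' + 1) (s(a := (s a)(aval e s := aval e' s)))"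
| Seq: "\<lbrakk>exec c s t s'; exec c' s' t' s''\<rbrakk> \<Longrightarrow> exec (Seq c c') s (t + t') s''"
| IfTrue: "\<lbrakk>aval e s \<noteq> 0; exec c s t s'\<rbrakk> \<Longrightarrow> exec (If e c c') s (acost e + 1 + t) s'"
| IfFalse: "\<lbrakk>aval e s = 0; exec c' s t s'\<rbrakk> \<Longrightarrow> exec (If e c c') s (acost e + 1 + t) s'"
| WhileFalse: "aval e s = 0 \<Longrightarrow> exec (While e c) s (acost e + 1) s"
| WhileTrue: "\<lbrakk>aval e s \<noteq> 0; exec c s t s'; exec (While e c) s' t' s''\<rbrakk>
    \<Longrightarrow> exec (While e c) s (acost e + 1 + t + t') s''"

lemma exec_deterministic:
  assumes "exec c s t s'" and "exec c s u s''"
  shows "t = u \<and> s' = s''"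
  using assms
proof (induction arbitrary: u s'' rule: exec.induct)
  case (Skip s)
  from Skip.prems show ?case by cases auto
next
  case (Assign a e e' s)
  from Assign.prems show ?case by cases auto
next
  case (Seq c s t s' c' t' s1)
  from Seq.prems obtain v v' r where v: "u = v + v'" "exec c s v r" "exec c' r v' s''"
    by cases auto
  from Seq.IH(1)[OF v(2)] v(3) have "t = v" "exec c' s' v' s''" by simp_all
  with Seq.IH(2)[of v' s''] v(1) show ?case by simp
next
  case (IfTrue e s c t s' c')
  from IfTrue.prems IfTrue.hyps(1) obtain v where v: "u = acost e + 1 + v" "exec c s v s''"
    by cases auto
  from IfTrue.IH[OF v(2)] v(1) show ?case by simp
next
  case (IfFalse e s c' t s' c)
  from IfFalse.prems IfFalse.hyps(1) obtain v where v: "u = acost e + 1 + v" "exec c' s v s''"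
    by cases auto
  from IfFalse.IH[OF v(2)] v(1) show ?case by simp
next
  case (WhileFalse e s c)
  from WhileFalse.prems WhileFalse.hyps show ?case by cases auto
next
  case (WhileTrue e s c t s' t' s1)
  from WhileTrue.prems WhileTrue.hyps(1) obtain v v' r
    where v: "u = acost e + 1 + v + v'" "exec c s v r" "exec (While e c) r v' s''"
    by cases auto
  from WhileTrue.IH(1)[OF v(2)] v(3) have "t = v" "exec (While e c) s' v' s''" by simp_all
  with WhileTrue.IH(2)[of v' s''] v(1) show ?case by simp
qed


section \<open>Input and output\<close>

text \<open>A formula is stored as the sequence of its literals, each term being followed by the end
  marker 0.\<close>

fun lit_code :: "literal \<Rightarrow> nat" where
  "lit_code (Pos i) = 2 * i + 1"
| "lit_code (Neg i) = 2 * i + 2"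

definition dnf_code :: "dnf \<Rightarrow> nat list" where
  "dnf_code f = concat (map (\<lambda>T. map lit_code T @ [0]) f)"

text \<open>The real number \<open>\<epsilon>\<close> is presented by its binary expansion: \<open>bin_digit \<epsilon> k\<close> is the digit of
  weight \<open>2\<close> to the power \<open>- (k + 1)\<close>. An algorithm can read as many digits as it has time for.\<close>

definition bin_digit :: "real \<Rightarrow> nat \<Rightarrow> nat" where
  "bin_digit \<epsilon> k = nat (\<lfloor>\<epsilon> * 2 ^ (k + 1)\<rfloor> mod 2)"

text \<open>Array 0 starts with the number of variables and the number of terms, array 1 contains the
  formula and array 2 contains \<open>\<epsilon>\<close>. All other cells are initially 0.\<close>

definition input_state :: "nat \<Rightarrow> dnf \<Rightarrow> real \<Rightarrow> state" where
  "input_state n f \<epsilon> = (\<lambda>a i.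
     if a = 0 \<and> i = 0 then n
     else if a = 0 \<and> i = 1 then length f
     else if a = 1 \<and> i < length (dnf_code f) then dnf_code f ! i
     else if a = 2 then bin_digit \<epsilon> i
     else 0)"

text \<open>The output is the rational number whose numerator and denominator are the first two cells
  of array 3.\<close>

definition outputs :: "state \<Rightarrow> real \<Rightarrow> bool" where
  "outputs s v \<longleftrightarrow> s 3 1 > 0 \<and> v = real (s 3 0) / real (s 3 1)"


section \<open>Asymptotic bounds\<close>

definition lg :: "real \<Rightarrow> real" where
  "lg y = max 2 (log 2 y)"

definition softO :: "real \<Rightarrow> real \<Rightarrow> real" where
  "softO C T = C * T * lg T powr C"

end

theory Submission
  imports Defs
begin

text \<open>The bias is estimated by running a pseudorandom assignment procedure on all its seeds. Terms
  with more than \<open>log (m / \<epsilon>)\<close> literals are negligible. A hash function distributes the variables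
  over \<open>2 ^ c\<close> buckets in such a way that, with high probability, a given narrower term has at most
  \<open>r = O(log log (m n) + log (1 / \<epsilon>))\<close> variables in every bucket, where \<open>2 ^ c * r\<close> is
  \<open>O(log (m n / \<epsilon>))\<close>. The buckets are treated one after the other. While every term has at most
  \<open>w = 2 ^ a\<close> free variables in the bucket, a stage selects each of them with probability
  \<open>1 / (32 * w)\<close> and assigns almost \<open>r\<close>-wise independent bits to the selected ones. This hardly
  changes the acceptance probability, by a switching lemma: with probability \<open>1 - 2 * (1/2) ^ r\<close>
  over the selection and over the other variables, a decision tree of depth \<open>r\<close> in the selected
  variables finds the first satisfied term. After \<open>O(r)\<close> stages the first satisfied term is
  unlikely to have more than \<open>w / 2\<close> free variables in the bucket, so that terms with more of them
  can be dropped and \<open>w\<close> can be halved. A stage needs \<open>O(r * log r)\<close> random bits, which gives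
  \<open>(m n / \<epsilon>)\<close> to the power \<open>O(r * (log r) ^ 2)\<close> seeds altogether. The almost independent
  bits come from a sample space that is built greedily, by derandomizing the Chernoff bound for all parities of few bits.\<close>

section \<open>Averages and almost independence\<close>

text \<open>The buckets keep the seed short. Without them the width \<open>w\<close> would start
  near \<open>log (m n / \<epsilon>)\<close>; a stage would need independence of that order, since
  the lower bound for \<open>deep\<close> loses \<open>(1/2) ^ w\<close>, and as many stages would
  be needed, because the union bound over surviving sets of variables costs \<open>2 ^ w\<close>.
  The seed length would be quadratic in that logarithm. With width \<open>r\<close> in each of
  \<open>2 ^ c\<close> buckets it is about \<open>2 ^ c * r * r\<close>, up to factors
  \<open>log r\<close>. The selections are known only through the probability that they contain or
  miss a fixed set. The term queried by the canonical tree depends on the selection, so its paths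
  cannot be counted beforehand. A full random assignment replaces the first open term by the first
  satisfied one, which the selection does not influence, and a union bound over few candidate sets
  becomes possible. Fooling is proved for every event about the first satisfied term, not only for
  its existence: the terms dropped later depend on the selections, and whether the first satisfied
  term is still narrow is such an event.\<close>

definition avg :: "'a set \<Rightarrow> ('a \<Rightarrow> real) \<Rightarrow> real" where
  "avg I g = (\<Sum>i\<in>I. g i) / real (card I)"

lemma avg_cong [fundef_cong]: "I = J \<Longrightarrow> (\<And>i. i \<in> J \<Longrightarrow> g i = h i) \<Longrightarrow> avg I g = avg J h"
  unfolding avg_def by (auto intro: sum.cong)

lemma avg_mono: "(\<And>i. i \<in> I \<Longrightarrow> g i \<le> h i) \<Longrightarrow> avg I g \<le> avg I h"
  unfolding avg_def by (intro divide_right_mono sum_mono) auto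

lemma avg_nonneg: "(\<And>i. i \<in> I \<Longrightarrow> 0 \<le> g i) \<Longrightarrow> 0 \<le> avg I g"
  unfolding avg_def by (intro divide_nonneg_nonneg sum_nonneg) auto

lemma avg_const: "finite I \<Longrightarrow> I \<noteq> {} \<Longrightarrow> avg I (\<lambda>_. c) = c"
  unfolding avg_def by (simp add: card_eq_0_iff)

lemma avg_le: "finite I \<Longrightarrow> I \<noteq> {} \<Longrightarrow> (\<And>i. i \<in> I \<Longrightarrow> g i \<le> c) \<Longrightarrow> avg I g \<le> c"
  using avg_mono[of I g "\<lambda>_. c"] avg_const[of I c] by simp

lemma avg_add: "avg I (\<lambda>i. g i + h i) = avg I g + avg I h"
  unfolding avg_def by (simp add: sum.distrib add_divide_distrib)

lemma avg_diff: "avg I (\<lambda>i. g i - h i) = avg I g - avg I h"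
  unfolding avg_def by (simp add: sum_subtractf diff_divide_distrib)

lemma avg_cmult: "avg I (\<lambda>i. c * g i) = c * avg I g"
  unfolding avg_def by (simp add: sum_distrib_left)

lemma avg_multc: "avg I (\<lambda>i. g i * c) = avg I g * c"
  unfolding avg_def by (simp add: sum_distrib_right)

lemma avg_sum: "avg I (\<lambda>i. \<Sum>a\<in>A. g a i) = (\<Sum>a\<in>A. avg I (g a))"
  unfolding avg_def by (subst sum.swap) (simp add: sum_divide_distrib)

lemma avg_swap: "avg I (\<lambda>i. avg J (g i)) = avg J (\<lambda>j. avg I (\<lambda>i. g i j))"
  unfolding avg_def
  by (simp add: sum_divide_distrib[symmetric]) (subst sum.swap, simp add: mult.commute)

lemma avg_abs_diff:
  assumes "\<And>i. i \<in> I \<Longrightarrow> \<bar>g i - h i\<bar> \<le> d i"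
  shows "\<bar>avg I g - avg I h\<bar> \<le> avg I d"
proof -
  have "avg I (\<lambda>i. g i - h i) \<le> avg I d" using assms by (intro avg_mono) (meson abs_le_iff)
  moreover have "avg I (\<lambda>i. h i - g i) \<le> avg I d" using assms by (intro avg_mono) (smt (verit))
  ultimately show ?thesis by (simp add: avg_diff abs_le_iff)
qed

lemma avg_abs_diff_le:
  assumes "finite I" "I \<noteq> {}" "\<And>i. i \<in> I \<Longrightarrow> \<bar>g i - h i\<bar> \<le> c"
  shows "\<bar>avg I g - avg I h\<bar> \<le> c"
  using avg_abs_diff[of I g h "\<lambda>_. c", OF assms(3)] avg_const[OF assms(1,2), of c] by simp

definition pr :: "'a set \<Rightarrow> ('a \<Rightarrow> bool) \<Rightarrow> real" where
  "pr I P = avg I (\<lambda>i. of_bool (P i))"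

lemma pr_cong: "(\<And>i. i \<in> I \<Longrightarrow> P i = Q i) \<Longrightarrow> pr I P = pr I Q"
  unfolding pr_def by (intro avg_cong) auto

lemma pr_nonneg: "0 \<le> pr I P" unfolding pr_def by (intro avg_nonneg) auto

lemma pr_le_1: "pr I P \<le> 1"
proof (cases "finite I \<and> I \<noteq> {}")
  case True then show ?thesis unfolding pr_def by (intro avg_le) auto
next
  case False then show ?thesis unfolding pr_def avg_def by auto
qed

lemma pr_mono: "(\<And>i. i \<in> I \<Longrightarrow> P i \<Longrightarrow> Q i) \<Longrightarrow> pr I P \<le> pr I Q"
  unfolding pr_def by (intro avg_mono) auto

lemma pr_card: "finite I \<Longrightarrow> pr I P = real (card {i\<in>I. P i}) / real (card I)"
  unfolding pr_def avg_def by (simp add: Int_def)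

lemma pr_union_le: "pr I (\<lambda>i. P i \<or> Q i) \<le> pr I P + pr I Q"
  unfolding pr_def avg_add[symmetric] by (intro avg_mono) auto

lemma pr_bex_le:
  assumes "finite A"
  shows "pr I (\<lambda>i. \<exists>a\<in>A. P a i) \<le> (\<Sum>a\<in>A. pr I (P a))"
proof -
  have "of_bool (\<exists>a\<in>A. P a i) \<le> (\<Sum>a\<in>A. of_bool (P a i) :: real)" for i
  proof (cases "\<exists>a\<in>A. P a i")
    case True
    then obtain a where a: "a \<in> A" "P a i" by blast
    have "(of_bool (P a i)::real) \<le> (\<Sum>a\<in>A. of_bool (P a i))"
      using a assms by (intro member_le_sum) auto
    with a True show ?thesis by simp
  next
    case False then show ?thesis by (simp add: sum_nonneg)
  qed
  then show ?thesis unfolding pr_def avg_sum[symmetric] by (intro avg_mono) auto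
qed

lemma pr_split:
  assumes "finite A" "\<And>i. i \<in> I \<Longrightarrow> h i \<in> A"
  shows "pr I P = (\<Sum>a\<in>A. pr I (\<lambda>i. h i = a \<and> P i))"
proof -
  have "of_bool (P i) = (\<Sum>a\<in>A. of_bool (h i = a \<and> P i) :: real)" if "i \<in> I" for i
    using assms that by (simp add: of_bool_conj sum_distrib_right[symmetric])
  then show ?thesis unfolding pr_def avg_sum[symmetric] by (intro avg_cong) auto
qed

lemma avg_Pow_reindex: "finite I \<Longrightarrow> bij_betw f J I \<Longrightarrow> avg I g = avg J (\<lambda>j. g (f j))"
  unfolding avg_def using bij_betw_same_card[of f J I] sum.reindex_bij_betw[of f J I g] by simp

section \<open>Restrictions \<open>y\<close> with free set \<open>U\<close>, their completions by
  \<open>z\<close>, and resampling\<close>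

definition cmb :: "nat set \<Rightarrow> nat set \<Rightarrow> nat set \<Rightarrow> nat set" where
  "cmb U y z = (y - U) \<union> (z \<inter> U)"

text \<open>Exchanging the parts of \<open>z\<close> and \<open>z'\<close> inside \<open>B\<close>
  is an involution on pairs, so refreshing a part of a uniform assignment leaves it uniform.\<close>

lemma avg_resample:
  assumes "finite V"
  shows "avg (Pow V) (\<lambda>z. avg (Pow V) (\<lambda>z'. g (cmb B z z'))) = avg (Pow V) g"
proof -
  let ?P = "Pow V"
  have "(\<Sum>z\<in>?P. \<Sum>z'\<in>?P. g (cmb B z z')) = (\<Sum>(z,z')\<in>?P \<times> ?P. g (cmb B z z'))"
    by (simp add: sum.cartesian_product)
  also have "\<dots> = (\<Sum>(z,z')\<in>?P \<times> ?P. g z)"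
    by (rule sum.reindex_bij_witness[where i="\<lambda>(z,z'). (cmb B z z', cmb B z' z)" and j="\<lambda>(z,z'). (cmb B z z', cmb B z' z)"])
      (auto simp: cmb_def)
  also have "\<dots> = real (card ?P) * (\<Sum>z\<in>?P. g z)"
    by (simp add: sum.cartesian_product[symmetric] sum_distrib_left)
  finally show ?thesis unfolding avg_def using assms
    by (simp add: sum_divide_distrib[symmetric] card_Pow)
qed

lemma pr_resample:
  "finite V \<Longrightarrow> avg (Pow V) (\<lambda>z. pr (Pow V) (\<lambda>z'. P (cmb B z z'))) = pr (Pow V) P"
  unfolding pr_def by (rule avg_resample)

lemma pr_pattern:
  assumes "finite V" "S \<subseteq> V" "q \<subseteq> S"
  shows "pr (Pow V) (\<lambda>z. z \<inter> S = q) = (1/2) ^ card S"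
proof -
  have "bij_betw (\<lambda>z. z \<union> q) (Pow (V - S)) {z\<in>Pow V. z \<inter> S = q}"
    using assms by (intro bij_betw_byWitness[where f'="\<lambda>z. z - S"]) auto
  then have "card {z\<in>Pow V. z \<inter> S = q} = card (Pow (V - S))"
    by (metis bij_betw_same_card)
  also have "\<dots> = 2 ^ (card V - card S)" using assms by (simp add: card_Pow card_Diff_subset finite_subset)
  finally have *: "card {z\<in>Pow V. z \<inter> S = q} = 2 ^ (card V - card S)" .
  have "card S \<le> card V" using assms by (simp add: card_mono)
  then have "real (card {z\<in>Pow V. z \<inter> S = q}) = 2 ^ card V / 2 ^ card S"
    unfolding * using power_diff[of "2::real" "card S" "card V"] by simp
  then show ?thesis using assms(1) pr_card[of "Pow V" "\<lambda>z. z \<inter> S = q"] by (simp add: card_Pow power_one_over)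
qed

text \<open>Resampling \<open>S\<close> makes the pattern depend on the fresh assignment only and
  \<open>g\<close> on the old one only, so the average factorizes.\<close>

lemma avg_pattern_indep:
  fixes S :: "nat set"
  assumes "finite V" "S \<subseteq> V" "q \<subseteq> S"
  shows "avg (Pow V) (\<lambda>z. of_bool (z \<inter> S = q) * g (z - S)) = (1/2) ^ card S * avg (Pow V) (\<lambda>z. g (z - S))"
proof -
  have *: "cmb S z z' \<inter> S = z' \<inter> S" "cmb S z z' - S = z - S" for z z' by (auto simp: cmb_def)
  have "avg (Pow V) (\<lambda>z. of_bool (z \<inter> S = q) * g (z - S))
     = avg (Pow V) (\<lambda>z. avg (Pow V) (\<lambda>z'. of_bool (z' \<inter> S = q) * g (z - S)))"
    by (subst avg_resample[OF assms(1), of _ S, symmetric]) (simp add: *)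
  also have "\<dots> = avg (Pow V) (\<lambda>z. (1/2)^card S * g (z - S))"
    using pr_pattern[OF assms] by (simp add: avg_multc pr_def)
  finally show ?thesis by (simp add: avg_cmult)
qed

text \<open>Almost \<open>k\<close>-wise independence in the maximum norm: the error \<delta> is
  allowed for each pattern separately. A decision tree of depth \<open>c\<close> therefore pays for
  each of its leaves, up to \<open>2 ^ c * \<delta>\<close>.\<close>

definition almost :: "'i set \<Rightarrow> ('i \<Rightarrow> nat set) \<Rightarrow> nat set \<Rightarrow> nat \<Rightarrow> real \<Rightarrow> bool" where
  "almost I D V k \<delta> \<longleftrightarrow> finite I \<and> I \<noteq> {} \<and> \<delta> \<ge> 0 \<and>
     (\<forall>Q q. Q \<subseteq> V \<and> card Q \<le> k \<and> q \<subseteq> Q \<longrightarrow> \<bar>pr I (\<lambda>i. D i \<inter> Q = q) - (1/2) ^ card Q\<bar> \<le> \<delta>)"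

lemma almost_cube: "finite V \<Longrightarrow> almost (Pow V) (\<lambda>z. z) V k 0"
  unfolding almost_def by (auto simp: pr_pattern)

section \<open>Decision trees\<close>

text \<open>A term is the pair of the set of its variables and the set of those that occur positively, an
  assignment is the set of the true variables.\<close>

type_synonym trm = "nat set \<times> nat set"

definition sat :: "nat set \<Rightarrow> trm \<Rightarrow> bool" where
  "sat x T \<longleftrightarrow> x \<inter> fst T = snd T"

text \<open>The variables in \<open>B\<close> are free, the others have the values given by \<open>y\<close>.\<close>

definition open_on :: "nat set \<Rightarrow> nat set \<Rightarrow> trm \<Rightarrow> bool" where
  "open_on B y T \<longleftrightarrow> y \<inter> (fst T - B) = snd T - B"

abbreviation first :: "trm list \<Rightarrow> nat set \<Rightarrow> trm option" where
  "first F x \<equiv> find (sat x) F"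

definition wf_terms :: "trm list \<Rightarrow> bool" where
  "wf_terms F \<longleftrightarrow> (\<forall>T\<in>set F. snd T \<subseteq> fst T \<and> finite (fst T))"

text \<open>The canonical decision tree for the first satisfied term, which always queries all free variables
  of the first term that is not yet falsified, has depth at most \<open>c\<close>.\<close>

inductive simple :: "trm list \<Rightarrow> nat \<Rightarrow> nat set \<Rightarrow> nat set \<Rightarrow> bool" for F where
  simple_None: "find (open_on B y) F = None \<Longrightarrow> simple F c B y"
| simple_sat: "find (open_on B y) F = Some T \<Longrightarrow> fst T \<inter> B = {} \<Longrightarrow> simple F c B y"
| simple_branch: "find (open_on B y) F = Some T \<Longrightarrow> fst T \<inter> B \<noteq> {} \<Longrightarrow> card (fst T \<inter> B) < c \<Longrightarrow>
    (\<And>a. a \<subseteq> fst T \<inter> B \<Longrightarrow> simple F (c - card (fst T \<inter> B)) (B - fst T) ((y - (fst T \<inter> B)) \<union> a)) \<Longrightarrow> simple F c B y"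

lemma sat_imp_open: "sat (cmb B y z) T \<Longrightarrow> open_on B y T"
  unfolding sat_def open_on_def cmb_def by blast

lemma find_None_mono: "find P F = None \<Longrightarrow> (\<And>T. Q T \<Longrightarrow> P T) \<Longrightarrow> find Q F = None"
  by (auto simp: find_None_iff)

lemma find_Some_mono: "find P F = Some T \<Longrightarrow> (\<And>T. Q T \<Longrightarrow> P T) \<Longrightarrow> Q T \<Longrightarrow> find Q F = Some T"
  by (induction F) (auto split: if_splits)

lemma find_SomeD: "find P F = Some T \<Longrightarrow> T \<in> set F \<and> P T"
  by (induction F) (auto split: if_splits)

lemma open_sat:
  assumes "open_on B y T" "z \<inter> (fst T \<inter> B) = snd T \<inter> B"
  shows "sat (cmb B y z) T"
  using assms unfolding sat_def open_on_def cmb_def by blast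

text \<open>A satisfied term is open. Hence no term before the first open one can be satisfied, and
  satisfying the first open one makes it the first satisfied one.\<close>

lemma first_cmb_Some:
  assumes "find (open_on B y) F = Some T" "z \<inter> (fst T \<inter> B) = snd T \<inter> B"
  shows "first F (cmb B y z) = Some T"
  using find_Some_mono[OF assms(1), of "sat (cmb B y z)"] sat_imp_open open_sat find_SomeD[OF assms(1)] assms(2)
  by blast

lemma cmb_branch:
  assumes "z \<inter> (S \<inter> B) = a"
  shows "cmb B y z = cmb (B - S) ((y - (S \<inter> B)) \<union> a) z"
  using assms unfolding cmb_def by blast

lemma abs_sum_le: fixes f g :: "'a \<Rightarrow> real" and c :: real shows "(\<And>a. a \<in> A \<Longrightarrow> \<bar>f a - g a\<bar> \<le> (c::real)) \<Longrightarrow> finite A \<Longrightarrow> \<bar>sum f A - sum g A\<bar> \<le> real (card A) * c"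
  using sum_abs[of "\<lambda>a. f a - g a" A] sum_bounded_above[of A "\<lambda>a. \<bar>f a - g a\<bar>" c]
  by (simp add: sum_subtractf)

text \<open>Induction over the tree, adding the errors of the leaves. \<open>L\<close> is the true
  probability; it is chosen before the sample space, so that the same number serves for the almost
  independent space and for the cube. The pattern \<open>q\<close> on \<open>Q\<close> carries the
  answers already read, without which the branches could not be summed.\<close>

lemma simple_fools:
  assumes "simple F c B y" "wf_terms F" "finite B" "B \<subseteq> V"
  shows "\<exists>L. \<forall>I D \<delta> k Q q. almost (I :: 'i set) D V k \<delta> \<longrightarrow> Q \<subseteq> V \<longrightarrow> finite Q \<longrightarrow> Q \<inter> B = {} \<longrightarrow> q \<subseteq> Q \<longrightarrow> card Q + c \<le> k \<longrightarrow>
    \<bar>pr I (\<lambda>i. D i \<inter> Q = q \<and> first F (cmb B y (D i)) \<in> A) - (1/2) ^ card Q * L\<bar> \<le> 2 ^ c * \<delta>"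
  using assms
proof (induction c B y rule: simple.induct)
  case (simple_None B y c)
  have *: "first F (cmb B y z) = None" for z
    using simple_None.hyps sat_imp_open find_None_mono by metis
  have "\<bar>pr I (\<lambda>i. D i \<inter> Q = q \<and> first F (cmb B y (D i)) \<in> A) - (1/2) ^ card Q * of_bool (None \<in> A)\<bar> \<le> 2 ^ c * \<delta>"
    if a: "almost I D V k \<delta>" and "Q \<subseteq> V" "q \<subseteq> Q" "card Q + c \<le> k" for I :: "'i set" and D \<delta> k Q q
  proof -
    have "\<delta> \<ge> 0" "\<bar>pr I (\<lambda>i. D i \<inter> Q = q) - (1/2) ^ card Q\<bar> \<le> \<delta>" using that unfolding almost_def by auto
    moreover from this have "\<delta> \<le> 2 ^ c * \<delta>" using mult_right_mono[of 1 "2^c" \<delta>] by simp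
    ultimately show ?thesis unfolding * by (cases "None \<in> A") (auto simp: pr_def avg_def)
  qed
  then show ?case by blast
next
  case (simple_sat B y T c)
  have "sat (cmb B y z) T" for z
    using find_SomeD[OF simple_sat.hyps(1)] simple_sat.hyps(2) simple_sat.prems(1)
    unfolding wf_terms_def open_on_def sat_def cmb_def by blast
  then have *: "first F (cmb B y z) = Some T" for z
    using find_Some_mono[OF simple_sat.hyps(1), of "sat (cmb B y z)"] sat_imp_open by blast
  have "\<bar>pr I (\<lambda>i. D i \<inter> Q = q \<and> first F (cmb B y (D i)) \<in> A) - (1/2) ^ card Q * of_bool (Some T \<in> A)\<bar> \<le> 2 ^ c * \<delta>"
    if a: "almost I D V k \<delta>" and "Q \<subseteq> V" "q \<subseteq> Q" "card Q + c \<le> k" for I :: "'i set" and D \<delta> k Q q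
  proof -
    have "\<delta> \<ge> 0" "\<bar>pr I (\<lambda>i. D i \<inter> Q = q) - (1/2) ^ card Q\<bar> \<le> \<delta>" using that unfolding almost_def by auto
    moreover from this have "\<delta> \<le> 2 ^ c * \<delta>" using mult_right_mono[of 1 "2^c" \<delta>] by simp
    ultimately show ?thesis unfolding * by (cases "Some T \<in> A") (auto simp: pr_def avg_def)
  qed
  then show ?case by blast
next
  case (simple_branch B y T c)
  let ?S = "fst T \<inter> B"
  have fS: "finite ?S" using simple_branch.prems by auto
  have "\<forall>a\<in>Pow ?S. \<exists>L. \<forall>I D \<delta> k Q q. almost (I :: 'i set) D V k \<delta> \<longrightarrow> Q \<subseteq> V \<longrightarrow> finite Q \<longrightarrow> Q \<inter> (B - fst T) = {} \<longrightarrow> q \<subseteq> Q \<longrightarrow> card Q + (c - card ?S) \<le> k \<longrightarrow>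
    \<bar>pr I (\<lambda>i. D i \<inter> Q = q \<and> first F (cmb (B - fst T) ((y - ?S) \<union> a) (D i)) \<in> A) - (1/2) ^ card Q * L\<bar> \<le> 2 ^ (c - card ?S) * \<delta>"
    by (intro ballI simple_branch.IH) (use simple_branch.prems in auto)
  from bchoice[OF this] obtain L where L: "\<forall>a\<in>Pow ?S. \<forall>I D \<delta> k Q q. almost (I :: 'i set) D V k \<delta> \<longrightarrow> Q \<subseteq> V \<longrightarrow> finite Q \<longrightarrow> Q \<inter> (B - fst T) = {} \<longrightarrow> q \<subseteq> Q \<longrightarrow> card Q + (c - card ?S) \<le> k \<longrightarrow>
    \<bar>pr I (\<lambda>i. D i \<inter> Q = q \<and> first F (cmb (B - fst T) ((y - ?S) \<union> a) (D i)) \<in> A) - (1/2) ^ card Q * L a\<bar> \<le> 2 ^ (c - card ?S) * \<delta>" ..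
  have "\<bar>pr I (\<lambda>i. D i \<inter> Q = q \<and> first F (cmb B y (D i)) \<in> A) - (1/2) ^ card Q * ((1/2) ^ card ?S * (\<Sum>a\<in>Pow ?S. L a))\<bar> \<le> 2 ^ c * \<delta>"
    if a: "almost I D V k \<delta>" and Q: "Q \<subseteq> V" "finite Q" "Q \<inter> B = {}" "q \<subseteq> Q" "card Q + c \<le> k" for I :: "'i set" and D \<delta> k Q q
  proof -
    have cQ: "card (Q \<union> ?S) = card Q + card ?S" using Q fS by (intro card_Un_disjoint) auto
    have "pr I (\<lambda>i. D i \<inter> Q = q \<and> first F (cmb B y (D i)) \<in> A)
       = (\<Sum>a\<in>Pow ?S. pr I (\<lambda>i. D i \<inter> ?S = a \<and> (D i \<inter> Q = q \<and> first F (cmb B y (D i)) \<in> A)))"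
      by (rule pr_split) (use fS in \<open>simp only: finite_Pow_iff, blast\<close>)
    also have "\<dots> = (\<Sum>a\<in>Pow ?S. pr I (\<lambda>i. D i \<inter> (Q \<union> ?S) = q \<union> a \<and> first F (cmb (B - fst T) ((y - ?S) \<union> a) (D i)) \<in> A))"
    proof (intro sum.cong refl pr_cong)
      fix a i assume "a \<in> Pow ?S" "i \<in> I"
      then have "(D i \<inter> ?S = a \<and> D i \<inter> Q = q) \<longleftrightarrow> D i \<inter> (Q \<union> ?S) = q \<union> a"
        using Q(3,4) by blast
      moreover have "cmb B y (D i) = cmb (B - fst T) ((y - ?S) \<union> a) (D i)" if "D i \<inter> ?S = a"
        using cmb_branch[of "D i" "fst T" B a y] that by simp
      ultimately show "(D i \<inter> ?S = a \<and> (D i \<inter> Q = q \<and> first F (cmb B y (D i)) \<in> A))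
         \<longleftrightarrow> (D i \<inter> (Q \<union> ?S) = q \<union> a \<and> first F (cmb (B - fst T) ((y - ?S) \<union> a) (D i)) \<in> A)"
        by metis
    qed
    finally have 1: "pr I (\<lambda>i. D i \<inter> Q = q \<and> first F (cmb B y (D i)) \<in> A) = \<dots>" .
    have 2: "(1/2) ^ card Q * ((1/2) ^ card ?S * (\<Sum>a\<in>Pow ?S. L a)) = (\<Sum>a\<in>Pow ?S. (1/2) ^ card (Q \<union> ?S) * L a)"
      unfolding cQ by (simp add: sum_distrib_left power_add mult.assoc)
    have "\<bar>pr I (\<lambda>i. D i \<inter> Q = q \<and> first F (cmb B y (D i)) \<in> A) - (1/2) ^ card Q * ((1/2) ^ card ?S * (\<Sum>a\<in>Pow ?S. L a))\<bar>
       \<le> card (Pow ?S) * (2 ^ (c - card ?S) * \<delta>)"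
      unfolding 1 2
    proof (rule abs_sum_le)
      fix b assume "b \<in> Pow ?S"
      then show "\<bar>pr I (\<lambda>i. D i \<inter> (Q \<union> ?S) = q \<union> b \<and> first F (cmb (B - fst T) ((y - ?S) \<union> b) (D i)) \<in> A) - (1/2) ^ card (Q \<union> ?S) * L b\<bar> \<le> 2 ^ (c - card ?S) * \<delta>"
        using Q fS a simple_branch.prems simple_branch.hyps(3) cQ
        by (intro L[rule_format, where k=k]) auto
    qed (simp only: finite_Pow_iff fS)
    also have "\<dots> = 2 ^ c * \<delta>"
      unfolding card_Pow[OF fS] using simple_branch.hyps(3) power_add[of "2::real" "card ?S" "c - card ?S"] by simp
    finally show ?thesis .
  qed
  then show ?case by blast
qed

text \<open>Unlike the negation of \<open>simple\<close>, this refers to a full assignment \<open>x\<close>, whose first satisfied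
  term replaces the first open one. A path of length \<open>c\<close> in the canonical tree yields it with
  probability at least \<open>(1/2) ^ (c + w)\<close>, because \<open>x\<close> may satisfy each term of the path in turn.\<close>

inductive deep :: "trm list \<Rightarrow> nat \<Rightarrow> nat set \<Rightarrow> nat set \<Rightarrow> bool" for F where
  deep_last: "first F x = Some T \<Longrightarrow> c \<le> card (fst T \<inter> B) \<Longrightarrow> deep F c B x"
| deep_step: "first F x = Some T \<Longrightarrow> fst T \<inter> B \<noteq> {} \<Longrightarrow> card (fst T \<inter> B) < c \<Longrightarrow> a \<subseteq> fst T \<inter> B \<Longrightarrow>
    deep F (c - card (fst T \<inter> B)) (B - fst T) ((x - (fst T \<inter> B)) \<union> a) \<Longrightarrow> deep F c B x"

lemma deep_lower:
  assumes "\<not> simple F c B y" "wf_terms F" "finite V" "B \<subseteq> V" "\<And>T. T \<in> set F \<Longrightarrow> card (fst T \<inter> B) \<le> w"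
  shows "(1/2) ^ (c + w) \<le> pr (Pow V) (\<lambda>z. deep F c B (cmb B y z))"
  using assms
proof (induction c arbitrary: B y rule: less_induct)
  case (less c)
  have fB: "finite B" using less.prems finite_subset by blast
  from less.prems(1) obtain T where T: "find (open_on B y) F = Some T"
    using simple_None by (metis not_None_eq)
  let ?S = "fst T \<inter> B"
  have ne: "?S \<noteq> {}" using less.prems(1) T simple_sat by blast
  have TF: "T \<in> set F" using find_SomeD[OF T] by simp
  have ST: "snd T \<inter> B \<subseteq> ?S" using TF less.prems(2) unfolding wf_terms_def by blast
  have SV: "?S \<subseteq> V" using less.prems by auto
  have fin: "finite ?S" using fB by simp
  show ?case
  proof (cases "c \<le> card ?S")
    \<comment> \<open>The last term of a path may have more free variables than are still missing,
      up to \<open>w\<close> in total. The summand \<open>w\<close> in the exponent pays for this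
      overshoot.\<close>
    case True
    have "(1/2::real) ^ (c + w) \<le> (1/2) ^ card ?S"
      using less.prems(5)[OF TF] by (intro power_decreasing) auto
    also have "\<dots> = pr (Pow V) (\<lambda>z. z \<inter> ?S = snd T \<inter> B)"
      using pr_pattern[OF less.prems(3) SV ST] by simp
    also have "\<dots> \<le> pr (Pow V) (\<lambda>z. deep F c B (cmb B y z))"
      using True first_cmb_Some[OF T] by (intro pr_mono) (auto intro: deep_last)
    finally show ?thesis .
  next
    case False
    then obtain a where a: "a \<subseteq> ?S" "\<not> simple F (c - card ?S) (B - fst T) ((y - ?S) \<union> a)"
      using less.prems(1) T ne simple_branch[OF T ne] by force
    have cS: "0 < card ?S" using ne fin by (simp add: card_gt_0_iff)
    have "card (fst T' \<inter> (B - fst T)) \<le> w" if "T' \<in> set F" for T'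
      using less.prems(5)[OF that] card_mono[of "fst T' \<inter> B" "fst T' \<inter> (B - fst T)"] fB by fastforce
    then have IH: "(1/2) ^ (c - card ?S + w) \<le> pr (Pow V) (\<lambda>z. deep F (c - card ?S) (B - fst T) (cmb (B - fst T) ((y - ?S) \<union> a) z))"
      using less.prems a False cS by (intro less.IH) auto
    \<comment> \<open>The bits of \<open>z\<close> in \<open>?S\<close> are overwritten by
      \<open>a\<close> in the recursive event, which is therefore independent of the event that they
      satisfy \<open>T\<close>.\<close>
    let ?g = "\<lambda>z. of_bool (deep F (c - card ?S) (B - fst T) (cmb (B - fst T) ((y - ?S) \<union> a) z)) :: real"
    have gS: "cmb (B - fst T) ((y - ?S) \<union> a) (z - ?S) = cmb (B - fst T) ((y - ?S) \<union> a) z" for z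
      unfolding cmb_def by blast
    have "(1/2::real) ^ (c + w) = (1/2) ^ card ?S * (1/2) ^ (c - card ?S + w)"
      using False by (simp add: power_add[symmetric])
    also have "\<dots> \<le> (1/2) ^ card ?S * avg (Pow V) (\<lambda>z. ?g (z - ?S))"
      using IH unfolding pr_def gS by (intro mult_left_mono) auto
    also have "\<dots> = avg (Pow V) (\<lambda>z. of_bool (z \<inter> ?S = snd T \<inter> B) * ?g (z - ?S))"
      using avg_pattern_indep[OF less.prems(3) SV ST, of ?g] by simp
    also have "\<dots> \<le> avg (Pow V) (\<lambda>z. of_bool (deep F c B (cmb B y z)))"
    proof (intro avg_mono)
      fix z assume "z \<in> Pow V"
      have "deep F c B (cmb B y z)" if z: "z \<inter> ?S = snd T \<inter> B"
        "deep F (c - card ?S) (B - fst T) (cmb (B - fst T) ((y - ?S) \<union> a) z)"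
      proof -
        have "(cmb B y z - ?S) \<union> a = cmb (B - fst T) ((y - ?S) \<union> a) z"
          using a(1) unfolding cmb_def by blast
        then show ?thesis using z(2) ne False a(1)
          by (intro deep.deep_step[OF first_cmb_Some[OF T z(1)], of B c a]) simp_all
      qed
      then show "of_bool (z \<inter> ?S = snd T \<inter> B) * ?g (z - ?S) \<le> (of_bool (deep F c B (cmb B y z)) :: real)"
        unfolding gS by auto
    qed
    finally show ?thesis unfolding pr_def .
  qed
qed

text \<open>The variable sets that certify \<open>deep\<close>. For fixed \<open>x\<close> there are few of them, so a random set
  \<open>B\<close> rarely contains one.\<close>

inductive wit :: "trm list \<Rightarrow> nat set \<Rightarrow> nat \<Rightarrow> nat set \<Rightarrow> nat set \<Rightarrow> bool" for F U where
  wit_0: "wit F U 0 x {}"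
| wit_step: "first F x = Some T \<Longrightarrow> R \<subseteq> fst T \<inter> U \<Longrightarrow> R \<noteq> {} \<Longrightarrow> card R \<le> c \<Longrightarrow> a \<subseteq> R \<Longrightarrow>
    wit F U (c - card R) ((x - R) \<union> a) S \<Longrightarrow> R \<inter> S = {} \<Longrightarrow> wit F U c x (R \<union> S)"

text \<open>The last term is cut down to a set \<open>R\<close> of exactly the missing size. Only
  subsets of \<open>U\<close> are mentioned, so the witnesses are determined before \<open>B\<close>
  is drawn.\<close>

lemma deep_wit:
  assumes "deep F c B x" "0 < c" "B \<subseteq> U" "finite B"
  shows "\<exists>S. wit F U c x S \<and> S \<subseteq> B"
  using assms
proof (induction rule: deep.induct)
  case (deep_last x T c B)
  then obtain R where R: "R \<subseteq> fst T \<inter> B" "card R = c"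
    by (meson finite_Int obtain_subset_with_card_n)
  then have "R \<noteq> {}" using deep_last by auto
  have "wit F U c x (R \<union> {})"
    by (rule wit_step[where T=T and a="{}"]) (use \<open>R \<noteq> {}\<close> deep_last R wit_0[of F U "x - R"] in auto)
  then show ?case using R by auto
next
  case (deep_step x T B c a)
  have "0 < c - card (fst T \<inter> B)" "B - fst T \<subseteq> U" "finite (B - fst T)"
    using deep_step.hyps deep_step.prems by auto
  from deep_step.IH[OF this] obtain S where S: "wit F U (c - card (fst T \<inter> B)) ((x - fst T \<inter> B) \<union> a) S" "S \<subseteq> B - fst T"
    by blast
  have "wit F U c x (fst T \<inter> B \<union> S)"
    by (rule wit_step[where T=T and a=a]) (use deep_step S in auto)
  then show ?case using S by blast
qed

lemma wit_sub: "wit F U c x S \<Longrightarrow> S \<subseteq> U"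
  by (induction rule: wit.induct) auto

lemma wit_card: "wit F U c x S \<Longrightarrow> finite U \<Longrightarrow> card S = c"
proof (induction rule: wit.induct)
  case (wit_step x T R c a S)
  have "finite R" "finite S" using wit_step.hyps wit_step.prems wit_sub[OF wit_step.hyps(6)] finite_subset[of _ U] by auto
  then show ?case using wit_step by (simp add: card_Un_disjoint)
qed simp

text \<open>The term \<open>T\<close> is determined by \<open>x\<close>, so a witness is given by
  the size \<open>s\<close> of its first part, one of at most \<open>w ^ s\<close> subsets, one of
  \<open>2 ^ s\<close> answers and a smaller witness. The recursion closes because the sum of
  \<open>w ^ s * 2 ^ s * (4 * w) ^ (c - s)\<close> over \<open>s \<ge> 1\<close> is at most
  \<open>(4 * w) ^ c\<close>.\<close>

lemma wit_count:
  assumes "finite U" "\<And>T. T \<in> set F \<Longrightarrow> card (fst T \<inter> U) \<le> w" "0 < w"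
  shows "real (card {S. wit F U c x S}) \<le> (4 * real w) ^ c"
proof (induction c arbitrary: x rule: less_induct)
  case (less c)
  have finW: "finite {S. wit F U c x S}" for c x
    by (rule finite_subset[of _ "Pow U"]) (use wit_sub assms(1) in \<open>blast, simp\<close>)
  show ?case
  proof (cases "c = 0")
    case True
    have "S = {}" if "wit F U c x S" for S
      using wit_card[OF that assms(1)] wit_sub[OF that] assms(1) True by (simp add: finite_subset)
    then have "{S. wit F U c x S} \<subseteq> {{}}" by auto
    from card_mono[OF _ this] have "card {S. wit F U c x S} \<le> 1" by simp
    then show ?thesis using True by simp
  next
    case False
    show ?thesis
    proof (cases "first F x")
      case None
      then have "{S. wit F U c x S} = {}" using False by (auto elim: wit.cases)
      then show ?thesis by simp
    next
      case (Some T)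
      let ?Y = "fst T \<inter> U"
      have cY: "card ?Y \<le> w" using find_SomeD[OF Some] assms(2) by blast
      have fY: "finite ?Y" using assms by simp
      have sub: "{S. wit F U c x S} \<subseteq> (\<Union>s\<in>{1..c}. \<Union>R\<in>{R. R \<subseteq> ?Y \<and> card R = s}. \<Union>a\<in>Pow R. (\<lambda>S. R \<union> S) ` {S. wit F U (c - s) ((x - R) \<union> a) S})"
      proof
        fix S assume "S \<in> {S. wit F U c x S}"
        then have "wit F U c x S" by simp
        then show "S \<in> (\<Union>s\<in>{1..c}. \<Union>R\<in>{R. R \<subseteq> ?Y \<and> card R = s}. \<Union>a\<in>Pow R. (\<lambda>S. R \<union> S) ` {S. wit F U (c - s) ((x - R) \<union> a) S})"
        proof cases
          case wit_0 then show ?thesis using False by simp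
        next
          case (wit_step T' R a S')
          then have [simp]: "T' = T" using Some by simp
          have "finite R" using wit_step(3) finite_subset[OF _ fY, of R] by simp
          then have "1 \<le> card R" using wit_step by (simp add: Suc_le_eq card_gt_0_iff)
          then have 1: "card R \<in> {1..c}" using wit_step by simp
          have 2: "R \<in> {R'. R' \<subseteq> ?Y \<and> card R' = card R}" using wit_step by simp
          have 3: "S \<in> (\<lambda>S. R \<union> S) ` {S. wit F U (c - card R) ((x - R) \<union> a) S}" using wit_step by blast
          show ?thesis by (rule UN_I[OF 1], rule UN_I[OF 2], rule UN_I[where a=a]) (use wit_step 3 in simp_all)
        qed
      qed
      have fR: "finite {R. R \<subseteq> ?Y \<and> card R = s}" for s
        by (rule finite_subset[of _ "Pow ?Y"]) (use fY finite_Pow_iff[of ?Y] in blast)+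
      have one: "real (card (\<Union>a\<in>Pow R. (\<lambda>S. R \<union> S) ` {S. wit F U (c - s) ((x - R) \<union> a) S})) \<le> 2 ^ s * (4 * real w) ^ (c - s)"
        if "s \<in> {1..c}" "R \<subseteq> ?Y" "card R = s" for s R
      proof -
        have fr: "finite R" using that fY finite_subset by blast
        have "card (\<Union>a\<in>Pow R. (\<lambda>S. R \<union> S) ` {S. wit F U (c - s) ((x - R) \<union> a) S})
          \<le> (\<Sum>a\<in>Pow R. card ((\<lambda>S. R \<union> S) ` {S. wit F U (c - s) ((x - R) \<union> a) S}))"
          using fr by (intro card_UN_le) auto
        also have "\<dots> \<le> (\<Sum>a\<in>Pow R. card {S. wit F U (c - s) ((x - R) \<union> a) S})"
          using finW by (intro sum_mono card_image_le) auto
        finally have "real (card (\<Union>a\<in>Pow R. (\<lambda>S. R \<union> S) ` {S. wit F U (c - s) ((x - R) \<union> a) S}))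
          \<le> (\<Sum>a\<in>Pow R. real (card {S. wit F U (c - s) ((x - R) \<union> a) S}))"
          by (simp add: of_nat_sum[symmetric] del: of_nat_sum)
        also have "\<dots> \<le> (\<Sum>a\<in>Pow R. (4 * real w) ^ (c - s))"
          using that False by (intro sum_mono less.IH) auto
        also have "\<dots> = 2 ^ s * (4 * real w) ^ (c - s)" using fr that by (simp add: card_Pow)
        finally show ?thesis .
      qed
      have two: "real (card (\<Union>R\<in>{R. R \<subseteq> ?Y \<and> card R = s}. \<Union>a\<in>Pow R. (\<lambda>S. R \<union> S) ` {S. wit F U (c - s) ((x - R) \<union> a) S}))
           \<le> (1/2)^s * (4 * real w) ^ c" if s: "s \<in> {1..c}" for s
      proof -
        have "real (card (\<Union>R\<in>{R. R \<subseteq> ?Y \<and> card R = s}. \<Union>a\<in>Pow R. (\<lambda>S. R \<union> S) ` {S. wit F U (c - s) ((x - R) \<union> a) S}))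
          \<le> (\<Sum>R\<in>{R. R \<subseteq> ?Y \<and> card R = s}. real (card (\<Union>a\<in>Pow R. (\<lambda>S. R \<union> S) ` {S. wit F U (c - s) ((x - R) \<union> a) S})))"
          unfolding of_nat_sum[symmetric] of_nat_le_iff using fR by (intro card_UN_le) auto
        also have "\<dots> \<le> (\<Sum>R\<in>{R. R \<subseteq> ?Y \<and> card R = s}. 2 ^ s * (4 * real w) ^ (c - s))"
          using one s by (intro sum_mono) auto
        also have "\<dots> = real (card ?Y choose s) * (2 ^ s * (4 * real w) ^ (c - s))"
          using n_subsets[OF fY] by simp
        also have "\<dots> \<le> real (w ^ s) * (2 ^ s * (4 * real w) ^ (c - s))"
        proof (intro mult_right_mono)
          have "card ?Y choose s \<le> card ?Y ^ s"
            by (cases "s \<le> card ?Y") (auto intro: binomial_le_pow simp: binomial_eq_0)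
          also have "\<dots> \<le> w ^ s" using cY by (intro power_mono) auto
          finally show "real (card ?Y choose s) \<le> real (w ^ s)" by (simp only: of_nat_le_iff)
        qed auto
        also have "\<dots> = (1/2)^s * ((4 * real w)^s * (4 * real w) ^ (c - s))"
        proof -
          have "real (w ^ s) * 2 ^ s = (1/2)^s * (4 * real w)^s"
            by (subst power_mult_distrib[symmetric]) (simp add: power_mult_distrib)
          then show ?thesis by (simp add: mult.assoc[symmetric])
        qed
        also have "\<dots> = (1/2)^s * (4 * real w) ^ c" using power_add[of "4 * real w" s "c - s"] s by simp
        finally show ?thesis .
      qed
      have fin: "finite (\<Union>s\<in>{1..c}. \<Union>R\<in>{R. R \<subseteq> ?Y \<and> card R = s}. \<Union>a\<in>Pow R. (\<lambda>S. R \<union> S) ` {S. wit F U (c - s) ((x - R) \<union> a) S})"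
      proof (intro finite_UN_I fR finite_imageI finW)
        fix s R assume "R \<in> {R. R \<subseteq> ?Y \<and> card R = s}"
        then have "finite R" using finite_subset[OF _ fY, of R] by simp
        then show "finite (Pow R)" by simp
      qed simp
      have "real (card {S. wit F U c x S}) \<le> real (card (\<Union>s\<in>{1..c}. \<Union>R\<in>{R. R \<subseteq> ?Y \<and> card R = s}. \<Union>a\<in>Pow R. (\<lambda>S. R \<union> S) ` {S. wit F U (c - s) ((x - R) \<union> a) S}))"
        using card_mono[OF fin sub] by simp
      also have "\<dots> \<le> (\<Sum>s\<in>{1..c}. real (card (\<Union>R\<in>{R. R \<subseteq> ?Y \<and> card R = s}. \<Union>a\<in>Pow R. (\<lambda>S. R \<union> S) ` {S. wit F U (c - s) ((x - R) \<union> a) S})))"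
        unfolding of_nat_sum[symmetric] of_nat_le_iff by (intro card_UN_le) auto
      also have "\<dots> \<le> (\<Sum>s\<in>{1..c}. (1/2)^s * (4 * real w) ^ c)" using two by (intro sum_mono) auto
      also have "\<dots> = (\<Sum>s\<in>{1..c}. (1/2)^s) * (4 * real w) ^ c" by (simp add: sum_distrib_right)
      also have "\<dots> \<le> 1 * (4 * real w) ^ c"
      proof (intro mult_right_mono)
        have "(\<Sum>s\<in>{1..c}. (1/2::real)^s) = 1 - (1/2)^c" by (induction c) auto
        then show "(\<Sum>s\<in>{1..c}. (1/2::real)^s) \<le> 1" by simp
      qed auto
      finally show ?thesis by simp
    qed
  qed
qed

section \<open>Stages\<close>

lemma cmb_cmb: "B \<subseteq> U \<Longrightarrow> cmb U y (cmb B z z') = cmb B (cmb U y z) z'"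
  unfolding cmb_def by blast

lemma cmb_assign: "B \<subseteq> U \<Longrightarrow> cmb (U - B) (cmb B y d) z = cmb B (cmb U y z) d"
  unfolding cmb_def by blast

definition tup :: "'a set \<Rightarrow> nat \<Rightarrow> 'a list set" where
  "tup I l = {xs. set xs \<subseteq> I \<and> length xs = l}"

lemma tup_0: "tup I 0 = {[]}" unfolding tup_def by auto

lemma finite_tup: "finite I \<Longrightarrow> finite (tup I l)"
  unfolding tup_def by (rule finite_lists_length_eq)

lemma tup_ne: "I \<noteq> {} \<Longrightarrow> tup I l \<noteq> {}"
proof -
  assume "I \<noteq> {}"
  then obtain i where "i \<in> I" by blast
  then have "replicate l i \<in> tup I l" unfolding tup_def by auto
  then show ?thesis by blast
qed

lemma tup_Suc: "tup I (Suc l) = (\<lambda>(t, ts). t # ts) ` (I \<times> tup I l)"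
  unfolding tup_def by (auto simp: length_Suc_conv image_iff)

lemma avg_tup_Suc:
  "avg (tup I (Suc l)) g = avg I (\<lambda>t. avg (tup I l) (\<lambda>ts. g (t # ts)))"
proof -
  have inj: "inj_on (\<lambda>(t, ts). t # ts) (I \<times> tup I l)" by (auto simp: inj_on_def)
  have "sum g (tup I (Suc l)) = (\<Sum>t\<in>I. \<Sum>ts\<in>tup I l. g (t # ts))"
    unfolding tup_Suc by (subst sum.reindex[OF inj]) (simp add: sum.cartesian_product case_prod_unfold)
  moreover have "card (tup I (Suc l)) = card I * card (tup I l)"
    unfolding tup_Suc by (subst card_image[OF inj]) (simp add: card_cartesian_product)
  ultimately show ?thesis
    unfolding avg_def by (simp add: sum_divide_distrib[symmetric] mult.commute)
qed

definition val :: "nat \<Rightarrow> trm list \<Rightarrow> nat set \<Rightarrow> nat set \<Rightarrow> real" where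
  "val n F R y = pr (Pow {..<n}) (\<lambda>z. first F (cmb R y z) \<noteq> None)"

definition narrow :: "nat set \<Rightarrow> nat \<Rightarrow> nat set \<Rightarrow> trm list \<Rightarrow> trm list" where
  "narrow W v R F = filter (\<lambda>T. card (fst T \<inter> (R \<inter> W)) \<le> v) F"

text \<open>The number \<open>L\<close> of \<open>simple_fools\<close> is common to the spaces over
  one index type only. To compare with the uniform distribution, the cube has to be indexed by
  numbers as well.\<close>

lemma cube_reindex:
  assumes "finite V"
  shows "\<exists>(E :: nat \<Rightarrow> nat set) m. (\<forall>P. pr (Pow V) P = pr {..<m::nat} (\<lambda>i. P (E i))) \<and> (\<forall>k. almost {..<m} E V k 0)"
proof -
  have fP: "finite (Pow V)" using assms by simp
  obtain E where E: "bij_betw E {0..<card (Pow V)} (Pow V)"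
    using ex_bij_betw_nat_finite[OF fP] by blast
  define m where "m = card (Pow V)"
  have E': "bij_betw E {..<m} (Pow V)" using E unfolding m_def by (simp add: atLeast0LessThan)
  have 1: "pr (Pow V) P = pr {..<m} (\<lambda>i. P (E i))" for P
    unfolding pr_def by (rule avg_Pow_reindex[OF fP E'])
  have "m > 0" unfolding m_def using fP by (auto simp: card_gt_0_iff)
  then have "almost {..<m} E V k 0" for k
    using almost_cube[OF assms, of k] unfolding almost_def 1 by auto
  with 1 show ?thesis by (intro exI[of _ E] exI[of _ m]) simp
qed

lemma simple_fools_cube:
  assumes "simple F c B y" "wf_terms F" "finite V" "B \<subseteq> V" "almost (I :: nat set) D V k \<delta>" "c \<le> k"
  shows "\<bar>pr I (\<lambda>i. first F (cmb B y (D i)) \<in> A) - pr (Pow V) (\<lambda>z. first F (cmb B y z) \<in> A)\<bar> \<le> 2 ^ c * \<delta>"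
proof -
  from cube_reindex[OF assms(3)] obtain E :: "nat \<Rightarrow> nat set" and m :: nat
    where E: "(\<forall>P. pr (Pow V) P = pr {..<m} (\<lambda>i. P (E i))) \<and> (\<forall>k. almost {..<m} E V k 0)"
    by (elim exE)
  note E1 = E[THEN conjunct1, rule_format] and E2 = E[THEN conjunct2, rule_format]
  have "finite B" using assms(3,4) finite_subset by blast
  from simple_fools[OF assms(1,2) this assms(4), where A=A and ?'i = nat]
  obtain L where L: "\<forall>I D \<delta> k Q q. almost (I :: nat set) D V k \<delta> \<longrightarrow> Q \<subseteq> V \<longrightarrow> finite Q \<longrightarrow> Q \<inter> B = {} \<longrightarrow> q \<subseteq> Q \<longrightarrow> card Q + c \<le> k \<longrightarrow>
    \<bar>pr I (\<lambda>i. D i \<inter> Q = q \<and> first F (cmb B y (D i)) \<in> A) - (1/2) ^ card Q * L\<bar> \<le> 2 ^ c * \<delta>" ..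
  have "\<bar>pr I (\<lambda>i. first F (cmb B y (D i)) \<in> A) - L\<bar> \<le> 2 ^ c * \<delta>"
    using L[rule_format, OF assms(5), of "{}" "{}"] assms(6) by simp
  moreover have "\<bar>pr {..<m} (\<lambda>i. first F (cmb B y (E i)) \<in> A) - L\<bar> \<le> 2 ^ c * 0"
    using L[rule_format, OF E2, of "{}" "{}" c] by simp
  ultimately show ?thesis unfolding E1 by simp
qed

text \<open>\<open>B b\<close> stands for a selection with probability about
  \<open>(1/2) ^ b\<close>. Containment of \<open>k\<close>-sets serves the switching lemma. Hitting
  serves the narrowing of terms and is required only for sets in which at most 1/32 of an element is
  selected on average, where pairs are negligible. The factors 2 and 1/2 leave room for almost
  independence.\<close>

locale prg =
  fixes n k bmax :: nat and I :: "nat set" and B :: "nat \<Rightarrow> nat \<Rightarrow> nat set" and D :: "nat \<Rightarrow> nat set" and \<delta> :: real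
  assumes D: "almost I D {..<n} k \<delta>"
    and kpos: "0 < k"
    and Bk: "\<And>S b. S \<subseteq> {..<n} \<Longrightarrow> card S = k \<Longrightarrow> b \<le> bmax \<Longrightarrow> pr I (\<lambda>t. S \<subseteq> B b t) \<le> 2 * ((1/2) ^ b) ^ k"
    and Bs: "\<And>S b. S \<subseteq> {..<n} \<Longrightarrow> 32 * card S \<le> 2 ^ b \<Longrightarrow> b \<le> bmax \<Longrightarrow>
      pr I (\<lambda>t. S \<inter> B b t = {}) \<le> 1 - (1/2) ^ b * real (card S) / 2"
begin

lemma finI: "finite I" and neI: "I \<noteq> {}" and \<delta>0: "0 \<le> \<delta>"
  using D unfolding almost_def by auto

abbreviation "V \<equiv> {..<n}"
abbreviation "Cb \<equiv> Pow {..<n}"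

lemma cube_fin: "finite Cb" "Cb \<noteq> {}" by auto

text \<open>The failure probability of the switching lemma plus the fooling error of a tree of depth
  \<open>k\<close>.\<close>

definition \<eta> :: real where "\<eta> = 2 * (1/2) ^ k + 2 ^ k * \<delta>"

lemma \<eta>0: "0 \<le> \<eta>" unfolding \<eta>_def using \<delta>0 by simp

text \<open>The probability of \<open>deep\<close> is counted twice. It is at least
  \<open>(1/4) ^ k\<close> times the failure probability, as \<open>w \<le> k\<close>. For each
  fixed full assignment a union bound over the witnesses gives at most
  \<open>(4 * w) ^ k * 2 * (1 / (32 * w)) ^ k\<close>, which is \<open>2 * (1/8) ^ k\<close>. The
  quotient is \<open>2 * (1/2) ^ k\<close>; this is where the 5 in the selection rate comes
  from.\<close>

lemma not_simple_bound:
  assumes F: "wf_terms F" "U \<subseteq> V" "\<And>T. T \<in> set F \<Longrightarrow> card (fst T \<inter> (U \<inter> W)) \<le> 2 ^ a" "2 ^ a \<le> k" "a + 5 \<le> bmax"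
  shows "avg I (\<lambda>t. pr Cb (\<lambda>z. \<not> simple F k (U \<inter> W \<inter> B (a+5) t) (cmb U y z))) \<le> 2 * (1/2) ^ k"
proof -
  define w :: nat where "w = 2 ^ a"
  define BB where "BB t = U \<inter> W \<inter> B (a+5) t" for t
  have w: "0 < w" "w \<le> k" using F(4) unfolding w_def by auto
  have BU: "BB t \<subseteq> U" "BB t \<subseteq> V" for t using F(2) unfolding BB_def by auto
  have wid: "card (fst T \<inter> BB t) \<le> w" if "T \<in> set F" for T t
  proof -
    have "finite (fst T \<inter> (U \<inter> W))" using F(2) finite_subset[of U V] by auto
    then have "card (fst T \<inter> BB t) \<le> card (fst T \<inter> (U \<inter> W))"
      unfolding BB_def by (intro card_mono) auto
    then show ?thesis using F(3)[OF that] unfolding w_def by simp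
  qed
  have 1: "(1/4) ^ k * pr Cb (\<lambda>z. \<not> simple F k (BB t) (cmb U y z)) \<le> pr Cb (\<lambda>z. deep F k (BB t) (cmb U y z))" for t
  proof -
    have "(1/4) ^ k * pr Cb (\<lambda>z. \<not> simple F k (BB t) (cmb U y z))
      = avg Cb (\<lambda>z. (1/4) ^ k * of_bool (\<not> simple F k (BB t) (cmb U y z)))"
      unfolding pr_def by (simp add: avg_cmult)
    also have "\<dots> \<le> avg Cb (\<lambda>z. pr Cb (\<lambda>z'. deep F k (BB t) (cmb (BB t) (cmb U y z) z')))"
    proof (intro avg_mono)
      fix z
      show "(1/4) ^ k * of_bool (\<not> simple F k (BB t) (cmb U y z)) \<le> pr Cb (\<lambda>z'. deep F k (BB t) (cmb (BB t) (cmb U y z) z'))"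
      proof (cases "simple F k (BB t) (cmb U y z)")
        case True then show ?thesis using pr_nonneg by simp
      next
        case False
        have "(1/4::real) ^ k = (1/2) ^ (k + k)" by (simp add: power_add power_mult_distrib[symmetric])
        also have "\<dots> \<le> (1/2) ^ (k + w)" using w by (intro power_decreasing) auto
        also have "\<dots> \<le> pr Cb (\<lambda>z'. deep F k (BB t) (cmb (BB t) (cmb U y z) z'))"
          using deep_lower[OF False F(1) _ BU(2) wid] by simp
        finally show ?thesis using False by simp
      qed
    qed
    also have "\<dots> = pr Cb (\<lambda>z. deep F k (BB t) (cmb U y z))"
      unfolding cmb_cmb[OF BU(1), symmetric] by (rule pr_resample) simp
    finally show ?thesis .
  qed
  have 2: "pr I (\<lambda>t. deep F k (BB t) x) \<le> (4 * real w) ^ k * (2 * ((1/2) ^ (a+5)) ^ k)" for x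
  proof -
    let ?W = "{S. wit F (U \<inter> W) k x S}"
    have fU: "finite (U \<inter> W)" using F(2) finite_subset[of U V] by auto
    have fW: "finite ?W" by (rule finite_subset[of _ "Pow (U \<inter> W)"]) (use wit_sub fU in \<open>blast, simp only: finite_Pow_iff\<close>)
    have "pr I (\<lambda>t. deep F k (BB t) x) \<le> pr I (\<lambda>t. \<exists>S\<in>?W. S \<subseteq> B (a+5) t)"
    proof (intro pr_mono)
      fix t assume "deep F k (BB t) x"
      then obtain S where "wit F (U \<inter> W) k x S" "S \<subseteq> BB t"
        using deep_wit[of F k "BB t" x "U \<inter> W"] kpos fU unfolding BB_def by auto
      then show "\<exists>S\<in>?W. S \<subseteq> B (a+5) t" unfolding BB_def by auto
    qed
    also have "\<dots> \<le> (\<Sum>S\<in>?W. pr I (\<lambda>t. S \<subseteq> B (a+5) t))" by (rule pr_bex_le[OF fW])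
    also have "\<dots> \<le> (\<Sum>S\<in>?W. 2 * ((1/2) ^ (a+5)) ^ k)"
    proof (intro sum_mono)
      fix S assume S: "S \<in> ?W"
      then have "S \<subseteq> V" "card S = k" using wit_sub[of F "U \<inter> W" k x S] wit_card[of F "U \<inter> W" k x S] fU F(2) by auto
      then show "pr I (\<lambda>t. S \<subseteq> B (a+5) t) \<le> 2 * ((1/2) ^ (a+5)) ^ k" using Bk F(5) by blast
    qed
    also have "\<dots> = real (card ?W) * (2 * ((1/2) ^ (a+5)) ^ k)" by simp
    also have "\<dots> \<le> (4 * real w) ^ k * (2 * ((1/2) ^ (a+5)) ^ k)"
      using wit_count[OF fU, of F w k x] F(3) w unfolding w_def by (intro mult_right_mono) auto
    finally show ?thesis .
  qed
  have "(1/4) ^ k * avg I (\<lambda>t. pr Cb (\<lambda>z. \<not> simple F k (BB t) (cmb U y z))) \<le> avg I (\<lambda>t. pr Cb (\<lambda>z. deep F k (BB t) (cmb U y z)))"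
    unfolding avg_cmult[symmetric] using 1 by (intro avg_mono) auto
  also have "\<dots> = avg Cb (\<lambda>z. pr I (\<lambda>t. deep F k (BB t) (cmb U y z)))"
    unfolding pr_def by (rule avg_swap)
  also have "\<dots> \<le> (4 * real w) ^ k * (2 * ((1/2) ^ (a+5)) ^ k)"
    using 2 cube_fin by (intro avg_le) auto
  also have "\<dots> = (1/4) ^ k * (2 * (1/2) ^ k)"
  proof -
    have "4 * real w * (1/2)^(a+5) = 1/8" unfolding w_def by (simp add: power_add power_one_over)
    then have "(4 * real w) ^ k * ((1/2) ^ (a+5)) ^ k = (1/8) ^ k" by (simp only: power_mult_distrib[symmetric])
    moreover have "(1/4::real)^k * (1/2)^k = (1/8)^k" by (simp only: power_mult_distrib[symmetric]) simp
    ultimately show ?thesis by simp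
  qed
  finally show ?thesis unfolding BB_def by simp
qed

text \<open>Where the tree is shallow the sample fools it, elsewhere the difference is at most 1.
  The event \<open>A t\<close> may depend on the selection, but not on the sample \<open>t'\<close>
  that supplies the values.\<close>

lemma stage:
  assumes F: "wf_terms F" "U \<subseteq> V" "\<And>T. T \<in> set F \<Longrightarrow> card (fst T \<inter> (U \<inter> W)) \<le> 2 ^ a" "2 ^ a \<le> k" "a + 5 \<le> bmax"
  shows "\<bar>avg I (\<lambda>t. avg I (\<lambda>t'. pr Cb (\<lambda>z. first F (cmb (U - (W \<inter> B (a+5) t)) (cmb (U \<inter> (W \<inter> B (a+5) t)) y (D t')) z) \<in> A t)))
     - avg I (\<lambda>t. pr Cb (\<lambda>z. first F (cmb U y z) \<in> A t))\<bar> \<le> \<eta>"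
proof -
  define BB where "BB t = U \<inter> W \<inter> B (a+5) t" for t
  have BU: "BB t \<subseteq> U" "BB t \<subseteq> V" for t using F(2) unfolding BB_def by auto
  have e: "U - (W \<inter> B (a+5) t) = U - BB t" "U \<inter> (W \<inter> B (a+5) t) = BB t" for t unfolding BB_def by auto
  let ?bad = "\<lambda>t z. of_bool (\<not> simple F k (BB t) (cmb U y z)) :: real"
  have 1: "\<bar>avg I (\<lambda>t'. pr Cb (\<lambda>z. first F (cmb (U - BB t) (cmb (BB t) y (D t')) z) \<in> A t)) - pr Cb (\<lambda>z. first F (cmb U y z) \<in> A t)\<bar>
    \<le> avg Cb (\<lambda>z. 2 ^ k * \<delta> + ?bad t z)" for t
  proof -
    have "avg I (\<lambda>t'. pr Cb (\<lambda>z. first F (cmb (U - BB t) (cmb (BB t) y (D t')) z) \<in> A t))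
       = avg Cb (\<lambda>z. pr I (\<lambda>t'. first F (cmb (BB t) (cmb U y z) (D t')) \<in> A t))"
      unfolding cmb_assign[OF BU(1)] pr_def by (rule avg_swap)
    moreover have "pr Cb (\<lambda>z. first F (cmb U y z) \<in> A t) = avg Cb (\<lambda>z. pr Cb (\<lambda>z'. first F (cmb (BB t) (cmb U y z) z') \<in> A t))"
      unfolding cmb_cmb[OF BU(1), symmetric] by (rule pr_resample[symmetric]) simp
    moreover have "\<bar>avg Cb (\<lambda>z. pr I (\<lambda>t'. first F (cmb (BB t) (cmb U y z) (D t')) \<in> A t)) - avg Cb (\<lambda>z. pr Cb (\<lambda>z'. first F (cmb (BB t) (cmb U y z) z') \<in> A t))\<bar>
       \<le> avg Cb (\<lambda>z. 2 ^ k * \<delta> + ?bad t z)"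
    proof (intro avg_abs_diff)
      fix z
      show "\<bar>pr I (\<lambda>t'. first F (cmb (BB t) (cmb U y z) (D t')) \<in> A t) - pr Cb (\<lambda>z'. first F (cmb (BB t) (cmb U y z) z') \<in> A t)\<bar> \<le> 2 ^ k * \<delta> + ?bad t z"
      proof (cases "simple F k (BB t) (cmb U y z)")
        case True
        then show ?thesis using simple_fools_cube[OF True F(1) _ BU(2) D] by simp
      next
        case False
        have "0 \<le> 2 ^ k * \<delta>" using \<delta>0 by simp
        then show ?thesis using False pr_nonneg[of I] pr_nonneg[of Cb] pr_le_1[of I] pr_le_1[of Cb]
          by (smt (verit) of_bool_eq(2))
      qed
    qed
    ultimately show ?thesis by simp
  qed
  have "\<bar>avg I (\<lambda>t. avg I (\<lambda>t'. pr Cb (\<lambda>z. first F (cmb (U - BB t) (cmb (BB t) y (D t')) z) \<in> A t)))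
     - avg I (\<lambda>t. pr Cb (\<lambda>z. first F (cmb U y z) \<in> A t))\<bar> \<le> avg I (\<lambda>t. avg Cb (\<lambda>z. 2 ^ k * \<delta> + ?bad t z))"
    by (intro avg_abs_diff 1)
  also have "\<dots> = 2 ^ k * \<delta> + avg I (\<lambda>t. pr Cb (\<lambda>z. \<not> simple F k (BB t) (cmb U y z)))"
    unfolding pr_def avg_add using avg_const[OF cube_fin] avg_const[OF finI neI] by simp
  also have "\<dots> \<le> \<eta>"
    using not_simple_bound[OF F(1,2), of W a y] F(3-5) unfolding \<eta>_def BB_def by simp
  finally show ?thesis unfolding e .
qed

fun proc :: "nat \<Rightarrow> nat set \<Rightarrow> nat \<Rightarrow> nat set \<Rightarrow> nat set \<Rightarrow> (nat set \<Rightarrow> nat set \<Rightarrow> real) \<Rightarrow> real" where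
  "proc b W 0 R y g = g R y"
| "proc b W (Suc l) R y g = avg I (\<lambda>t. avg I (\<lambda>t'. proc b W l (R - (W \<inter> B b t)) (cmb (R \<inter> (W \<inter> B b t)) y (D t')) g))"

lemma proc_diff:
  assumes "\<And>R' y'. R' \<subseteq> R \<Longrightarrow> \<bar>g R' y' - h R' y'\<bar> \<le> c"
  shows "\<bar>proc b W l R y g - proc b W l R y h\<bar> \<le> c"
  using assms
proof (induction l arbitrary: R y)
  case (Suc l)
  show ?case unfolding proc.simps
    by (intro avg_abs_diff_le finI neI Suc) (use Suc.prems in auto)
qed simp

lemma proc_mono:
  assumes "\<And>R' y'. R' \<subseteq> R \<Longrightarrow> g R' y' \<le> h R' y'"
  shows "proc b W l R y g \<le> proc b W l R y h"
  using assms
proof (induction l arbitrary: R y)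
  case (Suc l)
  show ?case unfolding proc.simps
    by (intro avg_mono Suc) (use Suc.prems in auto)
qed simp

definition left :: "nat \<Rightarrow> nat set \<Rightarrow> nat set \<Rightarrow> nat list \<Rightarrow> nat set" where
  "left b W R ts = R - (W \<inter> (\<Union>t\<in>set ts. B b t))"

text \<open>Hybrid argument: the pseudorandom values are replaced by uniform ones stage by stage, at
  a cost of \<eta> each. The selections remain, because the event depends on the set of variables
  that is finally left.\<close>

lemma phase_hybrid:
  assumes F: "wf_terms F" "R \<subseteq> V" "\<And>T. T \<in> set F \<Longrightarrow> card (fst T \<inter> (R \<inter> W)) \<le> 2 ^ a" "2 ^ a \<le> k" "a + 5 \<le> bmax"
  shows "\<bar>proc (a+5) W l R y (\<lambda>R' y'. pr Cb (\<lambda>z. first F (cmb R' y' z) \<in> A R'))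
    - avg (tup I l) (\<lambda>ts. pr Cb (\<lambda>z. first F (cmb R y z) \<in> A (left (a+5) W R ts)))\<bar> \<le> real l * \<eta>"
  using F(2,3)
proof (induction l arbitrary: R y)
  case 0
  show ?case by (simp add: tup_0 avg_def left_def)
next
  case (Suc l)
  define BB where "BB t = W \<inter> B (a+5) t" for t
  define rr where "rr t = R - BB t" for t
  define yy where "yy t t' = cmb (R \<inter> BB t) y (D t')" for t t'
  let ?g = "\<lambda>R' y'. pr Cb (\<lambda>z. first F (cmb R' y' z) \<in> A R')"
  have lf: "left (a+5) W R (t # ts) = left (a+5) W (rr t) ts" for t ts
    unfolding left_def rr_def BB_def by auto
  have rV: "rr t \<subseteq> V" for t using Suc.prems(1) unfolding rr_def by auto
  have wid: "card (fst T \<inter> (rr t \<inter> W)) \<le> 2 ^ a" if "T \<in> set F" for T t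
  proof -
    have "finite (fst T \<inter> (R \<inter> W))" using Suc.prems(1) finite_subset[of R V] by auto
    then have "card (fst T \<inter> (rr t \<inter> W)) \<le> card (fst T \<inter> (R \<inter> W))"
      unfolding rr_def by (intro card_mono) auto
    then show ?thesis using Suc.prems(2)[OF that] by simp
  qed
  \<comment> \<open>Only the first stage still assigns values from \<open>D\<close>; the later ones
    select, and all other free variables get uniform values.\<close>
  let ?mid = "avg I (\<lambda>t. avg I (\<lambda>t'. avg (tup I l) (\<lambda>ts. pr Cb (\<lambda>z. first F (cmb (rr t) (yy t t') z) \<in> A (left (a+5) W (rr t) ts)))))"
  have 1: "\<bar>proc (a+5) W (Suc l) R y ?g - ?mid\<bar> \<le> real l * \<eta>"
    unfolding proc.simps BB_def[symmetric] rr_def[symmetric] yy_def[symmetric]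
    by (intro avg_abs_diff_le finI neI Suc.IH rV wid) auto
  \<comment> \<open>With the later selections \<open>ts\<close> drawn outside, the event depends on
    the first selection only, as \<open>stage\<close> requires.\<close>
  have m: "?mid = avg (tup I l) (\<lambda>ts. avg I (\<lambda>t. avg I (\<lambda>t'. pr Cb (\<lambda>z. first F (cmb (rr t) (yy t t') z) \<in> A (left (a+5) W (rr t) ts)))))"
    by (subst (2) avg_swap, subst avg_swap) simp
  have t: "avg (tup I (Suc l)) (\<lambda>ts. pr Cb (\<lambda>z. first F (cmb R y z) \<in> A (left (a+5) W R ts)))
     = avg (tup I l) (\<lambda>ts. avg I (\<lambda>t. pr Cb (\<lambda>z. first F (cmb R y z) \<in> A (left (a+5) W (rr t) ts))))"
    unfolding avg_tup_Suc lf by (rule avg_swap)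
  have 2: "\<bar>?mid - avg (tup I (Suc l)) (\<lambda>ts. pr Cb (\<lambda>z. first F (cmb R y z) \<in> A (left (a+5) W R ts)))\<bar> \<le> \<eta>"
    unfolding m t
  proof (rule avg_abs_diff_le[OF finite_tup[OF finI] tup_ne[OF neI]])
    fix ts
    show "\<bar>avg I (\<lambda>t. avg I (\<lambda>t'. pr Cb (\<lambda>z. first F (cmb (rr t) (yy t t') z) \<in> A (left (a+5) W (rr t) ts))))
      - avg I (\<lambda>t. pr Cb (\<lambda>z. first F (cmb R y z) \<in> A (left (a+5) W (rr t) ts)))\<bar> \<le> \<eta>"
      unfolding rr_def yy_def BB_def by (rule stage[OF F(1) Suc.prems F(4,5)])
  qed
  show ?case using 1 2 by (simp add: algebra_simps)
qed

text \<open>The stages use independent seeds, so the probabilities of missing \<open>S\<close>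
  multiply.\<close>

lemma survive:
  assumes "S \<subseteq> V" "32 * card S \<le> 2 ^ b" "b \<le> bmax"
  shows "pr (tup I l) (\<lambda>ts. S \<inter> (\<Union>t\<in>set ts. B b t) = {}) \<le> (1 - (1/2) ^ b * real (card S) / 2) ^ l"
proof (induction l)
  case 0
  show ?case using pr_le_1 by simp
next
  case (Suc l)
  let ?q = "1 - (1/2) ^ b * real (card S) / 2"
  have q: "0 \<le> ?q" using Bs[OF assms] pr_nonneg[of I "\<lambda>t. S \<inter> B b t = {}"] by linarith
  have "pr (tup I (Suc l)) (\<lambda>ts. S \<inter> (\<Union>t\<in>set ts. B b t) = {})
     = avg I (\<lambda>t. of_bool (S \<inter> B b t = {}) * pr (tup I l) (\<lambda>ts. S \<inter> (\<Union>t\<in>set ts. B b t) = {}))"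
    unfolding pr_def avg_tup_Suc avg_cmult[symmetric] by (simp add: Int_Un_distrib of_bool_conj)
  also have "\<dots> = pr I (\<lambda>t. S \<inter> B b t = {}) * pr (tup I l) (\<lambda>ts. S \<inter> (\<Union>t\<in>set ts. B b t) = {})"
    unfolding avg_multc pr_def ..
  also have "\<dots> \<le> ?q * ?q ^ l" using Bs[OF assms] Suc q pr_nonneg by (intro mult_mono) auto
  finally show ?case by simp
qed

lemma first_narrow_le: "first (narrow W v R' F) x \<noteq> None \<Longrightarrow> first F x \<noteq> None"
  unfolding narrow_def by (auto simp: find_None_iff)

lemma first_narrow_ge:
  assumes "first F x \<in> {Some T |T. card (fst T \<inter> (R' \<inter> W)) \<le> v}"
  shows "first (narrow W v R' F) x \<noteq> None"
  using assms find_SomeD[of "sat x" F] unfolding narrow_def by (auto simp: find_None_iff)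

text \<open>Dropping terms can only lower the acceptance probability. Conversely, acceptance is lost
  only if the first satisfied term keeps more than \<open>v\<close> free variables in the bucket;
  then some set of \<open>v + 1\<close> of them is missed by all selections, and there are at most
  \<open>2 ^ (2 ^ a)\<close> such sets.\<close>

lemma phase:
  assumes F: "wf_terms F" "R \<subseteq> V" "\<And>T. T \<in> set F \<Longrightarrow> card (fst T \<inter> (R \<inter> W)) \<le> 2 ^ a" "2 ^ a \<le> k" "a + 5 \<le> bmax"
    and v: "v + 1 \<le> 2 ^ a"
    and \<theta>: "2 ^ (2 ^ a) * (1 - (1/2) ^ (a+5) * real (v+1) / 2) ^ l \<le> \<theta>"
  shows "\<bar>proc (a+5) W l R y (\<lambda>R' y'. val n (narrow W v R' F) R' y') - val n F R y\<bar> \<le> real l * \<eta> + \<theta>"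
proof -
  \<comment> \<open>The events speak of the first satisfied term of the full list \<open>F\<close>,
    which does not change with the selections; \<open>?A\<close> asks that it is still narrow,
    \<open>?N\<close> only that it exists.\<close>
  let ?A = "\<lambda>R'. {Some T |T. card (fst T \<inter> (R' \<inter> W)) \<le> v}"
  let ?N = "\<lambda>R'. {Some T |T :: trm. True}"
  let ?g = "\<lambda>A R' y'. pr Cb (\<lambda>z. first F (cmb R' y' z) \<in> A R')"
  have vN: "val n F R' y' = ?g ?N R' y'" for R' y' unfolding val_def by (intro pr_cong) auto
  have q0: "0 \<le> (1 - (1/2) ^ (a+5) * real (v+1) / 2 :: real)"
  proof -
    have "real (v+1) \<le> 2 ^ a" using of_nat_mono[OF v, where 'a=real] by simp
    then have "(1/2) ^ (a+5) * real (v+1) \<le> (1/2) ^ (a+5) * 2 ^ a" by (intro mult_left_mono) auto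
    also have "\<dots> \<le> 1" by (simp add: power_add power_one_over)
    finally show ?thesis by simp
  qed
  have ub: "proc (a+5) W l R y (\<lambda>R' y'. val n (narrow W v R' F) R' y') \<le> val n F R y + real l * \<eta>"
  proof -
    have "proc (a+5) W l R y (\<lambda>R' y'. val n (narrow W v R' F) R' y') \<le> proc (a+5) W l R y (?g ?N)"
      unfolding vN[symmetric] val_def by (intro proc_mono pr_mono) (rule first_narrow_le)
    also have "\<dots> \<le> avg (tup I l) (\<lambda>ts. ?g ?N R y) + real l * \<eta>"
      using phase_hybrid[OF F, of l y ?N] by (simp add: abs_le_iff)
    also have "avg (tup I l) (\<lambda>ts. ?g ?N R y) = val n F R y"
      unfolding vN by (rule avg_const[OF finite_tup[OF finI] tup_ne[OF neI]])
    finally show ?thesis .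
  qed
  have kill: "pr (tup I l) (\<lambda>ts. \<not> card (fst T \<inter> (left (a+5) W R ts \<inter> W)) \<le> v) \<le> \<theta>" if T: "T \<in> set F" for T
  proof -
    let ?Y = "fst T \<inter> (R \<inter> W)"
    have fY: "finite ?Y" using F(2) finite_subset[of R V] by auto
    let ?SS = "{S. S \<subseteq> ?Y \<and> card S = v + 1}"
    have fSS: "finite ?SS" by (rule finite_subset[of _ "Pow ?Y"]) (use fY finite_Pow_iff[of ?Y] in blast)+
    have "pr (tup I l) (\<lambda>ts. \<not> card (fst T \<inter> (left (a+5) W R ts \<inter> W)) \<le> v)
       \<le> pr (tup I l) (\<lambda>ts. \<exists>S\<in>?SS. S \<inter> (\<Union>t\<in>set ts. B (a+5) t) = {})"
    proof (intro pr_mono)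
      fix ts assume "\<not> card (fst T \<inter> (left (a+5) W R ts \<inter> W)) \<le> v"
      then have "v + 1 \<le> card (fst T \<inter> (left (a+5) W R ts \<inter> W))" by simp
      then obtain S where S: "S \<subseteq> fst T \<inter> (left (a+5) W R ts \<inter> W)" "card S = v + 1"
        by (meson obtain_subset_with_card_n)
      then have "S \<in> ?SS" "S \<inter> (\<Union>t\<in>set ts. B (a+5) t) = {}" unfolding left_def by blast+
      then show "\<exists>S\<in>?SS. S \<inter> (\<Union>t\<in>set ts. B (a+5) t) = {}" by blast
    qed
    also have "\<dots> \<le> (\<Sum>S\<in>?SS. pr (tup I l) (\<lambda>ts. S \<inter> (\<Union>t\<in>set ts. B (a+5) t) = {}))"
      by (rule pr_bex_le[OF fSS])
    also have "\<dots> \<le> (\<Sum>S\<in>?SS. (1 - (1/2) ^ (a+5) * real (v+1) / 2) ^ l)"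
    proof (intro sum_mono)
      fix S assume S: "S \<in> ?SS"
      then have SV: "S \<subseteq> V" using F(2) by blast
      have "32 * card S \<le> 2 ^ (a+5)" using S v by (simp add: power_add)
      from survive[OF SV this F(5), of l] S
      show "pr (tup I l) (\<lambda>ts. S \<inter> (\<Union>t\<in>set ts. B (a+5) t) = {}) \<le> (1 - (1/2) ^ (a+5) * real (v+1) / 2) ^ l" by simp
    qed
    also have "\<dots> = real (card ?SS) * (1 - (1/2) ^ (a+5) * real (v+1) / 2) ^ l" by simp
    also have "\<dots> \<le> 2 ^ (2 ^ a) * (1 - (1/2) ^ (a+5) * real (v+1) / 2) ^ l"
    proof (intro mult_right_mono zero_le_power q0)
      have "card ?SS \<le> card (Pow ?Y)" using fY by (intro card_mono) (simp only: finite_Pow_iff, blast)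
      also have "\<dots> = 2 ^ card ?Y" by (rule card_Pow[OF fY])
      also have "\<dots> \<le> 2 ^ (2 ^ a)" using F(3)[OF T] by (intro power_increasing) auto
      finally have "card ?SS \<le> 2 ^ (2 ^ a)" .
      from of_nat_mono[OF this, where 'a=real] show "real (card ?SS) \<le> 2 ^ (2 ^ a)" by simp
    qed
    finally show ?thesis using \<theta> by simp
  qed
  have \<theta>0: "0 \<le> \<theta>" using \<theta> q0 by (smt (verit) mult_nonneg_nonneg zero_le_power)
  have "val n F R y - avg (tup I l) (\<lambda>ts. pr Cb (\<lambda>z. first F (cmb R y z) \<in> ?A (left (a+5) W R ts))) \<le> \<theta>"
  proof -
    have "val n F R y - avg (tup I l) (\<lambda>ts. pr Cb (\<lambda>z. first F (cmb R y z) \<in> ?A (left (a+5) W R ts)))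
      = avg (tup I l) (\<lambda>ts. avg Cb (\<lambda>z. of_bool (first F (cmb R y z) \<noteq> None) - of_bool (first F (cmb R y z) \<in> ?A (left (a+5) W R ts))))"
      unfolding val_def pr_def avg_diff
      by (simp add: avg_const[OF finite_tup[OF finI] tup_ne[OF neI]])
    also have "\<dots> = avg Cb (\<lambda>z. avg (tup I l) (\<lambda>ts. of_bool (first F (cmb R y z) \<noteq> None) - of_bool (first F (cmb R y z) \<in> ?A (left (a+5) W R ts))))"
      by (rule avg_swap)
    also have "\<dots> \<le> \<theta>"
    proof (rule avg_le[OF cube_fin])
      fix z
      show "avg (tup I l) (\<lambda>ts. of_bool (first F (cmb R y z) \<noteq> None) - of_bool (first F (cmb R y z) \<in> ?A (left (a+5) W R ts))) \<le> \<theta>"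
      proof (cases "first F (cmb R y z)")
        case None
        then have "avg (tup I l) (\<lambda>ts. of_bool (first F (cmb R y z) \<noteq> None) - of_bool (first F (cmb R y z) \<in> ?A (left (a+5) W R ts))) = 0"
          by (simp add: avg_def)
        then show ?thesis using \<theta>0 by simp
      next
        case (Some T)
        have "avg (tup I l) (\<lambda>ts. of_bool (first F (cmb R y z) \<noteq> None) - of_bool (first F (cmb R y z) \<in> ?A (left (a+5) W R ts)))
          = pr (tup I l) (\<lambda>ts. \<not> card (fst T \<inter> (left (a+5) W R ts \<inter> W)) \<le> v)"
          unfolding pr_def Some by (intro avg_cong refl) (simp only: mem_Collect_eq option.inject, cases T, auto)
        then show ?thesis using kill find_SomeD[OF Some] by simp
      qed
    qed
    finally show ?thesis .
  qed
  moreover have "proc (a+5) W l R y (?g ?A) \<le> proc (a+5) W l R y (\<lambda>R' y'. val n (narrow W v R' F) R' y')"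
    unfolding val_def by (intro proc_mono pr_mono) (rule first_narrow_ge)
  moreover have "avg (tup I l) (\<lambda>ts. pr Cb (\<lambda>z. first F (cmb R y z) \<in> ?A (left (a+5) W R ts))) \<le> proc (a+5) W l R y (?g ?A) + real l * \<eta>"
    using phase_hybrid[OF F, of l y ?A] by (simp add: abs_le_iff)
  ultimately have "val n F R y - \<theta> - real l * \<eta> \<le> proc (a+5) W l R y (\<lambda>R' y'. val n (narrow W v R' F) R' y')" by linarith
  with ub \<theta>0 show ?thesis by (simp add: abs_le_iff)
qed

end

section \<open>The process over one bucket and over all buckets\<close>

context prg
begin

text \<open>One bucket: the width bound is halved after every \<open>l\<close> stages.\<close>

fun brun :: "nat set \<Rightarrow> nat \<Rightarrow> nat \<Rightarrow> trm list \<Rightarrow> nat set \<Rightarrow> nat set \<Rightarrow> (trm list \<Rightarrow> nat set \<Rightarrow> nat set \<Rightarrow> real) \<Rightarrow> real" where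
  "brun W l 0 F R y g = proc 5 W l R y (\<lambda>R' y'. g (narrow W 0 R' F) R' y')"
| "brun W l (Suc a) F R y g = proc (Suc a + 5) W l R y (\<lambda>R' y'. brun W l a (narrow W (2 ^ a) R' F) R' y' g)"

fun srun :: "nat \<Rightarrow> nat \<Rightarrow> nat set list \<Rightarrow> trm list \<Rightarrow> nat set \<Rightarrow> nat set \<Rightarrow> real" where
  "srun l a [] F R y = of_bool (\<exists>T\<in>set F. sat y T)"
| "srun l a (W # Ws) F R y = brun W l a F R y (\<lambda>F' R' y'. srun l a Ws F' R' y')"

lemma narrow_subset: "set (narrow W v R F) \<subseteq> set F" unfolding narrow_def by auto

lemma wf_narrow: "wf_terms F \<Longrightarrow> wf_terms (narrow W v R F)"
  unfolding wf_terms_def narrow_def by auto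

lemma card_narrow: "T \<in> set (narrow W v R F) \<Longrightarrow> card (fst T \<inter> (R \<inter> W)) \<le> v"
  unfolding narrow_def by auto

text \<open>\<open>g\<close> is the continuation with the later buckets and \<open>c\<close> its
  error. The bound after width \<open>2 ^ b\<close> is \<open>2 ^ b div 2\<close>, which is 0 for
  \<open>b = 0\<close>; so in the end no surviving term has a free variable in
  \<open>W\<close>.\<close>

lemma brun_val:
  assumes F: "wf_terms F" "R \<subseteq> V" "\<And>T. T \<in> set F \<Longrightarrow> card (fst T \<inter> (R \<inter> W)) \<le> 2 ^ a" "2 ^ a \<le> k" "a + 5 \<le> bmax"
    and \<theta>: "\<And>b. b \<le> a \<Longrightarrow> 2 ^ (2 ^ b) * (1 - (1/2) ^ (b+5) * real (2 ^ b div 2 + 1) / 2) ^ l \<le> \<theta>"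
    and g: "\<And>F' R' y'. set F' \<subseteq> set F \<Longrightarrow> R' \<subseteq> R \<Longrightarrow> (\<And>T. T \<in> set F' \<Longrightarrow> fst T \<inter> R' \<inter> W = {}) \<Longrightarrow>
       \<bar>g F' R' y' - val n F' R' y'\<bar> \<le> c"
  shows "\<bar>brun W l a F R y g - val n F R y\<bar> \<le> real (a + 1) * (real l * \<eta> + \<theta>) + c"
  using F \<theta> g
proof (induction a arbitrary: F R y)
  case 0
  have "\<bar>proc (0+5) W l R y (\<lambda>R' y'. val n (narrow W 0 R' F) R' y') - val n F R y\<bar> \<le> real l * \<eta> + \<theta>"
    by (rule phase[OF 0(1-5)]) (use 0(6)[of 0] in simp_all)
  moreover have "\<bar>proc 5 W l R y (\<lambda>R' y'. g (narrow W 0 R' F) R' y') - proc 5 W l R y (\<lambda>R' y'. val n (narrow W 0 R' F) R' y')\<bar> \<le> c"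
  proof (rule proc_diff)
    fix R' y' assume R': "R' \<subseteq> R"
    have "fst T \<inter> R' \<inter> W = {}" if "T \<in> set (narrow W 0 R' F)" for T
    proof -
      have "finite (fst T \<inter> (R' \<inter> W))" using R' 0(2) finite_subset[of R' V] by auto
      then show ?thesis using card_narrow[OF that] by auto
    qed
    then show "\<bar>g (narrow W 0 R' F) R' y' - val n (narrow W 0 R' F) R' y'\<bar> \<le> c"
      by (rule 0(7)[OF narrow_subset R'])
  qed
  ultimately show ?case by (simp add: abs_le_iff)
next
  case (Suc a)
  have "\<bar>proc (Suc a+5) W l R y (\<lambda>R' y'. val n (narrow W (2 ^ a) R' F) R' y') - val n F R y\<bar> \<le> real l * \<eta> + \<theta>"
    by (rule phase[OF Suc.prems(1-5)]) (use Suc.prems(6)[of "Suc a"] in simp_all)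
  moreover have "\<bar>proc (Suc a+5) W l R y (\<lambda>R' y'. brun W l a (narrow W (2 ^ a) R' F) R' y' g) - proc (Suc a+5) W l R y (\<lambda>R' y'. val n (narrow W (2 ^ a) R' F) R' y')\<bar>
      \<le> real (a + 1) * (real l * \<eta> + \<theta>) + c"
  proof (rule proc_diff)
    fix R' y' assume R': "R' \<subseteq> R"
    show "\<bar>brun W l a (narrow W (2 ^ a) R' F) R' y' g - val n (narrow W (2 ^ a) R' F) R' y'\<bar> \<le> real (a + 1) * (real l * \<eta> + \<theta>) + c"
    proof (rule Suc.IH)
      show "wf_terms (narrow W (2 ^ a) R' F)" using Suc.prems(1) by (rule wf_narrow)
      show "R' \<subseteq> V" using R' Suc.prems(2) by blast
      show "2 ^ a \<le> k" using Suc.prems(4) by simp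
      show "a + 5 \<le> bmax" using Suc.prems(5) by simp
      fix F' R'' y'' assume "set F' \<subseteq> set (narrow W (2 ^ a) R' F)" "R'' \<subseteq> R'" "\<And>T. T \<in> set F' \<Longrightarrow> fst T \<inter> R'' \<inter> W = {}"
      then show "\<bar>g F' R'' y'' - val n F' R'' y''\<bar> \<le> c"
        using R' narrow_subset[of W "2^a" R' F] by (intro Suc.prems(7)) blast+
    qed (use card_narrow Suc.prems(6) in auto)
  qed
  ultimately show ?case by (simp add: abs_le_iff algebra_simps)
qed

text \<open>A finished bucket has no free variables in surviving terms, so the remaining buckets
  cover those that are left. After the last bucket the acceptance probability is 0 or 1 and is
  evaluated exactly.\<close>

lemma srun_val:
  assumes F: "wf_terms F" "R \<subseteq> V" "\<And>T W. T \<in> set F \<Longrightarrow> W \<in> set Ws \<Longrightarrow> card (fst T \<inter> (R \<inter> W)) \<le> 2 ^ a" "2 ^ a \<le> k" "a + 5 \<le> bmax"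
    and \<theta>: "\<And>b. b \<le> a \<Longrightarrow> 2 ^ (2 ^ b) * (1 - (1/2) ^ (b+5) * real (2 ^ b div 2 + 1) / 2) ^ l \<le> \<theta>"
    and cov: "\<And>T. T \<in> set F \<Longrightarrow> fst T \<inter> R \<subseteq> \<Union>(set Ws)"
  shows "\<bar>srun l a Ws F R y - val n F R y\<bar> \<le> real (length Ws) * (real (a + 1) * (real l * \<eta> + \<theta>))"
  using F(1-3) cov
proof (induction Ws arbitrary: F R y)
  case Nil
  have "sat (cmb R y z) T \<longleftrightarrow> sat y T" if "T \<in> set F" for T z
  proof -
    have "fst T \<inter> R = {}" using Nil(4)[OF that] by simp
    then show ?thesis unfolding sat_def cmb_def by auto
  qed
  then have *: "first F (cmb R y z) \<noteq> None \<longleftrightarrow> (\<exists>T\<in>set F. sat y T)" for z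
    by (auto simp: find_None_iff)
  have "val n F R y = of_bool (\<exists>T\<in>set F. sat y T)" unfolding val_def * pr_def using avg_const[OF cube_fin] by simp
  then show ?case by simp
next
  case (Cons W Ws)
  have "\<bar>brun W l a F R y (\<lambda>F' R' y'. srun l a Ws F' R' y') - val n F R y\<bar>
      \<le> real (a + 1) * (real l * \<eta> + \<theta>) + real (length Ws) * (real (a + 1) * (real l * \<eta> + \<theta>))"
  proof (rule brun_val[OF Cons.prems(1,2) _ F(4,5) \<theta>])
    fix F' R' y' assume F': "set F' \<subseteq> set F" "R' \<subseteq> R" "\<And>T. T \<in> set F' \<Longrightarrow> fst T \<inter> R' \<inter> W = {}"
    show "\<bar>srun l a Ws F' R' y' - val n F' R' y'\<bar> \<le> real (length Ws) * (real (a + 1) * (real l * \<eta> + \<theta>))"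
    proof (rule Cons.IH)
      show "wf_terms F'" using F'(1) Cons.prems(1) unfolding wf_terms_def by blast
      show "R' \<subseteq> V" using F'(2) Cons.prems(2) by blast
      fix T assume T: "T \<in> set F'"
      show "fst T \<inter> R' \<subseteq> \<Union>(set Ws)" 
      proof
        fix x assume x: "x \<in> fst T \<inter> R'"
        then have "x \<in> \<Union>(set (W # Ws))" using Cons.prems(4)[of T] T F'(1,2) by blast
        moreover have "x \<notin> W" using F'(3)[OF T] x by blast
        ultimately show "x \<in> \<Union>(set Ws)" by simp
      qed
      fix W' assume W': "W' \<in> set Ws"
      have "finite (fst T \<inter> (R \<inter> W'))" using Cons.prems(2) finite_subset[of R V] by auto
      then have "card (fst T \<inter> (R' \<inter> W')) \<le> card (fst T \<inter> (R \<inter> W'))" using F'(2) by (intro card_mono) auto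
      also have "\<dots> \<le> 2 ^ a" using Cons.prems(3)[of T W'] W' T F'(1) by auto
      finally show "card (fst T \<inter> (R' \<inter> W')) \<le> 2 ^ a" .
    qed
  qed (use Cons.prems(3) in auto)
  then show ?case by (simp add: algebra_simps)
qed

end

text \<open>Removing terms cannot help acceptance. An accepting assignment is lost only if its first
  satisfied term has more than \<open>w0\<close> variables, which costs \<open>(1/2) ^ w0\<close>
  for each term, or if that particular term is not good.\<close>

lemma filter_good_val:
  assumes H: "finite H" "H \<noteq> {}"
    and F: "wf_terms F" "\<And>T. T \<in> set F \<Longrightarrow> fst T \<subseteq> {..<n}"
    and bad: "\<And>T. T \<in> set F \<Longrightarrow> card (fst T) \<le> w0 \<Longrightarrow> pr H (\<lambda>h. \<not> good h T) \<le> \<theta>"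
    and \<theta>: "0 \<le> \<theta>"
  shows "\<bar>avg H (\<lambda>h. val n (filter (good h) F) {..<n} y) - val n F {..<n} y\<bar> \<le> real (length F) * (1/2) ^ w0 + \<theta>"
proof -
  let ?C = "Pow {..<n}"
  have C: "finite ?C" "?C \<noteq> {}" by auto
  let ?x = "\<lambda>z. cmb {..<n} y z"
  have A: "avg H (\<lambda>h. val n (filter (good h) F) {..<n} y) = avg ?C (\<lambda>z. pr H (\<lambda>h. first (filter (good h) F) (?x z) \<noteq> None))"
    unfolding val_def pr_def by (rule avg_swap)
  have le: "pr H (\<lambda>h. first (filter (good h) F) (?x z) \<noteq> None) \<le> of_bool (first F (?x z) \<noteq> None)" for z
  proof (cases "first F (?x z) = None")
    case True
    then have "first (filter (good h) F) (?x z) = None" for h by (auto simp: find_None_iff)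
    then show ?thesis by (simp add: pr_def avg_def)
  next
    case False then show ?thesis using pr_le_1 by simp
  qed
  have long: "pr ?C (\<lambda>z. \<exists>T\<in>set F. w0 < card (fst T) \<and> sat (?x z) T) \<le> real (length F) * (1/2) ^ w0"
  proof -
    have "pr ?C (\<lambda>z. \<exists>T\<in>set F. w0 < card (fst T) \<and> sat (?x z) T) \<le> (\<Sum>T\<in>set F. pr ?C (\<lambda>z. w0 < card (fst T) \<and> sat (?x z) T))"
      by (rule pr_bex_le) simp
    also have "\<dots> \<le> (\<Sum>T\<in>set F. (1/2) ^ w0)"
    proof (intro sum_mono)
      fix T assume T: "T \<in> set F"
      show "pr ?C (\<lambda>z. w0 < card (fst T) \<and> sat (?x z) T) \<le> (1/2) ^ w0"
      proof (cases "w0 < card (fst T)")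
        case True
        have s: "sat (?x z) T \<longleftrightarrow> z \<inter> fst T = snd T" for z
          using F(2)[OF T] unfolding sat_def cmb_def by blast
        have "pr ?C (\<lambda>z. w0 < card (fst T) \<and> sat (?x z) T) = (1/2) ^ card (fst T)"
          using pr_pattern[of "{..<n}" "fst T" "snd T"] F T True unfolding s wf_terms_def by simp
        also have "\<dots> \<le> (1/2) ^ w0" using True by (intro power_decreasing) auto
        finally show ?thesis .
      next
        case False then show ?thesis by (simp add: pr_def avg_def)
      qed
    qed
    also have "\<dots> = real (card (set F)) * (1/2) ^ w0" by simp
    also have "\<dots> \<le> real (length F) * (1/2) ^ w0" using card_length[of F] by (intro mult_right_mono) auto
    finally show ?thesis .
  qed
  have ge: "of_bool (first F (?x z) \<noteq> None) \<le> pr H (\<lambda>h. first (filter (good h) F) (?x z) \<noteq> None) + (\<theta> + of_bool (\<exists>T\<in>set F. w0 < card (fst T) \<and> sat (?x z) T))" for z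
  proof (cases "first F (?x z)")
    case None
    have "0 \<le> pr H (\<lambda>h. first (filter (good h) F) (?x z) \<noteq> None) + (\<theta> + of_bool (\<exists>T\<in>set F. w0 < card (fst T) \<and> sat (?x z) T))"
      by (intro add_nonneg_nonneg pr_nonneg \<theta>) simp
    then show ?thesis using None by simp
  next
    case (Some T)
    have T: "T \<in> set F" "sat (?x z) T" using find_SomeD[OF Some] by auto
    show ?thesis
    proof (cases "w0 < card (fst T)")
      case True
      then have "\<exists>T\<in>set F. w0 < card (fst T) \<and> sat (?x z) T" using T by blast
      then show ?thesis using pr_nonneg[of H "\<lambda>h. first (filter (good h) F) (?x z) \<noteq> None"] \<theta> Some by simp
    next
      case False
      have "1 = pr H (\<lambda>h. True)" unfolding pr_def using avg_const[OF H] by simp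
      also have "\<dots> \<le> pr H (\<lambda>h. first (filter (good h) F) (?x z) \<noteq> None \<or> \<not> good h T)"
      proof (intro pr_mono)
        fix h
        have "find (sat (?x z)) (filter (good h) F) \<noteq> None" if "good h T"
          using T that unfolding find_None_iff by fastforce
        then show "first (filter (good h) F) (?x z) \<noteq> None \<or> \<not> good h T" by blast
      qed
      also have "\<dots> \<le> pr H (\<lambda>h. first (filter (good h) F) (?x z) \<noteq> None) + pr H (\<lambda>h. \<not> good h T)"
        by (rule pr_union_le)
      also have "\<dots> \<le> pr H (\<lambda>h. first (filter (good h) F) (?x z) \<noteq> None) + \<theta>"
        using bad[OF T(1)] False by simp
      finally show ?thesis using Some by simp
    qed
  qed
  have "avg H (\<lambda>h. val n (filter (good h) F) {..<n} y) \<le> val n F {..<n} y"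
    unfolding A unfolding val_def pr_def[of ?C] by (intro avg_mono le)
  moreover have "val n F {..<n} y \<le> avg H (\<lambda>h. val n (filter (good h) F) {..<n} y) + (\<theta> + real (length F) * (1/2) ^ w0)"
  proof -
    have "val n F {..<n} y \<le> avg ?C (\<lambda>z. pr H (\<lambda>h. first (filter (good h) F) (?x z) \<noteq> None) + (\<theta> + of_bool (\<exists>T\<in>set F. w0 < card (fst T) \<and> sat (?x z) T)))"
      unfolding val_def pr_def[of ?C] by (intro avg_mono ge)
    also have "\<dots> \<le> avg H (\<lambda>h. val n (filter (good h) F) {..<n} y) + (\<theta> + real (length F) * (1/2) ^ w0)"
      unfolding avg_add A avg_const[OF C] using long unfolding pr_def[of ?C] by simp
    finally show ?thesis .
  qed
  ultimately show ?thesis by (simp add: abs_le_iff)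
qed

section \<open>Bucket hashing\<close>

text \<open>If the first hash is injective on \<open>X\<close>, an overloaded bucket contains
  \<open>r\<close> distinct names with the same second hash value. The first summand bounds
  collisions of pairs, the second is a union bound over buckets and
  \<open>r\<close>-subsets.\<close>

lemma load_bound:
  fixes h1 :: "'s \<Rightarrow> nat \<Rightarrow> nat" and h2 :: "'u \<Rightarrow> nat \<Rightarrow> nat"
  assumes I: "finite I1" "I1 \<noteq> {}" "finite I2" "I2 \<noteq> {}"
    and coll: "\<And>i j. i < n \<Longrightarrow> j < n \<Longrightarrow> i \<noteq> j \<Longrightarrow> pr I1 (\<lambda>s. h1 s i = h1 s j) \<le> \<gamma>"
    and ran: "\<And>s i. s \<in> I1 \<Longrightarrow> i < n \<Longrightarrow> h1 s i < q"
    and h2: "\<And>Q \<beta>. Q \<subseteq> {..<q} \<Longrightarrow> card Q = r \<Longrightarrow> \<beta> < b \<Longrightarrow> pr I2 (\<lambda>u. \<forall>x\<in>Q. h2 u x = \<beta>) \<le> \<kappa>"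
    and X: "X \<subseteq> {..<n}" "card X \<le> w" and pos: "0 \<le> \<gamma>" "0 \<le> \<kappa>"
  shows "avg I1 (\<lambda>s. pr I2 (\<lambda>u. \<exists>\<beta><b. r \<le> card (X \<inter> {i. h2 u (h1 s i) = \<beta>})))
    \<le> real (w * w) * \<gamma> + real b * (real (w choose r) * \<kappa>)"
proof -
  have fX: "finite X" using X finite_subset by auto
  have step: "pr I2 (\<lambda>u. \<exists>\<beta><b. r \<le> card (X \<inter> {i. h2 u (h1 s i) = \<beta>}))
     \<le> of_bool (\<not> inj_on (h1 s) X) + real b * (real (w choose r) * \<kappa>)" if s: "s \<in> I1" for s
  proof (cases "inj_on (h1 s) X")
    case False
    have "0 \<le> real b * (real (w choose r) * \<kappa>)" using pos by simp
    with False show ?thesis using pr_le_1[of I2 "\<lambda>u. \<exists>\<beta><b. r \<le> card (X \<inter> {i. h2 u (h1 s i) = \<beta>})"] by simp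
  next
    case True
    let ?SS = "{S. S \<subseteq> X \<and> card S = r}"
    have fSS: "finite ?SS" by (rule finite_subset[of _ "Pow X"]) (use fX in auto)
    have "pr I2 (\<lambda>u. \<exists>\<beta><b. r \<le> card (X \<inter> {i. h2 u (h1 s i) = \<beta>}))
      \<le> pr I2 (\<lambda>u. \<exists>p\<in>{..<b} \<times> ?SS. \<forall>x\<in>h1 s ` snd p. h2 u x = fst p)"
    proof (intro pr_mono)
      fix u assume "\<exists>\<beta><b. r \<le> card (X \<inter> {i. h2 u (h1 s i) = \<beta>})"
      then obtain \<beta> where \<beta>: "\<beta> < b" "r \<le> card (X \<inter> {i. h2 u (h1 s i) = \<beta>})" by blast
      from \<beta>(2) obtain S where S: "S \<subseteq> X \<inter> {i. h2 u (h1 s i) = \<beta>}" "card S = r"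
        by (meson obtain_subset_with_card_n)
      then show "\<exists>p\<in>{..<b} \<times> ?SS. \<forall>x\<in>h1 s ` snd p. h2 u x = fst p"
        using \<beta>(1) by (intro bexI[of _ "(\<beta>, S)"]) auto
    qed
    also have "\<dots> \<le> (\<Sum>p\<in>{..<b} \<times> ?SS. pr I2 (\<lambda>u. \<forall>x\<in>h1 s ` snd p. h2 u x = fst p))"
      using fSS by (intro pr_bex_le) auto
    also have "\<dots> \<le> (\<Sum>p\<in>{..<b} \<times> ?SS. \<kappa>)"
    proof (intro sum_mono)
      fix p assume p: "p \<in> {..<b} \<times> ?SS"
      have "inj_on (h1 s) (snd p)" using p True inj_on_subset by auto
      then have "card (h1 s ` snd p) = r" using p by (auto simp: card_image)
      moreover have "h1 s ` snd p \<subseteq> {..<q}" using p X ran[OF s] by fastforce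
      ultimately show "pr I2 (\<lambda>u. \<forall>x\<in>h1 s ` snd p. h2 u x = fst p) \<le> \<kappa>"
        using h2[of "h1 s ` snd p" "fst p"] p by (simp add: mem_Times_iff)
    qed
    also have "\<dots> = real b * (real (card X choose r) * \<kappa>)"
      using n_subsets[OF fX] by (simp add: card_cartesian_product)
    also have "\<dots> \<le> real b * (real (w choose r) * \<kappa>)"
      using binomial_right_mono[OF X(2)] pos by (intro mult_left_mono mult_right_mono) auto
    finally show ?thesis by simp
  qed
  have "avg I1 (\<lambda>s. pr I2 (\<lambda>u. \<exists>\<beta><b. r \<le> card (X \<inter> {i. h2 u (h1 s i) = \<beta>})))
    \<le> avg I1 (\<lambda>s. of_bool (\<not> inj_on (h1 s) X) + real b * (real (w choose r) * \<kappa>))"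
    by (intro avg_mono step)
  also have "\<dots> = pr I1 (\<lambda>s. \<not> inj_on (h1 s) X) + real b * (real (w choose r) * \<kappa>)"
    unfolding avg_add avg_const[OF I(1,2)] pr_def ..
  also have "pr I1 (\<lambda>s. \<not> inj_on (h1 s) X) \<le> pr I1 (\<lambda>s. \<exists>p\<in>{p\<in>X \<times> X. fst p \<noteq> snd p}. h1 s (fst p) = h1 s (snd p))"
    by (intro pr_mono) (auto simp: inj_on_def)
  also have "\<dots> \<le> (\<Sum>p\<in>{p\<in>X \<times> X. fst p \<noteq> snd p}. pr I1 (\<lambda>s. h1 s (fst p) = h1 s (snd p)))"
    using fX by (intro pr_bex_le) auto
  also have "\<dots> \<le> (\<Sum>p\<in>{p\<in>X \<times> X. fst p \<noteq> snd p}. \<gamma>)"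
    using X by (intro sum_mono coll) auto
  also have "\<dots> \<le> (\<Sum>p\<in>X \<times> X. \<gamma>)" using fX pos by (intro sum_mono2) auto
  also have "\<dots> = real (card X * card X) * \<gamma>" by (simp add: card_cartesian_product)
  also have "\<dots> \<le> real (w * w) * \<gamma>"
    using X(2) pos by (intro mult_right_mono) (auto simp: mult_mono simp del: of_nat_mult)
  finally show ?thesis by simp
qed

section \<open>Numbers and hash values read from blocks of bits\<close>

definition bitnum :: "nat \<Rightarrow> (nat \<Rightarrow> bool) \<Rightarrow> nat" where
  "bitnum r P = (\<Sum>c<r. of_bool (P c) * 2 ^ c)"

lemma bitnum_0: "bitnum 0 P = 0" unfolding bitnum_def by simp

lemma bitnum_Suc: "bitnum (Suc r) P = of_bool (P 0) + 2 * bitnum r (\<lambda>c. P (Suc c))"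
  unfolding bitnum_def sum.lessThan_Suc_shift by (simp add: sum_distrib_left mult_ac del: sum_of_bool_mult_eq sum_mult_of_bool_eq)

lemma bitnum_less: "bitnum r P < 2 ^ r"
proof (induction r arbitrary: P)
  case (Suc r)
  show ?case using Suc[of "\<lambda>c. P (Suc c)"] unfolding bitnum_Suc by (cases "P 0") auto
qed (simp add: bitnum_0)

lemma bitnum_inj: "bitnum r P = bitnum r Q \<longleftrightarrow> (\<forall>c<r. P c = Q c)"
proof (induction r arbitrary: P Q)
  case (Suc r)
  have "bitnum (Suc r) P = bitnum (Suc r) Q \<longleftrightarrow> P 0 = Q 0 \<and> bitnum r (\<lambda>c. P (Suc c)) = bitnum r (\<lambda>c. Q (Suc c))"
    unfolding bitnum_Suc by (cases "P 0"; cases "Q 0") (auto, presburger+)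
  also have "\<dots> \<longleftrightarrow> (\<forall>c<Suc r. P c = Q c)"
    unfolding Suc by (auto simp: less_Suc_eq_0_disj)
  finally show ?case .
qed (simp add: bitnum_0)

lemma bitnum_surj: "\<beta> < 2 ^ r \<Longrightarrow> \<exists>P. bitnum r P = \<beta>"
proof (induction r arbitrary: \<beta>)
  case (Suc r)
  then obtain P where P: "bitnum r P = \<beta> div 2" by (metis less_mult_imp_div_less power_Suc2)
  have "bitnum (Suc r) (\<lambda>c. case c of 0 \<Rightarrow> odd \<beta> | Suc c \<Rightarrow> P c) = \<beta>"
    unfolding bitnum_Suc using P by simp
  then show ?case by blast
qed (simp add: bitnum_0)

text \<open>Each item owns \<open>s\<close> consecutive positions, of which only the first
  \<open>c\<close> are used; so different rates \<open>b\<close> can share one layout.\<close>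

definition block :: "nat \<Rightarrow> nat \<Rightarrow> nat set \<Rightarrow> nat set" where
  "block s c S = (\<lambda>(i, j). i * s + j) ` (S \<times> {..<c})"

lemma block_eq:
  fixes i j i' j' s :: nat
  assumes "j < s" "j' < s" "i * s + j = i' * s + j'"
  shows "i = i' \<and> j = j'"
proof -
  have "(i * s + j) div s = i" "(i' * s + j') div s = i'"
    using assms(1,2) by (simp_all add: div_mult_self3)
  then have "i = i'" using assms(3) by simp
  then show ?thesis using assms(3) by simp
qed

lemma block_inj:
  assumes "c \<le> s" shows "inj_on (\<lambda>(i, j). i * s + j) (S \<times> {..<c::nat})"
proof (rule inj_onI)
  fix p p' assume p: "p \<in> S \<times> {..<c}" "p' \<in> S \<times> {..<c}"
    "(case p of (i, j) \<Rightarrow> i * s + j) = (case p' of (i, j) \<Rightarrow> i * s + j)"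
  then have "snd p < s" "snd p' < s" using assms by (auto simp: mem_Times_iff)
  from block_eq[OF this, of "fst p" "fst p'"] p(3) show "p = p'"
    by (simp add: case_prod_unfold prod_eq_iff)
qed

lemma card_block: "c \<le> s \<Longrightarrow> card (block s c S) = card S * c"
  unfolding block_def by (subst card_image[OF block_inj]) (auto simp: card_cartesian_product)

lemma block_sub: "c \<le> s \<Longrightarrow> S \<subseteq> {..<m} \<Longrightarrow> block s c S \<subseteq> {..<m * s}"
proof
  fix p assume a: "c \<le> s" "S \<subseteq> {..<m}" "p \<in> block s c S"
  then obtain i j where ij: "i \<in> S" "j < c" "p = i * s + j" unfolding block_def by auto
  then have "i < m" "j < s" using a by auto
  then have "i * s + j < Suc i * s" by simp
  also have "\<dots> \<le> m * s" using \<open>i < m\<close> by (intro mult_right_mono) auto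
  finally show "p \<in> {..<m * s}" using ij by simp
qed

lemma almost_pattern:
  assumes "almost I X N K \<delta>" "Q \<subseteq> N" "card Q \<le> K" "q \<subseteq> Q"
  shows "pr I (\<lambda>i. X i \<inter> Q = q) \<le> (1/2) ^ card Q + \<delta>" "(1/2) ^ card Q - \<delta> \<le> pr I (\<lambda>i. X i \<inter> Q = q)"
proof -
  have "\<bar>pr I (\<lambda>i. X i \<inter> Q = q) - (1/2) ^ card Q\<bar> \<le> \<delta>"
    using assms unfolding almost_def by blast
  then show "pr I (\<lambda>i. X i \<inter> Q = q) \<le> (1/2) ^ card Q + \<delta>" "(1/2) ^ card Q - \<delta> \<le> pr I (\<lambda>i. X i \<inter> Q = q)"
    by (simp_all add: abs_le_iff)
qed

text \<open>Union bound over the \<open>2 ^ c\<close> common values; each of them is one pattern of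
  \<open>2 * c\<close> bits.\<close>

lemma hash1_coll:
  assumes a: "almost I X {..<n * s} K \<delta>" and c: "c \<le> s" "2 * c \<le> K" and ij: "i < n" "j < n" "i \<noteq> j"
  shows "pr I (\<lambda>t. bitnum c (\<lambda>u. i * s + u \<in> X t) = bitnum c (\<lambda>u. j * s + u \<in> X t)) \<le> (1/2) ^ c + 2 ^ c * \<delta>"
proof -
  define Bi where "Bi = block s c {i}"
  define Bj where "Bj = block s c {j}"
  define pat where "pat P = block s 1 {} \<union> ((\<lambda>u. i * s + u) ` P \<union> (\<lambda>u. j * s + u) ` P)" for P
  have B: "Bi = (\<lambda>u. i * s + u) ` {..<c}" "Bj = (\<lambda>u. j * s + u) ` {..<c}" unfolding Bi_def Bj_def block_def by auto
  have Q: "block s c {i,j} = Bi \<union> Bj" unfolding Bi_def Bj_def block_def by auto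
  have "pr I (\<lambda>t. bitnum c (\<lambda>u. i * s + u \<in> X t) = bitnum c (\<lambda>u. j * s + u \<in> X t))
     \<le> pr I (\<lambda>t. \<exists>P\<in>Pow {..<c}. X t \<inter> block s c {i,j} = (\<lambda>u. i * s + u) ` P \<union> (\<lambda>u. j * s + u) ` P)"
  proof (intro pr_mono)
    fix t assume "bitnum c (\<lambda>u. i * s + u \<in> X t) = bitnum c (\<lambda>u. j * s + u \<in> X t)"
    then have e: "\<forall>u<c. i * s + u \<in> X t \<longleftrightarrow> j * s + u \<in> X t" by (simp add: bitnum_inj)
    define P where "P = {u. u < c \<and> i * s + u \<in> X t}"
    have "X t \<inter> block s c {i,j} = (\<lambda>u. i * s + u) ` P \<union> (\<lambda>u. j * s + u) ` P"
      unfolding Q B P_def using e by auto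
    then show "\<exists>P\<in>Pow {..<c}. X t \<inter> block s c {i,j} = (\<lambda>u. i * s + u) ` P \<union> (\<lambda>u. j * s + u) ` P"
      unfolding P_def by blast
  qed
  also have "\<dots> \<le> (\<Sum>P\<in>Pow {..<c}. pr I (\<lambda>t. X t \<inter> block s c {i,j} = (\<lambda>u. i * s + u) ` P \<union> (\<lambda>u. j * s + u) ` P))"
    by (rule pr_bex_le) simp
  also have "\<dots> \<le> (\<Sum>P\<in>Pow {..<c}. (1/2) ^ (2 * c) + \<delta>)"
  proof (intro sum_mono)
    fix P assume "P \<in> Pow {..<c}"
    have cd: "card (block s c {i,j}) = 2 * c" using card_block[OF c(1), of "{i,j}"] ij by simp
    have "(\<lambda>u. i * s + u) ` P \<union> (\<lambda>u. j * s + u) ` P \<subseteq> block s c {i,j}"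
      unfolding Q B using \<open>P \<in> Pow {..<c}\<close> by auto
    from almost_pattern(1)[OF a _ _ this] show "pr I (\<lambda>t. X t \<inter> block s c {i,j} = (\<lambda>u. i * s + u) ` P \<union> (\<lambda>u. j * s + u) ` P) \<le> (1/2) ^ (2 * c) + \<delta>"
      using block_sub[OF c(1), of "{i,j}" n] ij cd c(2) by auto
  qed
  also have "\<dots> = 2 ^ c * (1/2) ^ (2 * c) + 2 ^ c * \<delta>" by (simp add: card_Pow distrib_left)
  also have "2 ^ c * (1/2) ^ (2 * c) = ((1/2) ^ c :: real)" by (simp add: mult_2 power_add power_one_over)
  finally show ?thesis .
qed

lemma hash2_const:
  assumes a: "almost I X {..<q * c} K \<delta>" and Q: "Q \<subseteq> {..<q}" "card Q * c \<le> K" and \<beta>: "\<beta> < 2 ^ c"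
  shows "pr I (\<lambda>t. \<forall>x\<in>Q. bitnum c (\<lambda>u. x * c + u \<in> X t) = \<beta>) \<le> (1/2) ^ (card Q * c) + \<delta>"
proof -
  obtain P where P: "bitnum c P = \<beta>" using bitnum_surj[OF \<beta>] by blast
  have "pr I (\<lambda>t. \<forall>x\<in>Q. bitnum c (\<lambda>u. x * c + u \<in> X t) = \<beta>)
    \<le> pr I (\<lambda>t. X t \<inter> block c c Q = (\<lambda>(i, j). i * c + j) ` (Q \<times> {u. u < c \<and> P u}))"
  proof (intro pr_mono)
    fix t assume "\<forall>x\<in>Q. bitnum c (\<lambda>u. x * c + u \<in> X t) = \<beta>"
    then have e: "\<forall>x\<in>Q. \<forall>u<c. x * c + u \<in> X t \<longleftrightarrow> P u" unfolding P[symmetric] bitnum_inj .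
    then show "X t \<inter> block c c Q = (\<lambda>(i, j). i * c + j) ` (Q \<times> {u. u < c \<and> P u})"
      unfolding block_def by auto
  qed
  also have "\<dots> \<le> (1/2) ^ card (block c c Q) + \<delta>"
    using block_sub[OF order_refl Q(1)] card_block[of c c Q] Q(2) by (intro almost_pattern(1)[OF a]) (auto simp: block_def)
  finally show ?thesis using card_block[of c c Q] by simp
qed

section \<open>Sample spaces\<close>

text \<open>The Walsh character of \<open>S\<close>.\<close>

definition chr :: "nat set \<Rightarrow> nat set \<Rightarrow> real" where
  "chr S x = (-1) ^ card (S \<inter> x)"

lemma chr_cases: "chr S x = 1 \<or> chr S x = -1"
  unfolding chr_def by (cases "even (card (S \<inter> x))") auto

lemma chr_prod: "finite S \<Longrightarrow> chr S x = (\<Prod>i\<in>S. if i \<in> x then -1 else 1)"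
  unfolding chr_def by (simp add: prod.If_cases Int_def)

lemma chr_insert:
  assumes "finite S" "i \<notin> S"
  shows "chr (insert i S) x = chr S x * (if i \<in> x then -1 else 1)"
  using assms unfolding chr_prod[OF assms(1)] by (subst chr_prod) auto

text \<open>The indicator of a pattern is \<open>(1/2) ^ card Q\<close> times a signed sum of
  \<open>2 ^ card Q\<close> characters. The empty one gives the uniform probability, and each other
  one contributes at most \<delta>; normalization and number of terms cancel, so nothing is
  lost.\<close>

lemma bias_almost:
  assumes I: "finite I" "I \<noteq> {}" and \<delta>: "0 \<le> \<delta>"
    and b: "\<And>S. S \<subseteq> V \<Longrightarrow> S \<noteq> {} \<Longrightarrow> finite S \<Longrightarrow> card S \<le> K \<Longrightarrow> \<bar>avg I (\<lambda>t. chr S (x t))\<bar> \<le> \<delta>"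
    and V: "finite V"
  shows "almost I x V K \<delta>"
proof -
  have "\<bar>pr I (\<lambda>i. x i \<inter> Q = q) - (1/2) ^ card Q\<bar> \<le> \<delta>" if Q: "Q \<subseteq> V" "card Q \<le> K" "q \<subseteq> Q" for Q q
  proof -
    have fQ: "finite Q" using Q V finite_subset by blast
    have fS: "finite S" if "S \<in> Pow Q" for S using that fQ finite_subset by blast
    define \<tau> where "\<tau> i = (if i \<in> q then -1 else 1 :: real)" for i
    define \<sigma> where "\<sigma> t i = (if i \<in> x t then -1 else 1 :: real)" for t i
    have ind: "of_bool (x t \<inter> Q = q) = (1/2) ^ card Q * (\<Sum>S\<in>Pow Q. (\<Prod>i\<in>S. \<tau> i) * chr S (x t))" for t
    proof -
      have "of_bool (x t \<inter> Q = q) = (\<Prod>i\<in>Q. of_bool (i \<in> x t \<longleftrightarrow> i \<in> q) :: real)"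
      proof (cases "x t \<inter> Q = q")
        case True
        then have "\<And>i. i \<in> Q \<Longrightarrow> i \<in> x t \<longleftrightarrow> i \<in> q" by blast
        with True show ?thesis by simp
      next
        case False
        then have "\<exists>i\<in>Q. \<not> (i \<in> x t \<longleftrightarrow> i \<in> q)" using Q(3) by blast
        with False show ?thesis using fQ by (simp add: prod_zero_iff)
      qed
      also have "\<dots> = (\<Prod>i\<in>Q. (1/2) * (\<tau> i * \<sigma> t i + 1))"
        by (intro prod.cong) (auto simp: \<tau>_def \<sigma>_def)
      also have "\<dots> = (1/2) ^ card Q * (\<Prod>i\<in>Q. \<tau> i * \<sigma> t i + 1)"
        unfolding prod.distrib by simp
      also have "(\<Prod>i\<in>Q. \<tau> i * \<sigma> t i + 1) = (\<Sum>S\<in>Pow Q. (\<Prod>i\<in>S. \<tau> i * \<sigma> t i))"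
        using prod_add[OF fQ, of "\<lambda>i. \<tau> i * \<sigma> t i" "\<lambda>_. 1"] by simp
      also have "\<dots> = (\<Sum>S\<in>Pow Q. (\<Prod>i\<in>S. \<tau> i) * chr S (x t))"
        using fS by (intro sum.cong) (auto simp: prod.distrib chr_prod \<sigma>_def)
      finally show ?thesis .
    qed
    have "pr I (\<lambda>i. x i \<inter> Q = q) = (1/2) ^ card Q * (\<Sum>S\<in>Pow Q. (\<Prod>i\<in>S. \<tau> i) * avg I (\<lambda>t. chr S (x t)))"
      unfolding pr_def ind avg_cmult avg_sum ..
    also have "(\<Sum>S\<in>Pow Q. (\<Prod>i\<in>S. \<tau> i) * avg I (\<lambda>t. chr S (x t))) = 1 + (\<Sum>S\<in>Pow Q - {{}}. (\<Prod>i\<in>S. \<tau> i) * avg I (\<lambda>t. chr S (x t)))"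
      using fQ by (subst sum.remove[of _ "{}"]) (auto simp: chr_def avg_const[OF I])
    finally have eq: "pr I (\<lambda>i. x i \<inter> Q = q) - (1/2) ^ card Q = (1/2) ^ card Q * (\<Sum>S\<in>Pow Q - {{}}. (\<Prod>i\<in>S. \<tau> i) * avg I (\<lambda>t. chr S (x t)))"
      by (simp add: distrib_left)
    have t1: "\<bar>\<Prod>i\<in>S. \<tau> i\<bar> = 1" for S unfolding abs_prod \<tau>_def by (intro prod.neutral) auto
    have "\<bar>\<Sum>S\<in>Pow Q - {{}}. (\<Prod>i\<in>S. \<tau> i) * avg I (\<lambda>t. chr S (x t))\<bar> \<le> (\<Sum>S\<in>Pow Q - {{}}. \<bar>(\<Prod>i\<in>S. \<tau> i) * avg I (\<lambda>t. chr S (x t))\<bar>)"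
      by (rule sum_abs)
    also have "\<dots> \<le> (\<Sum>S\<in>Pow Q - {{}}. \<delta>)"
    proof (intro sum_mono)
      fix S assume S: "S \<in> Pow Q - {{}}"
      then have "card S \<le> K" using card_mono[OF fQ, of S] Q(2) by auto
      then show "\<bar>(\<Prod>i\<in>S. \<tau> i) * avg I (\<lambda>t. chr S (x t))\<bar> \<le> \<delta>"
        unfolding abs_mult t1 using b[of S] S Q(1) fS[of S] by auto
    qed
    also have "\<dots> \<le> (\<Sum>S\<in>Pow Q. \<delta>)" using fQ \<delta> by (intro sum_mono2) auto
    also have "\<dots> = 2 ^ card Q * \<delta>" using fQ by (simp add: card_Pow)
    finally have "(1/2) ^ card Q * \<bar>\<Sum>S\<in>Pow Q - {{}}. (\<Prod>i\<in>S. \<tau> i) * avg I (\<lambda>t. chr S (x t))\<bar> \<le> (1/2) ^ card Q * (2 ^ card Q * \<delta>)"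
      by (intro mult_left_mono) auto
    also have "\<dots> = \<delta>" by (simp add: power_one_over)
    finally show ?thesis unfolding eq by (simp add: abs_mult)
  qed
  then show ?thesis using I \<delta> unfolding almost_def by auto
qed

text \<open>The potential \<open>(\<Sum>e\<in>T. (\<Prod>u<t. 1 + l * \<xi> e u) + (\<Prod>u<t. 1 - l * \<xi> e u))\<close> does not increase.\<close>

lemma greedy_bias:
  fixes \<xi> :: "'e \<Rightarrow> nat \<Rightarrow> real"
  assumes T: "finite T" "e \<in> T" and \<xi>: "\<And>e t. \<xi> e t = 1 \<or> \<xi> e t = -1"
    and l: "0 < l" "l \<le> 1/2"
    and g: "\<And>t. t < M \<Longrightarrow> (\<Sum>e\<in>T. \<xi> e t * ((\<Prod>u<t. 1 + l * \<xi> e u) - (\<Prod>u<t. 1 - l * \<xi> e u))) \<le> 0"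
  shows "\<bar>\<Sum>t<M. \<xi> e t\<bar> \<le> 2 * l * real M + ln (2 * real (card T)) / l"
proof -
  define P where "P s e t = (\<Prod>u<t. 1 + s * l * \<xi> e u)" for s :: real and e and t :: nat
  define \<Phi> where "\<Phi> t = (\<Sum>e\<in>T. P 1 e t + P (-1) e t)" for t
  have fac: "0 < 1 + s * l * \<xi> e u" if "s = 1 \<or> s = -1" for s e u
    using \<xi>[of e u] l that by auto
  have P0: "0 < P s e t" if "s = 1 \<or> s = -1" for s e t
    unfolding P_def by (intro prod_pos) (use fac[OF that] in auto)
  have dec: "\<Phi> (Suc t) \<le> \<Phi> t" if "t < M" for t
  proof -
    have "\<Phi> (Suc t) = \<Phi> t + l * (\<Sum>e\<in>T. \<xi> e t * (P 1 e t - P (-1) e t))"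
      unfolding \<Phi>_def P_def by (simp add: sum_distrib_left sum.distrib[symmetric] algebra_simps)
    moreover have "(\<Sum>e\<in>T. \<xi> e t * (P 1 e t - P (-1) e t)) \<le> 0"
      using g[OF that] unfolding P_def by simp
    ultimately show ?thesis using l by (simp add: mult_nonneg_nonpos)
  qed
  have "t \<le> M \<Longrightarrow> \<Phi> t \<le> \<Phi> 0" for t
    by (induction t) (use dec in \<open>auto intro: order_trans simp: Suc_le_eq\<close>)
  from this[of M] have "\<Phi> M \<le> 2 * real (card T)" by (simp add: \<Phi>_def P_def)
  have main: "s * (\<Sum>t<M. \<xi> e t) \<le> 2 * l * real M + ln (2 * real (card T)) / l" if s: "s = 1 \<or> s = -1" for s :: real
  proof -
    have "P s e M \<le> P 1 e M + P (-1) e M" using s P0[of 1 e M] P0[of "-1" e M] by auto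
    also have "\<dots> \<le> \<Phi> M" unfolding \<Phi>_def
      using T P0 by (intro member_le_sum) (auto simp: add_nonneg_nonneg less_imp_le)
    also have "\<dots> \<le> 2 * real (card T)" by fact
    finally have "ln (P s e M) \<le> ln (2 * real (card T))" using P0[OF s, of e M] by simp
    moreover have "ln (P s e M) = (\<Sum>u<M. ln (1 + s * l * \<xi> e u))"
      unfolding P_def using fac[OF s, of e] by (intro ln_prod) (auto simp: less_le)
    \<comment> \<open>Since \<open>l \<le> 1/2\<close>, the logarithm of each factor is at least its
      linear part minus \<open>2 * l^2\<close>. The bound for the product thus becomes a bound for
      the signed sum.\<close>
    moreover have "(\<Sum>u<M. s * l * \<xi> e u - 2 * l^2) \<le> (\<Sum>u<M. ln (1 + s * l * \<xi> e u))"
    proof (intro sum_mono)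
      fix u
      have cs: "s * l * \<xi> e u = l \<or> s * l * \<xi> e u = - l" using \<xi>[of e u] s by auto
      moreover have "l - 2 * l^2 \<le> ln (1 + l)" using ln_one_plus_pos_lower_bound[of l] l
        by (smt (verit) zero_le_power2 divide_le_eq_1)
      moreover have "- l - 2 * l^2 \<le> ln (1 - l)" using ln_one_minus_pos_lower_bound[of l] l by simp
      ultimately show "s * l * \<xi> e u - 2 * l^2 \<le> ln (1 + s * l * \<xi> e u)"
        using cs by (elim disjE) (simp_all only:, simp_all)
    qed
    moreover have "(\<Sum>u<M. s * l * \<xi> e u - 2 * l^2) = l * (s * (\<Sum>t<M. \<xi> e t)) - 2 * l^2 * real M"
      by (simp add: sum_subtractf sum_distrib_left mult_ac)
    ultimately have "l * (s * (\<Sum>t<M. \<xi> e t)) \<le> ln (2 * real (card T)) + 2 * l^2 * real M" by linarith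
    then have "s * (\<Sum>t<M. \<xi> e t) \<le> (ln (2 * real (card T)) + 2 * l^2 * real M) / l"
      using l by (simp add: pos_le_divide_eq mult.commute)
    also have "\<dots> = 2 * l * real M + ln (2 * real (card T)) / l" using l by (simp add: field_simps power2_eq_square)
    finally show ?thesis .
  qed
  from main[of 1] main[of "-1"] show ?thesis by (simp add: abs_le_iff)
qed

definition tests :: "nat \<Rightarrow> nat \<Rightarrow> nat set set" where
  "tests N K = {S. S \<subseteq> {..<N} \<and> card S \<le> K}"

lemma finite_tests: "finite (tests N K)" unfolding tests_def by simp

text \<open>A set is written as \<open>K\<close> letters from \<open>{..<N}\<close> and one blank,
  for which \<open>N\<close> is used.\<close>

lemma card_tests: "card (tests N K) \<le> (N + 1) ^ K"
proof (induction K)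
  case 0
  have "tests N 0 = {{}}" unfolding tests_def by (auto simp: finite_subset[of _ "{..<N}"])
  then show ?case by simp
next
  case (Suc K)
  have "tests N (Suc K) \<subseteq> (\<lambda>(i, S). if i < N then insert i S else S) ` ({..<N+1} \<times> tests N K)"
  proof
    fix S assume S: "S \<in> tests N (Suc K)"
    then have fS: "finite S" unfolding tests_def using finite_subset by blast
    show "S \<in> (\<lambda>(i, S). if i < N then insert i S else S) ` ({..<N+1} \<times> tests N K)"
    proof (cases "S = {}")
      case True
      then show ?thesis by (intro image_eqI[of _ _ "(N, {})"]) (auto simp: tests_def)
    next
      case False
      then obtain i where i: "i \<in> S" by blast
      have "card (S - {i}) \<le> K" "i < N" "S - {i} \<subseteq> {..<N}" using S i fS unfolding tests_def by auto
      then show ?thesis using i by (intro image_eqI[of _ _ "(i, S - {i})"]) (auto simp: tests_def)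
    qed
  qed
  then have "card (tests N (Suc K)) \<le> card ((\<lambda>(i, S). if i < N then insert i S else S) ` ({..<N+1} \<times> tests N K))"
    by (intro card_mono finite_imageI finite_cartesian_product finite_tests) auto
  also have "\<dots> \<le> card ({..<N+1} \<times> tests N K)" by (intro card_image_le finite_cartesian_product finite_tests) auto
  also have "\<dots> \<le> (N+1) * (N+1) ^ K" unfolding card_cartesian_product using mult_le_mono2[OF Suc, of "N+1"] by simp
  finally show ?case by simp
qed

text \<open>Divided by \<open>M\<close>, the bound of \<open>greedy_bias\<close> is
  \<open>2 * l + ln (2 * card T) / (l * M)\<close> with \<open>l = (1/2) ^ (K + 2)\<close>. There
  are at most \<open>(N + 1) ^ K\<close>, hence at most \<open>2 ^ (2 ^ K * K)\<close> tests, so the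
  logarithm is below \<open>2 * l^2 * M = 2 ^ (6 * K - 3)\<close> for this \<open>M\<close>. Both
  parts are then at most \<open>2 * l\<close>, and \<open>4 * l = (1/2) ^ K\<close>.\<close>

lemma greedy_almost:
  fixes M K N :: nat
  assumes M: "M = 2 ^ (8 * K)" and N: "N + 1 \<le> 2 ^ (2 ^ K)"
    and g: "\<And>t. t < M \<Longrightarrow> (\<Sum>S\<in>tests N K - {{}}. chr S (x t) * ((\<Prod>u<t. 1 + (1/2) ^ (K+2) * chr S (x u)) - (\<Prod>u<t. 1 - (1/2) ^ (K+2) * chr S (x u)))) \<le> 0"
  shows "almost {..<M} x {..<N} K ((1/2) ^ K)"
proof (rule bias_almost)
  have Mpos: "0 < M" using M by simp
  then show "finite {..<M}" "{..<M} \<noteq> {}" by auto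
  fix S assume S: "S \<subseteq> {..<N}" "S \<noteq> {}" "finite S" "card S \<le> K"
  let ?T = "tests N K - {{}}" and ?l = "(1/2::real) ^ (K+2)"
  have fT: "finite ?T" using finite_tests by simp
  have ST: "S \<in> ?T" using S unfolding tests_def by auto
  have K: "1 \<le> K" using S by (metis One_nat_def Suc_leI card_gt_0_iff le_trans)
  have l: "0 < ?l" "?l \<le> 1/2" using power_decreasing[of 1 "K+2" "1/2::real"] by auto
  have 1: "\<bar>\<Sum>t<M. chr S (x t)\<bar> \<le> 2 * ?l * real M + ln (2 * real (card ?T)) / ?l"
    by (rule greedy_bias[where \<xi>="\<lambda>S t. chr S (x t)", OF fT ST _ l g]) (use chr_cases in auto)
  have "ln (2 * real (card ?T)) \<le> 2 * ?l^2 * real M"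
  proof -
    have "card ?T \<le> card (tests N K)" by (intro card_mono finite_tests) auto
    also have "\<dots> \<le> (N + 1) ^ K" by (rule card_tests)
    also have "\<dots> \<le> (2 ^ (2 ^ K)) ^ K" using N by (rule power_mono) simp
    finally have "card ?T \<le> 2 ^ (2 ^ K * K)" by (simp add: power_mult)
    from of_nat_mono[OF this, where 'a=real] have "real (card ?T) \<le> 2 ^ (2 ^ K * K)" by simp
    then have "2 * real (card ?T) \<le> 2 ^ (2 ^ K * K + 1)" by simp
    moreover have "0 < card ?T" using fT ST card_gt_0_iff by blast
    ultimately have "ln (2 * real (card ?T)) \<le> ln (2 ^ (2 ^ K * K + 1))"
      by (subst ln_le_cancel_iff) simp_all
    also have "\<dots> = real (2 ^ K * K + 1) * ln 2" by (rule ln_realpow)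
    also have "\<dots> \<le> real (2 ^ K * K + 1) * 1" using ln_le_minus_one[of 2] by (intro mult_left_mono) simp_all
    also have "real (2 ^ K * K + 1) \<le> real (2 ^ (6 * K - 3))"
    proof -
      have "K < 2 ^ K" by simp
      then have "2 ^ K * K + 1 \<le> 2 ^ K * 2 ^ K + (1::nat)" by simp
      also have "\<dots> \<le> 2 ^ (2 * K + 1)" by (simp add: mult_2 power_add)
      also have "\<dots> \<le> 2 ^ (6 * K - 3)" using K by (intro power_increasing) auto
      finally show ?thesis by (simp only: of_nat_le_iff)
    qed
    also have "real (2 ^ (6 * K - 3)) = 2 * ?l^2 * real M"
    proof -
      have e: "(K + 2) * 2 = 2 * K + 4" by simp
      have "?l^2 = (1/2) ^ (2 * K + 4)" unfolding power_mult[symmetric] e ..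
      moreover have "(2::real) ^ (8 * K) = 2 ^ (6 * K - 3) * 2 ^ (2 * K + 3)" using K by (simp add: power_add[symmetric])
      moreover have "(1/2::real) ^ (2 * K + 4) * 2 ^ (2 * K + 3) = 1/2" by (simp add: power_add power_one_over)
      ultimately show ?thesis unfolding M by simp
    qed
    finally show ?thesis by simp
  qed
  then have "ln (2 * real (card ?T)) / ?l \<le> 2 * ?l^2 * real M / ?l" using l by (intro divide_right_mono) auto
  also have "\<dots> = 2 * ?l * real M" using l by (simp add: power2_eq_square)
  finally have "\<bar>\<Sum>t<M. chr S (x t)\<bar> \<le> 4 * ?l * real M" using 1 by simp
  also have "4 * ?l = (1/2) ^ K" by (simp add: power_add power2_eq_square)
  finally show "\<bar>avg {..<M} (\<lambda>t. chr S (x t))\<bar> \<le> (1/2) ^ K"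
    unfolding avg_def using Mpos by (simp add: pos_divide_le_eq abs_divide)
qed auto

text \<open>Each of the \<open>n\<close> variables owns \<open>s\<close> bits of a sample: its first \<open>b\<close> bits decide
  whether it is selected, while its value is the first bit of another sample.\<close>

definition selB :: "nat \<Rightarrow> nat \<Rightarrow> (nat \<Rightarrow> nat set) \<Rightarrow> nat \<Rightarrow> nat \<Rightarrow> nat set" where
  "selB n s X b t = {i. i < n \<and> (\<forall>c<b. i * s + c \<in> X t)}"

definition selD :: "nat \<Rightarrow> nat \<Rightarrow> (nat \<Rightarrow> nat set) \<Rightarrow> nat \<Rightarrow> nat set" where
  "selD n s X t = {i. i < n \<and> i * s \<in> X t}"

lemma selB_iff: "b \<le> s \<Longrightarrow> S \<subseteq> {..<n} \<Longrightarrow> S \<subseteq> selB n s X b t \<longleftrightarrow> X t \<inter> block s b S = block s b S"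
  unfolding selB_def block_def by auto

lemma selD_iff:
  assumes "1 \<le> s" "Q \<subseteq> {..<n}" "q \<subseteq> Q"
  shows "selD n s X t \<inter> Q = q \<longleftrightarrow> X t \<inter> block s 1 Q = block s 1 q"
proof -
  have e: "selD n s X t \<inter> Q = q \<longleftrightarrow> (\<forall>i\<in>Q. i * s \<in> X t \<longleftrightarrow> i \<in> q)" using assms(2,3) unfolding selD_def by blast
  have b: "block s 1 S = (\<lambda>i. i * s) ` S" for S unfolding block_def by force
  have inj: "i * s \<in> (\<lambda>i. i * s) ` q \<longleftrightarrow> i \<in> q" for i using assms(1) by auto
  show ?thesis unfolding e b using assms(3) inj by blast
qed

text \<open>Selecting all of \<open>S\<close> is a single pattern of \<open>card S * b\<close> bits.
  For the hitting property the second Bonferroni inequality is used, which needs singletons and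
  pairs only; \<open>2 \<le> k\<close> ensures that the error \<delta> is below the probability of a
  pair.\<close>

lemma prg_instance:
  assumes a: "almost I X {..<n * s} K \<delta>" and k: "2 \<le> k" "k \<le> K" "bmax * k \<le> K" "bmax \<le> s" "1 \<le> s"
    and \<delta>: "\<delta> \<le> (1/2) ^ (bmax * k)"
  shows "prg n k bmax I (selB n s X) (selD n s X) \<delta>"
proof
  show "0 < k" using k by simp
  show "almost I (selD n s X) {..<n} k \<delta>"
    unfolding almost_def
  proof (intro conjI allI impI)
    show "finite I" "I \<noteq> {}" "0 \<le> \<delta>" using a unfolding almost_def by auto
    fix Q q assume Q: "Q \<subseteq> {..<n} \<and> card Q \<le> k \<and> q \<subseteq> Q"
    have c: "card (block s 1 Q) = card Q" using card_block[of 1 s Q] k by simp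
    have AL: "\<bar>pr I (\<lambda>i. X i \<inter> Q = q) - (1/2) ^ card Q\<bar> \<le> \<delta>" if "Q \<subseteq> {..<n * s}" "card Q \<le> K" "q \<subseteq> Q" for Q q
      using a that unfolding almost_def by blast
    have "block s 1 q \<subseteq> block s 1 Q" using Q unfolding block_def by auto
    moreover have "block s 1 Q \<subseteq> {..<n * s}" using block_sub[of 1 s Q n] Q k by auto
    ultimately have "\<bar>pr I (\<lambda>i. X i \<inter> block s 1 Q = block s 1 q) - (1/2) ^ card (block s 1 Q)\<bar> \<le> \<delta>"
      using AL[of "block s 1 Q" "block s 1 q"] Q k c by simp
    then show "\<bar>pr I (\<lambda>i. selD n s X i \<inter> Q = q) - (1/2) ^ card Q\<bar> \<le> \<delta>"
      using selD_iff[of s Q n q X] Q k c by simp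
  qed
  have ub: "pr I (\<lambda>t. S \<subseteq> selB n s X b t) \<le> (1/2) ^ (card S * b) + \<delta>"
    and lb: "(1/2) ^ (card S * b) - \<delta> \<le> pr I (\<lambda>t. S \<subseteq> selB n s X b t)"
    if S: "S \<subseteq> {..<n}" "b \<le> bmax" "card S * b \<le> K" for S b
  proof -
    have bs: "b \<le> s" using S k by simp
    have c: "card (block s b S) = card S * b" by (rule card_block[OF bs])
    note al = almost_pattern[OF a block_sub[OF bs S(1)] _ order_refl, unfolded c, OF S(3)]
    show "pr I (\<lambda>t. S \<subseteq> selB n s X b t) \<le> (1/2) ^ (card S * b) + \<delta>"
      "(1/2) ^ (card S * b) - \<delta> \<le> pr I (\<lambda>t. S \<subseteq> selB n s X b t)"
      unfolding selB_iff[OF bs S(1)] using al by auto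
  qed
  show "pr I (\<lambda>t. S \<subseteq> selB n s X b t) \<le> 2 * ((1/2) ^ b) ^ k"
    if S: "S \<subseteq> {..<n}" "card S = k" "b \<le> bmax" for S b
  proof -
    have kb: "card S * b \<le> bmax * k" using S by (simp add: mult.commute)
    have "\<delta> \<le> (1/2) ^ (card S * b)" 
      by (rule order_trans[OF \<delta>]) (rule power_decreasing[OF kb], auto)
    then have "pr I (\<lambda>t. S \<subseteq> selB n s X b t) \<le> 2 * (1/2) ^ (card S * b)"
      using ub[OF S(1,3)] kb k by linarith
    then show ?thesis using S(2) by (simp add: power_mult mult.commute)
  qed
  show "pr I (\<lambda>t. S \<inter> selB n s X b t = {}) \<le> 1 - (1/2) ^ b * real (card S) / 2"
    if S: "S \<subseteq> {..<n}" "32 * card S \<le> 2 ^ b" "b \<le> bmax" for S b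
  proof (cases "S = {}")
    case True then show ?thesis using pr_le_1 by simp
  next
    case False
    have fS: "finite S" using S finite_subset by auto
    define p :: real where "p = (1/2) ^ b"
    define N where "N = real (card S)"
    have N1: "1 \<le> N" using False fS unfolding N_def by (simp add: Suc_le_eq card_gt_0_iff)
    have "real (32 * card S) \<le> real (2 ^ b)" using S(2) by (simp only: of_nat_le_iff)
    then have pN: "32 * (p * N) \<le> 1" unfolding p_def N_def by (simp add: power_one_over field_simps)
    have p0: "0 < p" unfolding p_def by simp
    have b2: "2 * b \<le> bmax * k" using S(3) k(1) by (metis mult.commute mult_le_mono)
    have \<delta>p: "\<delta> \<le> p^2"
    proof -
      have "(1/2::real) ^ (bmax * k) \<le> (1/2) ^ (2 * b)" using b2 by (intro power_decreasing) auto
      also have "\<dots> = p^2" unfolding p_def by (simp add: power_mult[symmetric] mult.commute)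
      finally show ?thesis using \<delta> by simp
    qed
    define Y where "Y t = (\<Sum>i\<in>S. of_bool (i \<in> selB n s X b t) :: real)" for t
    have Yc: "Y t = real (card (S \<inter> selB n s X b t))" for t unfolding Y_def using fS by (simp add: Int_def)
    \<comment> \<open>The right-hand side is \<open>1 - Y + Y * (Y - 1) / 2\<close>; the inequality
      amounts to \<open>(Y - 1) * (Y - 2) \<ge> 0\<close>, true for every positive integer.\<close>
    have ineq: "of_bool (S \<inter> selB n s X b t = {}) \<le> 1 - (3/2 * Y t - 1/2 * (Y t)^2)" for t
    proof (cases "S \<inter> selB n s X b t = {}")
      case True then show ?thesis unfolding Yc by simp
    next
      case False
      have "0 \<le> (Y t - 1) * (Y t - 2)"
      proof (cases "card (S \<inter> selB n s X b t) \<le> 1")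
        case True
        then have "card (S \<inter> selB n s X b t) = 1" using False fS by (simp add: le_Suc_eq)
        then show ?thesis unfolding Yc by simp
      next
        case False
        then have "2 \<le> Y t" unfolding Yc by linarith
        then show ?thesis by simp
      qed
      then show ?thesis using False by (simp add: power2_eq_square algebra_simps)
    qed
    have sq: "(Y t)^2 = Y t + (\<Sum>i\<in>S. \<Sum>j\<in>S - {i}. of_bool ({i, j} \<subseteq> selB n s X b t))" for t
    proof -
      have "(Y t)^2 = (\<Sum>i\<in>S. \<Sum>j\<in>S. of_bool (i \<in> selB n s X b t) * of_bool (j \<in> selB n s X b t))"
        unfolding Y_def power2_eq_square by (rule sum_product)
      also have "\<dots> = (\<Sum>i\<in>S. of_bool (i \<in> selB n s X b t) + (\<Sum>j\<in>S - {i}. of_bool ({i, j} \<subseteq> selB n s X b t)))"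
        using fS by (intro sum.cong refl) (subst sum.remove, auto simp: of_bool_conj[symmetric] intro!: sum.cong)
      finally show ?thesis unfolding Y_def by (simp add: sum.distrib)
    qed
    have EY: "N * (p - \<delta>) \<le> avg I Y"
    proof -
      have "avg I Y = (\<Sum>i\<in>S. pr I (\<lambda>t. {i} \<subseteq> selB n s X b t))"
        unfolding Y_def pr_def avg_sum by simp
      also have "\<dots> \<ge> (\<Sum>i\<in>S. p - \<delta>)"
      proof (intro sum_mono)
        fix i assume "i \<in> S"
        then show "p - \<delta> \<le> pr I (\<lambda>t. {i} \<subseteq> selB n s X b t)"
          using lb[of "{i}" b] S b2 k(3) unfolding p_def by auto
      qed
      finally show ?thesis unfolding N_def by simp
    qed
    have EP: "avg I (\<lambda>t. \<Sum>i\<in>S. \<Sum>j\<in>S - {i}. of_bool ({i, j} \<subseteq> selB n s X b t)) \<le> N * (N * (p^2 + \<delta>))"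
    proof -
      have "avg I (\<lambda>t. \<Sum>i\<in>S. \<Sum>j\<in>S - {i}. of_bool ({i, j} \<subseteq> selB n s X b t))
        = (\<Sum>i\<in>S. \<Sum>j\<in>S - {i}. pr I (\<lambda>t. {i, j} \<subseteq> selB n s X b t))"
        unfolding avg_sum pr_def ..
      also have "\<dots> \<le> (\<Sum>i\<in>S. \<Sum>j\<in>S - {i}. p^2 + \<delta>)"
      proof (intro sum_mono)
        fix i j assume "i \<in> S" "j \<in> S - {i}"
        then show "pr I (\<lambda>t. {i, j} \<subseteq> selB n s X b t) \<le> p^2 + \<delta>"
          using ub[of "{i,j}" b] S b2 k(3) unfolding p_def
            by (auto simp: power_mult[symmetric] mult.commute mult_2[symmetric] mult_2_right[symmetric])
      qed
      also have "\<dots> \<le> (\<Sum>i\<in>S. \<Sum>j\<in>S. p^2 + \<delta>)"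
        using fS a unfolding almost_def by (intro sum_mono sum_mono2) auto
      finally show ?thesis unfolding N_def by simp
    qed
    have "pr I (\<lambda>t. S \<inter> selB n s X b t = {}) \<le> avg I (\<lambda>t. 1 - (3/2 * Y t - 1/2 * (Y t)^2))"
      unfolding pr_def by (intro avg_mono ineq)
    also have "\<dots> = avg I (\<lambda>t. 1 - Y t + 1/2 * (\<Sum>i\<in>S. \<Sum>j\<in>S - {i}. of_bool ({i, j} \<subseteq> selB n s X b t)))"
      by (simp add: sq algebra_simps)
    also have "\<dots> = 1 - avg I Y + 1/2 * avg I (\<lambda>t. \<Sum>i\<in>S. \<Sum>j\<in>S - {i}. of_bool ({i, j} \<subseteq> selB n s X b t))"
      using a unfolding almost_def avg_add avg_diff avg_cmult by (simp add: avg_const)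
    also have "\<dots> \<le> 1 - N * (p - \<delta>) + 1/2 * (N * (N * (p^2 + \<delta>)))" using EY EP by linarith
    also have "\<dots> \<le> 1 - p * N / 2"
    proof -
      \<comment> \<open>As \<open>p * N \<le> 1/32\<close>, the error in the first moment and half
        of the pair term are each at most \<open>p * N / 32\<close>, far below the slack
        \<open>p * N / 2\<close>.\<close>
      have "N * \<delta> \<le> N * p^2" using \<delta>p N1 by (intro mult_left_mono) auto
      also have "N * p^2 = (p * N) * p" by (simp add: power2_eq_square)
      also have "\<dots> \<le> (p * N) * (1/32)"
      proof -
        have "p * 1 \<le> p * N" using p0 N1 by (intro mult_left_mono) auto
        then have "p \<le> 1/32" using pN by simp
        then show ?thesis using p0 N1 by (intro mult_left_mono) auto
      qed
      finally have A: "N * \<delta> \<le> p * N / 32" by simp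
      have "N * (N * (p^2 + \<delta>)) \<le> N * (N * (2 * p^2))" using \<delta>p N1 by (intro mult_left_mono) auto
      also have "\<dots> = 2 * ((p * N) * (p * N))" by (simp add: power2_eq_square)
      also have "\<dots> \<le> 2 * ((p * N) * (1/32))" using pN p0 N1 by (intro mult_left_mono) auto
      finally have B: "N * (N * (p^2 + \<delta>)) \<le> p * N / 16" by (simp add: mult.commute)
      have "N * (p - \<delta>) = p * N - N * \<delta>" by (simp add: algebra_simps)
      then have "1 - N * (p - \<delta>) + 1/2 * (N * (N * (p^2 + \<delta>))) \<le> 1 - (p * N - p * N / 32) + 1/2 * (p * N / 16)" using A B by linarith
      also have "\<dots> \<le> 1 - p * N / 2" using p0 N1 by simp
      finally show ?thesis .
    qed
    finally show ?thesis unfolding p_def N_def .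
  qed
qed

section \<open>Accuracy\<close>

lemma avg_prod: "avg (I \<times> J) (\<lambda>p. g (fst p) (snd p)) = avg I (\<lambda>i. avg J (g i))"
proof -
  have "(\<Sum>p\<in>I \<times> J. g (fst p) (snd p)) = (\<Sum>i\<in>I. \<Sum>j\<in>J. g i j)"
    by (simp add: sum.cartesian_product case_prod_unfold)
  then show ?thesis unfolding avg_def
    by (simp add: card_cartesian_product sum_divide_distrib[symmetric] mult.commute)
qed

text \<open>Two levels: \<open>r\<close> bits of the first sample give variable \<open>i\<close> a
  name, \<open>c\<close> bits of the second give that name a bucket. High independence is then
  needed over \<open>2 ^ r\<close> names instead of \<open>n\<close> variables; otherwise
  \<open>r * c * log n\<close> would enter the exponent of the time, and \<open>c\<close> can be
  proportional to \<open>r\<close>. The stride \<open>r + 5\<close> is that of the stages, so one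
  sample space serves both.\<close>

definition hbucket :: "nat \<Rightarrow> nat \<Rightarrow> (nat \<Rightarrow> nat set) \<Rightarrow> (nat \<Rightarrow> nat set) \<Rightarrow> nat \<Rightarrow> nat \<Rightarrow> nat \<Rightarrow> nat" where
  "hbucket r c X1 X2 s u i = bitnum c (\<lambda>v. bitnum r (\<lambda>v. i * (r + 5) + v \<in> X1 s) * c + v \<in> X2 u)"

definition bset :: "nat \<Rightarrow> nat \<Rightarrow> (nat \<Rightarrow> nat set) \<Rightarrow> (nat \<Rightarrow> nat set) \<Rightarrow> nat \<Rightarrow> nat \<Rightarrow> nat \<Rightarrow> nat set" where
  "bset r c X1 X2 s u \<beta> = {i. hbucket r c X1 X2 s u i = \<beta>}"

definition light :: "nat \<Rightarrow> nat \<Rightarrow> nat \<Rightarrow> (nat \<Rightarrow> nat set) \<Rightarrow> (nat \<Rightarrow> nat set) \<Rightarrow> nat \<Rightarrow> nat \<Rightarrow> trm \<Rightarrow> bool" where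
  "light n r c X1 X2 s u T \<longleftrightarrow> (\<forall>\<beta><2 ^ c. card (fst T \<inter> ({..<n} \<inter> bset r c X1 X2 s u \<beta>)) \<le> r)"

lemma half_pow_le: "a \<le> b \<Longrightarrow> (1/2::real) ^ b \<le> (1/2) ^ a"
  by (intro power_decreasing) auto

lemma power_le_exp_fact:
  fixes x :: real assumes that: "0 \<le> x"
  shows "x ^ k / fact k \<le> exp x"
proof -
  have "(\<Sum>n\<in>{k}. inverse (fact n) *\<^sub>R x ^ n) \<le> (\<Sum>n. inverse (fact n) *\<^sub>R x ^ n)"
    by (intro sum_le_suminf summable_exp_generic) (use that in auto)
  then show ?thesis unfolding exp_def by (simp add: field_simps)
qed

text \<open>From \<open>r ^ r / fact r \<le> exp r \<le> 3 ^ r\<close>.\<close>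

lemma binomial_bound:
  assumes "0 < r"
  shows "real (w choose r) \<le> (3 * real w / real r) ^ r"
proof -
  have "real (w choose r) * fact r \<le> real w ^ r"
    using binomial_fact_pow[of w r] by (metis of_nat_fact of_nat_le_iff of_nat_mult of_nat_power)
  moreover have "(real r) ^ r \<le> 3 ^ r * fact r"
  proof -
    have "(real r) ^ r / fact r \<le> exp (real r)" by (rule power_le_exp_fact) simp
    also have "\<dots> = exp 1 ^ r" by (simp add: exp_of_nat_mult[symmetric])
    also have "\<dots> \<le> 3 ^ r" using exp_le by (intro power_mono) auto
    finally show ?thesis by (simp add: divide_le_eq)
  qed
  ultimately have "real (w choose r) * fact r * (real r) ^ r \<le> real w ^ r * (3 ^ r * fact r)"
    by (intro mult_mono) auto
  then have "real (w choose r) * (real r) ^ r \<le> (3 * real w) ^ r"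
    by (simp add: power_mult_distrib mult_ac)
  then show ?thesis using assms by (simp add: power_divide pos_le_divide_eq)
qed

text \<open>A set of more than half of \<open>2 ^ b\<close> variables is hit by a stage with
  probability at least 1/128. So \<open>256 * r\<close> stages miss it with probability at most
  \<open>exp (-2) ^ r \<le> (1/4) ^ r\<close>, which outweighs the factor
  \<open>2 ^ (2 ^ b) \<le> 2 ^ r\<close>.\<close>

lemma decay:
  assumes "2 ^ b \<le> r"
  shows "2 ^ (2 ^ b) * (1 - (1/2) ^ (b+5) * real (2 ^ b div 2 + 1) / 2) ^ (256 * r) \<le> (1/2::real) ^ r"
proof -
  define x :: real where "x = (1/2) ^ (b+5) * real (2 ^ b div 2 + 1) / 2"
  have x1: "1 / 128 \<le> x"
  proof -
    have "(2::nat) ^ b \<le> 2 * (2 ^ b div 2 + 1)" by presburger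
    from of_nat_mono[OF this, where 'a=real] have h: "(2::real) ^ b / 2 \<le> real (2 ^ b div 2 + 1)" by simp
    have "(1/2::real) ^ (b+5) * (2 ^ b / 2) / 2 \<le> x" unfolding x_def
      by (intro divide_right_mono mult_left_mono h) auto
    then show ?thesis by (simp add: power_add power_one_over)
  qed
  have x2: "x \<le> 1"
  proof -
    have "2 ^ b div 2 + 1 \<le> (2::nat) * 2 ^ b" by (metis add_mono div_le_dividend mult_2 one_le_numeral one_le_power)
    from of_nat_mono[OF this, where 'a=real] have h: "real (2 ^ b div 2 + 1) \<le> 2 * 2 ^ b" by simp
    have "x \<le> (1/2::real) ^ (b+5) * (2 * 2 ^ b) / 2" unfolding x_def
      by (intro divide_right_mono mult_left_mono h) auto
    also have "\<dots> \<le> 1" by (simp add: power_add power_one_over)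
    finally show ?thesis .
  qed
  have "1 - x \<le> exp (- (1/128))" using exp_ge_add_one_self[of "-(1/128)"] exp_ge_add_one_self[of "-x"] x1
    by (smt (verit) exp_le_cancel_iff)
  then have "(1 - x) ^ (256 * r) \<le> exp (-(1/128)) ^ (256 * r)" using x2 by (intro power_mono) auto
  also have "\<dots> = exp (-2) ^ r"
    by (simp add: exp_of_nat_mult[symmetric])
  also have "\<dots> \<le> (1/4) ^ r"
  proof (intro power_mono)
    have "2 \<le> exp (1::real)" using exp_ge_add_one_self[of "1::real"] by simp
    then have "2 * 2 \<le> exp (1::real) * exp 1" by (intro mult_mono) auto
    then have "4 \<le> exp (2::real)" by (simp add: exp_add[symmetric])
    then show "exp (-2) \<le> (1/4::real)" by (simp add: exp_minus inverse_eq_divide divide_le_eq)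
  qed auto
  finally have 1: "(1 - x) ^ (256 * r) \<le> (1/4) ^ r" .
  have "2 ^ (2 ^ b) * (1 - x) ^ (256 * r) \<le> 2 ^ r * (1/4::real) ^ r"
    using 1 x2 assms by (intro mult_mono power_increasing) auto
  also have "\<dots> = (1/2) ^ r" by (simp add: power_mult_distrib[symmetric])
  finally show ?thesis unfolding x_def .
qed

text \<open>This explains the lower bound on \<open>r\<close>: in
  \<open>2 * g + 13 + 2 * \<rho> + e \<le> r\<close> one half of \<open>r\<close> covers
  \<open>2 * g + e + 13\<close>, the other covers \<open>2 * \<rho>\<close>, since \<open>r\<close>
  is \<open>2 ^ \<rho>\<close>; 8192 is \<open>2 ^ 13\<close>.\<close>

lemma size_arith:
  assumes r: "r = 2 ^ \<rho>" "4 * g + 2 * e + 128 \<le> r"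
  shows "(1/2::real) ^ r * (2 ^ (2 * g) * (8192 * real r ^ 2)) \<le> (1/2) ^ e"
proof -
  have \<rho>7: "7 \<le> \<rho>"
  proof (rule ccontr)
    assume "\<not> 7 \<le> \<rho>"
    then have "(2::nat) ^ \<rho> \<le> 2 ^ 6" by (intro power_increasing) auto
    then show False using r by simp
  qed
  have h: "2 * \<rho> \<le> 2 ^ (\<rho> - 1)"
  proof -
    obtain j where j: "\<rho> = j + 7" using \<rho>7 le_Suc_ex by (metis add.commute)
    have "2 * (j + 7) \<le> 64 * 2 ^ j" by (induction j) auto
    then show ?thesis unfolding j by (simp add: power_add)
  qed
  have r2: "r = 2 * 2 ^ (\<rho> - 1)" using r(1) \<rho>7 by (simp add: power_Suc[symmetric] del: power_Suc)
  have "real r ^ 2 = 2 ^ (2 * \<rho>)" unfolding r(1) by (simp add: power_mult[symmetric] mult.commute)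
  then have "2 ^ (2 * g) * (8192 * real r ^ 2) = 2 ^ (2 * g + 13 + 2 * \<rho>)" by (simp add: power_add)
  also have "\<dots> \<le> 2 ^ (r - e)" using h r(2) r2 by (intro power_increasing) auto
  finally have "(1/2::real) ^ r * (2 ^ (2 * g) * (8192 * real r ^ 2)) \<le> (1/2) ^ r * 2 ^ (r - e)"
    by (intro mult_left_mono) auto
  also have "\<dots> = (1/2) ^ e" using r(2) by (simp add: power_diff power_one_over)
  finally show ?thesis .
qed

text \<open>One \<open>(1/2) ^ e\<close> pays for the terms with more than \<open>2 ^ g\<close>
  variables, the other for the hashing and for all stages together.\<close>

theorem average_approximates:
  fixes F :: "trm list" and X1 X2 :: "nat \<Rightarrow> nat set"
  assumes r: "r = 2 ^ \<rho>" "4 * g + 2 * e + 128 \<le> r"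
    and c: "(c = 0 \<and> 8 * 2 ^ g \<le> r) \<or> 2 ^ c * r = 8 * 2 ^ g"
    and F: "wf_terms F" "\<And>T. T \<in> set F \<Longrightarrow> fst T \<subseteq> {..<n}" "length F * 2 ^ e \<le> 2 ^ (2 ^ g)"
    and X1: "almost {..<M1} X1 {..<n * (r + 5)} (r * (\<rho> + 5)) ((1/2) ^ (r * (\<rho> + 5)))"
    and X2: "almost {..<M2} X2 {..<2 ^ r * c} (r * c) ((1/2) ^ (r * c))"
  shows "\<bar>avg {..<M1} (\<lambda>s. avg {..<M2} (\<lambda>u. prg.srun {..<M1} (selB n (r + 5) X1) (selD n (r + 5) X1) (256 * r) \<rho>
     (map (bset r c X1 X2 s u) [0..<2 ^ c]) (filter (light n r c X1 X2 s u) F) {..<n} {})) - val n F {..<n} {}\<bar> \<le> 2 * (1/2) ^ e"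
proof -
  define K where "K = r * (\<rho> + 5)"
  define \<delta> :: real where "\<delta> = (1/2) ^ K"
  have r128: "128 \<le> r" using r(2) by simp
  have K5: "5 * r \<le> K" unfolding K_def by simp
  interpret prg n r "\<rho> + 5" "{..<M1}" "selB n (r + 5) X1" "selD n (r + 5) X1" \<delta>
  proof (rule prg_instance)
    show "almost {..<M1} X1 {..<n * (r + 5)} K \<delta>" using X1 unfolding K_def \<delta>_def .
    have "\<rho> < r" unfolding r(1) by simp
    then show "\<rho> + 5 \<le> r + 5" by simp
    show "\<delta> \<le> (1/2) ^ ((\<rho> + 5) * r)" unfolding \<delta>_def K_def by (simp add: mult.commute)
  qed (use r128 in \<open>auto simp: K_def\<close>)
  define \<epsilon> :: real where "\<epsilon> = (1/2) ^ r"
  have e0: "0 < \<epsilon>" unfolding \<epsilon>_def by simp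
  have \<eta>: "\<eta> \<le> 3 * \<epsilon>"
  proof -
    have "2 ^ r * \<delta> \<le> 2 ^ r * (1/2) ^ (2 * r)" unfolding \<delta>_def
      using K5 r128 by (intro mult_left_mono half_pow_le) auto
    also have "\<dots> = \<epsilon>" unfolding \<epsilon>_def by (simp add: mult_2 power_add power_one_over)
    finally show ?thesis unfolding \<eta>_def \<epsilon>_def by simp
  qed
  let ?Ws = "\<lambda>s u. map (bset r c X1 X2 s u) [0..<2 ^ c]"
  let ?F = "\<lambda>s u. filter (light n r c X1 X2 s u) F"
  have hb: "hbucket r c X1 X2 s u i < 2 ^ c" for s u i unfolding hbucket_def by (rule bitnum_less)
  have run: "\<bar>srun (256 * r) \<rho> (?Ws s u) (?F s u) {..<n} {} - val n (?F s u) {..<n} {}\<bar>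
      \<le> real (2 ^ c) * (real (\<rho> + 1) * (real (256 * r) * \<eta> + \<epsilon>))" for s u
  proof -
    have "\<bar>srun (256 * r) \<rho> (?Ws s u) (?F s u) {..<n} {} - val n (?F s u) {..<n} {}\<bar>
      \<le> real (length (?Ws s u)) * (real (\<rho> + 1) * (real (256 * r) * \<eta> + \<epsilon>))"
    proof (rule srun_val)
      show "wf_terms (?F s u)" using F(1) unfolding wf_terms_def by auto
      show "card (fst T \<inter> ({..<n} \<inter> W)) \<le> 2 ^ \<rho>" if "T \<in> set (?F s u)" "W \<in> set (?Ws s u)" for T W
        using that unfolding light_def r(1) by auto
      show "2 ^ (2 ^ b) * (1 - (1/2) ^ (b+5) * real (2 ^ b div 2 + 1) / 2) ^ (256 * r) \<le> \<epsilon>" if "b \<le> \<rho>" for b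
        unfolding \<epsilon>_def using that r(1) by (intro decay) (simp add: power_increasing)
      show "fst T \<inter> {..<n} \<subseteq> \<Union> (set (?Ws s u))" for T
        using hb by (auto simp: bset_def)
    qed (use r in auto)
    then show ?thesis by simp
  qed
  have M: "finite {..<M1}" "{..<M1} \<noteq> {}" "finite {..<M2}" "{..<M2} \<noteq> {}"
    using X1 X2 unfolding almost_def by auto
  define H where "H = {..<M1} \<times> {..<M2}"
  have H: "finite H" "H \<noteq> {}" unfolding H_def using M by auto
  define w :: nat where "w = 2 ^ g"
  \<comment> \<open>Collisions of two variables under the first hash, and overloaded
    buckets.\<close>
  define \<theta> where "\<theta> = real (w * w) * (2 * \<epsilon>) + 16 * real w * \<epsilon>"
  have \<theta>0: "0 \<le> \<theta>" unfolding \<theta>_def using e0 by simp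
  have coll: "pr {..<M1} (\<lambda>s. bitnum r (\<lambda>v. i * (r + 5) + v \<in> X1 s) = bitnum r (\<lambda>v. j * (r + 5) + v \<in> X1 s)) \<le> 2 * \<epsilon>"
    if "i < n" "j < n" "i \<noteq> j" for i j
  proof -
    have "2 ^ r * \<delta> \<le> 2 ^ r * (1/2) ^ (2 * r)" unfolding \<delta>_def
      using K5 r128 by (intro mult_left_mono half_pow_le) auto
    also have "\<dots> = \<epsilon>" unfolding \<epsilon>_def by (simp add: mult_2 power_add power_one_over)
    finally show ?thesis
      using hash1_coll[OF X1, of r i j] that K5 unfolding K_def[symmetric] \<delta>_def[symmetric] \<epsilon>_def by simp
  qed
  have h2c: "pr {..<M2} (\<lambda>u. \<forall>x\<in>Q. bitnum c (\<lambda>v. x * c + v \<in> X2 u) = \<beta>) \<le> 2 * (1/2) ^ (r * c)"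
    if "Q \<subseteq> {..<2 ^ r}" "card Q = r" "\<beta> < 2 ^ c" for Q \<beta>
    using hash2_const[OF X2 that(1) _ that(3)] that(2) by simp
  \<comment> \<open>For a single bucket \<open>w < r\<close>, so no term with at most
    \<open>w\<close> variables overloads it and the binomial vanishes. Otherwise the probability per
    bucket is governed by \<open>(3 * w / (2 ^ c * r)) ^ r = (3/8) ^ r\<close>; the constant 8 in
    the choice of \<open>c\<close> brings this below \<open>(1/2) ^ r\<close>.\<close>
  have wr: "2 ^ c * (real (w choose r) * (2 * (1/2) ^ (r * c))) \<le> 16 * real w * \<epsilon>"
    using c
  proof
    assume "c = 0 \<and> 8 * 2 ^ g \<le> r"
    moreover have "(2::nat) ^ g < 8 * 2 ^ g" by simp
    ultimately have "w < r" unfolding w_def by linarith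
    then show ?thesis using e0 by (simp add: binomial_eq_0)
  next
    assume c: "2 ^ c * r = 8 * 2 ^ g"
    then have cr: "2 ^ c * real r = 8 * real w" unfolding w_def by (metis of_nat_mult of_nat_numeral of_nat_power)
    have "real (w choose r) * (1/2) ^ (r * c) \<le> (3 * real w / real r) ^ r * ((1/2) ^ c) ^ r"
      using binomial_bound[of r w] r128 by (simp add: power_mult[symmetric] mult.commute mult_right_mono)
    also have "\<dots> = (3 * real w / (2 ^ c * real r)) ^ r" unfolding power_mult_distrib[symmetric] by (simp add: power_one_over mult.commute)
    also have "\<dots> = (3/8) ^ r" unfolding cr w_def by simp
    also have "\<dots> \<le> \<epsilon>" unfolding \<epsilon>_def by (intro power_mono) auto
    finally have "2 ^ c * (real (w choose r) * (2 * (1/2) ^ (r * c))) \<le> 2 ^ c * (2 * \<epsilon>)" by simp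
    also have "\<dots> \<le> (8 * real w) * (2 * \<epsilon>)"
    proof (intro mult_right_mono)
      have "2 ^ c * 1 \<le> 2 ^ c * real r" using r128 by (intro mult_left_mono) auto
      then show "2 ^ c \<le> 8 * real w" using cr by simp
    qed (use e0 in auto)
    finally show ?thesis by simp
  qed
  have bad: "pr H (\<lambda>h. \<not> light n r c X1 X2 (fst h) (snd h) T) \<le> \<theta>" if T: "T \<in> set F" "card (fst T) \<le> w" for T
  proof -
    have "pr H (\<lambda>h. \<not> light n r c X1 X2 (fst h) (snd h) T)
      = avg {..<M1} (\<lambda>s. pr {..<M2} (\<lambda>u. \<not> light n r c X1 X2 s u T))"
      unfolding pr_def H_def using avg_prod[of "{..<M1}" "{..<M2}" "\<lambda>s u. of_bool (\<not> light n r c X1 X2 s u T)"] .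
    also have "\<dots> \<le> avg {..<M1} (\<lambda>s. pr {..<M2} (\<lambda>u. \<exists>\<beta><2 ^ c. r \<le> card (fst T \<inter> {i. bitnum c (\<lambda>v. bitnum r (\<lambda>v. i * (r + 5) + v \<in> X1 s) * c + v \<in> X2 u) = \<beta>})))"
    proof (intro avg_mono pr_mono)
      fix s u assume "\<not> light n r c X1 X2 s u T"
      then obtain \<beta> where \<beta>: "\<beta> < 2 ^ c" "r < card (fst T \<inter> ({..<n} \<inter> bset r c X1 X2 s u \<beta>))"
        unfolding light_def by (auto simp: not_le)
      have "fst T \<inter> ({..<n} \<inter> bset r c X1 X2 s u \<beta>) = fst T \<inter> {i. bitnum c (\<lambda>v. bitnum r (\<lambda>v. i * (r + 5) + v \<in> X1 s) * c + v \<in> X2 u) = \<beta>}"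
        using F(2)[OF T(1)] unfolding bset_def hbucket_def by blast
      then show "\<exists>\<beta><2 ^ c. r \<le> card (fst T \<inter> {i. bitnum c (\<lambda>v. bitnum r (\<lambda>v. i * (r + 5) + v \<in> X1 s) * c + v \<in> X2 u) = \<beta>})"
        using \<beta> by (intro exI[of _ \<beta>]) auto
    qed
    also have "\<dots> \<le> real (w * w) * (2 * \<epsilon>) + real (2 ^ c) * (real (w choose r) * (2 * (1/2) ^ (r * c)))"
      by (rule load_bound[where n=n and q="2 ^ r", OF M coll bitnum_less h2c F(2)[OF T(1)] T(2)]) (use e0 in auto)
    also have "\<dots> \<le> \<theta>" unfolding \<theta>_def using wr by simp
    finally show ?thesis .
  qed
  have "\<bar>avg H (\<lambda>h. val n (?F (fst h) (snd h)) {..<n} {}) - val n F {..<n} {}\<bar> \<le> real (length F) * (1/2) ^ w + \<theta>"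
    by (rule filter_good_val[OF H F(1,2) bad \<theta>0])
  also have "avg H (\<lambda>h. val n (?F (fst h) (snd h)) {..<n} {}) = avg {..<M1} (\<lambda>s. avg {..<M2} (\<lambda>u. val n (?F s u) {..<n} {}))"
    unfolding H_def by (rule avg_prod)
  finally have A: "\<bar>avg {..<M1} (\<lambda>s. avg {..<M2} (\<lambda>u. val n (?F s u) {..<n} {})) - val n F {..<n} {}\<bar> \<le> real (length F) * (1/2) ^ w + \<theta>" .
  have B: "\<bar>avg {..<M1} (\<lambda>s. avg {..<M2} (\<lambda>u. srun (256 * r) \<rho> (?Ws s u) (?F s u) {..<n} {})) - avg {..<M1} (\<lambda>s. avg {..<M2} (\<lambda>u. val n (?F s u) {..<n} {}))\<bar>
     \<le> real (2 ^ c) * (real (\<rho> + 1) * (real (256 * r) * \<eta> + \<epsilon>))"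
    by (rule avg_abs_diff_le[OF M(1,2)], rule avg_abs_diff_le[OF M(3,4)], rule run)
  have t1: "real (length F) * (1/2) ^ w \<le> (1/2) ^ e"
  proof -
    from of_nat_mono[OF F(3), where 'a=real] have "real (length F) * 2 ^ e \<le> 2 ^ w" unfolding w_def by simp
    then show ?thesis by (simp add: power_one_over field_simps)
  qed
  have t2: "\<theta> + real (2 ^ c) * (real (\<rho> + 1) * (real (256 * r) * \<eta> + \<epsilon>)) \<le> (1/2) ^ e"
  proof -
    have c8: "real (2 ^ c) \<le> 8 * real w"
    proof -
      have "(2::nat) ^ c \<le> 8 * w"
        using c
      proof
        assume a: "2 ^ c * r = 8 * 2 ^ g"
        have "(2::nat) ^ c * 1 \<le> 2 ^ c * r" using r128 by (intro mult_le_mono2) auto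
        then show ?thesis using a unfolding w_def by simp
      qed (simp add: w_def)
      from of_nat_mono[OF this, where 'a=real] show ?thesis by simp
    qed
    have rr: "real (\<rho> + 1) \<le> real r" unfolding r(1) by (metis Suc_eq_plus1 Suc_leI less_exp of_nat_le_iff)
    have r1: "1 \<le> real r" using r128 by simp
    have w1: "1 \<le> real w" unfolding w_def by simp
    have "real (256 * r) * \<eta> + \<epsilon> \<le> real (256 * r) * (3 * \<epsilon>) + real r * \<epsilon>"
      using \<eta> e0 r1 by (intro add_mono mult_left_mono) auto
    also have "\<dots> = 769 * (real r * \<epsilon>)" by simp
    finally have "real (2 ^ c) * (real (\<rho> + 1) * (real (256 * r) * \<eta> + \<epsilon>)) \<le> (8 * real w) * (real r * (769 * (real r * \<epsilon>)))"
      using c8 rr \<eta>0 e0 by (intro mult_mono) auto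
    also have "\<dots> = 6152 * (real r ^ 2 * (real w * \<epsilon>))" by (simp add: power2_eq_square)
    also have "\<dots> \<le> 6152 * (real r ^ 2 * (real w ^ 2 * \<epsilon>))"
      using w1 e0 by (intro mult_left_mono mult_right_mono) (auto simp: power2_eq_square)
    finally have P: "real (2 ^ c) * (real (\<rho> + 1) * (real (256 * r) * \<eta> + \<epsilon>)) \<le> 6152 * (real r ^ 2 * (real w ^ 2 * \<epsilon>))" .
    have "\<theta> \<le> 18 * (real w ^ 2 * \<epsilon>)"
    proof -
      have "16 * real w * \<epsilon> \<le> 16 * (real w ^ 2 * \<epsilon>)"
        using w1 e0 mult_right_mono[of 1 "real w" "real w * \<epsilon>"] by (simp add: power2_eq_square mult_ac)
      then show ?thesis unfolding \<theta>_def by (simp add: power2_eq_square mult_ac)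
    qed
    also have "\<dots> \<le> 18 * (real r ^ 2 * (real w ^ 2 * \<epsilon>))"
    proof -
      have "1 \<le> real r ^ 2" using r1 by simp
      then have "1 * (real w ^ 2 * \<epsilon>) \<le> real r ^ 2 * (real w ^ 2 * \<epsilon>)" using e0 by (intro mult_right_mono) auto
      then show ?thesis by simp
    qed
    \<comment> \<open>6152 from the stages and 18 from the hashing; the sum is then rounded up to a
      power of two.\<close>
    finally have "\<theta> + real (2 ^ c) * (real (\<rho> + 1) * (real (256 * r) * \<eta> + \<epsilon>)) \<le> 6170 * (real r ^ 2 * (real w ^ 2 * \<epsilon>))"
      using P by linarith
    also have "\<dots> \<le> 8192 * (real r ^ 2 * (real w ^ 2 * \<epsilon>))" using e0 by (intro mult_right_mono) auto
    also have "\<dots> = \<epsilon> * (2 ^ (2 * g) * (8192 * real r ^ 2))"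
      unfolding w_def by (simp add: power_mult[symmetric] mult_ac)
    also have "\<dots> \<le> (1/2) ^ e" unfolding \<epsilon>_def by (rule size_arith[OF r])
    finally show ?thesis .
  qed
  show ?thesis using A B t1 t2 by (simp add: abs_le_iff)
qed

section \<open>Running times of programs\<close>

fun mods :: "com \<Rightarrow> nat set" where
  "mods Skip = {}"
| "mods (Assign a e e') = {a}"
| "mods (Seq c c') = mods c \<union> mods c'"
| "mods (If e c c') = mods c \<union> mods c'"
| "mods (While e c) = mods c"

lemma exec_frame: "exec c s t s' \<Longrightarrow> a \<notin> mods c \<Longrightarrow> s' a = s a"
  by (induction rule: exec.induct) auto

fun reads :: "aexp \<Rightarrow> nat set" where
  "reads (Num k) = {}"
| "reads (Cell a e) = insert a (reads e)"
| "reads (Plus e e') = reads e \<union> reads e'"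
| "reads (Monus e e') = reads e \<union> reads e'"

lemma aval_frame: "(\<And>a. a \<in> reads e \<Longrightarrow> s' a = s a) \<Longrightarrow> aval e s' = aval e s"
  by (induction e) auto

text \<open>If no loop runs more than \<open>H\<close> times, a program whose syntactic depth is \<open>d\<close> takes
  at most \<open>(50 * (H + 1)) ^ d\<close> steps.\<close>

definition runs :: "nat \<Rightarrow> nat \<Rightarrow> com \<Rightarrow> state \<Rightarrow> (state \<Rightarrow> bool) \<Rightarrow> bool" where
  "runs H d c s Q \<longleftrightarrow> (\<exists>t s'. exec c s t s' \<and> t \<le> (50 * (H + 1)) ^ d \<and> Q s')"

lemma runs_use:
  assumes "runs H d' c s P" "d' \<le> d" "\<And>s'. P s' \<Longrightarrow> (\<And>a. a \<notin> mods c \<Longrightarrow> s' a = s a) \<Longrightarrow> Q s'"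
  shows "runs H d c s Q"
proof -
  obtain t s' where e: "exec c s t s'" "t \<le> (50 * (H + 1)) ^ d'" "P s'"
    using assms(1) unfolding runs_def by blast
  have "(50 * (H + 1)) ^ d' \<le> (50 * (H + 1)) ^ d" using assms(2) by (intro power_increasing) auto
  then show ?thesis unfolding runs_def using e assms(3)[OF e(3)] exec_frame[OF e(1)] by (meson le_trans)
qed

lemma one_le_C: "1 \<le> (50 * (H + 1)) ^ (d::nat)" for H :: nat by simp

lemma C_Suc: "(50 * (H + 1)) ^ Suc d = 50 * (50 * (H + 1)) ^ d + 50 * (H * (50 * (H + 1)) ^ d)" for H :: nat
  by (simp add: algebra_simps)

lemma runs_assign:
  assumes "Q (s(a := (s a)(aval e s := aval e' s)))" "acost e + acost e' \<le> 49" "0 < d"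
  shows "runs H d (Assign a e e') s Q"
proof -
  obtain d' where "d = Suc d'" using assms(3) gr0_implies_Suc by blast
  then have "acost e + acost e' + 1 \<le> (50 * (H + 1)) ^ d"
    using assms(2) one_le_C[of H d'] unfolding \<open>d = Suc d'\<close> C_Suc by linarith
  then show ?thesis unfolding runs_def using exec.Assign assms(1) by blast
qed

lemma runs_skip: "Q s \<Longrightarrow> runs H d Skip s Q"
  unfolding runs_def using exec.Skip one_le_C by blast

lemma runs_if_Suc:
  assumes "aval e s \<noteq> 0 \<Longrightarrow> runs H d c s Q" "aval e s = 0 \<Longrightarrow> runs H d c' s Q" "acost e \<le> 40"
  shows "runs H (Suc d) (If e c c') s Q"
proof (cases "aval e s = 0")
  case True
  then obtain t s' where e: "exec c' s t s'" "t \<le> (50 * (H + 1)) ^ d" "Q s'" using assms unfolding runs_def by blast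
  have "acost e + 1 + t \<le> (50 * (H + 1)) ^ Suc d" using e(2) assms(3) one_le_C[of H d] unfolding C_Suc by linarith
  then show ?thesis unfolding runs_def using exec.IfFalse[OF True e(1)] e(3) by blast
next
  case False
  then obtain t s' where e: "exec c s t s'" "t \<le> (50 * (H + 1)) ^ d" "Q s'" using assms unfolding runs_def by blast
  have "acost e + 1 + t \<le> (50 * (H + 1)) ^ Suc d" using e(2) assms(3) one_le_C[of H d] unfolding C_Suc by linarith
  then show ?thesis unfolding runs_def using exec.IfTrue[OF False e(1)] e(3) by blast
qed

fun seqs :: "com list \<Rightarrow> com" where
  "seqs [] = Skip"
| "seqs (c # cs) = Seq c (seqs cs)"

text \<open>A sequence is counted as a whole: its length multiplies the bound at depth
  \<open>d\<close>, and the depth grows once, not once for every \<open>Seq\<close>.\<close>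

definition runl :: "nat \<Rightarrow> nat \<Rightarrow> com list \<Rightarrow> state \<Rightarrow> (state \<Rightarrow> bool) \<Rightarrow> bool" where
  "runl H d cs s Q \<longleftrightarrow> (\<exists>t s'. exec (seqs cs) s t s' \<and> t \<le> length cs * (50 * (H + 1)) ^ d + 1 \<and> Q s')"

lemma runl_Nil: "Q s \<Longrightarrow> runl H d [] s Q"
  unfolding runl_def using exec.Skip by fastforce

lemma runl_Cons:
  assumes "runs H d c s (\<lambda>s'. runl H d cs s' Q)"
  shows "runl H d (c # cs) s Q"
proof -
  obtain t s' where e: "exec c s t s'" "t \<le> (50 * (H + 1)) ^ d" "runl H d cs s' Q"
    using assms unfolding runs_def by blast
  obtain t' s'' where e': "exec (seqs cs) s' t' s''" "t' \<le> length cs * (50 * (H + 1)) ^ d + 1" "Q s''"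
    using e(3) unfolding runl_def by blast
  have "t + t' \<le> length (c # cs) * (50 * (H + 1)) ^ d + 1" using e(2) e'(2) by simp
  then show ?thesis unfolding runl_def using exec.Seq[OF e(1) e'(1)] e'(3) by auto
qed

lemma runs_seqs_Suc:
  assumes "runl H d cs s Q" "length cs \<le> 49"
  shows "runs H (Suc d) (seqs cs) s Q"
proof -
  obtain t s' where e: "exec (seqs cs) s t s'" "t \<le> length cs * (50 * (H + 1)) ^ d + 1" "Q s'"
    using assms(1) unfolding runl_def by blast
  have "length cs * (50 * (H + 1)) ^ d \<le> 49 * (50 * (H + 1)) ^ d" using assms(2) by (intro mult_right_mono) auto
  then have "t \<le> (50 * (H + 1)) ^ Suc d" using e(2) one_le_C[of H d] unfolding C_Suc by linarith
  then show ?thesis unfolding runs_def using e by blast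
qed

abbreviation Sc :: "nat \<Rightarrow> aexp" where "Sc a \<equiv> Cell a (Num 0)"

definition SetS :: "nat \<Rightarrow> aexp \<Rightarrow> com" where "SetS a e = Assign a (Num 0) e"

definition setsc :: "state \<Rightarrow> nat \<Rightarrow> nat \<Rightarrow> state" where
  "setsc s a x = s(a := (s a)(0 := x))"

lemma mods_SetS: "mods (SetS a e) = {a}" unfolding SetS_def by simp

lemma runs_sets:
  assumes "Q (s(a := (s a)(0 := aval e s)))" "acost e \<le> 48" "0 < d"
  shows "runs H d (SetS a e) s Q"
  unfolding SetS_def by (rule runs_assign) (use assms in auto)

definition For :: "nat \<Rightarrow> aexp \<Rightarrow> com \<Rightarrow> com" where
  "For v e b = Seq (SetS v (Num 0)) (While (Monus e (Sc v)) (Seq b (SetS v (Plus (Sc v) (Num 1)))))"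

lemma mods_For: "mods (For v e b) = insert v (mods b)" unfolding For_def mods_SetS by (auto simp: mods_SetS)

text \<open>The loop evaluates its bound again in every round, so neither the body nor the counter
  may touch what \<open>e\<close> reads. The invariant has to survive arbitrary changes of the
  counter array. In a round, everything outside \<open>mods b\<close> and \<open>v\<close> may be
  taken from the initial state \<open>s\<close>.\<close>

lemma runs_for_Suc:
  assumes N: "aval e s = N" "N \<le> H" "acost e \<le> 30"
    and fr: "v \<notin> mods b" "v \<notin> reads e" "reads e \<inter> mods b = {}"
    and I0: "I 0 s"
    and Iv: "\<And>i s' x. I i s' \<Longrightarrow> I i (s'(v := x))"
    and st: "\<And>i s'. i < N \<Longrightarrow> I i s' \<Longrightarrow> s' v 0 = i \<Longrightarrow> (\<And>a. a \<notin> mods b \<Longrightarrow> a \<noteq> v \<Longrightarrow> s' a = s a) \<Longrightarrow> runs H d b s' (I (Suc i))"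
  shows "runs H (Suc d) (For v e b) s (I N)"
proof -
  let ?C = "(50 * (H + 1)) ^ d"
  let ?W = "While (Monus e (Sc v)) (Seq b (SetS v (Plus (Sc v) (Num 1))))"
  have W: "\<exists>t s2. exec ?W s1 t s2 \<and> t \<le> j * (?C + 40) + 34 \<and> I N s2"
    if "j = N - i" "i \<le> N" "I i s1" "s1 v 0 = i" "\<And>a. a \<notin> mods b \<Longrightarrow> a \<noteq> v \<Longrightarrow> s1 a = s a" for j i s1
    using that
  proof (induction j arbitrary: i s1)
    case 0
    have e1: "aval e s1 = N" using N(1) aval_frame[of e s1 s] 0(5) fr by (metis disjoint_iff)
    have "exec ?W s1 (acost (Monus e (Sc v)) + 1) s1" by (rule exec.WhileFalse) (use e1 0 in simp)
    then show ?case using 0 N(3) by (intro exI conjI) auto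
  next
    case (Suc j)
    have e1: "aval e s1 = N" using N(1) aval_frame[of e s1 s] Suc.prems(5) fr by (metis disjoint_iff)
    have iN: "i < N" using Suc.prems by simp
    obtain t s2 where b: "exec b s1 t s2" "t \<le> ?C" "I (Suc i) s2"
      using st[OF iN Suc.prems(3-5)] unfolding runs_def by blast
    have v2: "s2 v 0 = i" using exec_frame[OF b(1) fr(1)] Suc.prems(4) by simp
    define s3 where "s3 = s2(v := (s2 v)(0 := Suc i))"
    have x: "exec (SetS v (Plus (Sc v) (Num 1))) s2 6 s3"
      unfolding SetS_def s3_def using exec.Assign[of v "Num 0" "Plus (Sc v) (Num 1)" s2] v2 by (simp add: numeral_eq_Suc)
    have "s3 a = s a" if "a \<notin> mods b" "a \<noteq> v" for a
      using exec_frame[OF b(1) that(1)] Suc.prems(5)[OF that] that unfolding s3_def by simp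
    moreover have "I (Suc i) s3" unfolding s3_def by (rule Iv[OF b(3)])
    moreover have "s3 v 0 = Suc i" unfolding s3_def by simp
    ultimately obtain t' s4 where w: "exec ?W s3 t' s4" "t' \<le> j * (?C + 40) + 34" "I N s4"
    proof -
      assume a: "\<And>a. a \<notin> mods b \<Longrightarrow> a \<noteq> v \<Longrightarrow> s3 a = s a" "I (Suc i) s3" "s3 v 0 = Suc i"
        and th: "\<And>t' s4. exec ?W s3 t' s4 \<Longrightarrow> t' \<le> j * (?C + 40) + 34 \<Longrightarrow> I N s4 \<Longrightarrow> thesis"
      have "j = N - Suc i" "Suc i \<le> N" using Suc.prems(1) iN by simp_all
      from Suc.IH[OF this a(2,3,1)] show thesis using th by blast
    qed
    have "exec ?W s1 (acost (Monus e (Sc v)) + 1 + (t + 6) + t') s4"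
      by (rule exec.WhileTrue[OF _ exec.Seq[OF b(1) x] w(1)]) (use e1 Suc.prems iN in simp)
    moreover have "acost (Monus e (Sc v)) + 1 + (t + 6) + t' \<le> Suc j * (?C + 40) + 34"
      using b(2) w(2) N(3) by simp
    ultimately show ?case using w(3) by blast
  qed
  define s1 where "s1 = s(v := (s v)(0 := 0))"
  have x: "exec (SetS v (Num 0)) s 3 s1" unfolding SetS_def s1_def using exec.Assign[of v "Num 0" "Num 0" s] by (simp add: numeral_eq_Suc)
  have "I 0 s1" unfolding s1_def by (rule Iv[OF I0])
  then obtain t s2 where w: "exec ?W s1 t s2" "t \<le> N * (?C + 40) + 34" "I N s2"
    using W[of N 0 s1] unfolding s1_def by auto
  have "3 + t \<le> (50 * (H + 1)) ^ Suc d"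
  proof -
    have "N * (?C + 40) \<le> H * (?C + 40)" using N(2) by (rule mult_right_mono) simp
    also have "\<dots> \<le> H * (41 * ?C)" using one_le_C[of H d] by (intro mult_left_mono) auto
    finally show ?thesis using w(2) one_le_C[of H d] unfolding C_Suc by linarith
  qed
  then show ?thesis unfolding runs_def For_def using exec.Seq[OF x w(1)] w(3) by blast
qed

lemma runs_mono: "runs H d c s Q \<Longrightarrow> d \<le> d' \<Longrightarrow> runs H d' c s Q"
  by (rule runs_use) auto

lemma runs_if:
  assumes "0 < d" "acost e \<le> 40" "aval e s \<noteq> 0 \<Longrightarrow> runs H (d - 1) c s Q" "aval e s = 0 \<Longrightarrow> runs H (d - 1) c' s Q"
  shows "runs H d (If e c c') s Q"
  using runs_if_Suc[OF assms(3,4,2)] assms(1) by simp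

lemma runs_seqs:
  assumes "0 < d" "length cs \<le> 49" "runl H (d - 1) cs s Q"
  shows "runs H d (seqs cs) s Q"
  using runs_seqs_Suc[OF assms(3,2)] assms(1) by simp

lemma runs_for:
  assumes d: "0 < d" and N: "aval e s = N" "N \<le> H" "acost e \<le> 30"
    and fr: "v \<notin> mods b" "v \<notin> reads e" "reads e \<inter> mods b = {}"
    and I0: "I 0 s"
    and Iv: "\<And>i s' x. I i s' \<Longrightarrow> I i (s'(v := x))"
    and st: "\<And>i s'. i < N \<Longrightarrow> I i s' \<Longrightarrow> s' v 0 = i \<Longrightarrow> (\<And>a. a \<notin> mods b \<Longrightarrow> a \<noteq> v \<Longrightarrow> s' a = s a) \<Longrightarrow> runs H (d - 1) b s' (I (Suc i))"
  shows "runs H d (For v e b) s (I N)"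
proof -
  have "runs H (Suc (d - 1)) (For v e b) s (I N)" by (rule runs_for_Suc[OF N fr I0 Iv st])
  then show ?thesis using d by (simp only: Suc_diff_1)
qed

lemmas vcg = runs_seqs runl_Cons runl_Nil runs_sets runs_assign runs_if runs_skip

text \<open>The search for the leading digit 1 of \<epsilon>. The length of this loop is not given
  by any cell in advance; \<open>N\<close>, the position of the digit, bounds it.\<close>

lemma runs_find:
  assumes e: "\<And>i. i < N \<Longrightarrow> s a i = 0" "s a N = 1" "s v 0 = 0" "a \<noteq> v" "N \<le> H"
  shows "runs H 1 (While (Monus (Num 1) (Cell a (Sc v))) (SetS v (Plus (Sc v) (Num 1)))) s (\<lambda>s'. s' = s(v := (s v)(0 := N)))"
proof -
  let ?W = "While (Monus (Num 1) (Cell a (Sc v))) (SetS v (Plus (Sc v) (Num 1)))"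
  have W: "\<exists>t. exec ?W (s(v := (s v)(0 := i))) t (s(v := (s v)(0 := N))) \<and> t \<le> j * 12 + 6" if "j = N - i" "i \<le> N" for i j
    using that
  proof (induction j arbitrary: i)
    case 0
    have "exec ?W (s(v := (s v)(0 := N))) (acost (Monus (Num 1) (Cell a (Sc v))) + 1) (s(v := (s v)(0 := N)))"
      by (rule exec.WhileFalse) (use e in simp)
    then have x: "exec ?W (s(v := (s v)(0 := i))) (acost (Monus (Num 1) (Cell a (Sc v))) + 1) (s(v := (s v)(0 := N)))"
      using 0 by simp
    show ?case by (rule exI, rule conjI, rule x) simp
  next
    case (Suc j)
    let ?s = "s(v := (s v)(0 := i))"
    have "exec (SetS v (Plus (Sc v) (Num 1))) ?s 6 (s(v := (s v)(0 := Suc i)))"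
      unfolding SetS_def using exec.Assign[of v "Num 0" "Plus (Sc v) (Num 1)" ?s] by (simp add: numeral_eq_Suc)
    moreover obtain t where t: "exec ?W (s(v := (s v)(0 := Suc i))) t (s(v := (s v)(0 := N)))" "t \<le> j * 12 + 6"
    proof -
      have "j = N - Suc i" "Suc i \<le> N" using Suc.prems by simp_all
      from Suc.IH[OF this] show "(\<And>t. exec ?W (s(v := (s v)(0 := Suc i))) t (s(v := (s v)(0 := N))) \<Longrightarrow> t \<le> j * 12 + 6 \<Longrightarrow> thesis) \<Longrightarrow> thesis" by blast
    qed
    ultimately have x: "exec ?W ?s (acost (Monus (Num 1) (Cell a (Sc v))) + 1 + 6 + t) (s(v := (s v)(0 := N)))"
      using e Suc.prems by (intro exec.WhileTrue) auto
    show ?case by (rule exI, rule conjI, rule x) (use t(2) in simp)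
  qed
  have "s(v := (s v)(0 := 0)) = s" using fun_upd_triv[of "s v" 0] e(3) by simp
  then obtain t where t: "exec ?W s t (s(v := (s v)(0 := N)))" "t \<le> N * 12 + 6" using W[of N 0] by auto
  have "t \<le> (50 * (H + 1)) ^ 1" using t(2) e(5) by simp
  then show ?thesis unfolding runs_def using t(1) by blast
qed

section \<open>Building a sample space\<close>

text \<open>Element \<open>i\<close>, the counter 40, is added to every earlier set with fewer than
  \<open>K\<close> elements. The number of sets is saved in 39 because 38 grows while the loop runs
  and the bound must stay fixed.\<close>

definition build :: com where
  "build = For 40 (Sc 50) (seqs [SetS 39 (Sc 38),
     For 41 (Sc 39) (If (Monus (Sc 51) (Cell 34 (Sc 41)))
       (seqs [Assign 32 (Sc 38) (Sc 41), Assign 33 (Sc 38) (Sc 40),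
              Assign 34 (Sc 38) (Plus (Cell 34 (Sc 41)) (Num 1)), SetS 38 (Plus (Sc 38) (Num 1))])
       Skip)])"

text \<open>The sets \<open>f 0, \<dots>, f (E - 1)\<close> form a trie: the largest element of \<open>f e\<close> is in array 33, the
  index of the set without this element in array 32, and the cardinality in array 34. The root is
  the empty set, with a largest element out of range.\<close>

definition tree :: "nat \<Rightarrow> nat \<Rightarrow> (nat \<Rightarrow> nat set) \<Rightarrow> nat set set \<Rightarrow> state \<Rightarrow> bool" where
  "tree N E f \<S> s \<longleftrightarrow> s 38 0 = E \<and> 0 < E \<and> bij_betw f {..<E} \<S> \<and> f 0 = {} \<and> s 33 0 = N \<and>
     (\<forall>e<E. s 34 e = card (f e) \<and> finite (f e)) \<and>
     (\<forall>e<E. 0 < e \<longrightarrow> s 32 e < E \<and> s 33 e < N \<and> (\<forall>x\<in>f (s 32 e). x < s 33 e) \<and> f e = insert (s 33 e) (f (s 32 e)))"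

lemma tree_frame: "tree N E f \<S> s \<Longrightarrow> (\<And>a. a \<in> {32,33,34,38} \<Longrightarrow> s' a = s a) \<Longrightarrow> tree N E f \<S> s'"
  unfolding tree_def by simp

lemma tests_Suc: "tests (Suc i) K = tests i K \<union> {insert i S |S. S \<in> tests i K \<and> card S < K}"
proof (intro equalityI subsetI)
  fix S assume S: "S \<in> tests (Suc i) K"
  then have fS: "finite S" unfolding tests_def using finite_subset by blast
  show "S \<in> tests i K \<union> {insert i S |S. S \<in> tests i K \<and> card S < K}"
  proof (cases "i \<in> S")
    case True
    then have "card (S - {i}) < K" using S fS card_Diff1_less[OF fS True] unfolding tests_def by simp
    moreover have "S - {i} \<subseteq> {..<i}" using S unfolding tests_def by auto
    ultimately have "S - {i} \<in> tests i K \<and> card (S - {i}) < K" unfolding tests_def by simp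
    moreover have "S = insert i (S - {i})" using True by blast
    ultimately show ?thesis by blast
  next
    case False
    then have "S \<subseteq> {..<i}" using S unfolding tests_def by (auto simp: less_Suc_eq)
    then show ?thesis using S unfolding tests_def by simp
  qed
next
  fix S assume "S \<in> tests i K \<union> {insert i S |S. S \<in> tests i K \<and> card S < K}"
  then show "S \<in> tests (Suc i) K"
  proof
    assume "S \<in> {insert i S |S. S \<in> tests i K \<and> card S < K}"
    then obtain S' where S': "S = insert i S'" "S' \<in> tests i K" "card S' < K" by blast
    then have "finite S'" unfolding tests_def using finite_subset by blast
    then have "card S \<le> K" using S' by (simp add: card_insert_if)
    then show ?thesis using S' unfolding tests_def by auto
  qed (auto simp: tests_def)
qed

lemma tree_extend:
  assumes T: "tree N E f \<S> s" and e: "e < E" "i \<notin> \<Union>(f ` {e})" "\<forall>x\<in>f e. x < i" "i < N"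
    and new: "insert i (f e) \<notin> \<S>"
    and s': "s' = s(32 := (s 32)(E := e), 33 := (s 33)(E := i), 34 := (s 34)(E := s 34 e + 1), 38 := (s 38)(0 := E + 1))"
  shows "tree N (E + 1) (f(E := insert i (f e))) (insert (insert i (f e)) \<S>) s'"
proof -
  let ?f = "f(E := insert i (f e))"
  have bij: "bij_betw f {..<E} \<S>" using T unfolding tree_def by blast
  have "bij_betw ?f {..<E} \<S>" using bij bij_betw_cong[of "{..<E}" ?f f \<S>] by simp
  then have "bij_betw ?f (insert E {..<E}) (insert (insert i (f e)) \<S>)"
    using new by (subst notIn_Un_bij_betw3[of E "{..<E}" ?f \<S>, simplified, symmetric]) auto
  then have b: "bij_betw ?f {..<E+1} (insert (insert i (f e)) \<S>)" by (simp add: lessThan_Suc)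
  have "i \<notin> f e" using e by simp
  then show ?thesis using T e b unfolding tree_def s' by (auto simp: less_Suc_eq)
qed

lemma build_correct:
  assumes s: "s 38 0 = 1" "s 34 0 = 0" "s 33 0 = N" "s 50 0 = N" "s 51 0 = K"
    and H: "N \<le> H" "(N + 1) ^ K \<le> H"
  shows "runs H 8 build s (\<lambda>s'. \<exists>f. tree N (card (tests N K)) f (tests N K) s')"
proof -
  have cE: "card (tests i K) \<le> H" if "i \<le> N" for i
    using card_tests[of i K] power_mono[of "i+1" "N+1" K] that H(2) by simp
  show ?thesis unfolding build_def
  proof (rule runs_for[where I="\<lambda>i s'. \<exists>f. tree N (card (tests i K)) f (tests i K) s'"])
    have t0: "tests 0 K = {{}}" unfolding tests_def by auto
    show "\<exists>f. tree N (card (tests 0 K)) f (tests 0 K) s"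
      unfolding t0 by (rule exI[of _ "\<lambda>_. {}"]) (use s in \<open>auto simp: tree_def bij_betw_def inj_on_def\<close>)
  next
    fix i s' x assume "\<exists>f. tree N (card (tests i K)) f (tests i K) s'"
    then show "\<exists>f. tree N (card (tests i K)) f (tests i K) (s'(40 := x))"
      using tree_frame[of N _ _ _ s' "s'(40 := x)"] by fastforce
  next
    fix i s' assume i: "i < N" "\<exists>f. tree N (card (tests i K)) f (tests i K) s'" "s' 40 0 = i"
      and fr: "\<And>a. a \<notin> mods (seqs [SetS 39 (Sc 38),
     For 41 (Sc 39) (If (Monus (Sc 51) (Cell 34 (Sc 41)))
       (seqs [Assign 32 (Sc 38) (Sc 41), Assign 33 (Sc 38) (Sc 40),
              Assign 34 (Sc 38) (Plus (Cell 34 (Sc 41)) (Num 1)), SetS 38 (Plus (Sc 38) (Num 1))])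
       Skip)]) \<Longrightarrow> a \<noteq> 40 \<Longrightarrow> s' a = s a"
    obtain f0 where f0: "tree N (card (tests i K)) f0 (tests i K) s'" using i(2) by blast
    define E0 where "E0 = card (tests i K)"
    have K: "s' 51 0 = K" using fr[of 51] s by (simp add: mods_For mods_SetS)
    have b0: "bij_betw f0 {..<E0} (tests i K)" using f0 unfolding tree_def E0_def by blast
    have f0t: "f0 e \<in> tests i K" if "e < E0" for e using b0 that bij_betwE by blast
    have inj: "e = e'" if "f0 e = f0 e'" "e < E0" "e' < E0" for e e'
      using b0 that unfolding bij_betw_def inj_on_def by auto
    \<comment> \<open>Only the \<open>E0\<close> sets present at the start are visited; those
      appended meanwhile contain \<open>i\<close> and leave the first \<open>E0\<close>
      unchanged.\<close>
    define J where "J = (\<lambda>j s''. \<exists>f E. tree N E f (tests i K \<union> {insert i (f0 e) |e. e < j \<and> card (f0 e) < K}) s'' \<and>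
        (\<forall>e<E0. f e = f0 e) \<and> E0 \<le> E \<and> s'' 39 0 = E0 \<and> s'' 40 0 = i \<and> s'' 51 0 = K)"
    have fin: "\<exists>f. tree N (card (tests (Suc i) K)) f (tests (Suc i) K) s''" if J: "J E0 s''" for s''
    proof -
      obtain f E where t: "tree N E f (tests i K \<union> {insert i (f0 e) |e. e < E0 \<and> card (f0 e) < K}) s''"
        using J unfolding J_def by blast
      have "tests i K = f0 ` {..<E0}" using b0 unfolding bij_betw_def by simp
      then have "tests i K \<union> {insert i (f0 e) |e. e < E0 \<and> card (f0 e) < K} = tests (Suc i) K"
        unfolding tests_Suc by auto
      then have t': "tree N E f (tests (Suc i) K) s''" using t by simp
      then have "card (tests (Suc i) K) = E" unfolding tree_def using bij_betw_same_card by fastforce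
      then show ?thesis using t' by blast
    qed
    show "runs H (8 - 1) (seqs [SetS 39 (Sc 38),
     For 41 (Sc 39) (If (Monus (Sc 51) (Cell 34 (Sc 41)))
       (seqs [Assign 32 (Sc 38) (Sc 41), Assign 33 (Sc 38) (Sc 40),
              Assign 34 (Sc 38) (Plus (Cell 34 (Sc 41)) (Num 1)), SetS 38 (Plus (Sc 38) (Num 1))])
       Skip)]) s' (\<lambda>s''. \<exists>f. tree N (card (tests (Suc i) K)) f (tests (Suc i) K) s'')"
    proof ((intro vcg; (simp; fail)?), goal_cases)
      case 1
      let ?s = "s'(39 := (s' 39)(0 := aval (Sc 38) s'))"
      show ?case
      proof (rule runs_use[OF runs_for[where I=J and N=E0 and d=5]], goal_cases)
        case 2
        then show ?case using f0 unfolding tree_def E0_def by simp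
      next
        case 3 show ?case using cE i(1) unfolding E0_def by simp
      next
        case 8
        have "tree N E0 f0 (tests i K) ?s" unfolding E0_def by (rule tree_frame[OF f0]) auto
        then show ?case unfolding J_def using i(3) K f0
          by (intro exI[of _ f0] exI[of _ E0]) (auto simp: tree_def E0_def)
      next
        case (9 j s'' x)
        then obtain f E where t: "tree N E f (tests i K \<union> {insert i (f0 e) |e. e < j \<and> card (f0 e) < K}) s''"
          "\<forall>e<E0. f e = f0 e" "E0 \<le> E" "s'' 39 0 = E0" "s'' 40 0 = i" "s'' 51 0 = K" unfolding J_def by blast
        have "tree N E f (tests i K \<union> {insert i (f0 e) |e. e < j \<and> card (f0 e) < K}) (s''(41 := x))"
          by (rule tree_frame[OF t(1)]) auto
        then show ?case unfolding J_def using t by (intro exI[of _ f] exI[of _ E]) auto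
      next
        case (10 j s'')
        then obtain f E where t: "tree N E f (tests i K \<union> {insert i (f0 e) |e. e < j \<and> card (f0 e) < K}) s''"
          "\<forall>e<E0. f e = f0 e" "E0 \<le> E" "s'' 39 0 = E0" "s'' 40 0 = i" "s'' 51 0 = K" unfolding J_def by blast
        have j: "j < E0" "s'' 41 0 = j" "j < E" using 10 t by auto
        have sz: "s'' 34 j = card (f0 j)" using t j unfolding tree_def by auto
        have E: "s'' 38 0 = E" using t unfolding tree_def by blast
        show ?case
        proof ((intro vcg; (simp; fail)?), goal_cases)
          case (1)
          have lt: "card (f0 j) < K" using 1 t(6) j(2) sz by simp
          let ?s' = "s''(32 := (s'' 32)(E := j), 33 := (s'' 33)(E := i), 34 := (s'' 34)(E := s'' 34 j + 1), 38 := (s'' 38)(0 := E + 1))"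
          have sub: "f0 j \<subseteq> {..<i}" using f0t[OF j(1)] unfolding tests_def by simp
          have fj: "f j = f0 j" using t j by simp
          have nin: "insert i (f0 j) \<notin> tests i K \<union> {insert i (f0 e) |e. e < j \<and> card (f0 e) < K}"
          proof
            assume "insert i (f0 j) \<in> tests i K \<union> {insert i (f0 e) |e. e < j \<and> card (f0 e) < K}"
            then consider "insert i (f0 j) \<in> tests i K" | e where "e < j" "insert i (f0 j) = insert i (f0 e)" by blast
            then show False
            proof cases
              case 1 then show False unfolding tests_def by auto
            next
              case 2
              have "f0 e \<subseteq> {..<i}" using f0t[of e] 2 j(1) unfolding tests_def by simp
              then have "f0 j = f0 e" using 2(2) sub by (metis Diff_insert_absorb lessThan_iff less_irrefl subsetD)
              then have "j = e" using inj[of j e] 2(1) j(1) by simp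
              then show False using 2(1) by simp
            qed
          qed
          have "tree N (E + 1) (f(E := insert i (f j))) (insert (insert i (f j)) (tests i K \<union> {insert i (f0 e) |e. e < j \<and> card (f0 e) < K})) ?s'"
            by (rule tree_extend[OF t(1) j(3)]) (use sub fj nin i(1) in auto)
          moreover have "insert (insert i (f j)) (tests i K \<union> {insert i (f0 e) |e. e < j \<and> card (f0 e) < K}) = tests i K \<union> {insert i (f0 e) |e. e < Suc j \<and> card (f0 e) < K}"
            unfolding fj using lt by (auto simp: less_Suc_eq)
          ultimately have "tree N (E + 1) (f(E := insert i (f j))) (tests i K \<union> {insert i (f0 e) |e. e < Suc j \<and> card (f0 e) < K}) ?s'" by simp
          then have "J (Suc j) ?s'" unfolding J_def using t by (intro exI[of _ "f(E := insert i (f j))"] exI[of _ "E+1"]) auto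
          moreover have "?s' = (let s1 = s''(32 := (s'' 32)(E := j)); s2 = s1(33 := (s1 33)(E := i)); s3 = s2(34 := (s2 34)(E := s'' 34 j + 1)) in s3(38 := (s3 38)(0 := E + 1)))"
            by (simp add: Let_def)
          ultimately show ?case using E j t by (simp add: Let_def)
        next
          case 2
          then have "\<not> card (f0 j) < K" using t(6) j(2) sz by simp
          then have "{insert i (f0 e) |e. e < Suc j \<and> card (f0 e) < K} = {insert i (f0 e) |e. e < j \<and> card (f0 e) < K}"
            by (auto simp: less_Suc_eq)
          then show ?case using t unfolding J_def by auto
        qed
      qed (use fin in \<open>auto simp: mods_SetS intro: runl_Nil\<close>)
    qed
  qed (use s H in \<open>auto simp: mods_For mods_SetS\<close>)
qed

abbreviation neq :: "aexp \<Rightarrow> aexp \<Rightarrow> aexp" where "neq a b \<equiv> Plus (Monus a b) (Monus b a)"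

text \<open>Arrays 50, 51 and 52 contain the parameters \<open>N\<close>, \<open>K\<close> and the number of samples. Sample
  \<open>t\<close> is stored in the cells \<open>t * N, \<dots>, t * N + N - 1\<close> of array \<open>X\<close>. Arrays 35 and 36 contain
  the two products in the potential, scaled to integers, and array 37 the parities of the
  current sample. A bit can be chosen by looking at the tests with this largest element only,
  since the others do not depend on it or have a conditional expectation of 0.\<close>

definition weigh :: com where
  "weigh = For 41 (Sc 38) (If (neq (Cell 33 (Sc 41)) (Sc 40)) Skip
       (If (Cell 37 (Cell 32 (Sc 41)))
          (seqs [SetS 43 (Plus (Sc 43) (Cell 36 (Sc 41))), SetS 44 (Plus (Sc 44) (Cell 35 (Sc 41)))])
          (seqs [SetS 43 (Plus (Sc 43) (Cell 35 (Sc 41))), SetS 44 (Plus (Sc 44) (Cell 36 (Sc 41)))])))"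

definition set_parities :: com where
  "set_parities = For 41 (Sc 38) (If (neq (Cell 33 (Sc 41)) (Sc 40)) Skip
       (If (Sc 45) (Assign 37 (Sc 41) (Monus (Num 1) (Cell 37 (Cell 32 (Sc 41)))))
                   (Assign 37 (Sc 41) (Cell 37 (Cell 32 (Sc 41))))))"

text \<open>43 minus 44 is what the tests with largest element \<open>i\<close> contribute if the
  new bit is 0; the bit 1 negates this. The bit is chosen so that the contribution is not
  positive.\<close>

definition bitstep :: "nat \<Rightarrow> com" where
  "bitstep X = seqs [SetS 43 (Num 0), SetS 44 (Num 0), weigh,
     If (Monus (Sc 43) (Sc 44)) (SetS 45 (Num 1)) (SetS 45 (Num 0)),
     Assign X (Sc 46) (Sc 45), SetS 46 (Plus (Sc 46) (Num 1)), set_parities]"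

text \<open>With \<open>l = (1/2) ^ (K + 2)\<close> a factor of the potential becomes the integer
  \<open>2 ^ (K + 2)\<close> plus or minus 1 after scaling, so doublings and one addition or
  subtraction suffice.\<close>

definition reweigh :: com where
  "reweigh = For 41 (Sc 38) (seqs [SetS 47 (Cell 35 (Sc 41)), SetS 48 (Cell 36 (Sc 41)),
    For 49 (Plus (Sc 51) (Num 2)) (seqs [SetS 47 (Plus (Sc 47) (Sc 47)), SetS 48 (Plus (Sc 48) (Sc 48))]),
    If (Cell 37 (Sc 41))
      (seqs [Assign 35 (Sc 41) (Monus (Sc 47) (Cell 35 (Sc 41))), Assign 36 (Sc 41) (Plus (Sc 48) (Cell 36 (Sc 41)))])
      (seqs [Assign 35 (Sc 41) (Plus (Sc 47) (Cell 35 (Sc 41))), Assign 36 (Sc 41) (Monus (Sc 48) (Cell 36 (Sc 41)))])])"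

definition sampler :: "nat \<Rightarrow> com" where
  "sampler X = seqs [SetS 38 (Num 1), Assign 34 (Num 0) (Num 0), Assign 33 (Num 0) (Sc 50), build,
   For 41 (Sc 38) (seqs [Assign 35 (Sc 41) (Num 1), Assign 36 (Sc 41) (Num 1), Assign 37 (Sc 41) (Num 0)]),
   SetS 46 (Num 0),
   For 42 (Sc 52) (seqs [For 40 (Sc 50) (bitstep X), reweigh])]"

lemma mods_weigh: "mods weigh = {41, 43, 44}" unfolding weigh_def by (auto simp: mods_For mods_SetS)
lemma mods_set_parities: "mods set_parities = {41, 37}" unfolding set_parities_def by (auto simp: mods_For mods_SetS)
lemma mods_build: "mods build = {32, 33, 34, 38, 39, 40, 41}" unfolding build_def by (auto simp: mods_For mods_SetS)
lemma mods_bitstep: "mods (bitstep X) = {X, 37, 41, 43, 44, 45, 46}"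
  unfolding bitstep_def by (auto simp: mods_weigh mods_set_parities mods_SetS)
lemma mods_reweigh: "mods reweigh = {35, 36, 41, 47, 48, 49}"
  unfolding reweigh_def by (auto simp: mods_For mods_SetS)
lemma mods_sampler: "mods (sampler X) = {X, 32, 33, 34, 35, 36, 37, 38, 39, 40, 41, 42, 43, 44, 45, 46, 47, 48, 49}"
  unfolding sampler_def by (auto simp: mods_build mods_bitstep mods_reweigh mods_For mods_SetS)

lemmas mods_simps = mods_For mods_SetS mods_weigh mods_set_parities mods_build mods_bitstep mods_reweigh mods_sampler

lemma weigh_correct:
  assumes "s 38 0 = E" "E \<le> H" "s 40 0 = i" "s 43 0 = 0" "s 44 0 = 0"
  shows "runs H 6 weigh s (\<lambda>s'.
     s' 43 0 = (\<Sum>e\<in>{e. e < E \<and> s 33 e = i}. if s 37 (s 32 e) \<noteq> 0 then s 36 e else s 35 e) \<and>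
     s' 44 0 = (\<Sum>e\<in>{e. e < E \<and> s 33 e = i}. if s 37 (s 32 e) \<noteq> 0 then s 35 e else s 36 e))"
  unfolding weigh_def
proof (rule runs_for[where I="\<lambda>j s'.
     s' 43 0 = (\<Sum>e\<in>{e. e < j \<and> s 33 e = i}. if s 37 (s 32 e) \<noteq> 0 then s 36 e else s 35 e) \<and>
     s' 44 0 = (\<Sum>e\<in>{e. e < j \<and> s 33 e = i}. if s 37 (s 32 e) \<noteq> 0 then s 35 e else s 36 e)"], goal_cases)
  case (10 j s')
  have fr: "s' a = s a" if "a \<in> {32,33,35,36,37,40}" for a
    using 10(4)[of a] that by (auto simp: mods_simps)
  have ins: "{e. e < Suc j \<and> s 33 e = i} = (if s 33 j = i then insert j {e. e < j \<and> s 33 e = i} else {e. e < j \<and> s 33 e = i})"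
    by (auto simp: less_Suc_eq)
  show ?case
    by ((intro vcg; (simp; fail)?), goal_cases) (use 10 fr ins assms in \<open>auto simp: split: if_splits\<close>)
qed (use assms in \<open>auto simp: mods_simps\<close>)

lemma set_parities_correct:
  assumes "s 38 0 = E" "E \<le> H" "s 40 0 = i" and par: "\<And>e. e < E \<Longrightarrow> s 33 e = i \<Longrightarrow> s 33 (s 32 e) \<noteq> i"
  shows "runs H 6 set_parities s (\<lambda>s'. s' 37 = (\<lambda>e. if e < E \<and> s 33 e = i then
      (if s 45 0 \<noteq> 0 then 1 - s 37 (s 32 e) else s 37 (s 32 e)) else s 37 e))"
  unfolding set_parities_def
proof (rule runs_for[where I="\<lambda>j s'. s' 37 = (\<lambda>e. if e < j \<and> s 33 e = i then
      (if s 45 0 \<noteq> 0 then 1 - s 37 (s 32 e) else s 37 (s 32 e)) else s 37 e)"], goal_cases)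
  case (10 j s')
  have fr: "s' a = s a" if "a \<in> {32,33,45,40}" for a
    using 10(4)[of a] that by (auto simp: mods_simps)
  show ?case
    by ((intro vcg; (simp; fail)?), goal_cases) (use 10 fr assms par[of j] in \<open>auto simp: less_Suc_eq fun_eq_iff\<close>)
qed (use assms in \<open>auto simp: mods_simps\<close>)

lemma reweigh_correct:
  assumes "s 38 0 = E" "E \<le> H" "s 51 0 = K" "K + 2 \<le> H"
  shows "runs H 6 reweigh s (\<lambda>s'.
     (\<forall>e<E. s' 35 e = (if s 37 e \<noteq> 0 then 2 ^ (K+2) * s 35 e - s 35 e else 2 ^ (K+2) * s 35 e + s 35 e) \<and>
            s' 36 e = (if s 37 e \<noteq> 0 then 2 ^ (K+2) * s 36 e + s 36 e else 2 ^ (K+2) * s 36 e - s 36 e)))"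
  unfolding reweigh_def
proof (rule runs_use[OF runs_for[where d=6 and N=E and I="\<lambda>j s'.
     (\<forall>e. s' 35 e = (if e < j then (if s 37 e \<noteq> 0 then 2 ^ (K+2) * s 35 e - s 35 e else 2 ^ (K+2) * s 35 e + s 35 e) else s 35 e)) \<and>
     (\<forall>e. s' 36 e = (if e < j then (if s 37 e \<noteq> 0 then 2 ^ (K+2) * s 36 e + s 36 e else 2 ^ (K+2) * s 36 e - s 36 e) else s 36 e))"]], goal_cases)
  case (10 j s')
  have fr: "s' a = s a" if "a \<in> {37,51}" for a
    using 10(4)[of a] that by (auto simp: mods_simps)
  show ?case
  proof ((intro vcg; (simp; fail)?), goal_cases)
    case 1
    let ?s = "(\<lambda>s. s(48 := (s 48)(0 := aval (Cell 36 (Sc 41)) s))) (s'(47 := (s' 47)(0 := aval (Cell 35 (Sc 41)) s')))"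
    show ?case
    proof (rule runs_use[OF runs_for[where d=4 and s="?s" and N="K+2" and I="\<lambda>u s''. s'' 47 0 = 2 ^ u * s 35 j \<and> s'' 48 0 = 2 ^ u * s 36 j"]], goal_cases)
      case (10 u s'')
      show ?case by ((intro vcg; (simp; fail)?), goal_cases) (use 10 in auto)
    next
      case (12 s'')
      have f: "s'' a = s' a" if "a \<in> {35, 36, 37, 41}" for a using 12(2)[of a] that by (auto simp: mods_simps)
      show ?case by ((intro vcg; (simp; fail)?), goal_cases) (use 12 10 fr f in \<open>auto simp: less_Suc_eq\<close>)
    qed (use assms fr 10 in \<open>auto simp: mods_simps\<close>)
  qed
qed (use assms in \<open>auto simp: mods_simps\<close>)

definition bits :: "nat \<Rightarrow> nat \<Rightarrow> nat \<Rightarrow> state \<Rightarrow> nat set" where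
  "bits X b i s = {i'. i' < i \<and> s X (b + i') \<noteq> 0}"

lemma bits_Suc: "bits X b (Suc i) s = (if s X (b + i) \<noteq> 0 then insert i (bits X b i s) else bits X b i s)"
  unfolding bits_def by (auto simp: less_Suc_eq)

lemma bits_cong: "(\<And>i'. i' < i \<Longrightarrow> s' X (b + i') = s X (b + i')) \<Longrightarrow> bits X b i s' = bits X b i s"
  unfolding bits_def by auto

lemma chr_cut: "S \<subseteq> {..<i} \<Longrightarrow> i \<le> j \<Longrightarrow> chr S (bits X b j s) = chr S (bits X b i s)"
proof -
  assume "S \<subseteq> {..<i}" "i \<le> j"
  then have "S \<inter> bits X b j s = S \<inter> bits X b i s" unfolding bits_def by auto
  then show ?thesis unfolding chr_def by simp
qed

definition par :: "nat set \<Rightarrow> nat set \<Rightarrow> nat" where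
  "par S x = (if chr S x = 1 then 0 else 1)"

text \<open>A test with largest element \<open>i\<close> has the parity of its parent, flipped if
  the new bit is 1. Hence the sum over these tests is \<open>PP - QQ\<close> up to a common sign,
  which the new bit decides. The root needs the separate case \<open>e = 0\<close>, because its
  largest element counts as \<open>N\<close>.\<close>

lemma bitstep_correct:
  assumes T: "tree N E f \<S> s" and E: "E \<le> H" and i: "s 40 0 = i" "i < N" and X: "X < 32"
    and b: "s 46 0 = b + i"
    and chi: "\<And>e. e < E \<Longrightarrow> e = 0 \<or> s 33 e < i \<Longrightarrow> s 37 e = par (f e) (bits X b i s)"
  shows "runs H 8 (bitstep X) s (\<lambda>s'. (\<exists>x. (x = 0 \<or> x = 1) \<and> s' X = (s X)(b + i := x)) \<and> s' 46 0 = b + Suc i \<and>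
     (\<forall>e<E. e = 0 \<or> s 33 e < Suc i \<longrightarrow> s' 37 e = par (f e) (bits X b (Suc i) s')) \<and>
     (\<Sum>e\<in>{e. e < E \<and> s 33 e = i}. chr (f e) (bits X b (Suc i) s') * (real (s 35 e) - real (s 36 e))) \<le> 0)"
proof -
  let ?Ei = "{e. e < E \<and> s 33 e = i}"
  define p where "p e = s 32 e" for e
  have Ei: "0 < e" "p e < E" "p e = 0 \<or> s 33 (p e) < i" "s 33 (p e) \<noteq> i" "f e = insert i (f (p e))" "f (p e) \<subseteq> {..<i}" "finite (f (p e))" "i \<notin> f (p e)"
    if "e \<in> ?Ei" for e
  proof -
    have l0: "s 33 0 = N" using T unfolding tree_def by simp
    show e0: "0 < e" using that l0 i(2) by (cases e) auto
    have P: "p e < E" "\<forall>x\<in>f (p e). x < i" "f e = insert i (f (p e))" using T that e0 unfolding tree_def p_def by auto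
    then show "p e < E" "f e = insert i (f (p e))" "f (p e) \<subseteq> {..<i}" "i \<notin> f (p e)" by auto
    show "finite (f (p e))" using T P(1) unfolding tree_def by simp
    show c: "p e = 0 \<or> s 33 (p e) < i"
    proof (cases "p e = 0")
      case False
      then have "s 33 (p e) \<in> f (p e)" using T P(1) unfolding tree_def by blast
      then show ?thesis using P(2) by blast
    qed simp
    show "s 33 (p e) \<noteq> i" using c l0 i(2) by auto
  qed
  define C where "C = bits X b i s"
  define PP where "PP = (\<Sum>e\<in>?Ei. if s 37 (s 32 e) \<noteq> 0 then s 36 e else s 35 e)"
  define QQ where "QQ = (\<Sum>e\<in>?Ei. if s 37 (s 32 e) \<noteq> 0 then s 35 e else s 36 e)"
  have chip: "s 37 (s 32 e) = par (f (p e)) C" if "e \<in> ?Ei" for e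
    using chi[of "p e"] Ei(2,3)[OF that] unfolding p_def C_def by simp
  have PQ: "real PP - real QQ = (\<Sum>e\<in>?Ei. chr (f (p e)) C * (real (s 35 e) - real (s 36 e)))"
  proof -
    have "real PP - real QQ = (\<Sum>e\<in>?Ei. real (if s 37 (s 32 e) \<noteq> 0 then s 36 e else s 35 e) - real (if s 37 (s 32 e) \<noteq> 0 then s 35 e else s 36 e))"
      unfolding PP_def QQ_def by (simp add: sum_subtractf)
    also have "\<dots> = (\<Sum>e\<in>?Ei. chr (f (p e)) C * (real (s 35 e) - real (s 36 e)))"
    proof (intro sum.cong refl)
      fix e assume "e \<in> ?Ei"
      from chip[OF this] show "real (if s 37 (s 32 e) \<noteq> 0 then s 36 e else s 35 e) - real (if s 37 (s 32 e) \<noteq> 0 then s 35 e else s 36 e) = chr (f (p e)) C * (real (s 35 e) - real (s 36 e))"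
        using chr_cases[of "f (p e)" C] by (auto simp: par_def)
    qed
    finally show ?thesis .
  qed
  define x :: nat where "x = (if QQ < PP then 1 else 0)"
  have fin: "(\<exists>x. (x = 0 \<or> x = 1) \<and> s' X = (s X)(b + i := x)) \<and> s' 46 0 = b + Suc i \<and>
     (\<forall>e<E. e = 0 \<or> s 33 e < Suc i \<longrightarrow> s' 37 e = par (f e) (bits X b (Suc i) s')) \<and>
     (\<Sum>e\<in>?Ei. chr (f e) (bits X b (Suc i) s') * (real (s 35 e) - real (s 36 e))) \<le> 0"
    if s': "s' X = (s X)(b + i := x)" "s' 46 0 = b + Suc i"
      "s' 37 = (\<lambda>e. if e < E \<and> s 33 e = i then (if x \<noteq> 0 then 1 - s 37 (s 32 e) else s 37 (s 32 e)) else s 37 e)" for s'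
  proof -
    have C': "bits X b (Suc i) s' = (if x \<noteq> 0 then insert i C else C)"
      unfolding bits_Suc C_def using s'(1) bits_cong[of i s' X b s] by simp
    have iC: "i \<notin> C" unfolding C_def bits_def by simp
    have ce: "chr (f e) (bits X b (Suc i) s') = chr (f (p e)) C * (if x \<noteq> 0 then -1 else 1)" if e: "e \<in> ?Ei" for e
    proof -
      have "chr (f (p e)) (bits X b (Suc i) s') = chr (f (p e)) C"
      proof -
        have "f (p e) \<inter> bits X b (Suc i) s' = f (p e) \<inter> C" unfolding C' using Ei(8)[OF e] by auto
        then show ?thesis unfolding chr_def by simp
      qed
      moreover have "i \<in> bits X b (Suc i) s' \<longleftrightarrow> x \<noteq> 0" unfolding C' using iC by auto
      ultimately show ?thesis unfolding Ei(5)[OF e] chr_insert[OF Ei(7,8)[OF e]] by simp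
    qed
    have chi': "s' 37 e = par (f e) (bits X b (Suc i) s')" if e: "e < E" "e = 0 \<or> s 33 e < Suc i" for e
    proof (cases "s 33 e = i")
      case True
      then have eE: "e \<in> ?Ei" using e by simp
      show ?thesis using True e(1) ce[OF eE] chip[OF eE] chr_cases[of "f (p e)" C]
        unfolding s'(3) par_def by auto
    next
      case False
      then have c: "e = 0 \<or> s 33 e < i" using e by auto
      have sub: "f e \<subseteq> {..<i}"
      proof (cases "e = 0")
        case True then show ?thesis using T unfolding tree_def by simp
      next
        case False
        then have "f e = insert (s 33 e) (f (s 32 e))" "\<forall>x\<in>f (s 32 e). x < s 33 e" using T e unfolding tree_def by auto
        then show ?thesis using c False by auto
      qed
      then have "f e \<inter> bits X b (Suc i) s' = f e \<inter> C" unfolding C' by auto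
      then have "par (f e) (bits X b (Suc i) s') = par (f e) C" unfolding par_def chr_def by simp
      then show ?thesis using chi[OF e(1) c] False unfolding s'(3) C_def by simp
    qed
    have "(\<Sum>e\<in>?Ei. chr (f e) (bits X b (Suc i) s') * (real (s 35 e) - real (s 36 e)))
      = (\<Sum>e\<in>?Ei. (if x \<noteq> 0 then -1 else 1) * (chr (f (p e)) C * (real (s 35 e) - real (s 36 e))))"
      using ce by (intro sum.cong) auto
    also have "\<dots> = (if x \<noteq> 0 then -1 else 1) * (real PP - real QQ)" unfolding PQ sum_distrib_left ..
    also have "\<dots> \<le> 0" unfolding x_def by auto
    finally show ?thesis using s'(1,2) chi' unfolding x_def by auto
  qed
  have E38: "s 38 0 = E" using T unfolding tree_def by simp
  show ?thesis unfolding bitstep_def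
  proof ((intro vcg; (simp; fail)?), goal_cases)
    case 1
    let ?s = "(\<lambda>s. s(44 := (s 44)(0 := aval (Num 0) s))) (s(43 := (s 43)(0 := aval (Num 0) s)))"
    show ?case
    proof (rule runs_use[OF weigh_correct[of ?s E H i]], goal_cases)
      case (7 s1)
      have f1: "s1 a = s a" if "a \<notin> {41, 43, 44}" for a using 7(2)[of a] that by (simp add: mods_simps)
      have P1: "s1 43 0 = PP" "s1 44 0 = QQ" using 7(1) unfolding PP_def QQ_def by (simp_all cong: if_cong)
      have B: "runs H 6 set_parities s2 (\<lambda>s'. runl H (8 - 1) [] s' (\<lambda>s'. (\<exists>x. (x = 0 \<or> x = 1) \<and> s' X = (s X)(b + i := x)) \<and> s' 46 0 = b + Suc i \<and>
     (\<forall>e<E. e = 0 \<or> s 33 e < Suc i \<longrightarrow> s' 37 e = par (f e) (bits X b (Suc i) s')) \<and>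
     (\<Sum>e\<in>{e. e < E \<and> s 33 e = i}. chr (f e) (bits X b (Suc i) s') * (real (s 35 e) - real (s 36 e))) \<le> 0))"
        if s2: "s2 X = (s X)(b + i := x)" "s2 46 0 = b + Suc i" "s2 45 0 = x" "\<And>a. a \<in> {32,33,35,36,37,38,40} \<Longrightarrow> s2 a = s a" for s2
      proof (rule runs_use[OF set_parities_correct[of s2 E H i]], goal_cases)
        case (4 e)
        then have "e \<in> ?Ei" using s2(4) by simp
        then show ?case using Ei(4)[of e] s2(4) unfolding p_def by simp
      next
        case (6 s3)
        have f3: "s3 a = s2 a" if "a \<notin> {41, 37}" for a using 6(2)[of a] that by (simp add: mods_simps)
        have "s3 37 = (\<lambda>e. if e < E \<and> s 33 e = i then (if x \<noteq> 0 then 1 - s 37 (s 32 e) else s 37 (s 32 e)) else s 37 e)"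
          using 6(1) s2 by (simp cong: if_cong)
        moreover have "s3 X = (s X)(b + i := x)" "s3 46 0 = b + Suc i" using f3[of X] f3[of 46] s2 X by auto
        ultimately show ?case by (intro runl_Nil fin)
      qed (use s2 E38 E i in auto)
      show ?case
      proof ((intro vcg; (simp; fail)?), goal_cases)
        case 1
        show ?case by (rule runs_mono[OF B]) (use 1 P1 f1[of X] f1[of 46] f1 X b in \<open>auto simp: x_def\<close>)
      next
        case 2
        show ?case by (rule runs_mono[OF B]) (use 2 P1 f1[of X] f1[of 46] f1 X b in \<open>auto simp: x_def\<close>)
      qed
    qed (use E38 E i in auto)
  qed
qed

lemma tree_sub:
  assumes "tree N E f \<S> s" "e < E" "0 < e"
  shows "f e \<subseteq> {..<Suc (s 33 e)}"
  using assms unfolding tree_def by (auto simp: less_Suc_eq)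

lemma sum_group_lst:
  fixes g :: "nat \<Rightarrow> real" and l :: "nat \<Rightarrow> nat"
  assumes "\<And>e. 0 < e \<Longrightarrow> e < E \<Longrightarrow> l e < N" "l 0 = N"
  shows "(\<Sum>e\<in>{1..<E}. g e) = (\<Sum>i<N. \<Sum>e\<in>{e. e < E \<and> l e = i}. g e)"
proof -
  have "(\<Sum>i<N. \<Sum>e\<in>{e. e < E \<and> l e = i}. g e) = (\<Sum>i<N. \<Sum>e\<in>{e \<in> {1..<E}. l e = i}. g e)"
  proof (intro sum.cong refl)
    fix i assume "i \<in> {..<N}"
    then have "e \<noteq> 0" if "l e = i" for e using assms(2) that by (metis lessThan_iff less_irrefl)
    then have "0 < e" if "l e = i" for e using that by blast
    then show "{e. e < E \<and> l e = i} = {e \<in> {1..<E}. l e = i}" by (simp add: Suc_le_eq set_eq_iff) blast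
  qed
  also have "\<dots> = (\<Sum>e\<in>{1..<E}. g e)"
    using assms(1) by (intro sum.group) auto
  finally show ?thesis by simp
qed

text \<open>The sum over all nonempty tests is grouped by the largest element. Later bits do not
  change the characters of an earlier group, so each group stays nonpositive.\<close>

lemma bitloop_correct:
  assumes T: "tree N E f \<S> s" and E: "E \<le> H" and N: "s 50 0 = N" "N \<le> H" and X: "X < 32"
    and b: "s 46 0 = b" and chi0: "s 37 0 = 0"
  shows "runs H 9 (For 40 (Sc 50) (bitstep X)) s (\<lambda>s'. s' 46 0 = b + N \<and>
     (\<forall>q<b. s' X q = s X q) \<and> (\<forall>q<N. s' X (b + q) \<le> 1) \<and>
     (\<forall>e<E. s' 37 e = par (f e) (bits X b N s')) \<and>
     (\<Sum>e\<in>{1..<E}. chr (f e) (bits X b N s') * (real (s 35 e) - real (s 36 e))) \<le> 0)"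
proof -
  have l0: "s 33 0 = N" and f0: "f 0 = {}" and E0: "0 < E" using T unfolding tree_def by auto
  have lN: "s 33 e < N" if "0 < e" "e < E" for e using T that unfolding tree_def by auto
  have p0: "par {} x = 0" for x unfolding par_def chr_def by simp
  define J where "J = (\<lambda>i s'. s' 46 0 = b + i \<and>
     (\<forall>q<b. s' X q = s X q) \<and> (\<forall>q<i. s' X (b + q) \<le> 1) \<and>
     (\<forall>e<E. e = 0 \<or> s 33 e < i \<longrightarrow> s' 37 e = par (f e) (bits X b i s')) \<and>
     (\<forall>i'<i. (\<Sum>e\<in>{e. e < E \<and> s 33 e = i'}. chr (f e) (bits X b i s') * (real (s 35 e) - real (s 36 e))) \<le> 0))"
  show ?thesis
  proof (rule runs_use[OF runs_for[where I=J and N=N and d=9]], goal_cases)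
    case 8
    show ?case unfolding J_def using b chi0 f0 p0 by auto
  next
    case (9 i s' x)
    have "bits X b i (s'(40 := x)) = bits X b i s'" using X unfolding bits_def by simp
    then show ?case using 9 X unfolding J_def by simp
  next
    case (10 i s')
    have fr: "s' a = s a" if "a \<notin> {X, 37, 40, 41, 43, 44, 45, 46}" for a
      using 10(4)[of a] that by (auto simp: mods_simps)
    have frX: "s' a = s a" if "a \<in> {32,33,34,35,36,38}" for a
      using fr[of a] that X by auto
    have T': "tree N E f \<S> s'" by (rule tree_frame[OF T]) (use frX in auto)
    have J: "s' 46 0 = b + i" "\<forall>q<b. s' X q = s X q" "\<forall>q<i. s' X (b + q) \<le> 1"
      "\<And>e. e < E \<Longrightarrow> e = 0 \<or> s 33 e < i \<Longrightarrow> s' 37 e = par (f e) (bits X b i s')"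
      "\<forall>i'<i. (\<Sum>e\<in>{e. e < E \<and> s 33 e = i'}. chr (f e) (bits X b i s') * (real (s 35 e) - real (s 36 e))) \<le> 0"
      using 10(2) unfolding J_def by blast+
    show ?case
    proof (rule runs_use[OF bitstep_correct[OF T' E 10(3) 10(1) X J(1)]], goal_cases)
      case (1 e)
      then show ?case using J(4)[of e] frX by simp
    next
      case (3 s'')
      then obtain x where x: "x = 0 \<or> x = 1" "s'' X = (s' X)(b + i := x)" by blast
      have e33: "s' 33 = s 33" "s' 35 = s 35" "s' 36 = s 36" using frX by auto
      have old: "(\<Sum>e\<in>{e. e < E \<and> s 33 e = i'}. chr (f e) (bits X b (Suc i) s'') * (real (s 35 e) - real (s 36 e))) \<le> 0" if i': "i' < i" for i'
      proof -
        have "chr (f e) (bits X b (Suc i) s'') = chr (f e) (bits X b i s')" if e: "e < E" "s 33 e = i'" for e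
        proof -
          have "0 < e" using e l0 i' 10(1) by (cases e) auto
          then have sub: "f e \<subseteq> {..<i}" using tree_sub[OF T e(1)] e i' by auto
          have "chr (f e) (bits X b (Suc i) s'') = chr (f e) (bits X b i s'')" by (rule chr_cut[OF sub]) simp
          also have "bits X b i s'' = bits X b i s'" by (rule bits_cong) (simp add: x)
          finally show ?thesis .
        qed
        then have "(\<Sum>e\<in>{e. e < E \<and> s 33 e = i'}. chr (f e) (bits X b (Suc i) s'') * (real (s 35 e) - real (s 36 e)))
          = (\<Sum>e\<in>{e. e < E \<and> s 33 e = i'}. chr (f e) (bits X b i s') * (real (s 35 e) - real (s 36 e)))"
          by (intro sum.cong) auto
        then show ?thesis using J(5) i' by simp
      qed
      show ?case unfolding J_def
      proof (intro conjI allI impI)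
        show "s'' 46 0 = b + Suc i" using 3 by blast
        show "s'' X q = s X q" if "q < b" for q using J(2) that x by simp
        show "s'' X (b + q) \<le> 1" if "q < Suc i" for q using J(3) that x by (auto simp: less_Suc_eq)
        show "s'' 37 e = par (f e) (bits X b (Suc i) s'')" if "e < E" "e = 0 \<or> s 33 e < Suc i" for e
          using 3 that e33 by auto
        show "(\<Sum>e\<in>{e. e < E \<and> s 33 e = i'}. chr (f e) (bits X b (Suc i) s'') * (real (s 35 e) - real (s 36 e))) \<le> 0" if "i' < Suc i" for i'
          using old 3 e33 that by (auto simp: less_Suc_eq)
      qed
    qed auto
  next
    case (12 s')
    have "(\<Sum>e\<in>{1..<E}. chr (f e) (bits X b N s') * (real (s 35 e) - real (s 36 e)))
      = (\<Sum>i<N. \<Sum>e\<in>{e. e < E \<and> s 33 e = i}. chr (f e) (bits X b N s') * (real (s 35 e) - real (s 36 e)))"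
      by (rule sum_group_lst[where l="s 33", OF lN l0])
    also have "\<dots> \<le> 0" by (rule sum_nonpos) (use 12(1) in \<open>simp add: J_def\<close>)
    finally have "(\<Sum>e\<in>{1..<E}. chr (f e) (bits X b N s') * (real (s 35 e) - real (s 36 e))) \<le> 0" .
    moreover have "\<forall>e<E. s' 37 e = par (f e) (bits X b N s')"
      using 12(1) lN unfolding J_def by (metis neq0_conv)
    ultimately show ?case using 12(1) unfolding J_def by auto
  qed (use N X in \<open>auto simp: mods_simps\<close>)
qed

definition samples :: "nat \<Rightarrow> nat \<Rightarrow> state \<Rightarrow> nat \<Rightarrow> nat set" where
  "samples X N s t = bits X (t * N) N s"

lemma samples_iff: "p \<in> samples X N s t \<longleftrightarrow> p < N \<and> s X (t * N + p) \<noteq> 0"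
  unfolding samples_def bits_def by simp

text \<open>The inequalities established bit by bit are exactly the hypothesis of
  \<open>greedy_almost\<close>, once the trie enumerates the nonempty tests. Scaling by
  \<open>2 ^ (J * t)\<close> keeps the weights integral without affecting signs.\<close>

lemma sampler_correct:
  assumes s: "s 50 0 = N" "s 51 0 = K" "s 52 0 = 2 ^ (8 * K)" and X: "X < 32"
    and H: "N \<le> H" "(N + 1) ^ K \<le> H" "2 ^ (8 * K) \<le> H" "K + 2 \<le> H"
    and NK: "N + 1 \<le> 2 ^ (2 ^ K)"
  shows "runs H 12 (sampler X) s (\<lambda>s'. almost {..<2 ^ (8 * K)} (samples X N s') {..<N} K ((1/2) ^ K) \<and>
     (\<forall>q<2 ^ (8 * K) * N. s' X q \<le> 1))"
proof -
  define E where "E = card (tests N K)"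
  define J where "J = K + 2"
  have EH: "E \<le> H" unfolding E_def using card_tests[of N K] H(2) by simp
  let ?l = "(1/2::real) ^ J"
  define I where "I f s0 = (\<lambda>t s'. s' 46 0 = t * N \<and> (\<forall>q<t * N. s' X q \<le> 1) \<and> s' 37 0 = 0 \<and>
     (\<forall>e<E. real (s' 35 e) = 2 ^ (J * t) * (\<Prod>u<t. 1 + ?l * chr (f e) (samples X N s' u)) \<and>
            real (s' 36 e) = 2 ^ (J * t) * (\<Prod>u<t. 1 - ?l * chr (f e) (samples X N s' u))) \<and>
     (\<forall>u<t. (\<Sum>e\<in>{1..<E}. chr (f e) (samples X N s' u) *
        ((\<Prod>u'<u. 1 + ?l * chr (f e) (samples X N s' u')) - (\<Prod>u'<u. 1 - ?l * chr (f e) (samples X N s' u')))) \<le> 0))"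
    for f :: "nat \<Rightarrow> nat set" and s0 :: state
  have main: "runs H 11 (For 42 (Sc 52) (seqs [For 40 (Sc 50) (bitstep X), reweigh])) s0 (I f s0 (2 ^ (8 * K)))"
    if T: "tree N E f (tests N K) s0" and s0: "s0 50 0 = N" "s0 51 0 = K" "s0 52 0 = 2 ^ (8 * K)" "s0 46 0 = 0" "s0 37 0 = 0"
      "\<forall>e<E. s0 35 e = 1 \<and> s0 36 e = 1" for f s0
  proof (rule runs_for[where I="I f s0" and N="2 ^ (8 * K)"], goal_cases)
    case 8
    show ?case unfolding I_def using s0 by auto
  next
    case (9 t s' x)
    have "samples X N (s'(42 := x)) = samples X N s'" using X unfolding samples_def bits_def by simp
    then show ?case using 9 X unfolding I_def by simp
  next
    case (10 t s')
    have fr: "s' a = s0 a" if "a \<in> {32, 33, 34, 38, 50, 51, 52}" for a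
      using 10(4)[of a] that X by (auto simp: mods_simps)
    have T': "tree N E f (tests N K) s'" by (rule tree_frame[OF T]) (use fr in auto)
    have IT: "s' 46 0 = t * N" "\<forall>q<t * N. s' X q \<le> 1" "s' 37 0 = 0"
      "\<And>e. e < E \<Longrightarrow> real (s' 35 e) = 2 ^ (J * t) * (\<Prod>u<t. 1 + ?l * chr (f e) (samples X N s' u))"
      "\<And>e. e < E \<Longrightarrow> real (s' 36 e) = 2 ^ (J * t) * (\<Prod>u<t. 1 - ?l * chr (f e) (samples X N s' u))"
      "\<And>u. u < t \<Longrightarrow> (\<Sum>e\<in>{1..<E}. chr (f e) (samples X N s' u) *
        ((\<Prod>u'<u. 1 + ?l * chr (f e) (samples X N s' u')) - (\<Prod>u'<u. 1 - ?l * chr (f e) (samples X N s' u')))) \<le> 0"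
      using 10(2) unfolding I_def by blast+
    have f0: "f 0 = {}" using T unfolding tree_def by blast
    have E0: "0 < E" using T unfolding tree_def by blast
    show ?case
    proof ((intro vcg; (simp; fail)?), goal_cases)
      case 1
      show ?case
      proof (rule runs_use[OF bitloop_correct[OF T' EH _ H(1) X IT(1) IT(3)]], goal_cases)
        case 1 then show ?case using fr s0 by simp
      next
        case (3 s1)
        have f1: "s1 a = s' a" if "a \<notin> {X, 37, 40, 41, 43, 44, 45, 46}" for a
          using 3(2)[of a] that by (simp add: mods_simps)
        have f1': "s1 35 = s' 35" "s1 36 = s' 36" "s1 38 0 = E" "s1 51 0 = K" using f1[of 35] f1[of 36] f1[of 38] f1[of 51] X fr[of 38] fr[of 51] s0 T unfolding tree_def by auto
        have smp: "samples X N s1 u = samples X N s' u" if u: "u < t" for u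
        proof -
          have "s1 X (u * N + q) = s' X (u * N + q)" if q: "q < N" for q
          proof -
            have "u * N + q < Suc u * N" using q by simp
            also have "\<dots> \<le> t * N" using u by (intro mult_right_mono) auto
            finally show ?thesis using 3(1) by blast
          qed
          then show ?thesis unfolding samples_def by (intro bits_cong) auto
        qed
        have st: "samples X N s1 t = bits X (t * N) N s1" unfolding samples_def ..
        show ?case
        proof (intro vcg, rule runs_use[OF reweigh_correct[of s1 E H K]], goal_cases)
          case (6 s2)
          have f2: "s2 a = s1 a" if "a \<notin> {35, 36, 41, 47, 48, 49}" for a
            using 6(2)[of a] that by (simp add: mods_simps)
          have s2X: "s2 X = s1 X" "s2 46 = s1 46" "s2 37 = s1 37" using f2[of X] f2[of 46] f2[of 37] X by auto
          have smp2: "samples X N s2 u = samples X N s1 u" for u unfolding samples_def bits_def s2X ..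
          have chi: "s1 37 e = par (f e) (samples X N s2 t)" if "e < E" for e
            using 3(1) that unfolding smp2 st by blast
          have W: "real (s2 35 e) = 2 ^ (J * Suc t) * (\<Prod>u<Suc t. 1 + ?l * chr (f e) (samples X N s2 u)) \<and>
            real (s2 36 e) = 2 ^ (J * Suc t) * (\<Prod>u<Suc t. 1 - ?l * chr (f e) (samples X N s2 u))" if e: "e < E" for e
          proof -
            let ?c = "chr (f e) (samples X N s2 t)"
            \<comment> \<open>The truncated subtraction of the machine is exact here.\<close>
            have ge: "x \<le> 2 ^ J * x" for x :: nat by simp
            have u35: "s2 35 e = (if s1 37 e \<noteq> 0 then 2 ^ J * s' 35 e - s' 35 e else 2 ^ J * s' 35 e + s' 35 e)"
              and u36: "s2 36 e = (if s1 37 e \<noteq> 0 then 2 ^ J * s' 36 e + s' 36 e else 2 ^ J * s' 36 e - s' 36 e)"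
              using 6(1) e f1' unfolding J_def by auto
            have r35: "real (s2 35 e) = 2 ^ J * real (s' 35 e) * (1 + ?l * ?c)"
              using chr_cases[of "f e" "samples X N s2 t"] ge[of "s' 35 e"] unfolding u35 chi[OF e] par_def
              by (auto simp: of_nat_diff power_one_over field_simps)
            have r36: "real (s2 36 e) = 2 ^ J * real (s' 36 e) * (1 - ?l * ?c)"
              using chr_cases[of "f e" "samples X N s2 t"] ge[of "s' 36 e"] unfolding u36 chi[OF e] par_def
              by (auto simp: of_nat_diff power_one_over field_simps)
            have P: "(\<Prod>u<t. 1 + ?l * chr (f e) (samples X N s2 u)) = (\<Prod>u<t. 1 + ?l * chr (f e) (samples X N s' u))"
              "(\<Prod>u<t. 1 - ?l * chr (f e) (samples X N s2 u)) = (\<Prod>u<t. 1 - ?l * chr (f e) (samples X N s' u))"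
              using smp smp2 by (auto intro!: prod.cong)
            show ?thesis unfolding r35 r36 IT(4)[OF e] IT(5)[OF e] by (simp add: P power_add mult_ac)
          qed
          have G: "(\<Sum>e\<in>{1..<E}. chr (f e) (samples X N s2 u) *
            ((\<Prod>u'<u. 1 + ?l * chr (f e) (samples X N s2 u')) - (\<Prod>u'<u. 1 - ?l * chr (f e) (samples X N s2 u')))) \<le> 0"
            if u: "u < Suc t" for u
          proof (cases "u < t")
            case True
            have "(\<Sum>e\<in>{1..<E}. chr (f e) (samples X N s2 u) *
            ((\<Prod>u'<u. 1 + ?l * chr (f e) (samples X N s2 u')) - (\<Prod>u'<u. 1 - ?l * chr (f e) (samples X N s2 u'))))
            = (\<Sum>e\<in>{1..<E}. chr (f e) (samples X N s' u) *
            ((\<Prod>u'<u. 1 + ?l * chr (f e) (samples X N s' u')) - (\<Prod>u'<u. 1 - ?l * chr (f e) (samples X N s' u'))))"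
              using True smp smp2 by (auto intro!: sum.cong prod.cong arg_cong2[where f="(-)"])
            then show ?thesis using IT(6)[OF True] by simp
          next
            case False
            then have ut: "u = t" using u by simp
            let ?R = "\<lambda>e. (\<Prod>u'<t. 1 + ?l * chr (f e) (samples X N s2 u')) - (\<Prod>u'<t. 1 - ?l * chr (f e) (samples X N s2 u'))"
            have R: "real (s' 35 e) - real (s' 36 e) = 2 ^ (J * t) * ?R e" if e: "e \<in> {1..<E}" for e
            proof -
              have P: "(\<Prod>u<t. 1 + ?l * chr (f e) (samples X N s2 u)) = (\<Prod>u<t. 1 + ?l * chr (f e) (samples X N s' u))"
              "(\<Prod>u<t. 1 - ?l * chr (f e) (samples X N s2 u)) = (\<Prod>u<t. 1 - ?l * chr (f e) (samples X N s' u))"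
                using smp smp2 by (auto intro!: prod.cong)
              show ?thesis using IT(4)[of e] IT(5)[of e] e by (simp add: P right_diff_distrib)
            qed
            have "(\<Sum>e\<in>{1..<E}. chr (f e) (samples X N s2 t) * (real (s' 35 e) - real (s' 36 e))) \<le> 0"
              using 3(1) unfolding smp2 st by blast
            also have "(\<Sum>e\<in>{1..<E}. chr (f e) (samples X N s2 t) * (real (s' 35 e) - real (s' 36 e)))
              = 2 ^ (J * t) * (\<Sum>e\<in>{1..<E}. chr (f e) (samples X N s2 t) * ?R e)"
              unfolding sum_distrib_left by (intro sum.cong refl) (simp add: R)
            finally have h: "2 ^ (J * t) * (\<Sum>e\<in>{1..<E}. chr (f e) (samples X N s2 t) * ?R e) \<le> 0" .
            have "(0::real) < 2 ^ (J * t)" by simp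
            from h mult_pos_pos[OF this] show ?thesis unfolding ut by (meson not_le)
          qed
          have b: "s2 X q \<le> 1" if "q < Suc t * N" for q
          proof (cases "q < t * N")
            case True then show ?thesis using 3(1) IT(2) s2X by simp
          next
            case False
            then have "q = t * N + (q - t * N)" "q - t * N < N" using that by auto
            then show ?thesis using 3(1) s2X by metis
          qed
          have z: "s2 37 0 = 0" using chi[OF E0] f0 unfolding s2X par_def chr_def by simp
          have p: "s2 46 0 = Suc t * N" using 3(1) s2X by simp
          show ?case by (rule runl_Nil) (use W G b z p in \<open>auto simp: I_def\<close>)
        qed (use f1' EH H in auto)
      qed simp
    qed
  qed (use s0 H X in \<open>auto simp: mods_simps\<close>)
  have fin: "almost {..<2 ^ (8 * K)} (samples X N s') {..<N} K ((1/2) ^ K) \<and> (\<forall>q<2 ^ (8 * K) * N. s' X q \<le> 1)"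
    if T: "tree N E f (tests N K) s0" and I': "I f s0 (2 ^ (8 * K)) s'" for f s0 s'
  proof
    have b: "bij_betw f {..<E} (tests N K)" and f0: "f 0 = {}" and E0: "0 < E" using T unfolding tree_def by blast+
    have E1: "{..<E} - {0} = {1..<E}" by auto
    have "bij_betw f ({..<E} - {0}) (tests N K - {f 0})"
      using b E0 by (intro bij_betw_DiffI) (auto simp: bij_betw_def)
    then have b1: "bij_betw f {1..<E} (tests N K - {{}})" unfolding E1 f0 .
    show "almost {..<2 ^ (8 * K)} (samples X N s') {..<N} K ((1/2) ^ K)"
    proof (rule greedy_almost[OF refl NK])
      fix t :: nat assume "t < 2 ^ (8 * K)"
      then have "(\<Sum>e\<in>{1..<E}. chr (f e) (samples X N s' t) *
        ((\<Prod>u'<t. 1 + ?l * chr (f e) (samples X N s' u')) - (\<Prod>u'<t. 1 - ?l * chr (f e) (samples X N s' u')))) \<le> 0"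
        using I' unfolding I_def by blast
      then show "(\<Sum>S\<in>tests N K - {{}}. chr S (samples X N s' t) * ((\<Prod>u<t. 1 + (1/2) ^ (K+2) * chr S (samples X N s' u)) - (\<Prod>u<t. 1 - (1/2) ^ (K+2) * chr S (samples X N s' u)))) \<le> 0"
        unfolding sum.reindex_bij_betw[OF b1, symmetric] J_def .
    qed
    show "\<forall>q<2 ^ (8 * K) * N. s' X q \<le> 1" using I' unfolding I_def by blast
  qed
  show ?thesis unfolding sampler_def
  proof ((intro vcg; (simp; fail)?), goal_cases)
    case 1
    show ?case
    proof (rule runs_use[OF build_correct[of _ N K H]], goal_cases)
      case (9 s1)
      then obtain f where T: "tree N E f (tests N K) s1" unfolding E_def by blast
      have f1: "s1 a = s a" if "a \<notin> {32, 33, 34, 38, 39, 40, 41}" for a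
        using 9(2)[of a] that by (simp add: mods_simps)
      show ?case
      proof (intro vcg, rule runs_use[OF runs_for[where d=3 and N=E and I="\<lambda>j s'. \<forall>e<j. s' 35 e = 1 \<and> s' 36 e = 1 \<and> s' 37 e = 0"]], goal_cases)
        case (10 j s')
        show ?case by ((intro vcg; (simp; fail)?), goal_cases) (use 10 in \<open>auto simp: less_Suc_eq\<close>)
      next
        case (12 s2)
        have f2: "s2 a = s1 a" if "a \<notin> {35, 36, 37, 41}" for a
          using 12(2)[of a] that by (simp add: mods_simps)
        let ?s = "s2(46 := (s2 46)(0 := aval (Num 0) s2))"
        have T2: "tree N E f (tests N K) ?s" by (rule tree_frame[OF T]) (use f2 in auto)
        have E0: "0 < E" using T unfolding tree_def by blast
        have r: "runs H 11 (For 42 (Sc 52) (seqs [For 40 (Sc 50) (bitstep X), reweigh])) ?s (I f ?s (2 ^ (8 * K)))"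
          by (rule main[OF T2]) (use f2 f1 s 12 E0 in auto)
        show ?case
        proof ((intro vcg; (simp; fail)?), goal_cases)
          case 1
          show ?case
          proof (rule runs_use[OF r], goal_cases)
            case (2 s3)
            show ?case by (rule runl_Nil) (rule fin[OF T2 2(1)])
          qed simp
        qed
      qed (use T EH in \<open>auto simp: mods_simps tree_def\<close>)
    qed (use s H in auto)
  qed
qed

section \<open>Parameters\<close>

text \<open>The contents of single cells, for programs that are symbolically executed.\<close>

definition vals :: "((nat \<times> nat) \<times> nat) list \<Rightarrow> state \<Rightarrow> bool" where
  "vals xs s \<longleftrightarrow> (\<forall>p\<in>set xs. s (fst (fst p)) (snd (fst p)) = snd p)"

lemma vals_simps: "vals [] s" "vals (((a, i), v) # xs) s \<longleftrightarrow> s a i = v \<and> vals xs s"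
  unfolding vals_def by auto

text \<open>Known contents of arrays outside \<open>mods c\<close> survive; the rest is replaced by
  what \<open>c\<close> establishes.\<close>

lemma runl_step:
  assumes xs: "vals xs s" and r: "vals xs s \<Longrightarrow> runs H d' c s (vals ys)" and d: "d' \<le> d"
    and cont: "\<And>s'. vals (ys @ filter (\<lambda>p. fst (fst p) \<notin> mods c) xs) s' \<Longrightarrow> runl H d cs s' Q"
  shows "runl H d (c # cs) s Q"
proof (rule runl_Cons, rule runs_use[OF r[OF xs] d])
  fix s' assume "vals ys s'" "\<And>a. a \<notin> mods c \<Longrightarrow> s' a = s a"
  then show "runl H d cs s' Q" using xs by (intro cont) (auto simp: vals_def)
qed

lemma runl_checkpoint:
  assumes "vals xs s" "vals xs s \<Longrightarrow> vals ys s" "vals ys s \<Longrightarrow> runl H d cs s Q"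
  shows "runl H d cs s Q"
  using assms by blast

section \<open>Logarithms, products and powers on a machine that can only add and subtract\<close>

definition clog :: "nat \<Rightarrow> nat" where "clog x = (LEAST k. x \<le> 2 ^ k)"

lemma clog_le: "x \<le> 2 ^ clog x"
  unfolding clog_def by (rule LeastI[of _ x]) (simp add: less_imp_le)

lemma clog_less: "clog x = 0 \<or> 2 ^ (clog x - 1) < x"
proof (cases "clog x")
  case (Suc k)
  then have "\<not> x \<le> 2 ^ k" using not_less_Least[of k "\<lambda>k. x \<le> 2 ^ k"] unfolding clog_def by simp
  then show ?thesis using Suc by simp
qed simp

text \<open>The number of rounds is \<open>bnd\<close>, more than needed, but known in advance;
  rounds in which \<open>p\<close> has reached the bound do nothing.\<close>

definition dbl :: "nat \<Rightarrow> nat \<Rightarrow> aexp \<Rightarrow> com" where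
  "dbl p l bnd = For 60 bnd (If (Monus bnd (Sc p)) (seqs [SetS p (Plus (Sc p) (Sc p)), SetS l (Plus (Sc l) (Num 1))]) Skip)"

text \<open>Repeated addition costs as many rounds as the factor \<open>cnt\<close>, which is
  affordable: every such factor is among the loop bounds.\<close>

definition addmul :: "nat \<Rightarrow> aexp \<Rightarrow> aexp \<Rightarrow> com" where
  "addmul z e cnt = seqs [SetS z (Num 0), For 60 cnt (SetS z (Plus (Sc z) e))]"

definition pow2 :: "nat \<Rightarrow> aexp \<Rightarrow> com" where
  "pow2 z cnt = seqs [SetS z (Num 1), For 60 cnt (SetS z (Plus (Sc z) (Sc z)))]"

lemma mods_dbl: "mods (dbl p l bnd) = {60, p, l}" unfolding dbl_def by (auto simp: mods_simps)
lemma mods_addmul: "mods (addmul z e cnt) = {60, z}" unfolding addmul_def by (auto simp: mods_simps)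
lemma mods_pow2: "mods (pow2 z cnt) = {60, z}" unfolding pow2_def by (auto simp: mods_simps)

lemmas mods_simps2 = mods_simps mods_dbl mods_addmul mods_pow2

text \<open>The start \<open>a\<close> is free: \<open>a = 1\<close> yields \<open>clog\<close>,
  while \<open>a = r\<close> yields the number of bits of a bucket index without any
  division.\<close>

lemma runs_dbl:
  assumes "aval bnd s = N" "N \<le> H" "s p 0 = a" "s l 0 = b" "0 < a" "p \<noteq> l" "p \<noteq> 60" "l \<noteq> 60"
    "{p, l, 60} \<inter> reads bnd = {}" "acost bnd \<le> 20"
    and k: "N \<le> a * 2 ^ k" "k = 0 \<or> a * 2 ^ (k - 1) < N"
  shows "runs H 5 (dbl p l bnd) s (vals [((p, 0), a * 2 ^ k), ((l, 0), b + k)])"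
  unfolding dbl_def
proof (rule runs_use[OF runs_for[where d=5 and N=N and I="\<lambda>i s'. s' p 0 = a * 2 ^ min i k \<and> s' l 0 = b + min i k"]], goal_cases)
  case (10 i s')
  have av: "aval bnd s' = N"
  proof -
    have "aval bnd s' = aval bnd s"
      by (rule aval_frame, rule 10(4)) (use assms(9) in \<open>auto simp: mods_simps\<close>)
    then show ?thesis using assms(1) by simp
  qed
  have c: "N \<le> a * 2 ^ min i k \<longleftrightarrow> k \<le> i"
  proof
    assume h: "N \<le> a * 2 ^ min i k"
    show "k \<le> i"
    proof (rule ccontr)
      assume "\<not> k \<le> i"
      then have "min i k \<le> k - 1" "k \<noteq> 0" by auto
      then have "a * 2 ^ min i k \<le> a * 2 ^ (k - 1)" by (intro mult_left_mono power_increasing) auto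
      then show False using h k(2) \<open>k \<noteq> 0\<close> by linarith
    qed
  next
    assume "k \<le> i" then show "N \<le> a * 2 ^ min i k" using k(1) by (simp add: min_absorb2)
  qed
  show ?case
  proof ((intro vcg; (simp; fail)?), goal_cases)
    case 1
    then show ?case using assms(10) by simp
  next
    case 2
    then have "\<not> k \<le> i" using c av 10(2) by auto
    then have "min (Suc i) k = Suc (min i k)" by simp
    then show ?case using 10(2) assms(6) by simp
  next
    case 3
    then have "k \<le> i" using c av 10(2) by simp
    then have "min (Suc i) k = min i k" by simp
    then show ?case using 10(2) by simp
  qed
next
  case (12 s')
  have "min N k = k"
  proof (cases "k = 0")
    case False
    have "k - 1 < 2 ^ (k - 1)" by simp
    also have "\<dots> \<le> a * 2 ^ (k - 1)" using assms(5) by simp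
    also have "\<dots> < N" using k(2) False by simp
    finally show ?thesis by simp
  qed simp
  then show ?case using 12 by (simp add: vals_simps)
qed (use assms in \<open>auto simp: mods_simps\<close>)

lemma runs_clog:
  assumes "aval bnd s = N" "N \<le> H" "s p 0 = 1" "s l 0 = b" "p \<noteq> l" "p \<noteq> 60" "l \<noteq> 60"
    "{p, l, 60} \<inter> reads bnd = {}" "acost bnd \<le> 20"
  shows "runs H 5 (dbl p l bnd) s (vals [((p, 0), 2 ^ clog N), ((l, 0), b + clog N)])"
  using runs_dbl[of bnd s N H p 1 l b "clog N"] assms clog_le clog_less by simp

lemma runs_addmul:
  assumes "aval cnt s = N" "N \<le> H" "aval e s = x" "z \<noteq> 60" "z \<notin> reads cnt" "60 \<notin> reads cnt"
    "z \<notin> reads e" "60 \<notin> reads e" "acost cnt \<le> 20" "acost e \<le> 20"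
  shows "runs H 5 (addmul z e cnt) s (vals [((z, 0), N * x)])"
  unfolding addmul_def
proof ((intro vcg; (simp; fail)?), goal_cases)
  case 1
  let ?s = "s(z := (s z)(0 := aval (Num 0) s))"
  show ?case
  proof (rule runs_use[OF runs_for[where d=4 and N=N and s="?s" and I="\<lambda>i s'. s' z 0 = i * x"]], goal_cases)
    case 2 show ?case using assms(1,5) by (subst aval_frame[of cnt _ s]) auto
  next
    case (10 i s')
    have "aval e s' = aval e ?s" by (rule aval_frame, rule 10(4)) (use assms(7,8) in \<open>auto simp: mods_simps\<close>)
    also have "\<dots> = aval e s" by (rule aval_frame) (use assms(7) in auto)
    finally have "aval e s' = x" using assms(3) by simp
    then show ?case using 10 assms(10) by (intro runs_sets) auto
  next
    case (12 s') then show ?case by (auto intro: runl_Nil simp: vals_simps)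
  qed (use assms in \<open>auto simp: mods_simps\<close>)
qed

lemma runs_pow2:
  assumes "aval cnt s = N" "N \<le> H" "z \<noteq> 60" "z \<notin> reads cnt" "60 \<notin> reads cnt" "acost cnt \<le> 20"
  shows "runs H 5 (pow2 z cnt) s (vals [((z, 0), 2 ^ N)])"
  unfolding pow2_def
proof ((intro vcg; (simp; fail)?), goal_cases)
  case 1
  let ?s = "s(z := (s z)(0 := aval (Num 1) s))"
  show ?case
  proof (rule runs_use[OF runs_for[where d=4 and N=N and s="?s" and I="\<lambda>i s'. s' z 0 = 2 ^ i"]], goal_cases)
    case 2 show ?case using assms(1,4) by (subst aval_frame[of cnt _ s]) auto
  next
    case (10 i s') then show ?case by (intro runs_sets) auto
  next
    case (12 s') then show ?case by (auto intro: runl_Nil simp: vals_simps)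
  qed (use assms in \<open>auto simp: mods_simps\<close>)
qed

lemma runs_setv:
  assumes "aval e s = x" "acost e \<le> 48"
  shows "runs H 1 (SetS a e) s (vals [((a, 0), x)])"
  by (rule runs_sets) (use assms in \<open>auto simp: vals_simps\<close>)

text \<open>The threshold for narrow terms is \<open>2 ^ pG\<close>, the number of variables that a term may have in a
  bucket is \<open>pR\<close>, and the number of buckets is \<open>2 ^ pC\<close>, where the truncated subtraction gives a
  single bucket if \<open>pR\<close> exceeds \<open>8 * 2 ^ pG\<close>. There are \<open>pJ\<close> stages with two samples each, hence
  \<open>pTot\<close> seeds for the stages; the index 1 belongs to the sample space used for the stages and for
  the first hash function, the index 2 to the one for the second hash function.\<close>

definition pLam :: "nat \<Rightarrow> nat \<Rightarrow> nat \<Rightarrow> nat" where "pLam n m e = e + clog n + clog m"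
definition pG :: "nat \<Rightarrow> nat \<Rightarrow> nat \<Rightarrow> nat" where "pG n m e = clog (pLam n m e)"
definition pRho :: "nat \<Rightarrow> nat \<Rightarrow> nat \<Rightarrow> nat" where "pRho n m e = clog (4 * pG n m e + 2 * e + 128)"
definition pR :: "nat \<Rightarrow> nat \<Rightarrow> nat \<Rightarrow> nat" where "pR n m e = 2 ^ pRho n m e"
definition pC :: "nat \<Rightarrow> nat \<Rightarrow> nat \<Rightarrow> nat" where "pC n m e = pG n m e + 3 - pRho n m e"
definition pK1 :: "nat \<Rightarrow> nat \<Rightarrow> nat \<Rightarrow> nat" where "pK1 n m e = pR n m e * (pRho n m e + 5)"
definition pN1 :: "nat \<Rightarrow> nat \<Rightarrow> nat \<Rightarrow> nat" where "pN1 n m e = n * (pR n m e + 5)"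
definition pK2 :: "nat \<Rightarrow> nat \<Rightarrow> nat \<Rightarrow> nat" where "pK2 n m e = pR n m e * pC n m e"
definition pN2 :: "nat \<Rightarrow> nat \<Rightarrow> nat \<Rightarrow> nat" where "pN2 n m e = 2 ^ pR n m e * pC n m e"
definition pJ :: "nat \<Rightarrow> nat \<Rightarrow> nat \<Rightarrow> nat" where "pJ n m e = 2 ^ pC n m e * (pRho n m e + 1) * (256 * pR n m e)"
definition pTot :: "nat \<Rightarrow> nat \<Rightarrow> nat \<Rightarrow> nat" where "pTot n m e = (2 ^ (8 * pK1 n m e)) ^ (2 * pJ n m e)"

text \<open>Upper bounds for the numbers of rounds in the program, from which one common bound
  \<open>H\<close> is formed. The sum is a simple upper bound of all of them.\<close>

definition loop_bounds :: "nat \<Rightarrow> nat \<Rightarrow> nat \<Rightarrow> nat list" where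
  "loop_bounds n m e = [n, m, e, pLam n m e, 4 * pG n m e + 2 * e + 128, 8 * 2 ^ pG n m e, pRho n m e + 6, pR n m e + 5,
     8 * pK1 n m e, 2 ^ (8 * pK1 n m e), pN1 n m e, (pN1 n m e + 1) ^ pK1 n m e, pC n m e, 2 ^ pC n m e,
     8 * pK2 n m e, 2 ^ (8 * pK2 n m e), pN2 n m e, (pN2 n m e + 1) ^ pK2 n m e, 2 ^ pR n m e,
     256 * pR n m e, m * (2 * n + 1), pTot n m e, pK1 n m e + 2, pK2 n m e + 2]"

definition pH :: "nat \<Rightarrow> nat \<Rightarrow> nat \<Rightarrow> nat" where
  "pH n m e = sum_list (loop_bounds n m e)"

text \<open>The position of the leading digit of \<epsilon> plus one is the accuracy exponent
  \<open>e\<close>, so that \<open>(1/2) ^ e \<le> \<epsilon>\<close>. Array 11 starts with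
  \<open>e\<close> and passes through both doubling loops, which turns it into
  \<open>e + clog n + clog m\<close>.\<close>

definition params :: com where
  "params = seqs [
     SetS 10 (Num 0),
     While (Monus (Num 1) (Cell 2 (Sc 10))) (SetS 10 (Plus (Sc 10) (Num 1))),
     SetS 10 (Plus (Sc 10) (Num 1)),
     SetS 11 (Sc 10), SetS 12 (Num 1), dbl 12 11 (Sc 0),
     SetS 12 (Num 1), dbl 12 11 (Cell 0 (Num 1)),
     SetS 14 (Num 1), SetS 13 (Num 0), dbl 14 13 (Sc 11),
     SetS 12 (Plus (Plus (Plus (Sc 13) (Sc 13)) (Plus (Sc 13) (Sc 13))) (Plus (Plus (Sc 10) (Sc 10)) (Num 128))),
     SetS 16 (Num 1), SetS 15 (Num 0), dbl 16 15 (Sc 12),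
     SetS 12 (Plus (Plus (Plus (Sc 14) (Sc 14)) (Plus (Sc 14) (Sc 14))) (Plus (Plus (Sc 14) (Sc 14)) (Plus (Sc 14) (Sc 14)))),
     SetS 18 (Sc 16), SetS 17 (Num 0), dbl 18 17 (Sc 12),
     pow2 19 (Sc 17),
     addmul 20 (Plus (Sc 15) (Num 5)) (Sc 16),
     addmul 21 (Plus (Sc 16) (Num 5)) (Sc 0),
     addmul 12 (Sc 20) (Num 8), pow2 22 (Sc 12),
     addmul 23 (Sc 17) (Sc 16),
     pow2 24 (Sc 16),
     addmul 25 (Sc 17) (Sc 24),
     addmul 12 (Sc 23) (Num 8), pow2 26 (Sc 12),
     addmul 27 (Plus (Plus (Sc 0) (Sc 0)) (Num 1)) (Cell 0 (Num 1)),
     addmul 28 (Sc 16) (Num 256)]"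

lemma mods_params: "mods params = {10, 11, 12, 13, 14, 15, 16, 17, 18, 19, 20, 21, 22, 23, 24, 25, 26, 27, 28, 60}"
  unfolding params_def by (auto simp: mods_simps2)

definition pvals :: "nat \<Rightarrow> nat \<Rightarrow> nat \<Rightarrow> ((nat \<times> nat) \<times> nat) list" where
  "pvals n m e = [((0,0), n), ((0,1), m), ((15,0), pRho n m e), ((16,0), pR n m e), ((17,0), pC n m e), ((19,0), 2 ^ pC n m e),
     ((20,0), pK1 n m e), ((21,0), pN1 n m e), ((22,0), 2 ^ (8 * pK1 n m e)), ((23,0), pK2 n m e), ((25,0), pN2 n m e),
     ((26,0), 2 ^ (8 * pK2 n m e)), ((27,0), m * (2 * n + 1)), ((28,0), 256 * pR n m e)]"

text \<open>\<open>pC\<close> is the least \<open>c\<close> with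
  \<open>8 * 2 ^ g \<le> r * 2 ^ c\<close>, the number found by doubling. Both sides are powers of
  two, so it is the truncated difference of their exponents.\<close>

lemma pC_prop:
  "8 * 2 ^ pG n m e \<le> pR n m e * 2 ^ pC n m e"
  "pC n m e = 0 \<or> pR n m e * 2 ^ (pC n m e - 1) < 8 * 2 ^ pG n m e"
proof -
  let ?a = "pRho n m e" and ?g = "pG n m e"
  have 8: "8 * 2 ^ ?g = (2::nat) ^ (?g + 3)" by (simp add: power_add)
  have 1: "pR n m e * 2 ^ j = 2 ^ (?a + j)" for j unfolding pR_def by (simp add: power_add)
  show "8 * 2 ^ ?g \<le> pR n m e * 2 ^ pC n m e" unfolding 8 1 pC_def by (intro power_increasing) auto
  show "pC n m e = 0 \<or> pR n m e * 2 ^ (pC n m e - 1) < 8 * 2 ^ ?g"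
  proof (cases "pC n m e = 0")
    case False
    then have "?a + (pC n m e - 1) < ?g + 3" unfolding pC_def by simp
    then show ?thesis unfolding 8 1 by simp
  qed simp
qed

lemma params_correct:
  assumes s: "s 0 0 = n" "s 0 1 = m" and e: "\<And>i. i < e \<Longrightarrow> s 2 i = 0" "s 2 e = 1" and H: "pH n m (Suc e) \<le> H"
  shows "runs H 8 params s (vals (pvals n m (Suc e)))"
proof -
  let ?e = "Suc e"
  have B: "x \<le> H" if "x \<in> set (loop_bounds n m ?e)" for x
    by (rule order_trans[OF _ H[unfolded pH_def]], rule member_le_sum_list[OF that], simp)
  have r1: "1 \<le> pR n m ?e" unfolding pR_def by simp
  have Hs: "n \<le> H" "m \<le> H" "?e \<le> H" "pLam n m ?e \<le> H" "4 * pG n m ?e + 2 * ?e + 128 \<le> H" "8 * 2 ^ pG n m ?e \<le> H"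
    "8 * pK1 n m ?e \<le> H" "pC n m ?e \<le> H" "8 * pK2 n m ?e \<le> H" "2 ^ pR n m ?e \<le> H" "256 * pR n m ?e \<le> H"
    by (intro B; simp add: loop_bounds_def)+
  have Hr: "pR n m ?e \<le> H" "256 \<le> H" "8 \<le> H" using Hs(11) r1 by simp_all
  define lam where "lam = pLam n m ?e"
  define g where "g = pG n m ?e"
  define rho where "rho = pRho n m ?e"
  define r where "r = pR n m ?e"
  define c where "c = pC n m ?e"
  note dfs = lam_def g_def rho_def r_def c_def
  have pcp: "8 * 2 ^ g \<le> r * 2 ^ c" "c = 0 \<or> r * 2 ^ (c - 1) < 8 * 2 ^ g"
    unfolding dfs using pC_prop[of n m ?e] by auto
  have r0: "0 < r" unfolding dfs pR_def by simp
  have eqs: "?e + clog n + clog m = lam" "clog lam = g" "clog (4 * g + 2 * ?e + 128) = rho" "2 ^ rho = r"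
    unfolding dfs pLam_def pG_def pRho_def pR_def by simp_all
  have cl: "clog (pLam n m ?e) = g" "pLam n m ?e = lam" "pG n m ?e = g" "pRho n m ?e = rho" "pR n m ?e = r" "pC n m ?e = c"
    "pK1 n m ?e = r * (rho + 5)" "pN1 n m ?e = n * (r + 5)" "pK2 n m ?e = r * c" "pN2 n m ?e = 2 ^ r * c"
    unfolding dfs pG_def pK1_def pN1_def pK2_def pN2_def by simp_all
  note Hb = Hs[unfolded cl] Hr[unfolded cl]
  define tm where "tm = 4 * g + 2 * ?e + 128"
  have tmf: "tm \<le> H" "clog tm = rho" unfolding tm_def using Hb(5) eqs(3) by simp_all
  note V = vals_simps mods_simps2 Hb eqs(1,2,4) eqs(1)[simplified] tmf(2) pcp pcp(2)[simplified] r0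
  show ?thesis unfolding params_def
    apply (rule runs_seqs, simp, simp)
    apply (rule runl_Cons, rule runs_sets)
      apply (rule runl_Cons, rule runs_use[OF runs_find[where N=e]])
    subgoal by (simp add: e)
    subgoal by (simp add: e)
    subgoal by simp
    subgoal by simp
    subgoal using Hs by simp
    subgoal by simp
    subgoal for s1
      apply (rule runl_step[where xs="[((0,0),n),((0,1),m),((10,0),e)]"])
        apply (simp add: s s(2)[simplified] vals_simps)
       apply (rule runs_setv[where x="?e"]; simp add: vals_simps)
       apply simp
      apply (erule runl_step, (rule runs_setv[where x="?e"]; simp add: V), simp)
      apply (erule runl_step, (rule runs_setv[where x="1"]; simp add: V), simp)
      apply (erule runl_step, (rule runs_clog[where N="n" and b="?e"]; simp add: V), simp)
      apply (erule runl_step, (rule runs_setv[where x="1"]; simp add: V), simp)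
      apply (erule runl_step, (rule runs_clog[where N="m" and b="?e + clog n"]; simp add: V), simp)
      apply (erule runl_checkpoint[where ys="[((0,0),n),((0,1),m),((10,0),?e),((11,0),lam)]"], simp add: V)
      apply (erule runl_step, (rule runs_setv[where x="1"]; simp add: V), simp)
      apply (erule runl_step, (rule runs_setv[where x="0"]; simp add: V), simp)
      apply (erule runl_step, (rule runs_clog[where N="lam" and b="0"]; simp add: V), simp)
      apply (erule runl_checkpoint[where ys="[((0,0),n),((0,1),m),((10,0),?e),((13,0),g),((14,0),2 ^ g)]"], simp add: V)
      apply (erule runl_step, (rule runs_setv[where x=tm]; simp add: V tm_def), simp)
      apply (erule runl_step, (rule runs_setv[where x="1"]; simp add: V), simp)
      apply (erule runl_step, (rule runs_setv[where x="0"]; simp add: V), simp)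
      apply (erule runl_step, (rule runs_clog[where N=tm and b=0]; simp add: V tmf), simp)
      apply (erule runl_checkpoint[where ys="[((0,0),n),((0,1),m),((14,0),2 ^ g),((15,0),rho),((16,0),r)]"], simp add: V)
      apply (erule runl_step, (rule runs_setv[where x="8 * 2 ^ g"]; simp add: V), simp)
      apply (erule runl_step, (rule runs_setv[where x="r"]; simp add: V), simp)
      apply (erule runl_step, (rule runs_setv[where x="0"]; simp add: V), simp)
      apply (erule runl_step, (rule runs_dbl[where N="8 * 2 ^ g" and a=r and b=0 and k=c]; simp add: V), simp)
      apply (erule runl_checkpoint[where ys="[((0,0),n),((0,1),m),((15,0),rho),((16,0),r),((17,0),c)]"], simp add: V)
      apply (erule runl_step, (rule runs_pow2[where N=c]; simp add: V), simp)
      apply (erule runl_step, (rule runs_addmul[where N=r and x="rho + 5"]; simp add: V), simp)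
      apply (erule runl_checkpoint[where ys="[((0,0),n),((0,1),m),((15,0),rho),((16,0),r),((17,0),c),((19,0),2 ^ c),((20,0),r * (rho + 5))]"], simp add: V)
      apply (erule runl_step, (rule runs_addmul[where N=n and x="r + 5"]; simp add: V), simp)
      apply (erule runl_step, (rule runs_addmul[where N=8 and x="r * (rho + 5)"]; simp add: V), simp)
      apply (erule runl_step, (rule runs_pow2[where N="8 * (r * (rho + 5))"]; simp add: V), simp)
      apply (erule runl_checkpoint[where ys="[((0,0),n),((0,1),m),((15,0),rho),((16,0),r),((17,0),c),((19,0),2 ^ c),((20,0),r * (rho + 5)),((21,0),n * (r + 5)),((22,0),2 ^ (8 * (r * (rho + 5))))]"], simp add: V)
      apply (erule runl_step, (rule runs_addmul[where N=r and x=c]; simp add: V), simp)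
      apply (erule runl_step, (rule runs_pow2[where N=r]; simp add: V), simp)
      apply (erule runl_step, (rule runs_addmul[where N="2 ^ r" and x=c]; simp add: V), simp)
      apply (erule runl_checkpoint[where ys="[((0,0),n),((0,1),m),((15,0),rho),((16,0),r),((17,0),c),((19,0),2 ^ c),((20,0),r * (rho + 5)),((21,0),n * (r + 5)),((22,0),2 ^ (8 * (r * (rho + 5)))),((23,0),r * c),((25,0),2 ^ r * c)]"], simp add: V)
      apply (erule runl_step, (rule runs_addmul[where N=8 and x="r * c"]; simp add: V), simp)
      apply (erule runl_step, (rule runs_pow2[where N="8 * (r * c)"]; simp add: V), simp)
      apply (erule runl_step, (rule runs_addmul[where N=m and x="2 * n + 1"]; simp add: V), simp)
      apply (erule runl_step, (rule runs_addmul[where N=256 and x=r]; simp add: V), simp)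
      apply (rule runl_Nil)
      apply (simp add: V pvals_def cl)
      done
    subgoal by simp
    subgoal by simp
    done
qed

section \<open>Running the procedure on one seed\<close>

lemma dnf_code_split:
  assumes "j < length f"
  shows "dnf_code f = dnf_code (take j f) @ (map lit_code (f ! j) @ [0]) @ dnf_code (drop (Suc j) f)"
proof -
  have "f = take j f @ [f ! j] @ drop (Suc j) f" using id_take_nth_drop[OF assms] by simp
  then have "dnf_code f = dnf_code (take j f @ [f ! j] @ drop (Suc j) f)" by simp
  then show ?thesis unfolding dnf_code_def by simp
qed

definition off :: "dnf \<Rightarrow> nat \<Rightarrow> nat" where "off f j = length (dnf_code (take j f))"

lemma off_0: "off f 0 = 0" unfolding off_def dnf_code_def by simp

lemma off_Suc: "j < length f \<Longrightarrow> off f (Suc j) = off f j + length (f ! j) + 1"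
  unfolding off_def dnf_code_def by (simp add: take_Suc_conv_app_nth)

lemma off_length: "off f (length f) = length (dnf_code f)" unfolding off_def by simp

lemma code_at:
  assumes "j < length f" "k \<le> length (f ! j)"
  shows "off f j + k < length (dnf_code f)"
    "k < length (f ! j) \<Longrightarrow> dnf_code f ! (off f j + k) = lit_code (f ! j ! k)"
    "k = length (f ! j) \<Longrightarrow> dnf_code f ! (off f j + k) = 0"
  unfolding off_def by (subst (1) dnf_code_split[OF assms(1)], use assms(2) in \<open>auto simp: nth_append\<close>)+

lemma lit_code_pos: "lit_code l \<noteq> 0" by (cases l) auto

definition scan :: "com \<Rightarrow> com \<Rightarrow> com" where
  "scan cl ce = For 89 (Sc 27) (If (Cell 1 (Sc 89)) cl ce)"

lemma mods_scan: "mods (scan cl ce) = insert 89 (mods cl \<union> mods ce)"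
  unfolding scan_def by (simp add: mods_For)

text \<open>\<open>A j k\<close> means that \<open>j\<close> terms and \<open>k\<close> literals of
  the next one have been read. The program knows only the bound \<open>P\<close> on the length of
  the code; the cells after the code contain 0 and look like further end markers, which is why
  \<open>tail\<close> is required.\<close>

lemma runs_scan:
  assumes d: "1 < d"
    and code: "\<And>p. s 1 p = (if p < length (dnf_code f) then dnf_code f ! p else 0)"
    and P: "s 27 0 = P" "length (dnf_code f) \<le> P" "P \<le> H"
    and m: "{1, 27, 89} \<inter> (mods cl \<union> mods ce) = {}"
    and A0: "A 0 0 s"
    and Av: "\<And>j k s' x. A j k s' \<Longrightarrow> A j k (s'(89 := x))"
    and lit: "\<And>j k s'. j < length f \<Longrightarrow> k < length (f ! j) \<Longrightarrow> A j k s' \<Longrightarrow> s' 1 (s' 89 0) = lit_code (f ! j ! k) \<Longrightarrow>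
      (\<And>a. a \<notin> mods cl \<union> mods ce \<Longrightarrow> a \<noteq> 89 \<Longrightarrow> s' a = s a) \<Longrightarrow> runs H (d - 2) cl s' (A j (Suc k))"
    and en: "\<And>j s'. j < length f \<Longrightarrow> A j (length (f ! j)) s' \<Longrightarrow>
      (\<And>a. a \<notin> mods cl \<union> mods ce \<Longrightarrow> a \<noteq> 89 \<Longrightarrow> s' a = s a) \<Longrightarrow> runs H (d - 2) ce s' (A (Suc j) 0)"
    and tail: "\<And>s'. A (length f) 0 s' \<Longrightarrow>
      (\<And>a. a \<notin> mods cl \<union> mods ce \<Longrightarrow> a \<noteq> 89 \<Longrightarrow> s' a = s a) \<Longrightarrow> runs H (d - 2) ce s' (A (length f) 0)"
  shows "runs H d (scan cl ce) s (A (length f) 0)"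
proof -
  define I where "I = (\<lambda>p s'. (\<exists>j k. j < length f \<and> k \<le> length (f ! j) \<and> p = off f j + k \<and> A j k s') \<or>
    (length (dnf_code f) \<le> p \<and> A (length f) 0 s'))"
  have next0: "I (off f j) s'" if "j \<le> length f" "A j 0 s'" for j s'
  proof (cases "j = length f")
    case True then show ?thesis using that unfolding I_def off_length[symmetric] by auto
  next
    case False
    then show ?thesis using that unfolding I_def by (intro disjI1 exI[of _ j] exI[of _ 0]) auto
  qed
  show ?thesis unfolding scan_def
  proof (rule runs_use[OF runs_for[where I=I and N=P and d=d]], goal_cases)
    case 8 show ?case using next0[of 0 s] A0 off_0 by simp
  next
    case (9 p s' x) then show ?case unfolding I_def using Av by blast
  next
    case (10 p s')
    have s1: "s' 1 = s 1" using 10(4)[of 1] m by auto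
    have fr: "s' a = s a" if "a \<notin> mods cl \<union> mods ce" "a \<noteq> 89" for a using 10(4)[of a] that by auto
    consider j k where "j < length f" "k < length (f ! j)" "p = off f j + k" "A j k s'"
      | j where "j < length f" "p = off f j + length (f ! j)" "A j (length (f ! j)) s'"
      | "length (dnf_code f) \<le> p" "A (length f) 0 s'"
      using 10(2) unfolding I_def by (metis le_neq_implies_less)
    then show ?case
    proof cases
      case 1
      have c: "s' 1 p = lit_code (f ! j ! k)" using code_at[OF 1(1), of k] 1 code[of p] s1 by simp
      show ?thesis
      proof (rule runs_if)
        show "runs H (d - 1 - 1) cl s' (I (Suc p))"
        proof (rule runs_use[OF lit[OF 1(1,2,4) _ fr]])
          show "s' 1 (s' 89 0) = lit_code (f ! j ! k)" using c 10(3) by simp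
          fix s'' assume "A j (Suc k) s''"
          then show "I (Suc p) s''" unfolding I_def using 1 by (intro disjI1 exI[of _ j] exI[of _ "Suc k"]) auto
        qed (use d in auto)
      qed (use c 10(3) lit_code_pos d in auto)
    next
      case 2
      have c: "s' 1 p = 0" using code_at[OF 2(1), of "length (f ! j)"] 2 code[of p] s1 by simp
      show ?thesis
      proof (rule runs_if)
        show "runs H (d - 1 - 1) ce s' (I (Suc p))"
        proof (rule runs_use[OF en[OF 2(1,3) fr]])
          fix s'' assume "A (Suc j) 0 s''"
          then have "I (off f (Suc j)) s''" using 2(1) by (intro next0) auto
          then show "I (Suc p) s''" using off_Suc[OF 2(1)] 2(2) by simp
        qed (use d in auto)
      qed (use c 10(3) d in auto)
    next
      case 3
      have c: "s' 1 p = 0" using 3 code[of p] s1 by simp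
      show ?thesis
      proof (rule runs_if)
        show "runs H (d - 1 - 1) ce s' (I (Suc p))"
        proof (rule runs_use[OF tail[OF 3(2) fr]])
          fix s'' assume "A (length f) 0 s''"
          then show "I (Suc p) s''" unfolding I_def using 3 by auto
        qed (use d in auto)
      qed (use c 10(3) d in auto)
    qed
  next
    case (12 s')
    have "\<not> (j < length f \<and> k \<le> length (f ! j) \<and> P = off f j + k)" for j k
      using code_at(1)[of j f k] P(2) by auto
    then show ?case using 12(1) unfolding I_def by blast
  qed (use d P m in \<open>auto simp: mods_simps\<close>)
qed

fun pol :: "literal \<Rightarrow> nat" where
  "pol (Pos i) = 1"
| "pol (Neg i) = 0"

definition inputs :: "nat \<Rightarrow> dnf \<Rightarrow> state \<Rightarrow> bool" where
  "inputs n f s \<longleftrightarrow> s 0 0 = n \<and> s 0 1 = length f \<and> s 27 0 = length f * (2 * n + 1) \<and>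
     (\<forall>p. s 1 p = (if p < length (dnf_code f) then dnf_code f ! p else 0)) \<and>
     (\<forall>l. lit_var l < n \<longrightarrow> s 70 (lit_code l) = lit_var l \<and> s 71 (lit_code l) = pol l)"

lemma inputs_frame: "inputs n f s \<Longrightarrow> (\<And>a. a \<in> {0, 1, 27, 70, 71} \<Longrightarrow> s' a = s a) \<Longrightarrow> inputs n f s'"
  unfolding inputs_def by simp

lemma code_length:
  assumes "is_dnf n f"
  shows "length (dnf_code f) \<le> length f * (2 * n + 1)"
proof -
  have "length T \<le> 2 * n" if T: "T \<in> set f" for T
  proof -
    have "distinct T" "set T \<subseteq> Pos ` {..<n} \<union> Neg ` {..<n}"
    proof -
      show "distinct T" using assms T unfolding is_dnf_def by blast
      show "set T \<subseteq> Pos ` {..<n} \<union> Neg ` {..<n}"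
      proof
        fix l assume "l \<in> set T"
        then have "lit_var l < n" using assms T unfolding is_dnf_def by blast
        then show "l \<in> Pos ` {..<n} \<union> Neg ` {..<n}" by (cases l) auto
      qed
    qed
    then have "length T \<le> card (Pos ` {..<n} \<union> Neg ` {..<n})"
      using card_mono[of "Pos ` {..<n} \<union> Neg ` {..<n}" "set T"] distinct_card[of T] by simp
    also have "\<dots> \<le> card (Pos ` {..<n}) + card (Neg ` {..<n})" by (rule card_Un_le)
    also have "\<dots> \<le> n + n" using card_image_le[of "{..<n}" Pos] card_image_le[of "{..<n}" Neg] by simp
    finally show ?thesis by simp
  qed
  then show ?thesis
  proof (induction f)
    case (Cons T f)
    have "length (dnf_code (T # f)) = length T + 1 + length (dnf_code f)" unfolding dnf_code_def by simp
    also have "\<dots> \<le> 2 * n + 1 + length f * (2 * n + 1)" using Cons by (intro add_mono) auto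
    finally show ?case by simp
  qed (simp add: dnf_code_def)
qed

text \<open>Array 72 contains the bucket of a variable, 73 whether it is assigned, 74 its value, 75 whether a
  term is dropped; 84 is the current bucket, and 100 is the width bound. Arrays 70 and 71 decode
  literals.\<close>

definition narrowC :: com where
  "narrowC = seqs [SetS 98 (Num 0), SetS 99 (Num 0),
     scan (If (Cell 73 (Cell 70 (Cell 1 (Sc 89)))) Skip
            (If (neq (Cell 72 (Cell 70 (Cell 1 (Sc 89)))) (Sc 84)) Skip (SetS 99 (Plus (Sc 99) (Num 1)))))
          (seqs [If (Monus (Sc 99) (Sc 100)) (Assign 75 (Sc 98) (Num 1)) Skip,
                 SetS 98 (Plus (Sc 98) (Num 1)), SetS 99 (Num 0)])]"

lemma mods_narrowC: "mods narrowC = {75, 89, 98, 99}"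
  unfolding narrowC_def by (auto simp: mods_simps mods_scan)

text \<open>The machine counts literals. For a consistent term this is the number of free variables;
  for a contradictory one it may be larger, which is harmless because such a term is never
  satisfied.\<close>

definition free_lits :: "state \<Rightarrow> nat \<Rightarrow> literal list \<Rightarrow> nat" where
  "free_lits s \<beta> T = length (filter (\<lambda>l. s 73 (lit_var l) = 0 \<and> s 72 (lit_var l) = \<beta>) T)"

lemma narrowC_correct:
  assumes inp: "inputs n f s" "is_dnf n f" and H: "length f * (2 * n + 1) \<le> H" and b: "s 84 0 = \<beta>" "s 100 0 = w"
  shows "runs H 6 narrowC s (\<lambda>s'. \<forall>j. s' 75 j = (if j < length f \<and> w < free_lits s \<beta> (f ! j) then 1 else s 75 j))"
proof -
  \<comment> \<open>After the last term 98 is no longer controlled, but 99 stays 0, so no further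
    term is marked.\<close>
  define A where "A = (\<lambda>j k (s' :: state). (\<forall>j'. s' 75 j' = (if j' < j \<and> w < free_lits s \<beta> (f ! j') then 1 else s 75 j')) \<and>
      (if j < length f then s' 98 0 = j \<and> s' 99 0 = free_lits s \<beta> (take k (f ! j)) else s' 99 0 = 0))"
  show ?thesis unfolding narrowC_def
  proof ((intro vcg; (simp; fail)?), goal_cases)
    case 1
    let ?s = "(\<lambda>s. s(99 := (s 99)(0 := aval (Num 0) s))) (s(98 := (s 98)(0 := aval (Num 0) s)))"
    have inp': "inputs n f ?s" by (rule inputs_frame[OF inp(1)]) auto
    show ?case
    proof (rule runs_use[OF runs_scan[where f=f and P="length f * (2 * n + 1)" and A=A and s="?s" and d=5]], goal_cases)
      case 2 then show ?case using inp' unfolding inputs_def by blast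
    next
      case 3 show ?case using inp' unfolding inputs_def by blast
    next
      case 4 show ?case by (rule code_length[OF inp(2)])
    next
      case 7 show ?case unfolding A_def by (simp add: free_lits_def)
    next
      case 8 then show ?case unfolding A_def by simp
    next
      case (9 j k s')
      have fr: "s' a = s a" if "a \<in> {70, 72, 73, 84, 100}" for a
        using 9(5)[of a] that by (auto simp: mods_simps)
      let ?l = "f ! j ! k"
      have l: "lit_var ?l < n" using inp(2) 9(1,2) unfolding is_dnf_def by (metis nth_mem)
      have t: "s' 70 (s' 1 (s' 89 0)) = lit_var ?l" using 9(4) fr[of 70] l inp(1) unfolding inputs_def by simp
      have tk: "take (Suc k) (f ! j) = take k (f ! j) @ [?l]" using 9(2) by (rule take_Suc_conv_app_nth)
      have f1: "free_lits s \<beta> (take (Suc k) (f ! j)) = free_lits s \<beta> (take k (f ! j)) + (if s 73 (lit_var ?l) = 0 \<and> s 72 (lit_var ?l) = \<beta> then 1 else 0)"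
        unfolding tk free_lits_def by simp
      show ?case
        by ((intro vcg; (simp; fail)?), goal_cases)
          (use 9(1-3) t f1 fr b in \<open>auto simp: A_def simp del: take_Suc\<close>)
    next
      case (10 j s')
      have fr: "s' 100 0 = w" using 10(3)[of 100] b by (auto simp: mods_simps)
      show ?case
        by ((intro vcg; (simp; fail)?), goal_cases)
          (use 10(1,2) fr in \<open>auto simp: A_def less_Suc_eq free_lits_def\<close>)
    next
      case (11 s')
      show ?case
        by ((intro vcg; (simp; fail)?), goal_cases) (use 11(1) in \<open>auto simp: A_def\<close>)
    next
      case (13 s')
      then show ?case unfolding A_def by (auto intro!: runl_Nil)
    qed (use H in \<open>auto simp: mods_simps\<close>)
  qed
qed

text \<open>The zeros after the code would count as empty terms, which are satisfied. The comparison
  of 98 with the number of terms excludes them.\<close>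

definition finalC :: com where
  "finalC = seqs [SetS 98 (Num 0), SetS 94 (Num 1), SetS 101 (Num 0),
     scan (If (neq (Cell 74 (Cell 70 (Cell 1 (Sc 89)))) (Cell 71 (Cell 1 (Sc 89)))) (SetS 94 (Num 0)) Skip)
          (seqs [If (Sc 94) (If (Cell 75 (Sc 98)) Skip (If (Monus (Cell 0 (Num 1)) (Sc 98)) (SetS 101 (Num 1)) Skip)) Skip,
                 SetS 94 (Num 1), SetS 98 (Plus (Sc 98) (Num 1))])]"

lemma mods_finalC: "mods finalC = {89, 94, 98, 101}"
  unfolding finalC_def by (auto simp: mods_simps mods_scan)

lemma finalC_correct:
  assumes inp: "inputs n f s" "is_dnf n f" and H: "length f * (2 * n + 1) \<le> H"
  shows "runs H 8 finalC s (\<lambda>s'. s' 101 0 = of_bool (\<exists>j<length f. s 75 j = 0 \<and> (\<forall>l\<in>set (f ! j). s 74 (lit_var l) = pol l)))"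
proof -
  define good where "good T \<longleftrightarrow> (\<forall>l\<in>set T. s 74 (lit_var l) = pol l)" for T
  define A where "A = (\<lambda>j k (s' :: state). s' 101 0 = of_bool (\<exists>j'<j. s 75 j' = 0 \<and> good (f ! j')) \<and>
      (if j < length f then s' 98 0 = j \<and> s' 94 0 = of_bool (good (take k (f ! j))) else length f \<le> s' 98 0))"
  show ?thesis unfolding finalC_def good_def[symmetric]
  proof ((intro vcg; (simp; fail)?), goal_cases)
    case 1
    let ?s = "(\<lambda>s. s(101 := (s 101)(0 := aval (Num 0) s))) ((\<lambda>s. s(94 := (s 94)(0 := aval (Num 1) s))) (s(98 := (s 98)(0 := aval (Num 0) s))))"
    have inp': "inputs n f ?s" by (rule inputs_frame[OF inp(1)]) auto
    show ?case
    proof (rule runs_use[OF runs_scan[where f=f and P="length f * (2 * n + 1)" and A=A and s="?s" and d=7]], goal_cases)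
      case 2 then show ?case using inp' unfolding inputs_def by blast
    next
      case 3 show ?case using inp' unfolding inputs_def by blast
    next
      case 4 show ?case by (rule code_length[OF inp(2)])
    next
      case 7 show ?case unfolding A_def by (simp add: good_def)
    next
      case 8 then show ?case unfolding A_def by simp
    next
      case (9 j k s')
      have fr: "s' a = s a" if "a \<in> {70, 71, 74}" for a
        using 9(5)[of a] that by (auto simp: mods_simps)
      let ?l = "f ! j ! k"
      have l: "lit_var ?l < n" using inp(2) 9(1,2) unfolding is_dnf_def by (metis nth_mem)
      have t: "s' 70 (s' 1 (s' 89 0)) = lit_var ?l" "s' 71 (s' 1 (s' 89 0)) = pol ?l"
        using 9(4) fr[of 70] fr[of 71] l inp(1) unfolding inputs_def by simp_all
      have tk: "take (Suc k) (f ! j) = take k (f ! j) @ [?l]" using 9(2) by (rule take_Suc_conv_app_nth)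
      have f1: "good (take (Suc k) (f ! j)) \<longleftrightarrow> good (take k (f ! j)) \<and> s 74 (lit_var ?l) = pol ?l"
        unfolding tk good_def by auto
      show ?case
        by ((intro vcg; (simp; fail)?), goal_cases)
          (use 9(1-3) t f1 fr in \<open>auto simp: A_def\<close>)
    next
      case (10 j s')
      have fr: "s' 75 = s 75" "s' 0 1 = length f" using 10(3)[of 75] 10(3)[of 0] inp(1) unfolding inputs_def by (auto simp: mods_simps)
      have ex: "(\<exists>j'<Suc j. s 75 j' = 0 \<and> good (f ! j')) \<longleftrightarrow> (\<exists>j'<j. s 75 j' = 0 \<and> good (f ! j')) \<or> (s 75 j = 0 \<and> good (f ! j))"
        by (auto simp: less_Suc_eq)
      have g0: "good []" unfolding good_def by simp
      have a: "s' 98 0 = j" "s' 94 0 = of_bool (good (f ! j))" "s' 101 0 = of_bool (\<exists>j'<j. s 75 j' = 0 \<and> good (f ! j'))"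
        using 10(1,2) unfolding A_def by simp_all
      show ?case
        by ((intro vcg; (simp; fail)?), goal_cases)
          (use 10(1) in \<open>simp_all add: A_def a fr fr(2)[simplified] ex g0 del: One_nat_def split: if_splits\<close>)
    next
      case (11 s')
      have fr: "s' 0 1 = length f" using 11(2)[of 0] inp(1) unfolding inputs_def by (auto simp: mods_simps)
      show ?case
        by ((intro vcg; (simp; fail)?), goal_cases) (use 11(1) fr fr[simplified] in \<open>auto simp: A_def\<close>)
    next
      case (13 s')
      then show ?case unfolding A_def by (auto intro!: runl_Nil)
    qed (use H in \<open>auto simp: mods_simps\<close>)
  qed
qed

text \<open>Splits off the least significant digit in base \<open>M\<close>.\<close>

lemma avg_block:
  fixes M X :: nat
  assumes "0 < M"
  shows "avg {..<M * X} (\<lambda>v. h v) = avg {..<M} (\<lambda>t. avg {..<X} (\<lambda>v. h (v * M + t)))"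
proof -
  have "bij_betw (\<lambda>(t, v). v * M + t) ({..<M} \<times> {..<X}) {..<M * X}"
  proof (rule bij_betwI[where g="\<lambda>w. (w mod M, w div M)"])
    show "(\<lambda>(t, v). v * M + t) \<in> {..<M} \<times> {..<X} \<rightarrow> {..<M * X}"
    proof clarsimp
      fix t v assume "t < M" "v < X"
      have "v * M + t < Suc v * M" using \<open>t < M\<close> by simp
      also have "\<dots> \<le> X * M" using \<open>v < X\<close> by (intro mult_right_mono) auto
      finally show "v * M + t < M * X" by (simp add: mult.commute)
    qed
    show "(\<lambda>w. (w mod M, w div M)) \<in> {..<M * X} \<rightarrow> {..<M} \<times> {..<X}"
      using assms by (auto simp: less_mult_imp_div_less mult.commute)
  qed (use assms in auto)
  then have "avg {..<M * X} h = avg ({..<M} \<times> {..<X}) (\<lambda>p. h (case p of (t, v) \<Rightarrow> v * M + t))"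
    by (intro avg_Pow_reindex) auto
  also have "\<dots> = avg ({..<M} \<times> {..<X}) (\<lambda>p. h (snd p * M + fst p))" by (simp add: case_prod_unfold)
  also have "\<dots> = avg {..<M} (\<lambda>t. avg {..<X} (\<lambda>v. h (v * M + t)))" by (rule avg_prod)
  finally show ?thesis .
qed

type_synonym conf = "trm list \<times> nat \<times> nat set \<times> nat set"

text \<open>A configuration consists of the remaining terms, the seed for the remaining stages, the set of
  the free variables and the values of the others. The seed is a number in base \<open>M\<close>, with two digits
  for each stage.\<close>

definition stg :: "nat \<Rightarrow> (nat \<Rightarrow> nat \<Rightarrow> nat set) \<Rightarrow> (nat \<Rightarrow> nat set) \<Rightarrow> nat \<Rightarrow> nat set \<Rightarrow> conf \<Rightarrow> conf" where
  "stg M B D b W = (\<lambda>(F, v, R, y). let U = W \<inter> B b (v mod M) in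
     (F, v div M div M, R - U, cmb (R \<inter> U) y (D (v div M mod M))))"

text \<open>The width bound after the phase with width \<open>2 ^ a\<close>, that is,
  \<open>2 ^ a div 2\<close>.\<close>

definition width :: "nat \<Rightarrow> nat" where "width a = (if a = 0 then 0 else 2 ^ (a - 1))"

definition trim :: "nat set \<Rightarrow> nat \<Rightarrow> conf \<Rightarrow> conf" where
  "trim W w = (\<lambda>(F, v, R, y). (narrow W w R F, v, R, y))"

definition phs :: "nat \<Rightarrow> (nat \<Rightarrow> nat \<Rightarrow> nat set) \<Rightarrow> (nat \<Rightarrow> nat set) \<Rightarrow> nat \<Rightarrow> nat set \<Rightarrow> nat \<Rightarrow> conf \<Rightarrow> conf" where
  "phs M B D l W a \<sigma> = trim W (width a) ((stg M B D (a + 5) W ^^ l) \<sigma>)"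

definition bkt :: "nat \<Rightarrow> (nat \<Rightarrow> nat \<Rightarrow> nat set) \<Rightarrow> (nat \<Rightarrow> nat set) \<Rightarrow> nat \<Rightarrow> nat \<Rightarrow> nat set \<Rightarrow> conf \<Rightarrow> conf" where
  "bkt M B D l a W = fold (phs M B D l W) (rev [0..<Suc a])"

definition accepts :: "conf \<Rightarrow> bool" where
  "accepts = (\<lambda>(F, v, R, y). \<exists>T\<in>set F. sat y T)"

context prg
begin

text \<open>Two digits of a uniform seed are independent and uniform, one for the selection and one
  for the values. What remains of the seed is uniform below \<open>X\<close> and is handed to
  \<open>G\<close>.\<close>

lemma avg_stg:
  assumes I: "I = {..<M}"
  shows "avg {..<(M * M) ^ l * X} (\<lambda>v. G ((stg M B D b W ^^ l) (F, v, R, y)))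
    = proc b W l R y (\<lambda>R' y'. avg {..<X} (\<lambda>v. G (F, v, R', y')))"
proof (induction l arbitrary: R y)
  case (Suc l)
  have M: "0 < M" using neI I by (cases M) auto
  let ?h = "\<lambda>\<sigma>. G ((stg M B D b W ^^ l) \<sigma>)"
  have step: "stg M B D b W (F, (v * M + t') * M + t, R, y) = (F, v, R - (W \<inter> B b t), cmb (R \<inter> (W \<inter> B b t)) y (D t'))"
    if "t < M" "t' < M" for v t t'
    using that M unfolding stg_def by (simp add: Let_def)
  have "avg {..<(M * M) ^ Suc l * X} (\<lambda>v. G ((stg M B D b W ^^ Suc l) (F, v, R, y)))
    = avg {..<M * (M * ((M * M) ^ l * X))} (\<lambda>v. ?h (stg M B D b W (F, v, R, y)))"
    by (simp add: funpow_Suc_right mult_ac del: funpow.simps)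
  also have "\<dots> = avg {..<M} (\<lambda>t. avg {..<M} (\<lambda>t'. avg {..<(M * M) ^ l * X} (\<lambda>v. ?h (stg M B D b W (F, (v * M + t') * M + t, R, y)))))"
    using M by (simp only: avg_block)
  also have "\<dots> = avg {..<M} (\<lambda>t. avg {..<M} (\<lambda>t'. avg {..<(M * M) ^ l * X} (\<lambda>v. ?h (F, v, R - (W \<inter> B b t), cmb (R \<inter> (W \<inter> B b t)) y (D t')))))"
    by (intro avg_cong refl) (simp add: step)
  also have "\<dots> = proc b W (Suc l) R y (\<lambda>R' y'. avg {..<X} (\<lambda>v. G (F, v, R', y')))"
    by (simp add: Suc I[symmetric])
  finally show ?case .
qed simp

lemma avg_phs:
  assumes I: "I = {..<M}"
  shows "avg {..<(M * M) ^ l * X} (\<lambda>v. G (phs M B D l W a (F, v, R, y)))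
    = proc (a + 5) W l R y (\<lambda>R' y'. avg {..<X} (\<lambda>v. G (narrow W (width a) R' F, v, R', y')))"
  unfolding phs_def avg_stg[OF I, where G="\<lambda>\<sigma>. G (trim W (width a) \<sigma>)"] by (simp add: trim_def)

lemma avg_bkt:
  assumes I: "I = {..<M}"
  shows "avg {..<(M * M) ^ (l * (a + 1)) * X} (\<lambda>v. G (bkt M B D l a W (F, v, R, y)))
    = brun W l a F R y (\<lambda>F' R' y'. avg {..<X} (\<lambda>v. G (F', v, R', y')))"
proof (induction a arbitrary: F R y)
  case 0
  show ?case unfolding bkt_def using avg_phs[OF I, of l X G W 0] by (simp add: width_def)
next
  case (Suc a)
  have e: "(M * M) ^ (l * (Suc a + 1)) * X = (M * M) ^ l * ((M * M) ^ (l * (a + 1)) * X)"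
    by (simp add: power_add)
  have w: "width (Suc a) = 2 ^ a" unfolding width_def by simp
  have u: "G (bkt M B D l (Suc a) W \<sigma>) = G (bkt M B D l a W (phs M B D l W (Suc a) \<sigma>))" for \<sigma>
    unfolding bkt_def by (subst upt_Suc) simp
  show ?case unfolding e u avg_phs[OF I, where G="\<lambda>\<sigma>. G (bkt M B D l a W \<sigma>)"] Suc w by simp
qed

lemma avg_run:
  assumes I: "I = {..<M}"
  shows "avg {..<(M * M) ^ (l * (a + 1) * length Ws)} (\<lambda>v. of_bool (accepts (fold (bkt M B D l a) Ws (F, v, R, y))))
    = srun l a Ws F R y"
proof (induction Ws arbitrary: F R y)
  case Nil
  have s: "{..<Suc 0} = {0}" by auto
  show ?case by (simp add: accepts_def avg_def s)
next
  case (Cons W Ws)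
  have e: "(M * M) ^ (l * (a + 1) * length (W # Ws)) = (M * M) ^ (l * (a + 1)) * ((M * M) ^ (l * (a + 1) * length Ws))"
    by (simp add: power_add[symmetric] algebra_simps)
  show ?case unfolding e using avg_bkt[OF I, where G="\<lambda>\<sigma>. of_bool (accepts (fold (bkt M B D l a) Ws \<sigma>))"] Cons by simp
qed

end

section \<open>Machine states and configurations\<close>

definition tm :: "literal list \<Rightarrow> trm" where
  "tm T = (lit_var ` set T, {i. Pos i \<in> set T})"

definition consistent :: "literal list \<Rightarrow> bool" where
  "consistent T \<longleftrightarrow> (\<forall>i. \<not> (Pos i \<in> set T \<and> Neg i \<in> set T))"

text \<open>A contradictory term cannot be written as a pair of type \<open>trm\<close>. It is never
  satisfied and therefore left out, while the machine keeps it.\<close>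

definition live :: "dnf \<Rightarrow> state \<Rightarrow> trm list" where
  "live f s = map (\<lambda>j. tm (f ! j)) (filter (\<lambda>j. s 75 j = 0 \<and> consistent (f ! j)) [0..<length f])"

lemma sat_tm:
  assumes "consistent T"
  shows "sat y (tm T) \<longleftrightarrow> (\<forall>l\<in>set T. lit_holds (\<lambda>i. i \<in> y) l)"
proof
  assume s: "sat y (tm T)"
  show "\<forall>l\<in>set T. lit_holds (\<lambda>i. i \<in> y) l"
  proof
    fix l assume l: "l \<in> set T"
    then have v: "lit_var l \<in> lit_var ` set T" by blast
    show "lit_holds (\<lambda>i. i \<in> y) l"
      using s v l assms unfolding sat_def tm_def consistent_def by (cases l) auto
  qed
next
  assume h: "\<forall>l\<in>set T. lit_holds (\<lambda>i. i \<in> y) l"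
  have "i \<in> y \<inter> lit_var ` set T \<longleftrightarrow> Pos i \<in> set T" for i
  proof
    assume i: "i \<in> y \<inter> lit_var ` set T"
    then obtain l where "l \<in> set T" "lit_var l = i" by blast
    moreover have "l = Pos i"
      using bspec[OF h \<open>l \<in> set T\<close>] i \<open>lit_var l = i\<close> by (cases l) simp_all
    ultimately show "Pos i \<in> set T" by simp
  next
    assume p: "Pos i \<in> set T"
    then have "i \<in> lit_var ` set T" by (metis image_eqI lit_var.simps(1))
    then show "i \<in> y \<inter> lit_var ` set T" using h p by auto
  qed
  then show "sat y (tm T)" unfolding sat_def tm_def by auto
qed

lemma holds_consistent:
  assumes "\<forall>l\<in>set T. lit_holds x l"
  shows "consistent T"
  unfolding consistent_def by (metis assms lit_holds.simps)

lemma Bias_val: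
  assumes "is_dnf n f"
  shows "Bias n (dnf_holds f) = val n (map tm (filter consistent f)) {..<n} {}"
proof -
  have fc: "finite (cube n)" "cube n \<noteq> {}" unfolding cube_def by (auto simp: finite_PiE PiE_eq_empty_iff)
  have bij: "bij_betw (\<lambda>z. \<lambda>i\<in>{..<n}. i \<in> z) (Pow {..<n}) (cube n)"
    by (rule bij_betwI[where g="\<lambda>x. {i. i < n \<and> x i}"]) (auto simp: cube_def fun_eq_iff PiE_def extensional_def restrict_def)
  have "Bias n (dnf_holds f) = avg (cube n) (\<lambda>x. of_bool (dnf_holds f x))"
    unfolding Bias_def measure_pmf_of_set[OF fc(2,1)] avg_def using fc by (simp add: Int_def)
  also have "\<dots> = avg (Pow {..<n}) (\<lambda>z. of_bool (dnf_holds f (\<lambda>i\<in>{..<n}. i \<in> z)))"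
    by (rule avg_Pow_reindex[OF fc(1) bij])
  also have "\<dots> = val n (map tm (filter consistent f)) {..<n} {}"
    unfolding val_def pr_def
  proof (intro avg_cong refl)
    fix z assume z: "z \<in> Pow {..<n}"
    have c: "cmb {..<n} {} z = z" using z unfolding cmb_def by auto
    have "dnf_holds f (\<lambda>i\<in>{..<n}. i \<in> z) \<longleftrightarrow> (\<exists>T\<in>set f. \<forall>l\<in>set T. lit_holds (\<lambda>i. i \<in> z) l)"
      unfolding dnf_holds_def
    proof (intro bex_cong ball_cong refl)
      fix T l assume "T \<in> set f" "l \<in> set T"
      then have "lit_var l < n" using assms unfolding is_dnf_def by blast
      then show "lit_holds (\<lambda>i\<in>{..<n}. i \<in> z) l = lit_holds (\<lambda>i. i \<in> z) l" by (cases l) auto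
    qed
    also have "\<dots> \<longleftrightarrow> (\<exists>T\<in>set (map tm (filter consistent f)). sat z T)"
      using sat_tm[of _ z] holds_consistent[of _ "\<lambda>i. i \<in> z"] by auto
    also have "\<dots> \<longleftrightarrow> first (map tm (filter consistent f)) z \<noteq> None"
      by (auto simp: find_None_iff)
    finally show "of_bool (dnf_holds f (\<lambda>i\<in>{..<n}. i \<in> z)) = of_bool (first (map tm (filter consistent f)) (cmb {..<n} {} z) \<noteq> None)"
      unfolding c by simp
  qed
  finally show ?thesis .
qed

lemma live_initial:
  assumes "\<And>j. j < length f \<Longrightarrow> s 75 j = 0"
  shows "live f s = map tm (filter consistent f)"
proof -
  have "live f s = map tm (map (\<lambda>j. f ! j) (filter (\<lambda>j. consistent (f ! j)) [0..<length f]))"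
    unfolding live_def map_map comp_def
    by (rule arg_cong[where f="map _"], rule filter_cong[OF refl]) (use assms in auto)
  also have "map (\<lambda>j. f ! j) (filter (\<lambda>j. consistent (f ! j)) [0..<length f]) = filter consistent (map (\<lambda>j. f ! j) [0..<length f])"
    by (simp add: filter_map comp_def)
  finally show ?thesis by (simp add: map_nth)
qed

text \<open>In a consistent term \<open>lit_var\<close> is injective.\<close>

lemma consistent_card:
  assumes "consistent T" "distinct T"
  shows "length (filter (\<lambda>l. P (lit_var l)) T) = card {i \<in> lit_var ` set T. P i}"
proof -
  have inj: "inj_on lit_var (set T)"
  proof (rule inj_onI)
    fix l l' assume l: "l \<in> set T" "l' \<in> set T" "lit_var l = lit_var l'"
    have c: "Neg i \<notin> set T" if "Pos i \<in> set T" for i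
      using assms(1) that unfolding consistent_def by blast
    show "l = l'"
    proof (cases l)
      case (Pos i)
      then show ?thesis using l c[of i] by (cases l') simp_all
    next
      case (Neg i)
      then show ?thesis using l c[of i] by (cases l') simp_all
    qed
  qed
  have "length (filter (\<lambda>l. P (lit_var l)) T) = card (set (filter (\<lambda>l. P (lit_var l)) T))"
    by (rule distinct_card[symmetric]) (use assms(2) in simp)
  also have "\<dots> = card (lit_var ` set (filter (\<lambda>l. P (lit_var l)) T))"
    by (rule card_image[symmetric]) (rule inj_on_subset[OF inj], auto)
  also have "lit_var ` set (filter (\<lambda>l. P (lit_var l)) T) = {i \<in> lit_var ` set T. P i}" by auto
  finally show ?thesis .
qed

text \<open>The simulation relation: the program is verified by showing that its steps carry it
  along \<open>stg\<close> and \<open>trim\<close>.\<close>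

definition good_conf :: "nat \<Rightarrow> dnf \<Rightarrow> state \<Rightarrow> conf \<Rightarrow> bool" where
  "good_conf n f s = (\<lambda>(F, v, R, y). s 83 0 = v \<and> F = live f s \<and> R \<subseteq> {..<n} \<and> y \<subseteq> {..<n} \<and>
     (\<forall>i<n. (s 73 i = 0 \<longleftrightarrow> i \<in> R) \<and> s 74 i = of_bool (i \<in> y)))"

lemma good_conf_frame: "good_conf n f s \<sigma> \<Longrightarrow> (\<And>a. a \<in> {73, 74, 75, 83} \<Longrightarrow> s' a = s a) \<Longrightarrow> good_conf n f s' \<sigma>"
  unfolding good_conf_def live_def by auto

lemma good_conf_trim:
  assumes "is_dnf n f" and g: "good_conf n f s \<sigma>" and b: "\<And>i. i < n \<Longrightarrow> s 72 i = \<beta> \<longleftrightarrow> i \<in> W"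
    and d: "\<forall>j. s' 75 j = (if j < length f \<and> w < free_lits s \<beta> (f ! j) then 1 else s 75 j)"
    and fr: "\<And>a. a \<in> {73, 74, 83} \<Longrightarrow> s' a = s a"
  shows "good_conf n f s' (trim W w \<sigma>)"
proof -
  obtain F v R y where \<sigma>: "\<sigma> = (F, v, R, y)" by (cases \<sigma>)
  have "narrow W w R (live f s) = live f s'"
  proof -
    have c: "free_lits s \<beta> (f ! j) = card (fst (tm (f ! j)) \<inter> (R \<inter> W))" if j: "j < length f" "consistent (f ! j)" for j
    proof -
      have T: "distinct (f ! j)" "\<And>l. l \<in> set (f ! j) \<Longrightarrow> lit_var l < n"
        using assms(1) j(1) unfolding is_dnf_def by (auto dest: nth_mem)
      have "free_lits s \<beta> (f ! j) = card {i \<in> lit_var ` set (f ! j). s 73 i = 0 \<and> s 72 i = \<beta>}"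
        unfolding free_lits_def by (rule consistent_card[OF j(2) T(1)])
      also have "{i \<in> lit_var ` set (f ! j). s 73 i = 0 \<and> s 72 i = \<beta>} = fst (tm (f ! j)) \<inter> (R \<inter> W)"
        unfolding tm_def using T(2) g b unfolding \<sigma> good_conf_def by auto
      finally show ?thesis .
    qed
    show ?thesis unfolding narrow_def live_def filter_map filter_filter
      by (rule arg_cong[where f="map _"], rule filter_cong[OF refl]) (use d c in auto)
  qed
  then show ?thesis using g fr unfolding \<sigma> good_conf_def trim_def by auto
qed

text \<open>The final check of the literals needs no test of consistency: no assignment satisfies
  both literals of a variable.\<close>

lemma good_conf_accepts:
  assumes "is_dnf n f" and g: "good_conf n f s \<sigma>"
  shows "accepts \<sigma> \<longleftrightarrow> (\<exists>j<length f. s 75 j = 0 \<and> (\<forall>l\<in>set (f ! j). s 74 (lit_var l) = pol l))"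
proof -
  obtain F v R y where \<sigma>: "\<sigma> = (F, v, R, y)" by (cases \<sigma>)
  have h: "s 74 (lit_var l) = pol l \<longleftrightarrow> lit_holds (\<lambda>i. i \<in> y) l" if "j < length f" "l \<in> set (f ! j)" for j l
  proof -
    have "lit_var l < n" using assms(1) that unfolding is_dnf_def by (auto dest: nth_mem)
    then show ?thesis using g unfolding \<sigma> good_conf_def by (cases l) auto
  qed
  have "accepts \<sigma> \<longleftrightarrow> (\<exists>j<length f. s 75 j = 0 \<and> consistent (f ! j) \<and> sat y (tm (f ! j)))"
    using g unfolding \<sigma> good_conf_def accepts_def live_def by auto
  also have "\<dots> \<longleftrightarrow> (\<exists>j<length f. s 75 j = 0 \<and> (\<forall>l\<in>set (f ! j). lit_holds (\<lambda>i. i \<in> y) l))"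
    using sat_tm[of _ y] holds_consistent[of _ "\<lambda>i. i \<in> y"] by blast
  finally show ?thesis using h by (metis (mono_tags, lifting))
qed

section \<open>Hashing, stages and buckets on the machine\<close>

definition env :: "nat \<Rightarrow> dnf \<Rightarrow> nat \<Rightarrow> (nat \<Rightarrow> nat set) \<Rightarrow> (nat \<Rightarrow> nat set) \<Rightarrow> state \<Rightarrow> bool" where
  "env n f e X1 X2 s \<longleftrightarrow> inputs n f s \<and> vals (pvals n (length f) e) s \<and>
     samples 30 (pN1 n (length f) e) s = X1 \<and> samples 31 (pN2 n (length f) e) s = X2"

definition fixed :: "nat set" where
  "fixed = {0, 1, 15, 16, 17, 19, 20, 21, 22, 23, 25, 26, 27, 28, 30, 31, 70, 71}"

lemma samples_cong: "s' X = s X \<Longrightarrow> samples X N s' = samples X N s"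
  by (auto simp: samples_iff fun_eq_iff)

lemma env_frame:
  assumes "env n f e X1 X2 s" "\<And>a. a \<in> fixed \<Longrightarrow> s' a = s a"
  shows "env n f e X1 X2 s'"
proof -
  have "inputs n f s'" by (rule inputs_frame[of n f s]) (use assms in \<open>auto simp: env_def fixed_def\<close>)
  moreover have "vals (pvals n (length f) e) s'"
    using assms unfolding env_def pvals_def vals_def by (auto simp: fixed_def)
  ultimately show ?thesis using assms samples_cong[of s' 30 s] samples_cong[of s' 31 s]
    unfolding env_def fixed_def by auto
qed

definition readnum :: "nat \<Rightarrow> nat \<Rightarrow> nat \<Rightarrow> aexp \<Rightarrow> com" where
  "readnum X p z cnt = seqs [SetS z (Num 0), SetS 96 (Num 1),
     For 88 cnt (seqs [If (Cell X (Plus (Sc p) (Sc 88))) (SetS z (Plus (Sc z) (Sc 96))) Skip,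
       SetS 96 (Plus (Sc 96) (Sc 96))])]"

lemma mods_readnum: "mods (readnum X p z cnt) = {z, 88, 96}"
  unfolding readnum_def by (auto simp: mods_simps)

lemma bitnum_step: "bitnum (Suc r) P = bitnum r P + of_bool (P r) * 2 ^ r"
  unfolding bitnum_def by simp

lemma runs_readnum:
  assumes N: "aval cnt s = N" "N \<le> H" "acost cnt \<le> 20" "{z, 88, 96} \<inter> reads cnt = {}"
    and "z \<notin> {X, p, 88, 96}" "X \<notin> {88, 96}" "p \<notin> {88, 96}"
  shows "runs H 5 (readnum X p z cnt) s (\<lambda>s'. s' z 0 = bitnum N (\<lambda>v. s X (s p 0 + v) \<noteq> 0))"
  unfolding readnum_def
proof ((intro vcg; (simp; fail)?), goal_cases)
  case 1
  let ?s1 = "s(z := (s z)(0 := aval (Num 0) s))"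
  let ?s = "?s1(96 := (?s1 96)(0 := aval (Num 1) ?s1))"
  show ?case
  proof (rule runs_use[OF runs_for[where d=4 and N=N and s="?s" and I="\<lambda>i s'. s' z 0 = bitnum i (\<lambda>v. s X (s p 0 + v) \<noteq> 0) \<and> s' 96 0 = 2 ^ i"]], goal_cases)
    case 2
    have "aval cnt ?s = aval cnt s" by (rule aval_frame) (use N(4) in auto)
    then show ?case using N(1) by simp
  next
    case (10 i s')
    have fr: "s' X = s X" "s' p = s p" using 10(4)[of X] 10(4)[of p] assms(5-7) by (auto simp: mods_simps)
    show ?case
      by ((intro vcg; (simp; fail)?), goal_cases)
        (use 10(1-3) fr assms(5-7) in \<open>auto simp: bitnum_step\<close>)
  next
    case (12 s') then show ?case by (auto intro: runl_Nil)
  qed (use assms in \<open>auto simp: mods_simps bitnum_0\<close>)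
qed

text \<open>Cell 92 moves over the blocks of the variables in the first sample; 104 points to the
  block of the name just read in the second sample.\<close>

definition hashC :: com where
  "hashC = seqs [addmul 92 (Sc 21) (Sc 80), addmul 93 (Sc 25) (Sc 81),
     For 87 (Sc 0) (seqs [readnum 30 92 95 (Sc 16), addmul 104 (Sc 17) (Sc 95), SetS 104 (Plus (Sc 104) (Sc 93)),
       readnum 31 104 97 (Sc 17), Assign 72 (Sc 87) (Sc 97), SetS 92 (Plus (Sc 92) (Plus (Sc 16) (Num 5)))])]"

lemma mods_hashC: "mods hashC = {60, 72, 87, 88, 92, 93, 95, 96, 97, 104}"
  unfolding hashC_def by (auto simp: mods_simps2 mods_readnum)

definition hash :: "nat \<Rightarrow> nat \<Rightarrow> nat \<Rightarrow> (nat \<Rightarrow> nat set) \<Rightarrow> (nat \<Rightarrow> nat set) \<Rightarrow> nat \<Rightarrow> nat \<Rightarrow> nat \<Rightarrow> nat" where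
  "hash n m e X1 X2 = hbucket (pR n m e) (pC n m e) X1 X2"

lemma block_less:
  fixes i j a b :: nat
  assumes "i < a" "j < b"
  shows "i * b + j < a * b"
proof -
  have "i * b + j < Suc i * b" using assms by simp
  also have "\<dots> \<le> a * b" using assms by (intro mult_right_mono) auto
  finally show ?thesis .
qed

lemma hashC_correct:
  assumes e: "env n f e X1 X2 s" and H: "pH n (length f) e \<le> H"
    and su: "s 80 0 = su" "su \<le> H" "s 81 0 = u" "u \<le> H"
  shows "runs H 8 hashC s (\<lambda>s'. \<forall>i<n. s' 72 i = hash n (length f) e X1 X2 su u i)"
proof -
  define r where "r = pR n (length f) e"
  define c where "c = pC n (length f) e"
  define N1 where "N1 = pN1 n (length f) e"
  define N2 where "N2 = pN2 n (length f) e"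
  have dN: "N1 = n * (r + 5)" "N2 = 2 ^ r * c" unfolding N1_def N2_def pN1_def pN2_def r_def c_def by simp_all
  have V: "s 0 0 = n" "s 16 0 = r" "s 17 0 = c" "s 21 0 = N1" "s 25 0 = N2"
    using e unfolding env_def pvals_def vals_def r_def c_def N1_def N2_def by auto
  have Hs: "n \<le> H" "r \<le> H" "c \<le> H" "2 ^ r \<le> H"
    using H unfolding pH_def loop_bounds_def r_def c_def by auto
  have sX: "p \<in> X1 t \<longleftrightarrow> p < N1 \<and> s 30 (t * N1 + p) \<noteq> 0" "p \<in> X2 t \<longleftrightarrow> p < N2 \<and> s 31 (t * N2 + p) \<noteq> 0" for p t
    using e unfolding env_def N1_def N2_def using samples_iff by blast+
  show ?thesis unfolding hashC_def
  proof ((intro vcg; (simp; fail)?), rule runs_use[OF runs_addmul[where N=su and x=N1]], goal_cases)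
    case (12 s1)
    have f1: "s1 a = s a" if "a \<notin> {60, 92}" for a using 12(2)[of a] that by (simp add: mods_simps2)
    have v1: "s1 92 0 = su * N1" using 12(1) by (simp add: vals_simps)
    show ?case
    proof (intro vcg, rule runs_use[OF runs_addmul[where N=u and x=N2]], goal_cases)
      case (12 s2)
      have f2: "s2 a = s a" if "a \<notin> {60, 92, 93}" for a using 12(2)[of a] f1[of a] that by (simp add: mods_simps2)
      have v2: "s2 92 0 = su * N1" "s2 93 0 = u * N2" using 12 v1 by (simp_all add: vals_simps mods_simps2)
      show ?case
      proof (intro vcg, rule runs_use[OF runs_for[where d=7 and N=n and
            I="\<lambda>j s'. s' 92 0 = su * N1 + j * (r + 5) \<and> (\<forall>i<j. s' 72 i = hash n (length f) e X1 X2 su u i)"]], goal_cases)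
        case (10 i s')
        have f': "s' a = s a" if "a \<in> fixed" for a
          using 10(4)[of a] f2[of a] that by (auto simp: mods_simps2 mods_readnum fixed_def)
        have f'': "s' 93 = s2 93" using 10(4)[of 93] by (auto simp: mods_simps2 mods_readnum)
        define h where "h = bitnum r (\<lambda>v. i * (r + 5) + v \<in> X1 su)"
        have h: "bitnum r (\<lambda>v. s' 30 (s' 92 0 + v) \<noteq> 0) = h"
          unfolding h_def bitnum_def
        proof (intro sum.cong refl)
          fix v assume "v \<in> {..<r}"
          then have "i * (r + 5) + v < N1" unfolding dN using block_less[OF 10(1), of v "r + 5"] by simp
          then show "of_bool (s' 30 (s' 92 0 + v) \<noteq> 0) * 2 ^ v = of_bool (i * (r + 5) + v \<in> X1 su) * (2::nat) ^ v"
            using 10(2) f'[of 30] sX(1) by (simp add: fixed_def add.assoc)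
        qed
        have hr: "h < 2 ^ r" unfolding h_def by (rule bitnum_less)
        have k: "bitnum c (\<lambda>v. s 31 (u * N2 + (h * c + v)) \<noteq> 0) = hash n (length f) e X1 X2 su u i"
          unfolding hash_def hbucket_def r_def[symmetric] c_def[symmetric]
          unfolding h_def[symmetric] unfolding bitnum_def
        proof (intro sum.cong refl)
          fix v assume "v \<in> {..<c}"
          then have "h * c + v < N2" unfolding dN using block_less[OF hr, of v c] by simp
          then show "of_bool (s 31 (u * N2 + (h * c + v)) \<noteq> 0) * 2 ^ v = of_bool (h * c + v \<in> X2 u) * (2::nat) ^ v"
            using sX(2) by simp
        qed
        show ?case
        proof ((intro vcg; (simp; fail)?), rule runs_use[OF runs_readnum[where N=r]], goal_cases)
          case (9 s3)
          have g3: "s3 a = s' a" if "a \<notin> {88, 95, 96}" for a using 9(2)[of a] that by (simp add: mods_readnum)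
          show ?case
          proof (intro vcg, rule runs_use[OF runs_addmul[where N=h and x=c]], goal_cases)
            case (12 s4)
            have g4: "s4 a = s' a" if "a \<notin> {60, 88, 95, 96, 104}" for a using 12(2)[of a] g3[of a] that by (simp add: mods_simps2)
            have v4: "s4 104 0 = h * c" using 12 by (simp add: vals_simps)
            show ?case
            proof ((intro vcg; (simp; fail)?), rule runs_use[OF runs_readnum[where N=c]], goal_cases)
              case (9 s5)
              have g5: "s5 a = s' a" if "a \<notin> {60, 88, 95, 96, 97, 104}" for a using 9(2)[of a] g4[of a] that by (simp add: mods_readnum)
              have v5: "s5 97 0 = hash n (length f) e X1 X2 su u i"
                using 9(1) v4 v2(2) f'' g4[of 93] g4[of 31] f'[of 31] k by (simp add: fixed_def add_ac)
              show ?case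
                by ((intro vcg; (simp; fail)?), goal_cases)
                  (use 10(2,3) v5 g5 f'[of 16] V(2) in \<open>auto simp: fixed_def less_Suc_eq\<close>)
            qed (use V f'[of 17] g4 Hs in \<open>auto simp: fixed_def\<close>)
          qed (use V f'[of 17] g3 9(1) h hr Hs in \<open>auto simp: fixed_def\<close>)
        qed (use V f'[of 16] Hs in \<open>auto simp: fixed_def\<close>)
      next
        case (12 s') then show ?case by (auto intro: runl_Nil)
      qed (use V f2[of 0] v2 Hs in \<open>auto simp: mods_simps2 mods_readnum\<close>)
    qed (use V f1 su Hs in auto)
  qed (use V su Hs in auto)
qed

definition initC :: com where
  "initC = seqs [SetS 83 (Sc 82), For 87 (Sc 0) (seqs [Assign 73 (Sc 87) (Num 0), Assign 74 (Sc 87) (Num 0)]),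
     For 98 (Cell 0 (Num 1)) (Assign 75 (Sc 98) (Num 0))]"

lemma mods_initC: "mods initC = {73, 74, 75, 83, 87, 98}"
  unfolding initC_def by (auto simp: mods_simps)

lemma initC_correct:
  assumes "s 0 0 = n" "s 0 1 = length f" "n \<le> H" "length f \<le> H"
  shows "runs H 4 initC s (\<lambda>s'. good_conf n f s' (map tm (filter consistent f), s 82 0, {..<n}, {}))"
  unfolding initC_def
proof ((intro vcg; (simp; fail)?), rule runs_use[OF runs_for[where d=3 and N=n and
    I="\<lambda>j s'. \<forall>i<j. s' 73 i = 0 \<and> s' 74 i = 0"]], goal_cases)
  case (10 i s')
  show ?case by ((intro vcg; (simp; fail)?), goal_cases) (use 10 in \<open>auto simp: less_Suc_eq\<close>)
next
  case (12 s1)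
  have f1: "s1 a = s a" if "a \<in> {0, 82}" for a using 12(2)[of a] that by (auto simp: mods_simps)
  have v1: "s1 83 0 = s 82 0" using 12(2)[of 83] by (simp add: mods_simps)
  show ?case
  proof (intro vcg, rule runs_use[OF runs_for[where d=3 and N="length f" and I="\<lambda>j s'. \<forall>i<j. s' 75 i = 0"]], goal_cases)
    case (10 i s')
    show ?case by ((intro vcg; (simp; fail)?), goal_cases) (use 10 in \<open>auto simp: less_Suc_eq\<close>)
  next
    case (12 s2)
    have f2: "s2 a = s1 a" if "a \<in> {73, 74, 83}" for a using 12(2)[of a] that by (auto simp: mods_simps)
    have "live f s2 = map tm (filter consistent f)" by (rule live_initial) (use 12(1) in auto)
    then show ?case using \<open>\<forall>i<n. s1 73 i = 0 \<and> s1 74 i = 0\<close> f2 v1 by (intro runl_Nil) (auto simp: good_conf_def)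
  qed (use assms f1 f1[of 0, simplified] in \<open>auto simp: mods_simps\<close>)
qed (use assms in \<open>auto simp: mods_simps\<close>)

text \<open>Division with remainder by repeated subtraction. It takes as many rounds as the seed in
  83 is large, which does not matter because all seeds are tried anyway.\<close>

definition dm :: "nat \<Rightarrow> com" where
  "dm t = seqs [SetS 104 (Num 0), SetS t (Sc 83),
     For 60 (Sc 83) (If (Monus (Plus (Sc t) (Num 1)) (Sc 22)) (seqs [SetS t (Monus (Sc t) (Sc 22)), SetS 104 (Plus (Sc 104) (Num 1))]) Skip),
     SetS 83 (Sc 104)]"

lemma mods_dm: "mods (dm t) = {60, t, 83, 104}"
  unfolding dm_def by (auto simp: mods_simps)

lemma runs_dm:
  assumes s: "s 83 0 = v" "v \<le> H" "s 22 0 = M" "0 < M" "t \<notin> {22, 60, 83, 104}"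
  shows "runs H 5 (dm t) s (\<lambda>s'. s' t 0 = v mod M \<and> s' 83 0 = v div M)"
  unfolding dm_def
proof ((intro vcg; (simp; fail)?), rule runs_use[OF runs_for[where d=4 and N=v and
    I="\<lambda>i s'. s' 104 0 = min i (v div M) \<and> s' t 0 = v - M * min i (v div M)"]], goal_cases)
  case (10 i s')
  have f: "s' 22 0 = M" using 10(4)[of 22] s by (auto simp: mods_simps)
  have q: "M * (v div M) + v mod M = v" "v mod M < M" using s(4) by simp_all
  \<comment> \<open>The test \<open>t + 1 > M\<close> means that \<open>M\<close> can be subtracted
    once more, which happens exactly \<open>v div M\<close> times.\<close>
  have c: "M < Suc (v - M * min i (v div M)) \<longleftrightarrow> i < v div M"
  proof
    assume h: "M < Suc (v - M * min i (v div M))"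
    show "i < v div M"
    proof (rule ccontr)
      assume "\<not> i < v div M"
      then have "v - M * min i (v div M) = v mod M" using q by (simp add: min_absorb2 minus_mult_div_eq_mod)
      then show False using h q(2) by simp
    qed
  next
    assume h: "i < v div M"
    then have "M * Suc i \<le> M * (v div M)" by (intro mult_left_mono) auto
    also have "\<dots> \<le> v" using q(1) by linarith
    finally have "M * i + M \<le> v" by simp
    then show "M < Suc (v - M * min i (v div M))" using h by (simp add: min_absorb1)
  qed
  show ?case
  proof ((intro vcg; (simp; fail)?), goal_cases)
    case 1
    then have "i < v div M" using c f 10(2) by simp
    then show ?case using 10(2) f s(5) by (auto simp: min_def)
  next
    case 2
    then have "\<not> i < v div M" using c f 10(2) by simp
    then show ?case using 10(2) by (auto simp: min_def)
  qed
next
  case (12 s')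
  have "min v (v div M) = v div M" using div_le_dividend[of v M] by (simp add: min_absorb2)
  then show ?case using 12(1) s(5)
    by (intro vcg) (auto simp: minus_mult_div_eq_mod)
qed (use s in \<open>auto simp: mods_simps\<close>)

text \<open>Cells 92 and 93 point to the bits of variable 87 in the two samples of the stage.\<close>

definition pickC :: com where
  "pickC = seqs [SetS 94 (Num 1),
     For 88 (Plus (Monus (Sc 15) (Sc 85)) (Num 5)) (If (Cell 30 (Plus (Sc 92) (Sc 88))) Skip (SetS 94 (Num 0))),
     If (Sc 94) (If (Cell 73 (Sc 87)) Skip (If (neq (Cell 72 (Sc 87)) (Sc 84)) Skip
       (seqs [Assign 73 (Sc 87) (Num 1), If (Cell 30 (Sc 93)) (Assign 74 (Sc 87) (Num 1)) (Assign 74 (Sc 87) (Num 0))]))) Skip,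
     SetS 92 (Plus (Sc 92) (Plus (Sc 16) (Num 5))), SetS 93 (Plus (Sc 93) (Plus (Sc 16) (Num 5)))]"

lemma mods_pickC: "mods pickC = {73, 74, 88, 92, 93, 94}"
  unfolding pickC_def by (auto simp: mods_simps)

lemma runs_pickC:
  assumes b: "s 15 0 - s 85 0 + 5 = b" "b \<le> H" and i: "s 87 0 = i"
  shows "runs H 8 pickC s (\<lambda>s'. s' 92 0 = s 92 0 + (s 16 0 + 5) \<and> s' 93 0 = s 93 0 + (s 16 0 + 5) \<and>
    (let P = (\<forall>v<b. s 30 (s 92 0 + v) \<noteq> 0) \<and> s 73 i = 0 \<and> s 72 i = s 84 0 in
      s' 73 = (if P then (s 73)(i := 1) else s 73) \<and> s' 74 = (if P then (s 74)(i := of_bool (s 30 (s 93 0) \<noteq> 0)) else s 74)))"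
  unfolding pickC_def
proof ((intro vcg; (simp; fail)?), goal_cases)
  case 1
  let ?s = "s(94 := (s 94)(0 := aval (Num 1) s))"
  show ?case
  proof (rule runs_use[OF runs_for[where d=5 and N=b and s="?s" and I="\<lambda>j s'. s' 94 0 = of_bool (\<forall>v<j. s 30 (s 92 0 + v) \<noteq> 0)"]], goal_cases)
    case 2 show ?case using b by simp
  next
    case (10 j s')
    have fr: "s' 30 = s 30" "s' 92 = s 92" using 10(4)[of 30] 10(4)[of 92] by (auto simp: mods_simps)
    show ?case
      by ((intro vcg; (simp; fail)?), goal_cases) (use 10(1-3) fr in \<open>auto simp: less_Suc_eq\<close>)
  next
    case (12 s')
    have fr: "s' a = s a" if "a \<notin> {88, 94}" for a using 12(2)[of a] that by (simp add: mods_simps)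
    have c: "s' 94 0 \<noteq> 0 \<longleftrightarrow> (\<forall>v<b. s 30 (s 92 0 + v) \<noteq> 0)" using 12(1) by simp
    show ?case
      by ((intro vcg; (simp; fail)?), goal_cases) (use c fr i in \<open>auto simp: Let_def\<close>)
  qed (use b in \<open>auto simp: mods_simps\<close>)
qed

definition stageC :: com where
  "stageC = seqs [dm 90, dm 91, addmul 92 (Sc 21) (Sc 90), addmul 93 (Sc 21) (Sc 91), For 87 (Sc 0) pickC]"

lemma mods_stageC: "mods stageC = {60, 73, 74, 83, 87, 88, 90, 91, 92, 93, 94, 104}"
  unfolding stageC_def by (auto simp: mods_simps2 mods_dm mods_pickC)

definition mstep :: "nat \<Rightarrow> nat \<Rightarrow> nat \<Rightarrow> (nat \<Rightarrow> nat set) \<Rightarrow> nat \<Rightarrow> nat set \<Rightarrow> conf \<Rightarrow> conf" where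
  "mstep n m e X1 = stg (2 ^ (8 * pK1 n m e)) (selB n (pR n m e + 5) X1) (selD n (pR n m e + 5) X1)"

lemma stageC_correct:
  assumes e: "env n f e X1 X2 s" and H: "pH n (length f) e \<le> H"
    and g: "good_conf n f s \<sigma>" and v: "s 83 0 \<le> H"
    and W: "\<And>i. i < n \<Longrightarrow> s 72 i = s 84 0 \<longleftrightarrow> i \<in> W"
    and b: "b = pRho n (length f) e - s 85 0 + 5"
  shows "runs H 10 stageC s (\<lambda>s'. good_conf n f s' (mstep n (length f) e X1 b W \<sigma>) \<and> s' 83 0 \<le> s 83 0)"
proof -
  define r where "r = pR n (length f) e"
  define rho where "rho = pRho n (length f) e"
  define N1 where "N1 = pN1 n (length f) e"
  define M where "M = (2::nat) ^ (8 * pK1 n (length f) e)"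
  have dN: "N1 = n * (r + 5)" unfolding N1_def pN1_def r_def by simp
  have V: "s 0 0 = n" "s 15 0 = rho" "s 16 0 = r" "s 21 0 = N1" "s 22 0 = M"
    using e unfolding env_def pvals_def vals_def r_def rho_def N1_def M_def by auto
  have M0: "0 < M" unfolding M_def by simp
  have Hs: "n \<le> H" "r \<le> H" "rho + 6 \<le> H" "M \<le> H"
    using H unfolding pH_def loop_bounds_def r_def rho_def M_def by auto
  have sX: "p \<in> X1 t \<longleftrightarrow> p < N1 \<and> s 30 (t * N1 + p) \<noteq> 0" for p t
    using e unfolding env_def N1_def using samples_iff by blast
  obtain F v R y where \<sigma>: "\<sigma> = (F, v, R, y)" by (cases \<sigma>)
  have v0: "s 83 0 = v" using g unfolding \<sigma> good_conf_def by simp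
  define t where "t = v mod M"
  define t' where "t' = v div M mod M"
  have tM: "t < M" "t' < M" unfolding t_def t'_def using M0 by auto
  have \<rho>r: "rho + 5 \<le> r + 5" unfolding r_def rho_def pR_def using less_exp[of "pRho n (length f) e"] by simp
  have b': "b \<le> r + 5" "b \<le> H" unfolding b using \<rho>r Hs(3) unfolding rho_def by auto
  define U where "U = W \<inter> selB n (r + 5) X1 b t"
  have res: "mstep n (length f) e X1 b W \<sigma> = (F, v div M div M, R - U, cmb (R \<inter> U) y (selD n (r + 5) X1 t'))"
    unfolding mstep_def stg_def \<sigma> U_def t_def t'_def M_def r_def by (simp add: Let_def)
  \<comment> \<open>\<open>b \<le> r + 5\<close> keeps the bits read within the block of variable
    \<open>i\<close>.\<close>
  have inU: "(\<forall>v<b. s 30 (t * N1 + i * (r + 5) + v) \<noteq> 0) \<and> s 72 i = s 84 0 \<longleftrightarrow> i \<in> U" if i: "i < n" for i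
  proof -
    have "i * (r + 5) + v < N1" if "v < b" for v unfolding dN using block_less[OF i, of v "r + 5"] that b'(1) by simp
    then show ?thesis unfolding U_def selB_def using W[OF i] i sX by (auto simp: add.assoc)
  qed
  have inD: "s 30 (t' * N1 + i * (r + 5)) \<noteq> 0 \<longleftrightarrow> i \<in> selD n (r + 5) X1 t'" if i: "i < n" for i
  proof -
    have "i * (r + 5) < N1" unfolding dN using block_less[OF i, of 0 "r + 5"] by simp
    then show ?thesis unfolding selD_def using i sX by auto
  qed
  show ?thesis unfolding stageC_def
  proof ((intro vcg; (simp; fail)?), rule runs_use[OF runs_dm[where v=v and M=M]], goal_cases)
    case (7 s1)
    have f1: "s1 a = s a" if "a \<notin> {60, 83, 90, 104}" for a using 7(2)[of a] that by (simp add: mods_dm)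
    show ?case
    proof (intro vcg, rule runs_use[OF runs_dm[where v="v div M" and M=M]], goal_cases)
      case (7 s2)
      have f2: "s2 a = s a" if "a \<notin> {60, 83, 90, 91, 104}" for a using 7(2)[of a] f1[of a] that by (simp add: mods_dm)
      have v2: "s2 90 0 = t" "s2 91 0 = t'" "s2 83 0 = v div M div M"
        using 7 \<open>s1 90 0 = v mod M \<and> s1 83 0 = v div M\<close> by (simp_all add: mods_dm t_def t'_def)
      show ?case
      proof (intro vcg, rule runs_use[OF runs_addmul[where N=t and x=N1]], goal_cases)
        case (12 s3)
        have f3: "s3 a = s2 a" if "a \<notin> {60, 92}" for a using 12(2)[of a] that by (simp add: mods_simps2)
        have v3: "s3 92 0 = t * N1" using 12(1) by (simp add: vals_simps)
        show ?case
        proof (intro vcg, rule runs_use[OF runs_addmul[where N=t' and x=N1]], goal_cases)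
          case (12 s4)
          have f4: "s4 a = s2 a" if "a \<notin> {60, 92, 93}" for a using 12(2)[of a] f3[of a] that by (simp add: mods_simps2)
          have v4: "s4 93 0 = t' * N1" "s4 92 0 = t * N1" using 12 v3 by (simp_all add: vals_simps mods_simps2)
          define I where "I = (\<lambda>j (s' :: state). s' 92 0 = t * N1 + j * (r + 5) \<and> s' 93 0 = t' * N1 + j * (r + 5) \<and>
            (\<forall>i<n. s' 73 i = (if i < j \<and> s 73 i = 0 \<and> i \<in> U then 1 else s 73 i) \<and>
               s' 74 i = (if i < j \<and> s 73 i = 0 \<and> i \<in> U then of_bool (i \<in> selD n (r + 5) X1 t') else s 74 i)))"
          show ?case
          proof (intro vcg, rule runs_use[OF runs_for[where d=9 and N=n and I=I]], goal_cases)
            case 8 show ?case unfolding I_def using v4 f4[of 73] f4[of 74] f2[of 73] f2[of 74] by simp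
          next
            case 9 then show ?case unfolding I_def by simp
          next
            case (10 i s')
            have fr: "s' a = s a" if "a \<notin> {60, 73, 74, 83, 87, 88, 90, 91, 92, 93, 94, 104}" for a
              using 10(4)[of a] f4[of a] f2[of a] that by (simp add: mods_pickC)
            have p: "((\<forall>v<b. s' 30 (s' 92 0 + v) \<noteq> 0) \<and> s' 73 i = 0 \<and> s' 72 i = s' 84 0) \<longleftrightarrow> s 73 i = 0 \<and> i \<in> U"
              using inU[OF 10(1)] 10(1,2) fr[of 30] fr[of 72] fr[of 84] unfolding I_def by auto
            have q: "s' 30 (s' 93 0) \<noteq> 0 \<longleftrightarrow> i \<in> selD n (r + 5) X1 t'"
              using inD[OF 10(1)] 10(2) fr[of 30] unfolding I_def by auto
            show ?case
            proof (rule runs_use[OF runs_pickC[where b=b and i=i]], goal_cases)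
              case 1 show ?case using fr[of 15] fr[of 85] V b unfolding rho_def by simp
            next
              case (5 s5)
              have "s5 92 0 = s' 92 0 + (r + 5)" "s5 93 0 = s' 93 0 + (r + 5)" using 5(1) fr[of 16] V by simp_all
              moreover have "s5 73 = (if s 73 i = 0 \<and> i \<in> U then (s' 73)(i := 1) else s' 73)"
                "s5 74 = (if s 73 i = 0 \<and> i \<in> U then (s' 74)(i := of_bool (i \<in> selD n (r + 5) X1 t')) else s' 74)"
                using 5(1) unfolding p q Let_def by simp_all
              ultimately show ?case using 10(2) unfolding I_def by (auto simp: less_Suc_eq)
            qed (use b' 10(3) in auto)
          next
            case (12 s')
            have fr: "s' 83 0 = v div M div M" "s' 75 = s 75" using 12(2)[of 83] 12(2)[of 75] f4 f2 v2 by (simp_all add: mods_simps mods_pickC)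
            have le: "v div M div M \<le> v" by (meson div_le_dividend le_trans)
            have "live f s' = live f s" unfolding live_def fr ..
            then have "good_conf n f s' (mstep n (length f) e X1 b W \<sigma>)"
              using 12(1) g unfolding res unfolding \<sigma> good_conf_def I_def cmb_def
              by (auto simp: fr U_def selD_def selB_def)
            then show ?case using fr le v0 by (intro runl_Nil) auto
          qed (use V f4[of 0] f2[of 0] Hs in \<open>auto simp: mods_pickC\<close>)
        qed (use V v2 f3 f2 tM Hs in auto)
      qed (use V v2 f2 tM Hs in auto)
    qed (use V f1[of 22] 7 M0 v v0 in \<open>auto intro: le_trans[OF div_le_dividend]\<close>)
  qed (use V v v0 M0 in auto)
qed

lemma good_conf_upd: "good_conf n f s \<sigma> \<Longrightarrow> a \<notin> {73, 74, 75, 83} \<Longrightarrow> good_conf n f (s(a := x)) \<sigma>"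
  by (rule good_conf_frame[of n f s]) auto

definition widthC :: com where
  "widthC = If (Monus (Sc 15) (Sc 85)) (pow2 100 (Monus (Monus (Sc 15) (Sc 85)) (Num 1))) (SetS 100 (Num 0))"

lemma mods_widthC: "mods widthC = {60, 100}"
  unfolding widthC_def by (auto simp: mods_simps2)

lemma runs_widthC:
  assumes "s 15 0 \<le> H"
  shows "runs H 6 widthC s (\<lambda>s'. s' 100 0 = width (s 15 0 - s 85 0))"
  unfolding widthC_def
proof (rule runs_if, goal_cases)
  case 3
  show ?case
    by (rule runs_use[OF runs_pow2[where N="s 15 0 - s 85 0 - 1"]])
      (use 3 assms in \<open>auto simp: vals_simps width_def\<close>)
next
  case 4
  then show ?case by (intro runs_sets) (auto simp: width_def)
qed auto

lemma runs_trim: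
  assumes e: "env n f e X1 X2 s" "is_dnf n f" and H: "pH n (length f) e \<le> H"
    and g: "good_conf n f s \<sigma>" and w: "s 100 0 = w"
    and W: "\<And>i. i < n \<Longrightarrow> s 72 i = s 84 0 \<longleftrightarrow> i \<in> W"
  shows "runs H 6 narrowC s (\<lambda>s'. good_conf n f s' (trim W w \<sigma>))"
proof (rule runs_use[OF narrowC_correct[where s=s and \<beta>="s 84 0", OF _ e(2) _ refl w]])
  show "inputs n f s" using e unfolding env_def by simp
  show "length f * (2 * n + 1) \<le> H" using H unfolding pH_def loop_bounds_def by simp
  fix s' assume "\<forall>j. s' 75 j = (if j < length f \<and> w < free_lits s (s 84 0) (f ! j) then 1 else s 75 j)"
    "\<And>a. a \<notin> mods narrowC \<Longrightarrow> s' a = s a"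
  then show "good_conf n f s' (trim W w \<sigma>)"
    by (intro good_conf_trim[OF e(2) g W]) (auto simp: mods_narrowC)
qed simp

definition phaseC :: com where
  "phaseC = seqs [For 86 (Sc 28) stageC, widthC, narrowC]"

lemma mods_phaseC: "mods phaseC = {60, 73, 74, 75, 83, 86, 87, 88, 89, 90, 91, 92, 93, 94, 98, 99, 100, 104}"
  unfolding phaseC_def by (auto simp: mods_simps mods_stageC mods_widthC mods_narrowC)

definition mphs :: "nat \<Rightarrow> nat \<Rightarrow> nat \<Rightarrow> (nat \<Rightarrow> nat set) \<Rightarrow> nat set \<Rightarrow> nat \<Rightarrow> conf \<Rightarrow> conf" where
  "mphs n m e X1 = phs (2 ^ (8 * pK1 n m e)) (selB n (pR n m e + 5) X1) (selD n (pR n m e + 5) X1) (256 * pR n m e)"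

lemma mphs_eq: "mphs n m e X1 W a \<sigma> = trim W (width a) ((mstep n m e X1 (a + 5) W ^^ (256 * pR n m e)) \<sigma>)"
  unfolding mphs_def mstep_def phs_def ..

lemma phaseC_correct:
  assumes e: "env n f e X1 X2 s" "is_dnf n f" and H: "pH n (length f) e \<le> H"
    and g: "good_conf n f s \<sigma>" and v: "s 83 0 \<le> H"
    and W: "\<And>i. i < n \<Longrightarrow> s 72 i = s 84 0 \<longleftrightarrow> i \<in> W"
  shows "runs H 12 phaseC s (\<lambda>s'. good_conf n f s' (mphs n (length f) e X1 W (pRho n (length f) e - s 85 0) \<sigma>) \<and> s' 83 0 \<le> s 83 0)"
  unfolding phaseC_def
proof ((intro vcg; (simp; fail)?), goal_cases)
  case 1
  define b where "b = pRho n (length f) e - s 85 0 + 5"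
  define L where "L = 256 * pR n (length f) e"
  have V: "s 15 0 = pRho n (length f) e" "s 28 0 = L"
    using e unfolding env_def pvals_def vals_def L_def by auto
  have Hs: "L \<le> H" "pRho n (length f) e \<le> H" using H unfolding pH_def loop_bounds_def L_def by auto
  show ?case
  proof (rule runs_use[OF runs_for[where d=11 and N=L and
      I="\<lambda>i s'. good_conf n f s' ((mstep n (length f) e X1 b W ^^ i) \<sigma>) \<and> s' 83 0 \<le> s 83 0"]], goal_cases)
    case 9 then show ?case by (auto intro: good_conf_upd)
  next
    case (10 i s')
    have fr: "s' a = s a" if "a \<notin> {60, 73, 74, 83, 86, 87, 88, 90, 91, 92, 93, 94, 104}" for a
      using 10(4)[of a] that by (simp add: mods_stageC)
    show ?case
    proof (rule runs_use[OF stageC_correct[where s=s' and \<sigma>="(mstep n (length f) e X1 b W ^^ i) \<sigma>" and b=b and W=W and f=f and n=n and e=e and ?X1.0=X1 and ?X2.0=X2]], goal_cases)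
      case 1 show ?case by (rule env_frame[OF e(1)]) (rule fr, auto simp: fixed_def)
    next
      case 3 show ?case using 10(2) by blast
    next
      case (6) show ?case using fr[of 85] unfolding b_def by simp
    next
      case (5 i) then show ?case using W fr[of 72] fr[of 84] by simp
    qed (use H v 10(2) in auto)
  next
    case (12 s1)
    have f1: "s1 a = s a" if "a \<notin> {60, 73, 74, 83, 86, 87, 88, 90, 91, 92, 93, 94, 104}" for a
      using 12(2)[of a] that by (simp add: mods_simps mods_stageC)
    show ?case
    proof (intro vcg, rule runs_use[OF runs_widthC], goal_cases)
      case (3 s2)
      have f2: "s2 a = s1 a" if "a \<notin> {60, 100}" for a using 3(2)[of a] that by (simp add: mods_widthC)
      show ?case
      proof (intro vcg, rule runs_use[OF runs_trim[where s=s2 and \<sigma>="(mstep n (length f) e X1 b W ^^ L) \<sigma>" and w="s2 100 0" and W=W and f=f and n=n and e=e and ?X1.0=X1 and ?X2.0=X2]], goal_cases)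
        case 1 show ?case by (rule env_frame[OF e(1)]) (use f1 f2 in \<open>auto simp: fixed_def\<close>)
      next
        case 4 show ?case by (rule good_conf_frame[of n f s1]) (use 12(1) f2 in auto)
      next
        case (6 i) then show ?case using W f1 f2 by simp
      next
        case (8 s')
        have "s' 83 = s1 83" using 8(2)[of 83] f2[of 83] by (simp add: mods_narrowC)
        moreover have "s2 100 0 = width (pRho n (length f) e - s 85 0)" using 3(1) f1 V by simp
        ultimately show ?case using 8(1) 12(1) unfolding mphs_eq b_def L_def by (intro runl_Nil) auto
      qed (use e H in auto)
    qed (use V f1[of 15] Hs in auto)
  qed (use V Hs g in \<open>auto simp: mods_stageC\<close>)
qed

text \<open>The counter 85 goes up from 0 while the width exponent, \<open>15\<close> minus
  \<open>85\<close> in terms of the arrays, goes down to 0.\<close>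

definition bucketC :: com where
  "bucketC = For 85 (Plus (Sc 15) (Num 1)) phaseC"

lemma mods_bucketC: "mods bucketC = {60, 73, 74, 75, 83, 85, 86, 87, 88, 89, 90, 91, 92, 93, 94, 98, 99, 100, 104}"
  unfolding bucketC_def by (auto simp: mods_simps mods_phaseC)

definition mbkt :: "nat \<Rightarrow> nat \<Rightarrow> nat \<Rightarrow> (nat \<Rightarrow> nat set) \<Rightarrow> nat set \<Rightarrow> conf \<Rightarrow> conf" where
  "mbkt n m e X1 = bkt (2 ^ (8 * pK1 n m e)) (selB n (pR n m e + 5) X1) (selD n (pR n m e + 5) X1) (256 * pR n m e) (pRho n m e)"

lemma mbkt_eq: "mbkt n m e X1 W = fold (mphs n m e X1 W) (rev [0..<Suc (pRho n m e)])"
  unfolding mbkt_def bkt_def mphs_def ..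

lemma bucketC_correct:
  assumes e: "env n f e X1 X2 s" "is_dnf n f" and H: "pH n (length f) e \<le> H"
    and g: "good_conf n f s \<sigma>" and v: "s 83 0 \<le> H"
    and W: "\<And>i. i < n \<Longrightarrow> s 72 i = s 84 0 \<longleftrightarrow> i \<in> W"
  shows "runs H 13 bucketC s (\<lambda>s'. good_conf n f s' (mbkt n (length f) e X1 W \<sigma>) \<and> s' 83 0 \<le> s 83 0)"
proof -
  define a where "a = pRho n (length f) e"
  have V: "s 15 0 = a" using e unfolding env_def pvals_def vals_def a_def by auto
  have Hs: "Suc a \<le> H" using H unfolding pH_def loop_bounds_def a_def by auto
  let ?ph = "mphs n (length f) e X1 W"
  show ?thesis unfolding bucketC_def
  proof (rule runs_use[OF runs_for[where d=13 and N="Suc a" and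
      I="\<lambda>q s'. good_conf n f s' (fold ?ph (take q (rev [0..<Suc a])) \<sigma>) \<and> s' 83 0 \<le> s 83 0"]], goal_cases)
    case 9 then show ?case by (auto intro: good_conf_upd)
  next
    case (10 q s')
    have fr: "s' a = s a" if "a \<notin> {60, 73, 74, 75, 83, 85, 86, 87, 88, 89, 90, 91, 92, 93, 94, 98, 99, 100, 104}" for a
      using 10(4)[of a] that by (simp add: mods_phaseC)
    have q: "take (Suc q) (rev [0..<Suc a]) = take q (rev [0..<Suc a]) @ [a - q]"
      using 10(1) take_Suc_conv_app_nth[of q "rev [0..<Suc a]"] by (simp add: rev_nth del: upt_Suc)
    show ?case
    proof (rule runs_use[OF phaseC_correct[where s=s' and \<sigma>="fold ?ph (take q (rev [0..<Suc a])) \<sigma>" and W=W and f=f and n=n and e=e and ?X1.0=X1 and ?X2.0=X2]], goal_cases)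
      case 1 show ?case by (rule env_frame[OF e(1)]) (rule fr, auto simp: fixed_def)
    next
      case 4 show ?case using 10(2) by blast
    next
      case (6 i) then show ?case using W fr[of 72] fr[of 84] by simp
    next
      case (8 s'') then show ?case using 10(2,3) unfolding q a_def[symmetric] by auto
    qed (use e H v 10(2) in auto)
  next
    case (12 s') then show ?case unfolding mbkt_eq a_def[symmetric] by (simp del: upt_Suc)
  qed (use V Hs g in \<open>auto simp: mods_phaseC\<close>)
qed

definition evalC :: com where
  "evalC = seqs [hashC, initC, For 84 (Sc 19) (seqs [SetS 100 (Sc 16), narrowC]), For 84 (Sc 19) bucketC, finalC]"

lemma mods_evalC: "mods evalC = {60, 72, 73, 74, 75, 83, 84, 85, 86, 87, 88, 89, 90, 91, 92, 93, 94, 95, 96, 97, 98, 99, 100, 101, 104}"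
  unfolding evalC_def by (auto simp: mods_simps mods_hashC mods_initC mods_narrowC mods_bucketC mods_finalC)

definition outcome :: "nat \<Rightarrow> dnf \<Rightarrow> nat \<Rightarrow> (nat \<Rightarrow> nat set) \<Rightarrow> (nat \<Rightarrow> nat set) \<Rightarrow> nat \<Rightarrow> nat \<Rightarrow> nat \<Rightarrow> bool" where
  "outcome n f e X1 X2 su u v = (let m = length f; r = pR n m e; c = pC n m e in
     accepts (fold (mbkt n m e X1) (map (bset r c X1 X2 su u) [0..<2 ^ c])
       (filter (light n r c X1 X2 su u) (map tm (filter consistent f)), v, {..<n}, {})))"

text \<open>No variable is assigned yet, so trimming to width \<open>r\<close> once for every bucket
  gives the filter \<open>light\<close>.\<close>

lemma fold_trim: "fold (\<lambda>\<beta>. trim (Wf \<beta>) w) [0..<j] (F, v, R, y)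
    = (filter (\<lambda>T. \<forall>\<beta><j. card (fst T \<inter> (R \<inter> Wf \<beta>)) \<le> w) F, v, R, y)"
  by (induction j) (auto simp: trim_def narrow_def less_Suc_eq intro!: filter_cong)

lemma evalC_correct:
  assumes e: "env n f e X1 X2 s" "is_dnf n f" and H: "pH n (length f) e \<le> H"
    and su: "s 80 0 = su" "su \<le> H" "s 81 0 = u" "u \<le> H" "s 82 0 = v" "v \<le> H"
  shows "runs H 15 evalC s (\<lambda>s'. s' 101 0 = of_bool (outcome n f e X1 X2 su u v))"
  unfolding evalC_def
proof ((intro vcg; (simp; fail)?), goal_cases)
  case 1
  define r where "r = pR n (length f) e"
  define c where "c = pC n (length f) e"
  define Wf where "Wf = bset r c X1 X2 su u"
  define \<sigma>0 :: conf where "\<sigma>0 = (map tm (filter consistent f), v, {..<n}, {})"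
  define \<sigma>1 where "\<sigma>1 = fold (\<lambda>\<beta>. trim (Wf \<beta>) r) [0..<2 ^ c] \<sigma>0"
  have V: "s 19 0 = 2 ^ c" "s 16 0 = r" "s 0 0 = n" "s 0 1 = length f"
    using e unfolding env_def pvals_def vals_def r_def c_def by auto
  have Hs: "2 ^ c \<le> H" "n \<le> H" "length f \<le> H" "length f * (2 * n + 1) \<le> H" using H unfolding pH_def loop_bounds_def c_def by auto
  show ?case
  proof (rule runs_use[OF hashC_correct[OF e(1) H su(1-4)]], goal_cases)
    case (2 s1)
    have f1: "s1 a = s a" if "a \<notin> {60, 72, 87, 88, 92, 93, 95, 96, 97, 104}" for a
      using 2(2)[of a] that by (simp add: mods_hashC)
    have bk: "s1 72 i = \<beta> \<longleftrightarrow> i \<in> Wf \<beta>" if "i < n" for i \<beta>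
      using 2(1) that unfolding Wf_def bset_def hash_def r_def c_def by auto
    show ?case
    proof (intro vcg, rule runs_use[OF initC_correct[where n=n and f=f]], goal_cases)
      case (6 s2)
      have f2: "s2 a = s1 a" if "a \<notin> {73, 74, 75, 83, 87, 98}" for a
        using 6(2)[of a] that by (simp add: mods_initC)
      have g2: "good_conf n f s2 \<sigma>0" using 6(1) f1 su unfolding \<sigma>0_def by simp
      have e2: "env n f e X1 X2 s2" by (rule env_frame[OF e(1)]) (use f1 f2 in \<open>auto simp: fixed_def\<close>)
      show ?case
      proof (intro vcg, rule runs_use[OF runs_for[where d=8 and N="2 ^ c" and
          I="\<lambda>j s'. good_conf n f s' (fold (\<lambda>\<beta>. trim (Wf \<beta>) r) [0..<j] \<sigma>0)"]], goal_cases)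
        case 9 then show ?case by (auto intro: good_conf_upd)
      next
        case (10 j s')
        have fr: "s' a = s2 a" if "a \<notin> {75, 84, 89, 98, 99, 100}" for a
          using 10(4)[of a] that by (simp add: mods_simps mods_narrowC)
        have e': "env n f e X1 X2 s'" by (rule env_frame[OF e2]) (rule fr, auto simp: fixed_def)
        have w: "s' 16 0 = r" using fr f2 f1 V by simp
        let ?s = "s'(100 := (s' 100)(0 := aval (Sc 16) s'))"
        show ?case
        proof ((intro vcg; (simp; fail)?), rule runs_use[OF runs_trim[where s="?s" and \<sigma>="fold (\<lambda>\<beta>. trim (Wf \<beta>) r) [0..<j] \<sigma>0" and w=r and W="Wf j" and f=f and n=n and e=e and ?X1.0=X1 and ?X2.0=X2]], goal_cases)
          case 1 show ?case by (rule env_frame[OF e']) (auto simp: fixed_def)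
        next
          case 4 show ?case by (rule good_conf_frame[OF 10(2)]) auto
        next
          case (6 i)
          have "s' 84 0 = j" "s' 72 = s1 72" using 10(3) fr[of 72] f2[of 72] by simp_all
          then show ?case using 6 bk by simp
        next
          case (8 s'') then show ?case by (intro runl_Nil) simp
        qed (use e H w in auto)
      next
        case (12 s3)
        have f3: "s3 a = s2 a" if "a \<notin> {75, 84, 89, 98, 99, 100}" for a
          using 12(2)[of a] that by (simp add: mods_simps mods_narrowC)
        have g3: "good_conf n f s3 \<sigma>1" using 12(1) unfolding \<sigma>1_def .
        have e3: "env n f e X1 X2 s3" by (rule env_frame[OF e2]) (use f3 in \<open>auto simp: fixed_def\<close>)
        have v3: "s3 83 0 = v"
          using g2 f3 unfolding good_conf_def \<sigma>0_def by simp
        show ?case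
        proof (intro vcg, rule runs_use[OF runs_for[where d=14 and N="2 ^ c" and
            I="\<lambda>j s'. good_conf n f s' (fold (mbkt n (length f) e X1) (map Wf [0..<j]) \<sigma>1) \<and> s' 83 0 \<le> v"]], goal_cases)
          case 9 then show ?case by (auto intro: good_conf_upd)
        next
          case (10 j s')
          have fr: "s' a = s3 a" if "a \<notin> {60, 73, 74, 75, 83, 84, 85, 86, 87, 88, 89, 90, 91, 92, 93, 94, 98, 99, 100, 104}" for a
            using 10(4)[of a] that by (simp add: mods_bucketC)
          show ?case
          proof (rule runs_use[OF bucketC_correct[where s=s' and \<sigma>="fold (mbkt n (length f) e X1) (map Wf [0..<j]) \<sigma>1" and W="Wf j" and f=f and n=n and e=e and ?X1.0=X1 and ?X2.0=X2]], goal_cases)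
            case 1 show ?case by (rule env_frame[OF e3]) (rule fr, auto simp: fixed_def)
          next
            case 4 show ?case using 10(2) by blast
          next
            case (6 i)
            have "s' 84 0 = j" "s' 72 = s1 72" using 10(3) fr[of 72] f3[of 72] f2[of 72] by simp_all
            then show ?case using 6 bk by simp
          next
            case (8 s'') then show ?case using 10(2) by auto
          qed (use e H su 10(2) in auto)
        next
          case (12 s4)
          have f4: "s4 a = s3 a" if "a \<notin> {60, 73, 74, 75, 83, 84, 85, 86, 87, 88, 89, 90, 91, 92, 93, 94, 98, 99, 100, 104}" for a
            using 12(2)[of a] that by (simp add: mods_simps mods_bucketC)
          have e4: "inputs n f s4" by (rule inputs_frame[of n f s3]) (use f4 e3 in \<open>auto simp: env_def\<close>)
          have o: "outcome n f e X1 X2 su u v = accepts (fold (mbkt n (length f) e X1) (map Wf [0..<2 ^ c]) \<sigma>1)"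
            unfolding outcome_def \<sigma>1_def \<sigma>0_def fold_trim Let_def light_def r_def[symmetric] c_def[symmetric] Wf_def ..
          show ?case
          proof (intro vcg, rule runs_use[OF finalC_correct[OF e4 e(2) Hs(4)]], goal_cases)
            case (2 s5)
            then show ?case unfolding o using good_conf_accepts[OF e(2) conjunct1[OF 12(1)]] by (intro runl_Nil) simp
          qed simp
        qed (use V f1 f2 f3 Hs g3 v3 in \<open>auto simp: mods_bucketC\<close>)
      qed (use V f1 f2 Hs g2 in \<open>auto simp: mods_simps mods_narrowC\<close>)
    qed (use V f1[of 0] Hs in auto)
  qed simp
qed

section \<open>Counting the accepting seeds\<close>

definition tablesC :: com where
  "tablesC = For 87 (Sc 0) (seqs [
     Assign 70 (Plus (Plus (Sc 87) (Sc 87)) (Num 1)) (Sc 87), Assign 71 (Plus (Plus (Sc 87) (Sc 87)) (Num 1)) (Num 1),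
     Assign 70 (Plus (Plus (Sc 87) (Sc 87)) (Num 2)) (Sc 87), Assign 71 (Plus (Plus (Sc 87) (Sc 87)) (Num 2)) (Num 0)])"

lemma mods_tablesC: "mods tablesC = {70, 71, 87}"
  unfolding tablesC_def by (auto simp: mods_simps)

lemma lit_code_eq: "lit_code l = 2 * i + 1 \<longleftrightarrow> l = Pos i" "lit_code l = 2 * i + 2 \<longleftrightarrow> l = Neg i"
  by (cases l; simp; presburger)+

lemma runs_tablesC:
  assumes "s 0 0 = n" "n \<le> H"
  shows "runs H 4 tablesC s (\<lambda>s'. \<forall>l. lit_var l < n \<longrightarrow> s' 70 (lit_code l) = lit_var l \<and> s' 71 (lit_code l) = pol l)"
  unfolding tablesC_def
proof (rule runs_use[OF runs_for[where d=4 and N=n and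
    I="\<lambda>j s'. \<forall>l. lit_var l < j \<longrightarrow> s' 70 (lit_code l) = lit_var l \<and> s' 71 (lit_code l) = pol l"]], goal_cases)
  case (10 j s')
  have l: "lit_code l = Suc (j + j) \<longleftrightarrow> l = Pos j" "lit_code l = j + j + 2 \<longleftrightarrow> l = Neg j" for l
    using lit_code_eq[of l j] by (simp_all add: mult_2)
  have v: "lit_var l < Suc j \<longleftrightarrow> lit_var l < j \<or> l = Pos j \<or> l = Neg j" for l
    by (cases l) auto
  show ?case
    by ((intro vcg; (simp; fail)?), goal_cases) (use 10(2,3) in \<open>auto simp: l l[simplified] v\<close>)
qed (use assms in \<open>auto simp: mods_simps\<close>)

text \<open>The nested loops have \<open>pJ\<close> rounds in total, and each round multiplies by
  \<open>M\<close> twice, once for either sample of a stage.\<close>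

definition totC :: com where
  "totC = seqs [SetS 29 (Num 1), For 61 (Sc 19) (For 62 (Plus (Sc 15) (Num 1)) (For 63 (Sc 28)
     (seqs [addmul 12 (Sc 29) (Sc 22), SetS 29 (Sc 12), addmul 12 (Sc 29) (Sc 22), SetS 29 (Sc 12)])))]"

lemma mods_totC: "mods totC = {12, 29, 60, 61, 62, 63}"
  unfolding totC_def by (auto simp: mods_simps2)

lemma runs_totC:
  assumes V: "s 19 0 = k" "s 15 0 = a" "s 28 0 = L" "s 22 0 = M"
    and Hs: "k \<le> H" "a + 1 \<le> H" "L \<le> H" "M \<le> H"
  shows "runs H 10 totC s (\<lambda>s'. s' 29 0 = M ^ (2 * (k * (a + 1) * L)))"
proof -
  define b where "b = seqs [addmul 12 (Sc 29) (Sc 22), SetS 29 (Sc 12), addmul 12 (Sc 29) (Sc 22), SetS 29 (Sc 12)]"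
  have mb: "mods b = {12, 29, 60}" unfolding b_def by (auto simp: mods_simps2)
  have body: "runs H 6 b s (\<lambda>s'. s' 29 0 = M * M * x)" if "s 29 0 = x" "s 22 0 = M" for s x
    unfolding b_def
  proof ((intro vcg; (simp; fail)?), rule runs_use[OF runs_addmul[where N=M and x=x]], goal_cases)
    case (12 s1)
    show ?case
    proof ((intro vcg; (simp; fail)?), rule runs_use[OF runs_addmul[where N=M and x="M * x"]], goal_cases)
      case (12 s2)
      then show ?case by ((intro vcg; (simp; fail)?)) (simp add: vals_simps)
    qed (use that 12 Hs in \<open>auto simp: vals_simps mods_simps2\<close>)
  qed (use that Hs in auto)
  have loop1: "runs H 7 (For 63 (Sc 28) b) s (\<lambda>s'. s' 29 0 = M ^ (2 * L) * x)"
    if "s 29 0 = x" "s 22 0 = M" "s 28 0 = L" for s x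
  proof (rule runs_use[OF runs_for[where d=7 and N=L and I="\<lambda>i s'. s' 29 0 = M ^ (2 * i) * x"]], goal_cases)
    case (10 i s')
    show ?case by (rule runs_use[OF body]) (use 10 that 10(4)[of 22] in \<open>auto simp: mb\<close>)
  qed (use that Hs in \<open>auto simp: mb\<close>)
  have loop2: "runs H 8 (For 62 (Plus (Sc 15) (Num 1)) (For 63 (Sc 28) b)) s (\<lambda>s'. s' 29 0 = M ^ (2 * ((a + 1) * L)) * x)"
    if "s 29 0 = x" "s 22 0 = M" "s 28 0 = L" "s 15 0 = a" for s x
  proof (rule runs_use[OF runs_for[where d=8 and N="a + 1" and I="\<lambda>i s'. s' 29 0 = M ^ (2 * (i * L)) * x"]], goal_cases)
    case (10 i s')
    show ?case
      by (rule runs_use[OF loop1]) (use 10 that 10(4)[of 22] 10(4)[of 28] in \<open>auto simp: mb mods_simps power_add algebra_simps\<close>)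
  qed (use that Hs in \<open>auto simp: mb mods_simps\<close>)
  show ?thesis unfolding totC_def b_def[symmetric]
  proof ((intro vcg; (simp; fail)?), goal_cases)
    case 1
    show ?case
    proof (rule runs_use[OF runs_for[where d=9 and N=k and I="\<lambda>i s'. s' 29 0 = M ^ (2 * (i * (a + 1) * L))"]], goal_cases)
      case (10 i s')
      show ?case
        by (rule runs_use[OF loop2])
          (use 10 V 10(4)[of 22] 10(4)[of 28] 10(4)[of 15] in \<open>auto simp: mb mods_simps power_add algebra_simps\<close>)
    next
      case (12 s') then show ?case by (intro runl_Nil) simp
    qed (use V Hs in \<open>auto simp: mb mods_simps\<close>)
  qed
qed

definition countC :: com where
  "countC = For 80 (Sc 22) (For 81 (Sc 26) (For 82 (Sc 29)
     (seqs [evalC, SetS 102 (Plus (Sc 102) (Sc 101)), SetS 103 (Plus (Sc 103) (Num 1))])))"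

lemma countC_correct:
  assumes e: "env n f e X1 X2 s" "is_dnf n f" and H: "pH n (length f) e \<le> H" and tot: "s 29 0 = pTot n (length f) e"
    and z: "s 102 0 = 0" "s 103 0 = 0"
    and M: "M1 = 2 ^ (8 * pK1 n (length f) e)" "M2 = 2 ^ (8 * pK2 n (length f) e)" "Tot = pTot n (length f) e"
  shows "runs H 19 countC s (\<lambda>s'. s' 102 0 = (\<Sum>su<M1. \<Sum>u<M2. \<Sum>v<Tot. of_bool (outcome n f e X1 X2 su u v)) \<and>
    s' 103 0 = M1 * (M2 * Tot))"
proof -
  define o' :: "nat \<Rightarrow> nat \<Rightarrow> nat \<Rightarrow> nat" where "o' su u v = of_bool (outcome n f e X1 X2 su u v)" for su u v
  define b where "b = seqs [evalC, SetS 102 (Plus (Sc 102) (Sc 101)), SetS 103 (Plus (Sc 103) (Num 1))]"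
  have mb: "mods b = {60, 72, 73, 74, 75, 83, 84, 85, 86, 87, 88, 89, 90, 91, 92, 93, 94, 95, 96, 97, 98, 99, 100, 101, 102, 103, 104}"
    unfolding b_def by (auto simp: mods_simps mods_evalC)
  have Hs: "M1 \<le> H" "M2 \<le> H" "Tot \<le> H" using H unfolding M pH_def loop_bounds_def by auto
  define ok where "ok s \<longleftrightarrow> env n f e X1 X2 s \<and> s 29 0 = Tot" for s
  have ok_frame: "ok s'" if "ok s" "\<And>a. a \<in> insert 29 fixed \<Longrightarrow> s' a = s a" for s s'
    using env_frame[of n f e X1 X2 s s'] that unfolding ok_def by auto
  have V: "s 22 0 = M1" "s 26 0 = M2" if "ok s" for s
    using that unfolding ok_def env_def pvals_def vals_def M by auto
  have body: "runs H 16 b s (\<lambda>s'. s' 102 0 = s 102 0 + o' su u v \<and> s' 103 0 = s 103 0 + 1)"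
    if "ok s" "s 80 0 = su" "su < M1" "s 81 0 = u" "u < M2" "s 82 0 = v" "v < Tot" for s su u v
    unfolding b_def
  proof ((intro vcg; (simp; fail)?), rule runs_use[OF evalC_correct[where s=s and ?X1.0=X1 and ?X2.0=X2, OF _ e(2) H that(2) _ that(4) _ that(6)]], goal_cases)
    case (6 s1)
    then show ?case
      by ((intro vcg; (simp; fail)?)) (auto simp: mods_evalC o'_def)
  qed (use that Hs in \<open>auto simp: ok_def\<close>)
  have loop1: "runs H 17 (For 82 (Sc 29) b) s (\<lambda>s'. s' 102 0 = s 102 0 + (\<Sum>v<Tot. o' su u v) \<and> s' 103 0 = s 103 0 + Tot)"
    if k: "ok s" "s 80 0 = su" "su < M1" "s 81 0 = u" "u < M2" for s su u
  proof (rule runs_use[OF runs_for[where d=17 and N=Tot and I="\<lambda>i s'. s' 102 0 = s 102 0 + (\<Sum>v<i. o' su u v) \<and> s' 103 0 = s 103 0 + i"]], goal_cases)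
    case (10 i s')
    have fr: "s' a = s a" if "a \<in> insert 29 (insert 80 (insert 81 fixed))" for a
      using 10(4)[of a] that by (auto simp: mb fixed_def)
    have k': "ok s'" by (rule ok_frame[OF k(1)]) (use fr in auto)
    show ?case by (rule runs_use[OF body[OF k' _ k(3) _ k(5)]]) (use fr k 10 in auto)
  qed (use k Hs in \<open>auto simp: mb ok_def\<close>)
  have loop2: "runs H 18 (For 81 (Sc 26) (For 82 (Sc 29) b)) s (\<lambda>s'. s' 102 0 = s 102 0 + (\<Sum>u<M2. \<Sum>v<Tot. o' su u v) \<and> s' 103 0 = s 103 0 + M2 * Tot)"
    if k: "ok s" "s 80 0 = su" "su < M1" for s su
  proof (rule runs_use[OF runs_for[where d=18 and N=M2 and I="\<lambda>i s'. s' 102 0 = s 102 0 + (\<Sum>u<i. \<Sum>v<Tot. o' su u v) \<and> s' 103 0 = s 103 0 + i * Tot"]], goal_cases)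
    case (10 i s')
    have fr: "s' a = s a" if "a \<in> insert 29 (insert 80 fixed)" for a
      using 10(4)[of a] that by (auto simp: mb mods_simps fixed_def)
    have k': "ok s'" by (rule ok_frame[OF k(1)]) (use fr in auto)
    show ?case by (rule runs_use[OF loop1[OF k' _ k(3)]]) (use fr k 10 in auto)
  qed (use k Hs V in \<open>auto simp: mb mods_simps\<close>)
  have ok: "ok s" unfolding ok_def using e tot M by simp
  show ?thesis unfolding countC_def b_def[symmetric]
  proof (rule runs_use[OF runs_for[where d=19 and N=M1 and I="\<lambda>i s'. s' 102 0 = (\<Sum>su<i. \<Sum>u<M2. \<Sum>v<Tot. o' su u v) \<and> s' 103 0 = i * (M2 * Tot)"]], goal_cases)
    case (10 i s')
    have fr: "s' a = s a" if "a \<in> insert 29 fixed" for a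
      using 10(4)[of a] that by (auto simp: mb mods_simps fixed_def)
    have k': "ok s'" by (rule ok_frame[OF ok]) (use fr in auto)
    show ?case by (rule runs_use[OF loop2[OF k']]) (use 10 in auto)
  next
    case (12 s') then show ?case unfolding o'_def by simp
  qed (use z ok V Hs in \<open>auto simp: mb mods_simps\<close>)
qed

section \<open>The algorithm\<close>

definition algo :: com where
  "algo = seqs [params, SetS 50 (Sc 21), SetS 51 (Sc 20), SetS 52 (Sc 22), sampler 30,
     SetS 50 (Sc 25), SetS 51 (Sc 23), SetS 52 (Sc 26), sampler 31, tablesC, totC,
     SetS 102 (Num 0), SetS 103 (Num 0), countC, Assign 3 (Num 0) (Sc 102), Assign 3 (Num 1) (Sc 103)]"

text \<open>The requirement of \<open>greedy_almost\<close> on the number of bits. It holds because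
  \<open>clog n \<le> 2 ^ g\<close> and \<open>g < r\<close>, so \<open>n\<close> is at most doubly
  exponential in \<open>r\<close>.\<close>

lemma size_bounds:
  shows "pN1 n m e + 1 \<le> 2 ^ (2 ^ pK1 n m e)" "pN2 n m e + 1 \<le> 2 ^ (2 ^ pK2 n m e)"
proof -
  define r where "r = pR n m e"
  define g where "g = pG n m e"
  have r: "4 * g + 128 \<le> r" unfolding r_def g_def pR_def pRho_def using clog_le[of "4 * pG n m e + 2 * e + 128"] by linarith
  have n: "n \<le> 2 ^ (2 ^ g)"
  proof -
    have "clog n \<le> 2 ^ g" unfolding g_def pG_def using clog_le[of "pLam n m e"] unfolding pLam_def by linarith
    then have "(2::nat) ^ clog n \<le> 2 ^ (2 ^ g)" by (intro power_increasing) auto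
    then show ?thesis using clog_le[of n] by linarith
  qed
  have "pN1 n m e + 1 \<le> 2 ^ (2 ^ g) * (r + 6)"
  proof -
    have "pN1 n m e + 1 \<le> 2 ^ (2 ^ g) * (r + 5) + 2 ^ (2 ^ g)"
      unfolding pN1_def r_def[symmetric] using n by (intro add_mono mult_right_mono) auto
    then show ?thesis by (simp add: algebra_simps)
  qed
  also have "\<dots> \<le> 2 ^ (2 ^ g) * 2 ^ (r + 3)"
  proof (intro mult_left_mono)
    have "r + 6 \<le> 2 ^ r * 8" using less_exp[of r] by linarith
    then show "r + 6 \<le> 2 ^ (r + 3)" by (simp add: power_add)
  qed simp
  also have "\<dots> = 2 ^ (2 ^ g + (r + 3))" by (simp add: power_add)
  also have "\<dots> \<le> 2 ^ (2 ^ pK1 n m e)"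
  proof (intro power_increasing)
    have "2 ^ g + (r + 3) \<le> 2 ^ r + 2 ^ (r + 2)"
    proof (intro add_mono)
      show "(2::nat) ^ g \<le> 2 ^ r" using r by (intro power_increasing) auto
      have "r + 3 \<le> 2 ^ r * 4" using less_exp[of r] by linarith
      then show "r + 3 \<le> 2 ^ (r + 2)" by (simp add: power_add)
    qed
    also have "\<dots> \<le> 2 ^ (r * 5)"
    proof -
      have "(2::nat) ^ r + 2 ^ (r + 2) = 5 * 2 ^ r" by simp
      also have "\<dots> \<le> 2 ^ 3 * 2 ^ r" by simp
      also have "\<dots> = 2 ^ (r + 3)" by (simp add: power_add)
      also have "\<dots> \<le> 2 ^ (r * 5)" using r by (intro power_increasing) auto
      finally show ?thesis .
    qed
    also have "\<dots> \<le> 2 ^ pK1 n m e" unfolding pK1_def r_def[symmetric] by (intro power_increasing mult_left_mono) auto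
    finally show "2 ^ g + (r + 3) \<le> 2 ^ pK1 n m e" .
  qed simp
  finally show "pN1 n m e + 1 \<le> 2 ^ (2 ^ pK1 n m e)" .
  show "pN2 n m e + 1 \<le> 2 ^ (2 ^ pK2 n m e)"
  proof (cases "pC n m e")
    case 0 then show ?thesis unfolding pN2_def pK2_def by simp
  next
    case (Suc c')
    define c where "c = pC n m e"
    have c: "1 \<le> c" using Suc unfolding c_def by simp
    have "2 ^ r * c + 1 \<le> 2 ^ r * 2 ^ c"
    proof -
      have "c + 1 \<le> 2 ^ c" using less_exp[of c] by linarith
      then have "2 ^ r * (c + 1) \<le> 2 ^ r * 2 ^ c" by (intro mult_left_mono) auto
      then show ?thesis by simp (use one_le_power[of "2::nat" r] in linarith)
    qed
    also have "\<dots> = 2 ^ (r + c)" by (simp add: power_add)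
    also have "\<dots> \<le> 2 ^ (2 ^ (r * c))"
    proof (intro power_increasing)
      obtain r' where r': "r = Suc r'" using r by (cases r) auto
      have "r + c \<le> r * c + 1" using c unfolding r' by (cases c) auto
      also have "\<dots> \<le> 2 ^ (r * c)" using less_exp[of "r * c"] by linarith
      finally show "r + c \<le> 2 ^ (r * c)" .
    qed simp
    finally show ?thesis unfolding pN2_def pK2_def r_def c_def .
  qed
qed

lemma algo_correct:
  fixes n :: nat and f :: dnf and e :: nat
  defines "m \<equiv> length f"
  defines "M1 \<equiv> 2 ^ (8 * pK1 n m (Suc e))" and "M2 \<equiv> 2 ^ (8 * pK2 n m (Suc e))" and "Tot \<equiv> pTot n m (Suc e)"
  assumes f: "is_dnf n f" and d: "\<And>i. i < e \<Longrightarrow> bin_digit \<epsilon> i = 0" "bin_digit \<epsilon> e = 1"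
    and H: "pH n m (Suc e) \<le> H"
  shows "runs H 20 algo (input_state n f \<epsilon>) (\<lambda>s'. \<exists>X1 X2.
     almost {..<M1} X1 {..<pN1 n m (Suc e)} (pK1 n m (Suc e)) ((1/2) ^ pK1 n m (Suc e)) \<and>
     almost {..<M2} X2 {..<pN2 n m (Suc e)} (pK2 n m (Suc e)) ((1/2) ^ pK2 n m (Suc e)) \<and>
     s' 3 0 = (\<Sum>su<M1. \<Sum>u<M2. \<Sum>v<Tot. of_bool (outcome n f (Suc e) X1 X2 su u v)) \<and>
     s' 3 1 = M1 * (M2 * Tot))"
proof -
  define s where "s = input_state n f \<epsilon>"
  have s: "s 0 0 = n" "s 0 1 = m" "\<And>i. s 2 i = bin_digit \<epsilon> i"
    "\<And>p. s 1 p = (if p < length (dnf_code f) then dnf_code f ! p else 0)"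
    unfolding s_def input_state_def m_def by auto
  define e' where "e' = Suc e"
  have Hs: "n \<le> H" "m \<le> H" "2 ^ pC n m e' \<le> H" "pRho n m e' + 1 \<le> H" "256 * pR n m e' \<le> H" "M1 \<le> H" "M2 \<le> H"
    "pN1 n m e' \<le> H" "(pN1 n m e' + 1) ^ pK1 n m e' \<le> H" "pK1 n m e' + 2 \<le> H"
    "pN2 n m e' \<le> H" "(pN2 n m e' + 1) ^ pK2 n m e' \<le> H" "pK2 n m e' + 2 \<le> H"
    using H unfolding M1_def M2_def pH_def loop_bounds_def e'_def by auto
  show ?thesis unfolding algo_def s_def[symmetric] e'_def[symmetric]
  proof ((intro vcg; (simp; fail)?), goal_cases)
    case 1
    show ?case
    proof (rule runs_use[OF params_correct[where n=n and m=m and e=e]], goal_cases)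
      case (7 s1)
      have p1: "vals (pvals n m e') s1" using 7(1) unfolding e'_def .
      have f1: "s1 a = s a" if "a \<notin> {10, 11, 12, 13, 14, 15, 16, 17, 18, 19, 20, 21, 22, 23, 24, 25, 26, 27, 28, 60}" for a
        using 7(2)[of a] that by (simp add: mods_params)
      have V1: "s1 20 0 = pK1 n m e'" "s1 21 0 = pN1 n m e'" "s1 22 0 = M1" "s1 23 0 = pK2 n m e'" "s1 25 0 = pN2 n m e'" "s1 26 0 = M2"
        using p1 unfolding pvals_def vals_def M1_def M2_def e'_def[symmetric] by auto
      let ?s1a = "s1(50 := (s1 50)(0 := aval (Sc 21) s1))"
      let ?s1b = "?s1a(51 := (?s1a 51)(0 := aval (Sc 20) ?s1a))"
      let ?s1c = "?s1b(52 := (?s1b 52)(0 := aval (Sc 22) ?s1b))"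
      show ?case
      proof ((intro vcg; (simp; fail)?), rule runs_use[OF sampler_correct[where s="?s1c" and X=30 and N="pN1 n m e'" and K="pK1 n m e'"]], goal_cases)
        case (11 s2)
        have f2: "s2 a = s1 a" if "a \<notin> {30, 32, 33, 34, 35, 36, 37, 38, 39, 40, 41, 42, 43, 44, 45, 46, 47, 48, 49, 50, 51, 52}" for a
          using 11(2)[of a] that by (simp add: mods_sampler)
        define X1 where "X1 = samples 30 (pN1 n m e') s2"
        have x1: "almost {..<M1} X1 {..<pN1 n m e'} (pK1 n m e') ((1/2) ^ pK1 n m e')"
          using 11(1) unfolding X1_def M1_def e'_def by blast
        let ?s2a = "s2(50 := (s2 50)(0 := aval (Sc 25) s2))"
        let ?s2b = "?s2a(51 := (?s2a 51)(0 := aval (Sc 23) ?s2a))"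
        let ?s2c = "?s2b(52 := (?s2b 52)(0 := aval (Sc 26) ?s2b))"
        show ?case
        proof ((intro vcg; (simp; fail)?), rule runs_use[OF sampler_correct[where s="?s2c" and X=31 and N="pN2 n m e'" and K="pK2 n m e'"]], goal_cases)
          case (11 s3)
          have f3: "s3 a = s2 a" if "a \<notin> {31, 32, 33, 34, 35, 36, 37, 38, 39, 40, 41, 42, 43, 44, 45, 46, 47, 48, 49, 50, 51, 52}" for a
            using 11(2)[of a] that by (simp add: mods_sampler)
          define X2 where "X2 = samples 31 (pN2 n m e') s3"
          have x2: "almost {..<M2} X2 {..<pN2 n m e'} (pK2 n m e') ((1/2) ^ pK2 n m e')"
            using 11(1) unfolding X2_def M2_def e'_def by blast
          have V3: "s3 a = s1 a" if "a \<in> fixed - {30, 31, 70, 71}" for a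
            using f3[of a] f2[of a] that unfolding fixed_def by auto
          show ?case
          proof (intro vcg, rule runs_use[OF runs_tablesC[where n=n]], goal_cases)
            case (4 s4)
            have f4: "s4 a = s3 a" if "a \<notin> {70, 71, 87}" for a using 4(2)[of a] that by (simp add: mods_tablesC)
            have p4: "vals (pvals n m e') s4"
              using p1 V3 f4 unfolding pvals_def vals_def by (auto simp: fixed_def)
            have V4: "s4 19 0 = 2 ^ pC n m e'" "s4 15 0 = pRho n m e'" "s4 28 0 = 256 * pR n m e'" "s4 22 0 = M1" "s4 27 0 = m * (2 * n + 1)"
               "s4 0 0 = n" "s4 0 1 = m"
              using p4 unfolding pvals_def vals_def M1_def e'_def[symmetric] by auto
            have e4: "env n f e' X1 X2 s4"
              unfolding env_def
            proof (intro conjI)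
              show "inputs n f s4" unfolding inputs_def using V4 4(1) V3[of 1] f4[of 1] f1[of 1] s(4) by (auto simp: fixed_def m_def)
              show "vals (pvals n (length f) e') s4" using p4 unfolding m_def .
              show "samples 30 (pN1 n (length f) e') s4 = X1" using samples_cong[of s4 30 s2] f4 f3 unfolding X1_def m_def by simp
              show "samples 31 (pN2 n (length f) e') s4 = X2" using samples_cong[of s4 31 s3] f4 unfolding X2_def m_def by simp
            qed
            show ?case
            proof (intro vcg, rule runs_use[OF runs_totC[where s=s4, OF V4(1-4)]], goal_cases)
              case (6 s5)
              have f5: "s5 a = s4 a" if "a \<in> fixed" for a using 6(2)[of a] that by (auto simp: mods_totC fixed_def)
              have t5: "s5 29 0 = pTot n m e'" using 6(1) unfolding pTot_def pJ_def M1_def e'_def by simp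
              let ?s5a = "s5(102 := (s5 102)(0 := aval (Num 0) s5))"
              let ?s5b = "?s5a(103 := (?s5a 103)(0 := aval (Num 0) ?s5a))"
              have e5: "env n f e' X1 X2 ?s5b" 
              proof (rule env_frame[OF e4])
                fix a assume "a \<in> fixed"
                moreover from this have "a \<noteq> 102" "a \<noteq> 103" unfolding fixed_def by auto
                ultimately show "?s5b a = s4 a" using f5 by simp
              qed
              show ?case
              proof ((intro vcg; (simp; fail)?), rule runs_use[OF countC_correct[OF e5 f _ _ _ _ refl refl refl]], goal_cases)
                case (6 s6)
                show ?case
                  by ((intro vcg; (simp; fail)?), rule exI[of _ X1], rule exI[of _ X2])
                    (use 6(1) x1 x2 in \<open>simp add: M1_def M2_def Tot_def m_def e'_def\<close>)
              qed (use H t5 in \<open>auto simp: e'_def m_def\<close>)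
            qed (use Hs in auto)
          qed (use V3[of 0] p1 Hs in \<open>auto simp: fixed_def pvals_def vals_def\<close>)
        qed (use V1 f2 Hs size_bounds(2)[of n m e'] in \<open>auto simp: M2_def e'_def\<close>)
      qed (use V1 Hs size_bounds(1)[of n m e'] in \<open>auto simp: M1_def e'_def\<close>)
    qed (use s d H in \<open>auto simp: e'_def\<close>)
  qed
qed

lemma avg_sum3:
  "avg {..<a} (\<lambda>x. avg {..<b} (\<lambda>y. avg {..<c} (\<lambda>z. real (h x y z)))) = real (\<Sum>x<a. \<Sum>y<b. \<Sum>z<c. h x y z) / real (a * (b * c))"
  unfolding avg_def by (simp add: sum_divide_distrib[symmetric] mult_ac)

text \<open>The count divided by the number of seeds is a nested average; the innermost one equals
  \<open>srun\<close> by the reading of seeds in base \<open>M1\<close>.\<close>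

lemma outcome_average:
  fixes n :: nat and f :: dnf and e :: nat
  defines "m \<equiv> length f"
  defines "r \<equiv> pR n m e" and "c \<equiv> pC n m e" and "\<rho> \<equiv> pRho n m e" and "M1 \<equiv> 2 ^ (8 * pK1 n m e)" and "M2 \<equiv> 2 ^ (8 * pK2 n m e)"
  assumes f: "is_dnf n f"
    and X1: "almost {..<M1} X1 {..<pN1 n m e} (pK1 n m e) ((1/2) ^ pK1 n m e)"
    and X2: "almost {..<M2} X2 {..<pN2 n m e} (pK2 n m e) ((1/2) ^ pK2 n m e)"
  shows "\<bar>real (\<Sum>su<M1. \<Sum>u<M2. \<Sum>v<pTot n m e. of_bool (outcome n f e X1 X2 su u v)) / real (M1 * (M2 * pTot n m e))
    - Bias n (dnf_holds f)\<bar> \<le> 2 * (1/2) ^ e"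
proof -
  define F where "F = map tm (filter consistent f)"
  define g where "g = pG n m e"
  have r: "r = 2 ^ \<rho>" "4 * g + 2 * e + 128 \<le> r"
    unfolding r_def \<rho>_def g_def pR_def pRho_def by (auto intro: clog_le)
  have c: "(c = 0 \<and> 8 * 2 ^ g \<le> r) \<or> 2 ^ c * r = 8 * 2 ^ g"
  proof (cases "c = 0")
    case True
    then show ?thesis using pC_prop(1)[of n m e] unfolding c_def r_def g_def by simp
  next
    case False
    then have "c + \<rho> = g + 3" unfolding c_def \<rho>_def g_def pC_def by simp
    then have "(2::nat) ^ (c + \<rho>) = 2 ^ (g + 3)" by simp
    then show ?thesis unfolding r(1) by (simp add: power_add)
  qed
  have K: "pK1 n m e = r * (\<rho> + 5)" "pN1 n m e = n * (r + 5)" "pK2 n m e = r * c" "pN2 n m e = 2 ^ r * c"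
    unfolding r_def \<rho>_def c_def pK1_def pN1_def pK2_def pN2_def by simp_all
  have F1: "wf_terms F" unfolding wf_terms_def F_def tm_def by (auto simp: image_iff) (metis lit_var.simps(1))
  have F2: "fst T \<subseteq> {..<n}" if "T \<in> set F" for T
    using that f unfolding F_def tm_def is_dnf_def by auto
  have F3: "length F * 2 ^ e \<le> 2 ^ (2 ^ g)"
  proof -
    have "length F * 2 ^ e \<le> m * 2 ^ e" unfolding F_def m_def by (intro mult_right_mono) auto
    also have "\<dots> \<le> 2 ^ clog m * 2 ^ e" by (intro mult_right_mono clog_le) auto
    also have "\<dots> = 2 ^ (clog m + e)" by (simp add: power_add)
    also have "\<dots> \<le> 2 ^ (2 ^ g)"
      using clog_le[of "pLam n m e"] unfolding g_def pG_def pLam_def by (intro power_increasing) auto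
    finally show ?thesis .
  qed
  interpret prg n r "\<rho> + 5" "{..<M1}" "selB n (r + 5) X1" "selD n (r + 5) X1" "(1/2) ^ (r * (\<rho> + 5))"
  proof (rule prg_instance)
    show "almost {..<M1} X1 {..<n * (r + 5)} (r * (\<rho> + 5)) ((1/2) ^ (r * (\<rho> + 5)))" using X1 unfolding K .
    show "\<rho> + 5 \<le> r + 5" unfolding r(1) using less_exp[of \<rho>] by linarith
  qed (use r(2) in \<open>auto simp: mult.commute\<close>)
  have inner: "avg {..<pTot n m e} (\<lambda>v. of_bool (outcome n f e X1 X2 su u v))
    = srun (256 * r) \<rho> (map (bset r c X1 X2 su u) [0..<2 ^ c]) (filter (light n r c X1 X2 su u) F) {..<n} {}" for su u
  proof -
    \<comment> \<open>Two digits for each of the \<open>256 * r * (\<rho> + 1)\<close> stages of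
      each of the \<open>2 ^ c\<close> buckets.\<close>
    have T: "pTot n m e = (M1 * M1) ^ (256 * r * (\<rho> + 1) * length (map (bset r c X1 X2 su u) [0..<2 ^ c]))"
      unfolding pTot_def pJ_def M1_def r_def c_def \<rho>_def
      by (simp add: power2_eq_square[symmetric] power_mult[symmetric] algebra_simps)
    have o: "outcome n f e X1 X2 su u v = accepts (fold (bkt M1 (selB n (r + 5) X1) (selD n (r + 5) X1) (256 * r) \<rho>)
      (map (bset r c X1 X2 su u) [0..<2 ^ c]) (filter (light n r c X1 X2 su u) F, v, {..<n}, {}))" for v
      unfolding outcome_def Let_def mbkt_def F_def M1_def r_def c_def \<rho>_def m_def by simp
    show ?thesis unfolding T o by (rule avg_run[OF refl])
  qed
  have "real (\<Sum>su<M1. \<Sum>u<M2. \<Sum>v<pTot n m e. of_bool (outcome n f e X1 X2 su u v)) / real (M1 * (M2 * pTot n m e))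
    = avg {..<M1} (\<lambda>su. avg {..<M2} (\<lambda>u. avg {..<pTot n m e} (\<lambda>v. of_bool (outcome n f e X1 X2 su u v))))"
    unfolding avg_sum3[symmetric] by simp
  then show ?thesis unfolding inner Bias_val[OF f] F_def[symmetric]
    using average_approximates[OF r c F1 F2 F3, of M1 X1 M2 X2] X1 X2 unfolding K by simp
qed

lemma first_digit:
  assumes "0 < \<epsilon>" "\<epsilon> < 1"
  obtains e where "\<And>i. i < e \<Longrightarrow> bin_digit \<epsilon> i = 0" "bin_digit \<epsilon> e = 1" "(1/2) ^ Suc e \<le> \<epsilon>" "\<epsilon> < (1/2) ^ e"
proof -
  obtain k where "(1/2::real) ^ k < \<epsilon>" using real_arch_pow_inv[of \<epsilon> "1/2"] assms by auto
  define k0 where "k0 = (LEAST k. (1/2::real) ^ k \<le> \<epsilon>)"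
  have k0: "(1/2) ^ k0 \<le> \<epsilon>" unfolding k0_def by (rule LeastI[of _ k]) (use \<open>(1/2) ^ k < \<epsilon>\<close> in simp)
  have lt: "\<epsilon> < (1/2) ^ j" if "j < k0" for j using not_less_Least that unfolding k0_def by (meson not_le)
  have "k0 \<noteq> 0" using k0 assms by (cases k0) auto
  then obtain e where e: "k0 = Suc e" by (cases k0) auto
  show thesis
  proof
    show "(1/2) ^ Suc e \<le> \<epsilon>" using k0 e by simp
    show u: "\<epsilon> < (1/2) ^ e" using lt e by simp
    show "bin_digit \<epsilon> i = 0" if "i < e" for i
    proof -
      have "\<epsilon> < (1/2) ^ Suc i" using that e by (intro lt) simp
      then have "\<epsilon> * 2 ^ (i + 1) < 1" by (simp add: field_simps power_one_over)
      then have "\<lfloor>\<epsilon> * 2 ^ (i + 1)\<rfloor> = 0" using assms by (intro floor_unique) auto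
      then show ?thesis unfolding bin_digit_def by simp
    qed
    have "1 \<le> \<epsilon> * 2 ^ (e + 1)" using k0 unfolding e by (simp add: field_simps power_one_over)
    moreover have "\<epsilon> * 2 ^ (e + 1) < 2" using u by (simp add: field_simps power_one_over)
    ultimately have "\<lfloor>\<epsilon> * 2 ^ (e + 1)\<rfloor> = 1" by (intro floor_unique) auto
    then show "bin_digit \<epsilon> e = 1" unfolding bin_digit_def by simp
  qed
qed

text \<open>The accuracy exponent is \<open>Suc e\<close>, and
  \<open>(1/2) ^ Suc e \<le> \<epsilon>\<close> gives the error. The opposite estimate
  \<open>\<epsilon> < (1/2) ^ e\<close> is kept for the time bound, where it limits \<open>e\<close>
  by \<open>log (1 / \<epsilon>)\<close>.\<close>

theorem algo_approximates:
  assumes f: "is_dnf n f" and \<epsilon>: "0 < \<epsilon>" "\<epsilon> < 1"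
  shows "\<exists>t s v e. exec algo (input_state n f \<epsilon>) t s \<and> outputs s v \<and> \<bar>v - Bias n (dnf_holds f)\<bar> \<le> 2 * \<epsilon> \<and>
    \<epsilon> < (1/2) ^ e \<and> t \<le> (50 * (pH n (length f) (Suc e) + 1)) ^ 20"
proof -
  obtain e where e: "\<And>i. i < e \<Longrightarrow> bin_digit \<epsilon> i = 0" "bin_digit \<epsilon> e = 1" "(1/2) ^ Suc e \<le> \<epsilon>" "\<epsilon> < (1/2) ^ e"
    using first_digit[OF \<epsilon>] by blast
  let ?m = "length f" and ?e = "Suc e"
  let ?M1 = "2 ^ (8 * pK1 n ?m ?e) :: nat" and ?M2 = "2 ^ (8 * pK2 n ?m ?e) :: nat" and ?T = "pTot n ?m ?e"
  obtain t s X1 X2 where s: "exec algo (input_state n f \<epsilon>) t s" "t \<le> (50 * (pH n ?m ?e + 1)) ^ 20"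
    "almost {..<?M1} X1 {..<pN1 n ?m ?e} (pK1 n ?m ?e) ((1/2) ^ pK1 n ?m ?e)"
    "almost {..<?M2} X2 {..<pN2 n ?m ?e} (pK2 n ?m ?e) ((1/2) ^ pK2 n ?m ?e)"
    "s 3 0 = (\<Sum>su<?M1. \<Sum>u<?M2. \<Sum>v<?T. of_bool (outcome n f ?e X1 X2 su u v))" "s 3 1 = ?M1 * (?M2 * ?T)"
    using algo_correct[OF f e(1,2) order_refl] unfolding runs_def by blast
  define v where "v = real (s 3 0) / real (s 3 1)"
  have "0 < s 3 1" unfolding s(6) pTot_def by simp
  then have o: "outputs s v" unfolding outputs_def v_def by simp
  have "\<bar>v - Bias n (dnf_holds f)\<bar> \<le> 2 * (1/2) ^ ?e"
    unfolding v_def s(5,6) by (rule outcome_average[OF f s(3,4)])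
  also have "\<dots> \<le> 2 * \<epsilon>" using e(3) by simp
  finally show ?thesis using s(1,2) o e(4) by blast
qed

section \<open>The time bound\<close>

text \<open>A sum of binary exponents such that \<open>2 ^ pZ\<close> exceeds every entry of
  \<open>loop_bounds\<close>. The first summand is the exact logarithm of
  \<open>pTot\<close>.\<close>

definition pZ :: "nat \<Rightarrow> nat \<Rightarrow> nat \<Rightarrow> nat" where
  "pZ n m e = 16 * pK1 n m e * pJ n m e + 8 * pK1 n m e + pK1 n m e * (pLam n m e + pR n m e + 3) +
     pK2 n m e * (pR n m e + pC n m e) + 8 * pK2 n m e + pLam n m e + pR n m e + pG n m e + pC n m e + 8"

lemma le_pow2: "x \<le> k \<Longrightarrow> x \<le> (2::nat) ^ k"
  using less_exp[of k] by linarith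

lemma sum_list_le: "(\<And>x. x \<in> set xs \<Longrightarrow> x \<le> k) \<Longrightarrow> sum_list xs \<le> length xs * (k :: nat)"
proof (induction xs)
  case (Cons y ys)
  then have "y \<le> k" "sum_list ys \<le> length ys * k" by simp_all
  then show ?case by simp
qed simp

lemma pH_le: "pH n m e \<le> 24 * 2 ^ pZ n m e"
proof -
  define Z where "Z = pZ n m e"
  define lam g rho r c K1 K2 where d: "lam = pLam n m e" "g = pG n m e" "rho = pRho n m e" "r = pR n m e" "c = pC n m e"
    "K1 = pK1 n m e" "K2 = pK2 n m e"
  have Z: "Z = 16 * K1 * pJ n m e + 8 * K1 + K1 * (lam + r + 3) + K2 * (r + c) + 8 * K2 + lam + r + g + c + 8"
    unfolding Z_def pZ_def d ..
  have r: "r = 2 ^ rho" "4 * g + 2 * e + 128 \<le> r" unfolding d pR_def pRho_def by (auto intro: clog_le)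
  have rho: "rho < r" unfolding r(1) by simp
  have K1: "K1 = r * (rho + 5)" "pN1 n m e = n * (r + 5)" "K2 = r * c" "pN2 n m e = 2 ^ r * c"
    unfolding d pK1_def pN1_def pK2_def pN2_def by simp_all
  have lam: "lam = e + clog n + clog m" unfolding d pLam_def ..
  have N1: "pN1 n m e + 1 \<le> 2 ^ (lam + r + 3)"
  proof (cases "n = 0")
    case False
    have "pN1 n m e + 1 \<le> n * (r + 6)" unfolding K1 using False by (simp add: algebra_simps)
    also have "\<dots> \<le> 2 ^ lam * 2 ^ (r + 3)"
    proof (intro mult_mono)
      have "(2::nat) ^ clog n \<le> 2 ^ lam" unfolding lam by (intro power_increasing) auto
      then show "n \<le> 2 ^ lam" using clog_le[of n] by linarith
      have "r + 6 \<le> 2 ^ r * 8" using less_exp[of r] by linarith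
      then show "r + 6 \<le> 2 ^ (r + 3)" by (simp add: power_add)
    qed auto
    finally show ?thesis by (simp add: power_add)
  qed (simp add: pN1_def)
  have N2: "pN2 n m e + 1 \<le> 2 ^ (r + c)"
  proof -
    have "c + 1 \<le> 2 ^ c" using less_exp[of c] by linarith
    then have "2 ^ r * (c + 1) \<le> 2 ^ r * 2 ^ c" by (intro mult_left_mono) auto
    moreover have "2 ^ r * c + 1 \<le> 2 ^ r * (c + 1)" by simp
    ultimately show ?thesis unfolding K1 power_add by linarith
  qed
  have pw: "x \<le> 2 ^ Z" if "x \<le> 2 ^ k" "k \<le> Z" for x k :: nat
    using that(1) power_increasing[OF that(2), of "2::nat"] by linarith
  have K1pos: "1 \<le> K1" unfolding K1 using r(2) by simp
  have kn: "n \<le> 2 ^ clog n" "m \<le> 2 ^ clog m" by (rule clog_le)+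
  have "x \<le> 2 ^ Z" if "x \<in> set (loop_bounds n m e)" for x
    using that unfolding loop_bounds_def d[symmetric] list.set insert_iff empty_iff
  proof (elim disjE FalseE; hypsubst)
    show "n \<le> 2 ^ Z" "m \<le> 2 ^ Z" by (rule pw[OF kn(1)], simp add: Z lam) (rule pw[OF kn(2)], simp add: Z lam)
    show "e \<le> 2 ^ Z" "lam \<le> 2 ^ Z" "4 * g + 2 * e + 128 \<le> 2 ^ Z" "rho + 6 \<le> 2 ^ Z" "r + 5 \<le> 2 ^ Z" "8 * K1 \<le> 2 ^ Z"
      "c \<le> 2 ^ Z" "8 * K2 \<le> 2 ^ Z" "K1 + 2 \<le> 2 ^ Z" "K2 + 2 \<le> 2 ^ Z"
      by (rule le_pow2; use r(2) rho in \<open>simp add: Z lam\<close>)+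
    show "8 * 2 ^ g \<le> (2::nat) ^ Z" by (rule pw[of _ "g + 3"]) (simp_all add: power_add Z)
    show "2 ^ (8 * K1) \<le> (2::nat) ^ Z" "2 ^ c \<le> (2::nat) ^ Z" "2 ^ (8 * K2) \<le> (2::nat) ^ Z" "2 ^ r \<le> (2::nat) ^ Z"
      by (rule power_increasing; simp add: Z)+
    have n1: "(pN1 n m e + 1) ^ K1 \<le> (2 ^ (lam + r + 3)) ^ K1" using N1 by (rule power_mono) simp
    show N1K: "(pN1 n m e + 1) ^ K1 \<le> 2 ^ Z"
      by (rule pw[OF n1[folded power_mult]]) (simp add: Z mult.commute)
    have "(pN1 n m e + 1) ^ 1 \<le> (pN1 n m e + 1) ^ K1" using K1pos by (intro power_increasing) auto
    then show "pN1 n m e \<le> 2 ^ Z" using N1K by simp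
    have n2: "(pN2 n m e + 1) ^ K2 \<le> (2 ^ (r + c)) ^ K2" using N2 by (rule power_mono) simp
    show "(pN2 n m e + 1) ^ K2 \<le> 2 ^ Z"
      by (rule pw[OF n2[folded power_mult]]) (simp add: Z mult.commute)
    show "pN2 n m e \<le> 2 ^ Z" by (rule pw[of _ "r + c"]) (use N2 in \<open>simp_all add: Z\<close>)
    have "256 * r \<le> 2 ^ 8 * 2 ^ r" using less_exp[of r] by simp
    then show "256 * r \<le> 2 ^ Z" by (intro pw[of _ "r + 8"]) (simp_all add: power_add Z)
    have "m * (2 * n + 1) \<le> 2 ^ clog m * (2 ^ clog n * 4)"
    proof (intro mult_mono)
      show "2 * n + 1 \<le> 2 ^ clog n * 4" using kn(1) one_le_power[of "2::nat" "clog n"] by linarith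
    qed (use kn in auto)
    then show "m * (2 * n + 1) \<le> 2 ^ Z" by (intro pw[of _ "clog m + clog n + 2"]) (simp_all add: power_add Z lam)
    show "pTot n m e \<le> 2 ^ Z" unfolding pTot_def d[symmetric] power_mult[symmetric]
      by (rule power_increasing) (simp_all add: Z)
  qed
  \<comment> \<open>The list has 24 entries.\<close>
  then have "pH n m e \<le> length (loop_bounds n m e) * 2 ^ Z"
    unfolding pH_def by (rule sum_list_le)
  then show ?thesis unfolding Z_def by (simp add: loop_bounds_def)
qed

lemma le_log2_power:
  assumes "2 ^ k \<le> (x :: real)"
  shows "real k \<le> log 2 x"
proof -
  have "0 < x" using assms zero_less_power[of "2::real" k] by linarith
  then show ?thesis using assms by (simp add: le_log_iff powr_realpow)
qed

lemma clog_le_log: "1 \<le> x \<Longrightarrow> real (clog x) \<le> log 2 (real x) + 1"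
proof (cases "clog x")
  case (Suc k)
  assume "1 \<le> x"
  have "2 ^ k < x" using clog_less[of x] Suc by simp
  then have "(2::real) ^ k < real x" by (metis of_nat_less_iff of_nat_numeral of_nat_power)
  then have "real k \<le> log 2 (real x)" by (intro le_log2_power) simp
  then show ?thesis using Suc by simp
qed simp

lemma pow_clog_le: "1 \<le> x \<Longrightarrow> 2 ^ clog x \<le> 2 * x"
proof (cases "clog x")
  case (Suc k)
  then show ?thesis using clog_less[of x] by simp
qed simp

lemma ln2_ge_half: "1 / 2 \<le> ln (2::real)"
  using ln_le_minus_one[of "1/2::real"] by (simp add: ln_div)

lemma lg_ge: "2 \<le> lg x" "log 2 x \<le> lg x" unfolding lg_def by auto

text \<open>The dominant summand is \<open>16 * K1 * pJ\<close>, equal to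
  \<open>4096 * (2 ^ c * r) * r * (rho + 5) * (rho + 1)\<close>. Here
  \<open>2 ^ c * r = O(\<Lambda>)\<close>, \<open>r = O(T)\<close> and \<open>rho = O(lg T)\<close>;
  the first of these is the gain from the buckets.\<close>

lemma exponent_bound:
  fixes n m e :: nat and \<epsilon> :: real
  assumes n: "2 \<le> n" "1 \<le> m" "0 < \<epsilon>" "\<epsilon> < (1/2) ^ e"
  defines "\<Lambda> \<equiv> log 2 (real m * real n / \<epsilon>)" and "T \<equiv> lg (lg (real n)) + lg (lg (real m)) + lg (1 / \<epsilon>)"
  shows "1 \<le> \<Lambda>" "6 \<le> T" "real (pZ n m (Suc e)) + 12 \<le> 5000000000 * (\<Lambda> * T * lg T ^ 2)"
proof -
  define L where "L = lg T"
  define el where "el = log 2 (1 / \<epsilon>)"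
  have \<Lambda>: "\<Lambda> = log 2 n + log 2 m + el" unfolding \<Lambda>_def el_def using n by (simp add: log_mult log_divide)
  have ln: "1 \<le> log 2 (real n)" "0 \<le> log 2 (real m)" using n by auto
  have ele: "real e \<le> el"
  proof -
    have "\<epsilon> * 2 ^ e < 1" using n by (simp add: power_one_over field_simps)
    then have "2 ^ e < 1 / \<epsilon>" using n by (simp add: field_simps)
    then show ?thesis unfolding el_def by (intro le_log2_power) simp
  qed
  show \<Lambda>1: "1 \<le> \<Lambda>" unfolding \<Lambda> using ln ele by simp
  show T6: "6 \<le> T" unfolding T_def using lg_ge(1)[of "lg (real n)"] lg_ge(1)[of "lg (real m)"] lg_ge(1)[of "1 / \<epsilon>"] by simp
  have L2: "2 \<le> L" unfolding L_def by (rule lg_ge)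
  have eT: "real (Suc e) \<le> T" "real (Suc e) \<le> \<Lambda>"
    using ele ln lg_ge(1)[of "lg (real n)"] lg_ge(1)[of "lg (real m)"] lg_ge(2)[of "1 / \<epsilon>"] unfolding T_def \<Lambda> el_def by simp_all
  have logT: "log 2 \<Lambda> \<le> T"
  proof -
    \<comment> \<open>For numbers that are at least 2 the sum is at most the product, so the
      logarithm of \<Lambda> splits into three. The last part may be bounded by \<open>z\<close>
      itself, because \<open>T\<close> contains \<open>lg (1 / \<epsilon>)\<close> without a further
      logarithm.\<close>
    define x y z where xyz: "x = lg (real n)" "y = lg (real m)" "z = lg (1 / \<epsilon>)"
    have g2: "2 \<le> x" "2 \<le> y" "2 \<le> z" unfolding xyz by (rule lg_ge)+
    have "\<Lambda> \<le> x + y + z" unfolding \<Lambda> xyz el_def by (intro add_mono lg_ge)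
    also have "\<dots> \<le> x * y * z"
    proof -
      have s: "a + b \<le> a * b" if "2 \<le> a" "2 \<le> b" for a b :: real
        using mult_mono[of 1 "a - 1" 1 "b - 1"] that by (simp add: algebra_simps)
      have "2 * 2 \<le> x * y" using g2 by (intro mult_mono) auto
      then show ?thesis using s[OF g2(1,2)] s[of "x * y" z] g2 by simp
    qed
    finally have "log 2 \<Lambda> \<le> log 2 (x * y * z)" using \<Lambda>1 by simp
    also have "\<dots> = log 2 x + log 2 y + log 2 z" using g2 by (simp add: log_mult)
    also have "\<dots> \<le> lg x + lg y + z"
    proof -
      have "log 2 z \<le> z"
      proof -
        have "z * (1/2) \<le> z * ln 2" using g2 ln2_ge_half by (intro mult_left_mono) auto
        moreover have "ln z \<le> z / 2"
          using ln_le_minus_one[of "z / 2"] g2 ln_le_minus_one[of 2] by (simp add: ln_div)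
        ultimately show ?thesis unfolding log_def by (simp add: divide_le_eq)
      qed
      then show ?thesis by (intro add_mono lg_ge)
    qed
    finally show ?thesis unfolding T_def xyz .
  qed
  define lam g rho r c K1 K2 where d: "lam = pLam n m (Suc e)" "g = pG n m (Suc e)" "rho = pRho n m (Suc e)" "r = pR n m (Suc e)" "c = pC n m (Suc e)"
    "K1 = pK1 n m (Suc e)" "K2 = pK2 n m (Suc e)"
  have lam: "real lam \<le> 4 * \<Lambda>"
  proof -
    have "real lam = real (Suc e) + real (clog n) + real (clog m)" unfolding d pLam_def by simp
    also have "\<dots> \<le> (el + 1) + (log 2 n + 1) + (log 2 m + 1)"
      using ele n by (intro add_mono clog_le_log) auto
    also have "\<dots> \<le> 4 * \<Lambda>" using \<Lambda> \<Lambda>1 by simp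
    finally show ?thesis .
  qed
  have lam1: "1 \<le> lam" unfolding d pLam_def by simp
  have g8: "2 ^ g \<le> 8 * \<Lambda>"
  proof -
    have "2 ^ g \<le> 2 * lam" unfolding d pG_def using pow_clog_le lam1[unfolded d] by blast
    from of_nat_mono[OF this, where 'a=real] show ?thesis using lam by simp
  qed
  have gT: "real g \<le> 2 * T"
  proof -
    have "real g \<le> log 2 (8 * \<Lambda>)" using g8 by (rule le_log2_power)
    also have "\<dots> = 3 + log 2 \<Lambda>" using \<Lambda>1 log_pow_cancel[of "2::real" 3] by (simp add: log_mult)
    finally show ?thesis using logT T6 by simp
  qed
  have g\<Lambda>: "real g \<le> 8 * \<Lambda>" using g8 of_nat_less_two_power[of g, where 'a=real] by linarith
  have tm: "r \<le> 2 * (4 * g + 2 * Suc e + 128)" unfolding d pR_def pRho_def by (intro pow_clog_le) simp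
  from of_nat_mono[OF this, where 'a=real] have r: "real r \<le> 8 * real g + 4 * real (Suc e) + 256" by simp
  define E where "E = real (Suc e)"
  note r' = r[folded E_def] and eT' = eT[folded E_def]
  have rT: "real r \<le> 64 * T" using r' gT eT'(1) T6 by linarith
  have r\<Lambda>: "real r \<le> 324 * \<Lambda>" using r' g\<Lambda> eT'(2) \<Lambda>1 by linarith
  have r2: "r = 2 ^ rho" unfolding d pR_def ..
  have rho: "real rho + 5 \<le> 7 * L"
  proof -
    have "(2::real) ^ rho \<le> 64 * T" using rT unfolding r2 by simp
    then have "real rho \<le> log 2 (64 * T)" by (rule le_log2_power)
    also have "\<dots> = 6 + log 2 T" using T6 log_pow_cancel[of "2::real" 6] by (simp add: log_mult)
    also have "\<dots> \<le> 6 + L" unfolding L_def using lg_ge by simp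
    finally show ?thesis using L2 by simp
  qed
  have kr: "2 ^ c * real r \<le> 324 * \<Lambda>"
  proof (cases "c = 0")
    case True then show ?thesis using r\<Lambda> by simp
  next
    case False
    then have "c + rho = g + 3" unfolding d pC_def by simp
    then have "(2::real) ^ (c + rho) = 2 ^ (g + 3)" by simp
    then have "2 ^ c * real r = 8 * 2 ^ g" unfolding r2 by (simp add: power_add)
    then show ?thesis using g8 \<Lambda>1 by simp
  qed
  have c: "real c \<le> 3 * T" using gT T6 unfolding d pC_def by (simp add: of_nat_diff_if)
  have K1r: "real K1 = real r * (real rho + 5)" unfolding d pK1_def by simp
  have K1: "real K1 \<le> 448 * (T * L)"
  proof -
    have "real K1 \<le> (64 * T) * (7 * L)" unfolding K1r using rT rho T6 by (intro mult_mono) auto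
    then show ?thesis by simp
  qed
  have K2: "real K2 \<le> 324 * \<Lambda>"
  proof -
    have "real c \<le> 2 ^ c" using of_nat_mono[of c "2 ^ c", where 'a=real] less_exp[of c] by simp
    then have "real c * real r \<le> 2 ^ c * real r" by (intro mult_right_mono) auto
    then show ?thesis using kr unfolding d pK2_def by (simp add: mult.commute)
  qed
  define P where "P = \<Lambda> * T * L ^ 2"
  have LL: "1 \<le> L ^ 2" "L \<le> L ^ 2" using L2 mult_mono[of 1 L 1 L] mult_left_mono[of 1 L L] by (simp_all add: power2_eq_square)
  have P1: "\<Lambda> * T \<le> P" "\<Lambda> * (T * L) \<le> P"
    unfolding P_def using LL \<Lambda>1 T6 by (auto simp: mult_ac intro!: mult_left_mono)
  have P2: "\<Lambda> \<le> P" "T \<le> P" "T * L \<le> P"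
  proof -
    have "\<Lambda> * 1 \<le> \<Lambda> * T" "1 * T \<le> \<Lambda> * T" "1 * (T * L) \<le> \<Lambda> * (T * L)"
      using \<Lambda>1 T6 L2 by (auto intro!: mult_left_mono mult_right_mono)
    then show "\<Lambda> \<le> P" "T \<le> P" "T * L \<le> P" using P1 by simp_all
  qed
  have KJ: "real (16 * K1 * pJ n m (Suc e)) \<le> 4161798144 * P"
  proof -
    have "real (16 * K1 * pJ n m (Suc e)) = 4096 * ((2 ^ c * real r) * real r * ((real rho + 5) * (real rho + 1)))"
      unfolding pJ_def d[symmetric] by (simp add: K1r algebra_simps)
    also have "\<dots> \<le> 4096 * ((324 * \<Lambda>) * (64 * T) * ((7 * L) * (7 * L)))"
      by (rule mult_left_mono, rule mult_mono[OF mult_mono[OF kr rT] mult_mono]) (use rho \<Lambda>1 T6 L2 in auto)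
    also have "\<dots> = 4161798144 * P" unfolding P_def by (simp add: power2_eq_square)
    finally show ?thesis .
  qed
  have t2: "real (K1 * (lam + r + 3)) \<le> 148288 * P"
  proof -
    have "real (K1 * (lam + r + 3)) \<le> (448 * (T * L)) * (331 * \<Lambda>)"
      unfolding of_nat_mult using K1 lam r\<Lambda> \<Lambda>1 T6 L2 by (intro mult_mono) auto
    also have "\<dots> = 148288 * (\<Lambda> * (T * L))" by simp
    finally show ?thesis using P1 by simp
  qed
  have t3: "real (K2 * (r + c)) \<le> 21708 * P"
  proof -
    have "real (K2 * (r + c)) \<le> (324 * \<Lambda>) * (67 * T)"
      unfolding of_nat_mult using K2 rT c \<Lambda>1 T6 by (intro mult_mono) auto
    also have "\<dots> = 21708 * (\<Lambda> * T)" by simp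
    finally show ?thesis using P1 by simp
  qed
  have "real (pZ n m (Suc e)) = real (16 * K1 * pJ n m (Suc e)) + 8 * real K1 + real (K1 * (lam + r + 3)) + real (K2 * (r + c))
     + 8 * real K2 + real lam + real r + real g + real c + 8"
    unfolding pZ_def d by simp
  then show "real (pZ n m (Suc e)) + 12 \<le> 5000000000 * (\<Lambda> * T * lg T ^ 2)"
    using KJ t2 t3 K1 K2 lam rT gT c P2 T6 unfolding L_def[symmetric] P_def[symmetric] by linarith
qed

lemma lg_pos: "0 < lg x" using lg_ge(1)[of x] by linarith

text \<open>The base \<open>m * n / \<epsilon>\<close> is \<open>2 powr \<Lambda>\<close>, so an
  exponent with factor \<Lambda> is a power of it. The constant is 20, the nesting depth, times
  5000000000; \<open>lg T \<ge> 2\<close> allows the exponent 2 to be raised to the same constant.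
  The 12 covers \<open>50 * 25 \<le> 2 ^ 12\<close>.\<close>

lemma algo_time:
  fixes n m e :: nat and \<epsilon> :: real
  assumes n: "2 \<le> n" "1 \<le> m" "0 < \<epsilon>" "\<epsilon> < (1/2) ^ e" and t: "t \<le> (50 * (pH n m (Suc e) + 1)) ^ 20"
  shows "real t \<le> (real m * real n / \<epsilon>) powr softO 100000000000 (lg (lg (real n)) + lg (lg (real m)) + lg (1 / \<epsilon>))"
proof -
  define \<Lambda> where "\<Lambda> = log 2 (real m * real n / \<epsilon>)"
  define T where "T = lg (lg (real n)) + lg (lg (real m)) + lg (1 / \<epsilon>)"
  define Z where "Z = pZ n m (Suc e)"
  have b: "1 \<le> \<Lambda>" "6 \<le> T" "real Z + 12 \<le> 5000000000 * (\<Lambda> * T * lg T ^ 2)"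
    using exponent_bound[OF n] unfolding \<Lambda>_def T_def Z_def by simp_all
  have "50 * (pH n m (Suc e) + 1) \<le> 2 ^ (Z + 12)"
  proof -
    have "50 * (pH n m (Suc e) + 1) \<le> 50 * (24 * 2 ^ Z + 2 ^ Z)"
      using pH_le[of n m "Suc e"] unfolding Z_def by (intro mult_left_mono add_mono) auto
    also have "\<dots> \<le> 4096 * 2 ^ Z" by simp
    finally show ?thesis by (simp add: power_add)
  qed
  then have "(50 * (pH n m (Suc e) + 1)) ^ 20 \<le> (2 ^ (Z + 12)) ^ 20" by (rule power_mono) simp
  then have "t \<le> 2 ^ (20 * (Z + 12))" using t unfolding power_mult[symmetric] mult.commute[of 20] by linarith
  from of_nat_mono[OF this, where 'a=real] have "real t \<le> 2 ^ (20 * (Z + 12))" by simp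
  also have "\<dots> = 2 powr (20 * (real Z + 12))" using powr_realpow[of 2 "20 * (Z + 12)"] by simp
  also have "\<dots> \<le> 2 powr (\<Lambda> * softO 100000000000 T)"
  proof (rule powr_mono)
    have "lg T ^ 2 = lg T powr 2" using lg_pos[of T] by (simp add: powr_numeral)
    also have "\<dots> \<le> lg T powr 100000000000" using lg_ge(1)[of T] by (intro powr_mono) auto
    finally have "\<Lambda> * T * lg T ^ 2 \<le> \<Lambda> * T * lg T powr 100000000000" using b by (intro mult_left_mono) auto
    then show "20 * (real Z + 12) \<le> \<Lambda> * softO 100000000000 T" using b(3) unfolding softO_def by simp
  qed simp
  also have "\<dots> = (2 powr \<Lambda>) powr softO 100000000000 T" by (simp add: powr_powr)
  also have "2 powr \<Lambda> = real m * real n / \<epsilon>" unfolding \<Lambda>_def using n by simp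
  finally show ?thesis unfolding T_def .
qed

text \<open>A factor \<open>D\<close> in the argument costs \<open>D\<close> itself and at most
  \<open>(1 + log 2 D) powr C\<close> in the logarithmic part. Since \<open>lg U \<ge> 2\<close>,
  the exponent of the logarithm may grow to the new constant.\<close>

lemma softO_scale:
  assumes C: "1 \<le> C" and D: "1 \<le> D" and U: "2 \<le> U" and T: "0 < T" "T \<le> D * U" and q: "1 \<le> q"
  shows "q * softO C T \<le> softO (q * (C * D * (1 + log 2 D) powr C)) U"
proof -
  define d where "d = 1 + log 2 D"
  have d1: "1 \<le> d" unfolding d_def using D by simp
  have lT: "lg T \<le> d * lg U"
  proof -
    have "log 2 T \<le> log 2 (D * U)" using T by simp
    also have "\<dots> = log 2 D + log 2 U" using D U by (simp add: log_mult)
    also have "\<dots> \<le> (d - 1) * lg U + lg U"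
    proof (intro add_mono lg_ge(2))
      have "(d - 1) * 1 \<le> (d - 1) * lg U" using d1 lg_ge(1)[of U] by (intro mult_left_mono) auto
      then show "log 2 D \<le> (d - 1) * lg U" unfolding d_def by simp
    qed
    finally have "log 2 T \<le> d * lg U" by (simp add: algebra_simps)
    moreover have "2 \<le> d * lg U" using mult_mono[of 1 d 2 "lg U"] d1 lg_ge(1)[of U] by simp
    ultimately show ?thesis unfolding lg_def[of T] by simp
  qed
  define C' where "C' = q * (C * D * d powr C)"
  have C': "C \<le> C'"
  proof -
    have "1 \<le> d powr C" using d1 C by (simp add: ge_one_powr_ge_zero)
    then have "1 * (1 * C * 1) \<le> q * (D * C * d powr C)" using q D C by (intro mult_mono) auto
    then show ?thesis unfolding C'_def by (simp add: mult.commute)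
  qed
  have "lg T powr C \<le> (d * lg U) powr C" using lT lg_pos[of T] C by (intro powr_mono2) auto
  also have "\<dots> = d powr C * lg U powr C" using d1 lg_pos[of U] by (simp add: powr_mult)
  finally have p: "lg T powr C \<le> d powr C * lg U powr C" .
  have "q * softO C T \<le> q * (C * (D * U) * (d powr C * lg U powr C))"
    unfolding softO_def using p T C q D U by (intro mult_left_mono mult_mono) auto
  also have "\<dots> = C' * U * lg U powr C" unfolding C'_def by simp
  also have "\<dots> \<le> C' * U * lg U powr C'"
    using C' C U lg_ge(1)[of U] by (intro mult_left_mono powr_mono) auto
  finally show ?thesis unfolding softO_def C'_def d_def .
qed

text \<open>\<open>1 / \<epsilon>\<close> is at most a power of \<open>lg n\<close>, so its
  logarithm is \<open>O(lg (lg n))\<close>; \<open>lg m\<close> is at most a constant times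
  \<open>lg n\<close>, so one more logarithm adds only a constant. Every summand is absorbed by
  \<open>U \<ge> 2\<close>.\<close>

lemma parameters_small:
  fixes n m :: nat and \<epsilon> a b :: real
  assumes n: "2 \<le> n" "1 \<le> m" "0 < \<epsilon>" "\<epsilon> < 1" and ab: "0 < a" "0 < b"
    and m: "real m \<le> real n powr a" and \<epsilon>: "lg (real n) powr (- b) \<le> \<epsilon>"
  shows "real m * real n / \<epsilon> \<le> real n powr (a + 1 + b)"
    "lg (lg (real n)) + lg (lg (real m)) + lg (1 / \<epsilon>) \<le> (3 + log 2 (1 + a) + b) * lg (lg (real n))"
proof -
  define l where "l = lg (real n)"
  define U where "U = lg l"
  have l2: "2 \<le> l" unfolding l_def by (rule lg_ge)
  have U2: "2 \<le> U" unfolding U_def by (rule lg_ge)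
  have ie: "1 / \<epsilon> \<le> l powr b"
  proof -
    have "l powr (- b) * l powr b = 1" using l2 by (simp add: powr_add[symmetric])
    then have "1 \<le> \<epsilon> * l powr b" using \<epsilon> mult_right_mono[of "l powr (-b)" \<epsilon> "l powr b"] unfolding l_def by simp
    then show ?thesis using n by (simp add: divide_le_eq mult.commute)
  qed
  have ln: "l \<le> real n"
  proof -
    have "log 2 (real n) \<le> real n"
    proof -
      have "real n \<le> 2 powr real n" using of_nat_less_two_power[of n, where 'a=real] by (simp add: powr_realpow)
      then show ?thesis using n by (simp add: log_le_iff)
    qed
    then show ?thesis unfolding l_def lg_def using n by simp
  qed
  have "real m * real n / \<epsilon> = real m * real n * (1 / \<epsilon>)" by simp
  also have "\<dots> \<le> real n powr a * real n powr 1 * real n powr b"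
  proof (intro mult_mono)
    have "l powr b \<le> real n powr b" using ln l2 ab by (intro powr_mono2) auto
    then show "1 / \<epsilon> \<le> real n powr b" using ie by linarith
  qed (use m n in auto)
  also have "\<dots> = real n powr (a + 1 + b)" by (simp add: powr_add)
  finally show "real m * real n / \<epsilon> \<le> real n powr (a + 1 + b)" .
  have lm: "lg (real m) \<le> (1 + a) * l"
  proof -
    have "log 2 (real m) \<le> log 2 (real n powr a)" using m n by simp
    also have "\<dots> = a * log 2 (real n)" using n by (simp add: log_powr)
    also have "\<dots> \<le> a * l" unfolding l_def using ab lg_ge by (intro mult_left_mono) auto
    finally have "log 2 (real m) \<le> (1 + a) * l" using l2 by (simp add: algebra_simps)
    moreover have "2 \<le> (1 + a) * l" using mult_mono[of 1 "1 + a" 2 l] ab l2 by simp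
    ultimately show ?thesis unfolding lg_def[of "real m"] by simp
  qed
  have la: "0 \<le> log 2 (1 + a)" using ab by simp
  have llm: "lg (lg (real m)) \<le> (1 + log 2 (1 + a)) * U"
  proof -
    have "log 2 (lg (real m)) \<le> log 2 ((1 + a) * l)" using lm lg_pos[of "real m"] by simp
    also have "\<dots> = log 2 (1 + a) + log 2 l" using ab l2 by (simp add: log_mult)
    also have "\<dots> \<le> log 2 (1 + a) * U + U"
    proof (intro add_mono)
      show "log 2 (1 + a) \<le> log 2 (1 + a) * U" using la U2 mult_left_mono[of 1 U "log 2 (1 + a)"] by simp
      show "log 2 l \<le> U" unfolding U_def by (rule lg_ge)
    qed
    finally have "log 2 (lg (real m)) \<le> (1 + log 2 (1 + a)) * U" by (simp add: algebra_simps)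
    moreover have "2 \<le> (1 + log 2 (1 + a)) * U" using mult_mono[of 1 "1 + log 2 (1 + a)" 2 U] la U2 by simp
    ultimately show ?thesis unfolding lg_def[of "lg (real m)"] by simp
  qed
  have le: "lg (1 / \<epsilon>) \<le> (1 + b) * U"
  proof -
    have "log 2 (1 / \<epsilon>) \<le> log 2 (l powr b)" using ie n l2 by (subst log_le_cancel_iff) auto
    also have "\<dots> = b * log 2 l" using l2 by (simp add: log_powr)
    also have "\<dots> \<le> b * U" unfolding U_def using ab lg_ge by (intro mult_left_mono) auto
    finally have "log 2 (1 / \<epsilon>) \<le> (1 + b) * U" using U2 by (simp add: algebra_simps)
    moreover have "2 \<le> (1 + b) * U" using mult_mono[of 1 "1 + b" 2 U] ab U2 by simp
    ultimately show ?thesis unfolding lg_def[of "1 / \<epsilon>"] by simp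
  qed
  have "lg l + lg (lg (real m)) + lg (1 / \<epsilon>) \<le> U + (1 + log 2 (1 + a)) * U + (1 + b) * U"
    using llm le unfolding U_def by (intro add_mono) auto
  also have "\<dots> = (3 + log 2 (1 + a) + b) * U" by (simp add: algebra_simps)
  finally show "lg (lg (real n)) + lg (lg (real m)) + lg (1 / \<epsilon>) \<le> (3 + log 2 (1 + a) + b) * lg (lg (real n))"
    unfolding l_def U_def .
qed

theorem theorem1p6:
  "\<exists>(A :: com) (K :: real) (C :: real). K > 0 \<and> C > 0 \<and>
     (\<forall>(n :: nat) (m :: nat) (f :: dnf) (\<epsilon> :: real).
        n \<ge> 2 \<and> m \<ge> 1 \<and> is_dnf n f \<and> length f = m \<and> 0 < \<epsilon> \<and> \<epsilon> < 1 \<longrightarrow>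
        (\<exists>t s v. exec A (input_state n f \<epsilon>) t s \<and> outputs s v \<and>
           v \<in> {Bias n (dnf_holds f) - K * \<epsilon> .. Bias n (dnf_holds f) + K * \<epsilon>} \<and>
           real t \<le> (real m * real n / \<epsilon>) powr
             softO C (lg (lg (real n)) + lg (lg (real m)) + lg (1 / \<epsilon>)))) \<and>
     (\<forall>(a :: real) (b :: real). a > 0 \<and> b > 0 \<longrightarrow>
        (\<exists>C' > 0. \<forall>(n :: nat) (m :: nat) (f :: dnf) (\<epsilon> :: real).
           n \<ge> 2 \<and> m \<ge> 1 \<and> is_dnf n f \<and> length f = m \<and> 0 < \<epsilon> \<and> \<epsilon> < 1 \<and>
           real m \<le> real n powr a \<and> \<epsilon> \<ge> lg (real n) powr (- b) \<longrightarrow>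
           (\<exists>t s. exec A (input_state n f \<epsilon>) t s \<and>
              real t \<le> real n powr softO C' (lg (lg (real n))))))"
proof -
  define C :: real where "C = 100000000000"
  have C1: "1 \<le> C" unfolding C_def by simp
  have main: "\<exists>t s v. exec algo (input_state n f \<epsilon>) t s \<and> outputs s v \<and>
           v \<in> {Bias n (dnf_holds f) - 2 * \<epsilon> .. Bias n (dnf_holds f) + 2 * \<epsilon>} \<and>
           real t \<le> (real m * real n / \<epsilon>) powr softO C (lg (lg (real n)) + lg (lg (real m)) + lg (1 / \<epsilon>))"
    if "n \<ge> 2 \<and> m \<ge> 1 \<and> is_dnf n f \<and> length f = m \<and> 0 < \<epsilon> \<and> \<epsilon> < 1" for n m :: nat and f \<epsilon>
  proof -
    have c: "is_dnf n f" "0 < \<epsilon>" "\<epsilon> < 1" "length f = m" using that by auto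
    obtain t s v e where s: "exec algo (input_state n f \<epsilon>) t s" "outputs s v" "\<bar>v - Bias n (dnf_holds f)\<bar> \<le> 2 * \<epsilon>"
      "\<epsilon> < (1/2) ^ e" "t \<le> (50 * (pH n m (Suc e) + 1)) ^ 20"
      using algo_approximates[OF c(1-3)] unfolding c(4) by blast
    have "v \<in> {Bias n (dnf_holds f) - 2 * \<epsilon> .. Bias n (dnf_holds f) + 2 * \<epsilon>}" using s(3) by (auto simp: abs_le_iff)
    moreover have "real t \<le> (real m * real n / \<epsilon>) powr softO C (lg (lg (real n)) + lg (lg (real m)) + lg (1 / \<epsilon>))"
      unfolding C_def using that s(4,5) by (intro algo_time) auto
    ultimately show ?thesis using s(1,2) by blast
  qed
  have poly: "\<exists>C' > 0. \<forall>(n :: nat) (m :: nat) (f :: dnf) (\<epsilon> :: real).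
           n \<ge> 2 \<and> m \<ge> 1 \<and> is_dnf n f \<and> length f = m \<and> 0 < \<epsilon> \<and> \<epsilon> < 1 \<and>
           real m \<le> real n powr a \<and> \<epsilon> \<ge> lg (real n) powr (- b) \<longrightarrow>
           (\<exists>t s. exec algo (input_state n f \<epsilon>) t s \<and> real t \<le> real n powr softO C' (lg (lg (real n))))"
    if ab: "0 < a" "0 < b" for a b :: real
  proof -
    define D where "D = 3 + log 2 (1 + a) + b"
    have D: "1 \<le> D" unfolding D_def using ab by simp
    \<comment> \<open>The constant of \<open>softO_scale\<close>, with the exponent
      \<open>a + 1 + b\<close> of \<open>n\<close> as factor \<open>q\<close>.\<close>
    define C' where "C' = (a + 1 + b) * (C * D * (1 + log 2 D) powr C)"
    have "0 < 1 + log 2 D" using D by (simp add: add_pos_nonneg)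
    then have C'0: "0 < C'" unfolding C'_def using ab C1 D by (intro mult_pos_pos) auto
    show ?thesis
    proof (intro exI[of _ C'] conjI allI impI C'0)
      fix n m :: nat and f \<epsilon>
      assume h: "n \<ge> 2 \<and> m \<ge> 1 \<and> is_dnf n f \<and> length f = m \<and> 0 < \<epsilon> \<and> \<epsilon> < 1 \<and>
           real m \<le> real n powr a \<and> \<epsilon> \<ge> lg (real n) powr (- b)"
      define T where "T = lg (lg (real n)) + lg (lg (real m)) + lg (1 / \<epsilon>)"
      have T0: "0 < T" unfolding T_def by (intro add_pos_pos lg_pos)
      obtain t s where s: "exec algo (input_state n f \<epsilon>) t s" "real t \<le> (real m * real n / \<epsilon>) powr softO C T"
        using main[of n m f \<epsilon>] h unfolding T_def by blast
      have p: "real m * real n / \<epsilon> \<le> real n powr (a + 1 + b)" "T \<le> D * lg (lg (real n))"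
        using parameters_small[of n m \<epsilon> a b] h ab unfolding T_def D_def by auto
      have sp: "0 \<le> softO C T" unfolding softO_def using C1 T0 by simp
      have "(real m * real n / \<epsilon>) powr softO C T \<le> (real n powr (a + 1 + b)) powr softO C T"
        using p(1) sp h by (intro powr_mono2) auto
      also have "\<dots> = real n powr ((a + 1 + b) * softO C T)" by (simp add: powr_powr)
      also have "\<dots> \<le> real n powr softO C' (lg (lg (real n)))"
        unfolding C'_def using h ab
        by (intro powr_mono softO_scale[OF C1 D lg_ge(1) T0 p(2)]) auto
      finally show "\<exists>t s. exec algo (input_state n f \<epsilon>) t s \<and> real t \<le> real n powr softO C' (lg (lg (real n)))"
        using s by (meson order_trans)
    qed
  qed
  show ?thesis
    by (rule exI[of _ algo], rule exI[of _ 2], rule exI[of _ C]) (use main poly C1 in auto)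
qed

end
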